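(* Let $0\le a<b\le\infty$, $0<r\le 1$, $0<p,q<\infty$, and let $u,v,w$ be weights on $(a,b)$ such that $0<\mathcal{W}(x)<\infty$ for all $x\in(a,b)$. Consider the inequality $$\bigg(\int_a^b \bigg(\int_a^t f(s)^r v(s)\, ds \bigg)^{\frac{q}{r}} u(t)\, dt \bigg)^{\frac{1}{q}} \leq C\bigg(\int_a^b \bigg(\int_a^t f(s)\, ds \bigg)^{p} w(t)\, dt\bigg)^{\frac{1}{p}}. \qquad ( * )$$ Define $$C_1 := \operatorname*{ess\,sup}_{x\in (a,b)} \mathcal{W}(x)^{-\frac{1}{p}} \operatorname*{ess\,sup}_{t\in (x,b)} \bigg( \int_t^b u \bigg)^{\frac{1}{q}} V_r(x,t),$$ $$C_2 := \sup_{x\in (a,b)} \mathcal{W}(x)^{-\frac{1}{p}} \bigg( \int_x^b \bigg( \int_t^b u \bigg)^{\frac{q}{1-q}} u(t) V_r(x,t)^{\frac{q}{1-q}} dt \bigg)^{\frac{1-q}{q}},$$ $$C_3 := \sup_{x \in (a,b)} \bigg(\int_{x}^b u\bigg)^{\frac{1}{q}} \bigg(\int_a^{x} \mathcal{W}(t)^{-\frac{p}{p-r}} w(t) V_r(t,x)^{\frac{pr}{p-r}} dt \bigg)^{\frac{p-r}{pr}},$$ $$C_4 := \bigg(\int_a^{b} \bigg(\int_x^b u\bigg)^{\frac{q}{p-q}} u(x) \operatorname*{ess\,sup}_{t\in (a, x)} \Big[\mathcal{W}(t)^{-\frac{q}{p-q}} V_r(t,x)^{\frac{pq}{p-q}}\Big]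 dx \bigg)^{\frac{p-q}{pq}},$$ $$C_5 := \bigg(\int_a^b w(x) \operatorname*{ess\,sup}_{y\in (a,x)} \Big[\mathcal{W}(y)^{-\frac{p}{p-q}}\bigg( \int_{y}^x \bigg( \int_t^x u \bigg)^{\frac{q}{1-q}} u(t) V_r(y,t)^{\frac{q}{1-q}} dt \bigg)^{\frac{p(1-q)}{p-q}}\Big] dx \bigg)^{\frac{p-q}{pq}},$$ $$C_6 := \bigg(\int_a^{b} w(x) \operatorname*{ess\,sup}_{ y\in(a, x)} \Big[\mathcal{W}(y)^{-1} \bigg(\int_y^{x} \bigg(\int_t^b u\bigg)^{\frac{q}{p-q}} u(t)dt \bigg) \bigg(\int_a^y \mathcal{W}(t)^{-\frac{p}{p-r}} w(t)V_r(t,y)^{\frac{pr}{p-r}}dt\bigg)^{\frac{q(p-r)}{r(p-q)}}\Big] dx \bigg)^{\frac{p-q}{pq}},$$ $$C_7 := \bigg(\int_a^{b} w(x) \operatorname*{ess\,sup}_{y\in(a,x)} \Big[\mathcal{W}(y)^{-\frac{p}{p-q}} \operatorname*{ess\,sup}_{t\in(y,x)} \bigg( \int_t^{x} u \bigg)^{\frac{p}{p-q}} V_r(y,t)^{\frac{pq}{p-q}}\Big] dx \bigg)^{\frac{p-q}{pq}}$$ (each used only in the parameter ranges below). Then there is a constant $C\in(0,\infty)$ such that $( * )$ holds for all non-negative measurable functions $f$ on $(a,b)$ if and only if (i) in the case $p\le r\le 1\le q$: $C_1<\infty$; (ii) in the case $p\le q<1$ and $p\le r\le 1$: $C_2<\infty$;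 (iii) in the case $r<p\le q$ and $r\le 1\le q$: $\max\{C_1,C_3\}<\infty$; (iv) in the case $r<p\le q<1$: $\max\{C_2,C_3\}<\infty$; (v) in the case $q<p\le r\le 1$: $\max\{C_4,C_5\}<\infty$; (vi) in the case $q<p$, $q<1$, $r<p$, $r\le 1$: $\max\{C_1,C_5,C_6\}<\infty$; (vii) in the case $r\le 1\le q<p$: $\max\{C_1,C_6,C_7\}<\infty$. Moreover, the best (least) constant $C$ in $( * )$ satisfies $C\approx C_1$ in case (i), $C\approx C_2$ in case (ii), $C\approx C_1+C_3$ in case (iii), $C\approx C_2+C_3$ in case (iv), $C\approx C_4+C_5$ in case (v), $C\approx C_1+C_5+C_6$ in case (vi), and $C\approx C_1+C_6+C_7$ in case (vii), where the multiplicative constants in $\approx$ depend only on $p,q,r$.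
   Context: A weight on $(a,b)$ is a measurable function that is positive and finite a.e. on $(a,b)$. For $x\in[a,b]$, $\mathcal{W}(x):=\int_x^b w(t)\,dt$. For $a\le x<y\le b$, $$V_r(x,y):=\bigg(\int_x^y v^{\frac{1}{1-r}}\bigg)^{\frac{1-r}{r}}\ \text{ if } 0<r<1,\qquad V_1(x,y):=\operatorname*{ess\,sup}_{s\in(x,y)} v(s).$$ Arguments and differentials in integrals are omitted when clear, e.g. $\int_t^b u=\int_t^b u(s)\,ds$. $A\approx B$ means $c^{-1}B\le A\le cB$ for some constant $c\in(0,\infty)$ (with the stated dependence). All quantities take values in $[0,\infty]$, with conventions $1/(\pm\infty)=0$, $0/0=0$, $0\cdot(\pm\infty)=0$. *)

theory Defs
  imports "HOL-Probability.Essential_Supremum"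
begin

text \<open>
  Real powers on \<open>[0, \<infinity>]\<close>, with \<open>0\<close> and \<open>\<infinity>\<close> exchanged by negative exponents
  (the library's \<open>inverse\<close> on \<^typ>\<open>ennreal\<close> satisfies \<open>inverse 0 = \<infinity>\<close>
  and \<open>inverse \<infinity> = 0\<close>, and its multiplication satisfies \<open>0 * \<infinity> = 0\<close>).
\<close>

definition epowr :: "ennreal \<Rightarrow> real \<Rightarrow> ennreal" (infixr \<open>epowr\<close> 80) where
  "x epowr s =
     (if s = 0 then 1
      else if x = 0 then (if s > 0 then 0 else \<infinity>)
      else if x = \<infinity> then (if s > 0 then \<infinity> else 0)
      else ennreal (enn2real x powr s))"

text \<open>
  End points are extended reals, so that \<open>b = \<infinity>\<close> is allowed.  All functions are
  Lebesgue measurable with values in \<open>[0, \<infinity>]\<close>.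
\<close>

abbreviation integ :: "ereal \<Rightarrow> ereal \<Rightarrow> (real \<Rightarrow> ennreal) \<Rightarrow> ennreal" where
  "integ x y g \<equiv> (\<integral>\<^sup>+ t \<in> einterval x y. g t \<partial>lebesgue)"

text \<open>
  The library's \<^const>\<open>esssup\<close> is the top element for non-measurable functions.  All the
  functions it is applied to below are measurable, being either a weight or products of
  powers of functions which are monotone in the variable concerned.
\<close>

abbreviation ess_sup :: "ereal \<Rightarrow> ereal \<Rightarrow> (real \<Rightarrow> ennreal) \<Rightarrow> ennreal" where
  "ess_sup x y g \<equiv> esssup (lebesgue_on (einterval x y)) g"

definition measurable_on_interval :: "ereal \<Rightarrow> ereal \<Rightarrow> (real \<Rightarrow> ennreal) \<Rightarrow> bool" where
  "measurable_on_interval a b f \<longleftrightarrow> f \<in> borel_measurable (lebesgue_on (einterval a b))"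

definition weight :: "ereal \<Rightarrow> ereal \<Rightarrow> (real \<Rightarrow> ennreal) \<Rightarrow> bool" where
  "weight a b w \<longleftrightarrow>
     measurable_on_interval a b w \<and>
     (AE x in lebesgue_on (einterval a b). 0 < w x \<and> w x < \<infinity>)"

definition W :: "ereal \<Rightarrow> (real \<Rightarrow> ennreal) \<Rightarrow> real \<Rightarrow> ennreal" where
  "W b w x = integ x b w"

definition V :: "real \<Rightarrow> (real \<Rightarrow> ennreal) \<Rightarrow> ereal \<Rightarrow> ereal \<Rightarrow> ennreal" where
  "V r v x y =
     (if r < 1 then integ x y (\<lambda>s. v s epowr (1 / (1 - r))) epowr ((1 - r) / r)
      else ess_sup x y v)"

definition inequality_holds ::
  "ereal \<Rightarrow> ereal \<Rightarrow> real \<Rightarrow> real \<Rightarrow> real \<Rightarrow> (real \<Rightarrow> ennreal) \<Rightarrow> (real \<Rightarrow> ennreal) \<Rightarrow> (real \<Rightarrow> ennreal)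
     \<Rightarrow> ennreal \<Rightarrow> bool" where
  "inequality_holds a b p q r u v w C \<longleftrightarrow>
     (\<forall>f. measurable_on_interval a b f \<longrightarrow>
        integ a b (\<lambda>t. integ a t (\<lambda>s. f s epowr r * v s) epowr (q / r) * u t) epowr (1 / q)
        \<le> C * integ a b (\<lambda>t. integ a t f epowr p * w t) epowr (1 / p))"

text \<open>The least constant is \<open>\<infinity>\<close> if there is no admissible finite one.\<close>

definition best_constant ::
  "ereal \<Rightarrow> ereal \<Rightarrow> real \<Rightarrow> real \<Rightarrow> real \<Rightarrow> (real \<Rightarrow> ennreal) \<Rightarrow> (real \<Rightarrow> ennreal) \<Rightarrow> (real \<Rightarrow> ennreal)
     \<Rightarrow> ennreal" where
  "best_constant a b p q r u v w =
     Inf {C. 0 < C \<and> C < \<infinity> \<and> inequality_holds a b p q r u v w C}"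

definition approx :: "real \<Rightarrow> ennreal \<Rightarrow> ennreal \<Rightarrow> bool" where
  "approx c A B \<longleftrightarrow> ennreal (1 / c) * B \<le> A \<and> A \<le> ennreal c * B"

definition C1 ::
  "ereal \<Rightarrow> ereal \<Rightarrow> real \<Rightarrow> real \<Rightarrow> real \<Rightarrow> (real \<Rightarrow> ennreal) \<Rightarrow> (real \<Rightarrow> ennreal) \<Rightarrow> (real \<Rightarrow> ennreal)
     \<Rightarrow> ennreal" where
  "C1 a b p q r u v w =
     ess_sup a b (\<lambda>x. W b w x epowr (- (1 / p)) *
       ess_sup x b (\<lambda>t. integ t b u epowr (1 / q) * V r v x t))"

definition C2 ::
  "ereal \<Rightarrow> ereal \<Rightarrow> real \<Rightarrow> real \<Rightarrow> real \<Rightarrow> (real \<Rightarrow> ennreal) \<Rightarrow> (real \<Rightarrow> ennreal) \<Rightarrow> (real \<Rightarrow> ennreal)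
     \<Rightarrow> ennreal" where
  "C2 a b p q r u v w =
     (SUP x \<in> einterval a b. W b w x epowr (- (1 / p)) *
       integ x b (\<lambda>t. integ t b u epowr (q / (1 - q)) * u t * V r v x t epowr (q / (1 - q)))
         epowr ((1 - q) / q))"

definition C3 ::
  "ereal \<Rightarrow> ereal \<Rightarrow> real \<Rightarrow> real \<Rightarrow> real \<Rightarrow> (real \<Rightarrow> ennreal) \<Rightarrow> (real \<Rightarrow> ennreal) \<Rightarrow> (real \<Rightarrow> ennreal)
     \<Rightarrow> ennreal" where
  "C3 a b p q r u v w =
     (SUP x \<in> einterval a b. integ x b u epowr (1 / q) *
       integ a x (\<lambda>t. W b w t epowr (- (p / (p - r))) * w t * V r v t x epowr (p * r / (p - r)))
         epowr ((p - r) / (p * r)))"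

definition C4 ::
  "ereal \<Rightarrow> ereal \<Rightarrow> real \<Rightarrow> real \<Rightarrow> real \<Rightarrow> (real \<Rightarrow> ennreal) \<Rightarrow> (real \<Rightarrow> ennreal) \<Rightarrow> (real \<Rightarrow> ennreal)
     \<Rightarrow> ennreal" where
  "C4 a b p q r u v w =
     integ a b (\<lambda>x. integ x b u epowr (q / (p - q)) * u x *
       ess_sup a x (\<lambda>t. W b w t epowr (- (q / (p - q))) * V r v t x epowr (p * q / (p - q))))
     epowr ((p - q) / (p * q))"

definition C5 ::
  "ereal \<Rightarrow> ereal \<Rightarrow> real \<Rightarrow> real \<Rightarrow> real \<Rightarrow> (real \<Rightarrow> ennreal) \<Rightarrow> (real \<Rightarrow> ennreal) \<Rightarrow> (real \<Rightarrow> ennreal)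
     \<Rightarrow> ennreal" where
  "C5 a b p q r u v w =
     integ a b (\<lambda>x. w x *
       ess_sup a x (\<lambda>y. W b w y epowr (- (p / (p - q))) *
         integ y x (\<lambda>t. integ t x u epowr (q / (1 - q)) * u t * V r v y t epowr (q / (1 - q)))
           epowr (p * (1 - q) / (p - q))))
     epowr ((p - q) / (p * q))"

definition C6 ::
  "ereal \<Rightarrow> ereal \<Rightarrow> real \<Rightarrow> real \<Rightarrow> real \<Rightarrow> (real \<Rightarrow> ennreal) \<Rightarrow> (real \<Rightarrow> ennreal) \<Rightarrow> (real \<Rightarrow> ennreal)
     \<Rightarrow> ennreal" where
  "C6 a b p q r u v w =
     integ a b (\<lambda>x. w x *
       ess_sup a x (\<lambda>y. W b w y epowr (- 1) *
         integ y x (\<lambda>t. integ t b u epowr (q / (p - q)) * u t) *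
         integ a y (\<lambda>t. W b w t epowr (- (p / (p - r))) * w t * V r v t y epowr (p * r / (p - r)))
           epowr (q * (p - r) / (r * (p - q)))))
     epowr ((p - q) / (p * q))"

definition C7 ::
  "ereal \<Rightarrow> ereal \<Rightarrow> real \<Rightarrow> real \<Rightarrow> real \<Rightarrow> (real \<Rightarrow> ennreal) \<Rightarrow> (real \<Rightarrow> ennreal) \<Rightarrow> (real \<Rightarrow> ennreal)
     \<Rightarrow> ennreal" where
  "C7 a b p q r u v w =
     integ a b (\<lambda>x. w x *
       ess_sup a x (\<lambda>y. W b w y epowr (- (p / (p - q))) *
         ess_sup y x (\<lambda>t. integ t x u epowr (p / (p - q)) * V r v y t epowr (p * q / (p - q)))))
     epowr ((p - q) / (p * q))"

end

theory Submission
  imports Defs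
begin

text \<open>
  The tails \<open>\<integral>\<^sub>t\<^sup>b w\<close> and \<open>\<integral>\<^sub>t\<^sup>b u\<close> are each cut into dyadic blocks.  By a geometric Hardy inequality,
  sums over earlier blocks cost no more than their last term, so the inequality becomes the sum of
  a local part, the Hardy inequality for \<open>u\<close> on each block of \<open>w\<close> with the integral of \<open>f\<close> on the
  right, and a global part, where only the values \<open>V\<^sub>r\<close> of the blocks of \<open>w\<close> and the level of \<open>u\<close>
  on which each block ends matter.  In both parts the best constant is the norm of a diagonal operator
  \<open>\<ell>\<^sup>1 \<rightarrow> \<ell>\<^sup>\<theta>\<close>, which is a supremum for \<open>\<theta> \<ge> 1\<close> and an \<open>\<ell>\<^sup>s\<close> norm for \<open>\<theta> < 1\<close>; this
  is the source of the seven cases.  For sufficiency \<open>f\<close> is first cut off near \<open>a\<close>, as only there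
  the tails may be infinite.  Necessity tests the inequality with combinations of near-extremal functions
  supported in single blocks (of \<open>w\<close> or, for \<open>C\<^sub>4\<close>, of \<open>u\<close>).
\<close>

subsection \<open>Powers\<close>

text \<open>A sum over blocks becomes an integral only after a shift by one block: the weight of a
  block is read off from the block before it or after it. Once f is cut off near a, the first
  nonempty block of w has no predecessor, so its contribution cannot be charged to the integrals in
  C3 or C6. The pointwise condition C1 pays for it, which is why C1 accompanies C6 in the cases (vi)
  and (vii).

  The seven cases reduce to three comparisons. Comparing p with q and p with r decides which form
  the dual norms take, for the whole sequence and within one level of u. Comparing q with 1 only
  selects the form of the local Hardy constant \<open>E\<close>, so that C5 and C7 are treated as
  one quantity \<open>J57\<close>.

  The tails of u are not assumed to be finite. Before u can be cut into blocks this has to be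
  derived, either from the inequality or from the finiteness of the constants. All factors are
  explicit in p, q and r, because the final constant is fixed before the weights are.\<close>

lemma epowr_zero_right [simp]: "x epowr 0 = 1"
  by (simp add: epowr_def)

lemma zero_epowr [simp]: "0 < s \<Longrightarrow> 0 epowr s = 0"
  by (simp add: epowr_def)

lemma top_epowr [simp]: "0 < s \<Longrightarrow> top epowr s = top"
  by (simp add: epowr_def)

lemma one_epowr [simp]: "1 epowr s = 1"
  by (simp add: epowr_def)

lemma ennreal_epowr: "0 < x \<Longrightarrow> ennreal x epowr s = ennreal (x powr s)"
  by (auto simp: epowr_def)

lemma ennreal_pos_cases [case_names zero real top]:
  fixes x :: ennreal
  obtains "x = 0" | y where "x = ennreal y" "0 < y" | "x = top"
proof (cases x)
  case (real r)
  then show ?thesis using that by (cases "r = 0") auto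
next
  case top
  then show ?thesis using that by auto
qed

lemma epowr_one [simp]: "x epowr 1 = x"
  by (cases x rule: ennreal_pos_cases) (auto simp: epowr_def)

lemma epowr_epowr: "(x epowr s) epowr t = x epowr (s * t)"
  by (cases x rule: ennreal_pos_cases)
    (auto simp: epowr_def powr_powr zero_less_mult_iff mult_less_0_iff)

lemma epowr_mono: "x \<le> y \<Longrightarrow> 0 \<le> s \<Longrightarrow> x epowr s \<le> y epowr s"
  by (cases x rule: ennreal_pos_cases; cases y rule: ennreal_pos_cases; cases "s = 0")
    (auto simp: ennreal_epowr top_unique intro!: powr_mono2 ennreal_leI)

lemma epowr_le_iff: "0 < s \<Longrightarrow> x epowr s \<le> y \<longleftrightarrow> x \<le> y epowr (1 / s)"
  using epowr_mono[of "x epowr s" y "1/s"] epowr_mono[of x "y epowr (1/s)" s]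
  by (auto simp: epowr_epowr)

lemma epowr_mono_iff: "0 < s \<Longrightarrow> x epowr s \<le> y epowr s \<longleftrightarrow> x \<le> y"
  by (simp add: epowr_le_iff epowr_epowr)

lemma epowr_strict_mono_iff: "0 < s \<Longrightarrow> x epowr s < y epowr s \<longleftrightarrow> x < y"
  by (simp add: epowr_mono_iff flip: not_le)

lemma epowr_less_iff: "0 < s \<Longrightarrow> y < x epowr s \<longleftrightarrow> y epowr (1 / s) < x"
  by (simp add: epowr_le_iff flip: not_le)

lemma epowr_antimono: "x \<le> y \<Longrightarrow> s \<le> 0 \<Longrightarrow> y epowr s \<le> x epowr s"
  by (cases x rule: ennreal_pos_cases; cases y rule: ennreal_pos_cases; cases "s = 0")
    (auto simp: ennreal_epowr top_unique epowr_def intro!: powr_mono2' ennreal_leI)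

lemma epowr_mult: "0 \<le> s \<Longrightarrow> (x * y) epowr s = x epowr s * y epowr s"
  by (cases x rule: ennreal_pos_cases; cases y rule: ennreal_pos_cases; cases "s = 0")
    (auto simp: ennreal_epowr powr_mult ennreal_mult_top ennreal_top_mult simp flip: ennreal_mult'')

lemma epowr_add: "0 \<le> s \<Longrightarrow> 0 \<le> t \<Longrightarrow> x epowr (s + t) = x epowr s * x epowr t"
  by (cases x rule: ennreal_pos_cases; cases "s = 0"; cases "t = 0")
    (auto simp: ennreal_epowr powr_add simp flip: ennreal_mult'')

text \<open>For exponents of opposite sign the law fails at 0 and at infinity, where the right side
  is 0 times infinity; hence the two assumptions.\<close>

lemma epowr_add': "0 < x \<Longrightarrow> x < top \<Longrightarrow> x epowr (s + t) = x epowr s * x epowr t"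
  by (cases x rule: ennreal_pos_cases)
    (auto simp: ennreal_epowr powr_add simp flip: ennreal_mult'')

lemma epowr_eq_0_iff: "0 < s \<Longrightarrow> x epowr s = 0 \<longleftrightarrow> x = 0"
  by (cases x rule: ennreal_pos_cases) (auto simp: ennreal_epowr)

lemma epowr_pos: "0 < s \<Longrightarrow> 0 < x \<Longrightarrow> 0 < x epowr s"
  using epowr_eq_0_iff[of s x] by (auto simp: zero_less_iff_neq_zero)

lemma epowr_pos': "0 < x \<Longrightarrow> x < top \<Longrightarrow> 0 < x epowr s"
  by (cases x rule: ennreal_pos_cases) (auto simp: ennreal_epowr)

lemma epowr_finite: "0 \<le> s \<Longrightarrow> x < top \<Longrightarrow> x epowr s < top"
  by (cases x rule: ennreal_pos_cases; cases "s = 0") (auto simp: ennreal_epowr)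

lemma epowr_finite': "0 < x \<Longrightarrow> x < top \<Longrightarrow> x epowr s < top"
  by (cases x rule: ennreal_pos_cases) (auto simp: ennreal_epowr)

lemma epowr_finite_iff: "0 < s \<Longrightarrow> x epowr s < top \<longleftrightarrow> x < top"
  using epowr_strict_mono_iff[of s x top] by simp

lemma epowr_minus: "x epowr (- s) * x epowr s = 1" if "0 < x" "x < top"
  using epowr_add'[OF that, of "-s" s] by simp

lemma epowr_SUP:
  assumes "0 < s" "I \<noteq> {}"
  shows "(SUP i\<in>I. f i) epowr s = (SUP i\<in>I. f i epowr s)"
proof (rule antisym)
  show "(SUP i\<in>I. f i) epowr s \<le> (SUP i\<in>I. f i epowr s)"
    using assms by (auto simp: epowr_le_iff intro!: SUP_least) (auto simp flip: epowr_le_iff intro!: SUP_upper)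
  show "(SUP i\<in>I. f i epowr s) \<le> (SUP i\<in>I. f i) epowr s"
    using assms by (auto intro!: SUP_least epowr_mono SUP_upper)
qed

lemma epowr_sum_le:
  assumes "0 \<le> s"
  shows "(x + y) epowr s \<le> ennreal (2 powr s) * (x epowr s + y epowr s)"
proof -
  have *: "x + y \<le> 2 * max x y"
    by (simp add: mult_2 add_mono)
  have "(x + y) epowr s \<le> 2 epowr s * (max x y) epowr s"
    using epowr_mono[OF * assms] by (simp add: epowr_mult assms)
  also have "(2::ennreal) epowr s = ennreal (2 powr s)"
    using ennreal_epowr[of 2 s] by simp
  also have "(max x y) epowr s \<le> x epowr s + y epowr s"
    by (auto simp: max_def)
  finally show ?thesis
    by (simp add: mult_left_mono)
qed

lemma measurable_epowr [measurable]:
  assumes [measurable]: "f \<in> borel_measurable M"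
  shows "(\<lambda>x. f x epowr s) \<in> borel_measurable M"
  unfolding epowr_def by measurable

lemma epowr_le_mult:
  assumes "1 \<le> s" "x \<le> y" shows "x epowr s \<le> x * y epowr (s - 1)"
proof -
  have "x epowr s = x * x epowr (s - 1)"
    using epowr_add[of 1 "s - 1" x] assms by simp
  also have "\<dots> \<le> x * y epowr (s - 1)"
    using assms by (intro mult_left_mono epowr_mono) auto
  finally show ?thesis .
qed

text \<open>Each term is at most the whole sum S, so its s-th power is at most the term times
  S^(s-1), and S S^(s-1) = S^s even for infinite S.\<close>

lemma nn_integral_epowr_superadd:
  assumes "1 \<le> s"
  shows "(\<integral>\<^sup>+i. f i epowr s \<partial>count_space I) \<le> (\<integral>\<^sup>+i. f i \<partial>count_space I) epowr s"
proof -
  let ?S = "\<integral>\<^sup>+i. f i \<partial>count_space I"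
  have "f i \<le> ?S" if "i \<in> I" for i
    using nn_integral_ge_point[OF that] .
  then have "(\<integral>\<^sup>+i. f i epowr s \<partial>count_space I) \<le> (\<integral>\<^sup>+i. f i * ?S epowr (s - 1) \<partial>count_space I)"
    by (intro nn_integral_mono epowr_le_mult assms) auto
  also have "\<dots> = ?S epowr 1 * ?S epowr (s - 1)"
    by (simp add: nn_integral_multc)
  also have "\<dots> = ?S epowr s"
    using epowr_add[of 1 "s - 1" ?S] assms by simp
  finally show ?thesis .
qed

lemma nn_integral_epowr_subadd:
  assumes "0 < s" "s \<le> 1"
  shows "(\<integral>\<^sup>+i. f i \<partial>count_space I) epowr s \<le> (\<integral>\<^sup>+i. f i epowr s \<partial>count_space I)"
  using nn_integral_epowr_superadd[of "1 / s" I "\<lambda>i. f i epowr s"] assms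
  by (simp add: epowr_epowr epowr_le_iff)

section \<open>Powers of two with real exponents\<close>

definition p2 :: "real \<Rightarrow> ennreal" where "p2 x = ennreal (2 powr x)"

lemma p2_pos [simp]: "0 < p2 x" and p2_finite [simp]: "p2 x < top" and p2_0 [simp]: "p2 0 = 1"
  by (auto simp: p2_def)

lemma p2_neq [simp]: "p2 x \<noteq> 0" "p2 x \<noteq> top"
  using p2_pos[of x] p2_finite[of x] by (metis less_irrefl)+

lemma p2_add: "p2 x * p2 y = p2 (x + y)"
  by (simp add: p2_def powr_add flip: ennreal_mult'')

lemma p2_add_left: "p2 x * (p2 y * z) = p2 (x + y) * z"
  by (simp add: p2_add flip: mult.assoc)

lemma p2_epowr: "p2 x epowr s = p2 (x * s)"
  by (simp add: p2_def ennreal_epowr powr_powr)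

lemma p2_le_iff [simp]: "p2 x \<le> p2 y \<longleftrightarrow> x \<le> y"
  by (simp add: p2_def)

lemma p2_less_iff [simp]: "p2 x < p2 y \<longleftrightarrow> x < y"
  by (simp flip: not_le)

lemma p2_eq_iff [simp]: "p2 x = p2 y \<longleftrightarrow> x = y"
  by (simp add: order_eq_iff)

lemma p2_double: "p2 x + p2 x = p2 (x + 1)"
  by (simp add: p2_def powr_add flip: ennreal_plus)

lemma epowr_sum_le_p2: "0 \<le> s \<Longrightarrow> (x + y) epowr s \<le> p2 s * (x epowr s + y epowr s)"
  unfolding p2_def by (rule epowr_sum_le)

lemma p2_unbounded: "x < top \<Longrightarrow> \<exists>k::int. x < p2 k"
proof -
  assume "x < top"
  then obtain y where y: "x = ennreal y" "0 \<le> y" by (cases x) auto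
  obtain n where "y < 2 ^ n" using real_arch_pow[of 2 y] by auto
  then have "y < 2 powr real_of_int (int n)" by (simp add: powr_realpow)
  then show ?thesis using y by (auto simp: p2_def ennreal_less_iff intro!: exI[of _ "int n"])
qed

lemma p2_small: "0 < x \<Longrightarrow> \<exists>k::int. p2 k < x"
proof -
  assume "0 < x"
  then have "x epowr (-1) < top"
    by (cases x rule: ennreal_pos_cases) (auto simp: ennreal_epowr epowr_def)
  then obtain k :: int where k: "x epowr (-1) < p2 k" using p2_unbounded by blast
  have "p2 (- k) < x"
  proof (cases x rule: ennreal_pos_cases)
    case (real y)
    then have "y powr (-1) < 2 powr k" using k by (simp add: ennreal_epowr p2_def ennreal_less_iff)
    then have "1 / y < 2 powr k" using real by (simp add: powr_minus_divide)
    then have "1 < 2 powr k * y" using real by (simp add: field_simps)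
    then have "2 powr (-k) < y" by (simp add: powr_minus field_simps)
    then show ?thesis using real by (simp add: p2_def ennreal_less_iff)
  qed (use \<open>0 < x\<close> in auto)
  then show ?thesis by (intro exI[of _ "- k"]) simp
qed

subsection \<open>Sums over the integers\<close>

abbreviation isum :: "int set \<Rightarrow> (int \<Rightarrow> ennreal) \<Rightarrow> ennreal" where
  "isum I f \<equiv> \<integral>\<^sup>+ k. f k \<partial>count_space I"

lemma isum_restrict: "isum I f = isum UNIV (\<lambda>k. f k * indicator I k)"
  by (simp add: nn_integral_count_space_indicator)

lemma isum_cong: "(\<And>k. k \<in> I \<Longrightarrow> f k = g k) \<Longrightarrow> isum I f = isum I g"
  by (auto intro!: nn_integral_cong)

lemma isum_mono: "(\<And>k. k \<in> I \<Longrightarrow> f k \<le> g k) \<Longrightarrow> isum I f \<le> isum I g"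
  by (auto intro!: nn_integral_mono)

lemma isum_subset: "I \<subseteq> J \<Longrightarrow> isum I f \<le> isum J f"
  unfolding isum_restrict[of I] isum_restrict[of J]
  by (auto intro!: nn_integral_mono split: split_indicator)

lemma isum_cmult: "isum I (\<lambda>k. c * f k) = c * isum I f"
  by (rule nn_integral_cmult) auto

lemma isum_multc: "isum I (\<lambda>k. f k * c) = isum I f * c"
  by (rule nn_integral_multc) auto

lemma isum_add: "isum I (\<lambda>k. f k + g k) = isum I f + isum I g"
  by (rule nn_integral_add) auto

lemma isum_insert_le: "isum (insert i I) f \<le> f i + isum I f"
proof -
  have "isum (insert i I) f \<le> isum UNIV (\<lambda>k. f k * indicator {i} k + f k * indicator I k)"
    unfolding isum_restrict[of "insert i I"]
    by (auto intro!: nn_integral_mono split: split_indicator)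
  also have "\<dots> = isum {i} f + isum I f"
    by (subst isum_add) (simp only: isum_restrict[symmetric])
  also have "isum {i} f = f i"
    by (subst nn_integral_count_space_finite) auto
  finally show ?thesis .
qed

lemma isum_singleton [simp]: "isum {i} f = f i"
  by (subst nn_integral_count_space_finite) auto

lemma isum_point: "i \<in> I \<Longrightarrow> f i \<le> isum I f"
  by (rule nn_integral_ge_point)

lemma isum_reindex: "bij_betw g I J \<Longrightarrow> isum J f = isum I (\<lambda>k. f (g k))"
  by (rule nn_integral_bij_count_space[symmetric])

lemma isum_shift: "isum UNIV (\<lambda>k. f (k + n)) = isum UNIV f"
  by (rule isum_reindex[symmetric]) (auto intro: bij_plus_right)

text \<open>One enumeration of the integers serves all f at once, so that measurability and
  interchange with integrals carry over from \<open>suminf\<close>.\<close>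

lemma isum_suminf:
  obtains e :: "nat \<Rightarrow> int" where "\<And>f. isum UNIV f = (\<Sum>n. f (e n))"
proof
  let ?e = "from_nat_into (UNIV :: int set)"
  have "bij_betw ?e UNIV UNIV"
    by (simp add: bij_betw_from_nat_into infinite_UNIV_int)
  then show "isum UNIV f = (\<Sum>n. f (?e n))" for f
    by (simp add: nn_integral_bij_count_space[symmetric] nn_integral_count_space_nat)
qed

lemma isum_measurable [measurable]:
  assumes "\<And>k. f k \<in> borel_measurable M"
  shows "(\<lambda>x. isum UNIV (\<lambda>k. f k x)) \<in> borel_measurable M"
proof (rule isum_suminf)
  fix e :: "nat \<Rightarrow> int" assume e: "\<And>f. isum UNIV f = (\<Sum>n. f (e n))"
  have [measurable]: "f (e n) \<in> borel_measurable M" for n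
    by (rule assms)
  show ?thesis
    unfolding e by measurable
qed

lemma isum_nn_integral:
  assumes "\<And>k. f k \<in> borel_measurable M"
  shows "(\<integral>\<^sup>+x. isum UNIV (\<lambda>k. f k x) \<partial>M) = isum UNIV (\<lambda>k. \<integral>\<^sup>+x. f k x \<partial>M)"
  by (rule isum_suminf) (simp add: assms nn_integral_suminf)

lemma isum_swap: "isum UNIV (\<lambda>k. isum UNIV (\<lambda>j. f j k)) = isum UNIV (\<lambda>j. isum UNIV (\<lambda>k. f j k))"
  by (rule isum_nn_integral) simp

lemma isum_nat_swap: "isum I (\<lambda>k. (\<Sum>n::nat. f n k)) = (\<Sum>n. isum I (f n))"
  by (rule nn_integral_suminf) simp

text \<open>Needed in \<open>dual_converse\<close>, where the extremal sequence can be normalised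
  only on finite index sets.\<close>

lemma isum_SUP_finite: "isum I f = (SUP J\<in>{J. finite J \<and> J \<subseteq> I}. sum f J)"
proof -
  have "isum I f = (SUP J\<in>{J. finite J \<and> J \<subseteq> I}. isum J f)"
  proof (rule antisym)
    obtain e where e: "\<And>f. isum UNIV f = (\<Sum>n::nat. f (e n))" "bij e"
    proof (rule that)
      show "bij (from_nat_into (UNIV :: int set))"
        by (simp add: bij_betw_from_nat_into infinite_UNIV_int)
      then show "isum UNIV f = (\<Sum>n::nat. f (from_nat_into UNIV n))" for f
        by (simp add: nn_integral_bij_count_space[symmetric] nn_integral_count_space_nat)
    qed
    have "isum I f = (SUP n. (\<Sum>i<n. f (e i) * indicator I (e i)))"
      unfolding isum_restrict[of I] e(1) by (rule suminf_eq_SUP)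
    also have "\<dots> \<le> (SUP J\<in>{J. finite J \<and> J \<subseteq> I}. isum J f)"
    proof (rule SUP_least)
      fix n
      have "(\<Sum>i<n. f (e i) * indicator I (e i)) = (\<Sum>k\<in>e ` {..<n}. f k * indicator I k)"
        using e(2) by (subst sum.reindex) (auto intro: inj_on_subset simp: bij_def)
      also have "\<dots> = (\<Sum>k\<in>e ` {..<n} \<inter> I. f k)"
        by (rule sum.mono_neutral_cong_right) auto
      also have "\<dots> = isum (e ` {..<n} \<inter> I) f"
        by (subst nn_integral_count_space_finite) auto
      finally show "(\<Sum>i<n. f (e i) * indicator I (e i)) \<le> (SUP J\<in>{J. finite J \<and> J \<subseteq> I}. isum J f)"
        by (auto intro!: SUP_upper)
    qed
    finally show "isum I f \<le> (SUP J\<in>{J. finite J \<and> J \<subseteq> I}. isum J f)" .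
  qed (auto intro!: SUP_least isum_subset)
  also have "\<dots> = (SUP J\<in>{J. finite J \<and> J \<subseteq> I}. sum f J)"
    by (auto intro!: SUP_cong nn_integral_count_space_finite)
  finally show ?thesis .
qed

subsection \<open>Geometric Hardy inequality\<close>

definition geo :: "real \<Rightarrow> ennreal" where "geo d = (\<Sum>n::nat. p2 (- (n * d)))"

lemma geo_finite: "0 < d \<Longrightarrow> geo d < top"
proof -
  assume d: "0 < d"
  have eq: "p2 (- (real n * d)) = ennreal ((2 powr (- d)) ^ n)" for n
    by (simp add: p2_def powr_powr mult.commute flip: powr_realpow)
  have "summable (\<lambda>n. (2 powr (- d)) ^ n :: real)"
    using d powr_less_cancel_iff[of 2 "-d" 0] by (intro summable_geometric) auto
  then show ?thesis
    unfolding geo_def eq by (subst suminf_ennreal2) auto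
qed

lemma isum_atMost: "isum {..k} a = (\<Sum>n::nat. a (k - int n))"
proof -
  have "bij_betw (\<lambda>n. k - int n) UNIV {..k}"
    by (rule bij_betw_byWitness[of _ "\<lambda>j. nat (k - j)"]) auto
  from nn_integral_bij_count_space[OF this, of a] show ?thesis
    by (simp add: nn_integral_count_space_nat)
qed

text \<open>The decay d is split evenly. With epsilon = d / (2 s), the first factor is the cost of
  passing from a sum to a supremum, after the s-th power; the second sums the decay d - epsilon s =
  d / 2 that remains over all shifts.\<close>

definition GH :: "real \<Rightarrow> real \<Rightarrow> ennreal" where
  "GH d s = geo (d / (2 * s)) epowr s * geo (d / 2)"

lemma GH_finite: "0 < d \<Longrightarrow> 0 < s \<Longrightarrow> GH d s < top"
  unfolding GH_def by (auto simp: ennreal_mult_less_top intro!: epowr_finite geo_finite)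

text \<open>
  Inserting the factors \<open>2\<^sup>-\<^sup>n\<^sup>\<epsilon> 2\<^sup>n\<^sup>\<epsilon>\<close> bounds the inner sum by a supremum, whose powers are
  at most the sum of the powers of its terms; this avoids a case distinction on the exponent.
\<close>

lemma geometric_Hardy:
  fixes d s :: real
  assumes "0 < d" "0 < s"
  shows "isum UNIV (\<lambda>k. p2 (- d * k) * isum {..k} a epowr s)
    \<le> GH d s * isum UNIV (\<lambda>k. p2 (- d * k) * a k epowr s)"
proof -
  let ?e = "d / (2 * s)"
  let ?S = "isum UNIV (\<lambda>k. p2 (- d * k) * a k epowr s)"
  have *: "isum {..k} a epowr s \<le> geo ?e epowr s * (\<Sum>n. p2 (n * d / 2) * a (k - int n) epowr s)" for k
  proof -
    let ?M = "SUP n::nat. p2 (n * ?e) * a (k - int n)"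
    have "isum {..k} a = (\<Sum>n. p2 (- (real n * ?e)) * (p2 (n * ?e) * a (k - int n)))"
      by (simp add: isum_atMost p2_add_left)
    also have "\<dots> \<le> (\<Sum>n. p2 (- (real n * ?e)) * ?M)"
      by (intro suminf_le mult_left_mono SUP_upper) auto
    also have "\<dots> = geo ?e * ?M"
      by (simp add: geo_def)
    finally have "isum {..k} a epowr s \<le> (geo ?e * ?M) epowr s"
      using assms by (intro epowr_mono) auto
    also have "\<dots> = geo ?e epowr s * ?M epowr s"
      using assms by (intro epowr_mult) auto
    also have "?M epowr s = (SUP n::nat. p2 (n * d / 2) * a (k - int n) epowr s)"
      using assms by (simp add: epowr_SUP epowr_mult p2_epowr)
    also have "\<dots> \<le> (\<Sum>n. p2 (n * d / 2) * a (k - int n) epowr s)"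
    proof (rule SUP_least)
      fix n :: nat
      show "p2 (real n * d / 2) * a (k - int n) epowr s \<le> (\<Sum>n. p2 (n * d / 2) * a (k - int n) epowr s)"
        using sum_le_suminf[of "\<lambda>n. p2 (n * d / 2) * a (k - int n) epowr s" "{n}"] by simp
    qed
    finally show ?thesis
      by (simp add: mult_left_mono)
  qed
  have "isum UNIV (\<lambda>k. p2 (- d * k) * isum {..k} a epowr s)
      \<le> isum UNIV (\<lambda>k. geo ?e epowr s * (\<Sum>n. p2 (- d * k) * (p2 (n * d / 2) * a (k - int n) epowr s)))"
    using mult_left_mono[OF *, of "p2 (- d * _)"]
    by (auto intro!: nn_integral_mono simp: mult.left_commute)
  also have "\<dots> = geo ?e epowr s * (\<Sum>n. isum UNIV (\<lambda>k. p2 (- d * k) * (p2 (n * d / 2) * a (k - int n) epowr s)))"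
    by (simp only: isum_cmult isum_nat_swap)
  also have "(\<lambda>n. isum UNIV (\<lambda>k. p2 (- d * k) * (p2 (n * d / 2) * a (k - int n) epowr s)))
      = (\<lambda>n. p2 (- (n * (d / 2))) * ?S)"
  proof
    fix n :: nat
    have "isum UNIV (\<lambda>k. p2 (- d * k) * (p2 (n * d / 2) * a (k - int n) epowr s))
      = isum UNIV (\<lambda>k. p2 (- d * (k + int n)) * (p2 (n * d / 2) * a (k + int n - int n) epowr s))"
      by (rule isum_shift[symmetric])
    also have "\<dots> = isum UNIV (\<lambda>k. p2 (- (n * (d / 2))) * (p2 (- d * k) * a k epowr s))"
    proof (rule isum_cong)
      fix k :: int
      have "- d * (k + int n) + n * d / 2 = - (n * (d / 2)) + - d * k"
        by (simp add: field_simps)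
      then show "p2 (- d * (k + int n)) * (p2 (n * d / 2) * a (k + int n - int n) epowr s)
          = p2 (- (n * (d / 2))) * (p2 (- d * k) * a k epowr s)"
        by (simp only: p2_add_left add_diff_cancel_right')
    qed
    finally show "isum UNIV (\<lambda>k. p2 (- d * k) * (p2 (n * d / 2) * a (k - int n) epowr s))
      = p2 (- (n * (d / 2))) * ?S"
      by (simp add: isum_cmult)
  qed
  also have "geo ?e epowr s * (\<Sum>n. p2 (- (n * (d / 2))) * ?S) = GH d s * ?S"
    by (simp add: geo_def GH_def mult.assoc)
  finally show ?thesis .
qed

text \<open>Reflection of \<open>geometric_Hardy\<close> under k -> -k. It serves
  \<open>TT_le\<close>, where V from a point up to z collects all the blocks to the right of that
  point.\<close>

lemma geometric_Hardy_dual: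
  fixes d s :: real
  assumes "0 < d" "0 < s"
  shows "isum UNIV (\<lambda>k. p2 (d * k) * isum {k..} a epowr s)
    \<le> GH d s * isum UNIV (\<lambda>k. p2 (d * k) * a k epowr s)"
proof -
  have bij: "bij_betw uminus UNIV (UNIV :: int set)"
    by (rule bij_betw_byWitness[of _ uminus]) auto
  have "isum {- k..} a = isum {..k} (\<lambda>j. a (- j))" for k
    by (rule isum_reindex, rule bij_betw_byWitness[of _ uminus]) auto
  then show ?thesis
    using geometric_Hardy[OF assms, of "\<lambda>j. a (- j)"]
    by (simp add: isum_reindex[OF bij, of "\<lambda>k. p2 (d * k) * isum {k..} a epowr s"]
        isum_reindex[OF bij, of "\<lambda>k. p2 (d * k) * a k epowr s"])
qed

subsection \<open>Hoelder's inequality and duality for sequences\<close>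

lemma epowr_weighted_AM_GM:
  assumes "0 < s" "s < 1"
  shows "x epowr s * y epowr (1 - s) \<le> ennreal s * x + ennreal (1 - s) * y"
proof (cases x rule: ennreal_pos_cases)
  case x: (real x')
  show ?thesis
  proof (cases y rule: ennreal_pos_cases)
    case (real y')
    then show ?thesis
      using Youngs_inequality_0[of s "1 - s" x' y'] x assms
      by (simp add: ennreal_epowr flip: ennreal_mult ennreal_plus)
  qed (use assms x in \<open>auto simp: ennreal_mult_top\<close>)
qed (use assms in \<open>auto simp: ennreal_mult_top\<close>)

text \<open>After normalising both integrals to 1 this is the weighted AM-GM inequality under the
  integral. Integrals equal to 0 or infinity are treated apart, because there the normalising
  factors degenerate.\<close>

lemma nn_integral_Hoelder:
  assumes [measurable]: "f \<in> borel_measurable M" "g \<in> borel_measurable M" and s: "0 < s" "s < 1"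
  shows "(\<integral>\<^sup>+x. f x epowr s * g x epowr (1 - s) \<partial>M)
    \<le> (\<integral>\<^sup>+x. f x \<partial>M) epowr s * (\<integral>\<^sup>+x. g x \<partial>M) epowr (1 - s)"
proof -
  let ?F = "\<integral>\<^sup>+x. f x \<partial>M" and ?G = "\<integral>\<^sup>+x. g x \<partial>M"
  consider "?F = 0 \<or> ?G = 0" | "?F \<noteq> 0" "?G \<noteq> 0" "?F = top \<or> ?G = top"
    | "0 < ?F" "?F < top" "0 < ?G" "?G < top"
    by (metis less_top zero_less_iff_neq_zero)
  then show ?thesis
  proof cases
    case 1
    then have "AE x in M. f x epowr s * g x epowr (1 - s) = 0"
      using s by (auto simp: nn_integral_0_iff_AE elim!: eventually_mono)
    then have "(\<integral>\<^sup>+x. f x epowr s * g x epowr (1 - s) \<partial>M) = 0"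
      by (subst nn_integral_0_iff_AE) auto
    then show ?thesis by simp
  next
    case 2
    then have "?F epowr s * ?G epowr (1 - s) = top"
      using s by (auto simp: ennreal_top_mult ennreal_mult_top epowr_eq_0_iff)
    then show ?thesis by simp
  next
    case 3
    let ?a = "?F epowr (-1)" and ?b = "?G epowr (-1)"
    have a: "?a * ?F = 1" "?b * ?G = 1"
      using 3 epowr_minus[of ?F 1] epowr_minus[of ?G 1] by simp_all
    have "?F epowr s * ?a epowr s = 1" "?G epowr (1 - s) * ?b epowr (1 - s) = 1"
      using 3 epowr_minus[of ?F s] epowr_minus[of ?G "1 - s"]
      by (simp_all add: epowr_epowr mult.commute)
    then have "f x epowr s * g x epowr (1 - s)
        = (?F epowr s * ?G epowr (1 - s)) * ((?a * f x) epowr s * (?b * g x) epowr (1 - s))" for x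
    proof -
      have "(?F epowr s * ?G epowr (1 - s)) * ((?a * f x) epowr s * (?b * g x) epowr (1 - s))
        = (?F epowr s * ?a epowr s) * (?G epowr (1 - s) * ?b epowr (1 - s)) * (f x epowr s * g x epowr (1 - s))"
        using s by (simp add: epowr_mult ac_simps)
      also have "\<dots> = f x epowr s * g x epowr (1 - s)"
        by (simp only: \<open>?F epowr s * ?a epowr s = 1\<close> \<open>?G epowr (1 - s) * ?b epowr (1 - s) = 1\<close> mult_1)
      finally show ?thesis by simp
    qed
    also have "\<dots> x \<le> (?F epowr s * ?G epowr (1 - s)) * (ennreal s * (?a * f x) + ennreal (1 - s) * (?b * g x))" for x
      by (intro mult_left_mono epowr_weighted_AM_GM s) auto
    finally have "(\<integral>\<^sup>+x. f x epowr s * g x epowr (1 - s) \<partial>M)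
        \<le> (\<integral>\<^sup>+x. (?F epowr s * ?G epowr (1 - s)) * (ennreal s * (?a * f x) + ennreal (1 - s) * (?b * g x)) \<partial>M)"
      by (rule nn_integral_mono)
    also have "\<dots> = (?F epowr s * ?G epowr (1 - s)) * (ennreal s * (?a * ?F) + ennreal (1 - s) * (?b * ?G))"
      by (simp add: nn_integral_cmult nn_integral_add)
    also have "ennreal s * (?a * ?F) + ennreal (1 - s) * (?b * ?G) = 1"
      unfolding a using s by (simp flip: ennreal_plus)
    finally show ?thesis by simp
  qed
qed

text \<open>
  The norm of the diagonal operator with entries \<open>X\<close> (after the \<open>s\<close>-th power) from
  \<open>\<ell>\<^sup>1\<close> to \<open>\<ell>\<^sup>s\<close>.
\<close>

definition dual :: "real \<Rightarrow> int set \<Rightarrow> (int \<Rightarrow> ennreal) \<Rightarrow> ennreal" where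
  "dual s I X = (if s < 1 then isum I (\<lambda>i. X i epowr (1 / (1 - s))) epowr (1 - s) else (SUP i\<in>I. X i))"

lemma dual_Hoelder:
  assumes "0 < s"
  shows "isum I (\<lambda>i. X i * A i epowr s) \<le> dual s I X * isum I A epowr s"
proof (cases "s < 1")
  case True
  have "isum I (\<lambda>i. X i * A i epowr s) = isum I (\<lambda>i. A i epowr s * (X i epowr (1 / (1 - s))) epowr (1 - s))"
    using True by (simp add: epowr_epowr mult.commute)
  also have "\<dots> \<le> isum I A epowr s * isum I (\<lambda>i. X i epowr (1 / (1 - s))) epowr (1 - s)"
    using True assms by (intro nn_integral_Hoelder) auto
  finally show ?thesis
    using True by (simp add: dual_def mult.commute)
next
  case False
  have "isum I (\<lambda>i. X i * A i epowr s) \<le> isum I (\<lambda>i. (SUP i\<in>I. X i) * A i epowr s)"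
    by (intro isum_mono mult_right_mono SUP_upper) auto
  also have "\<dots> \<le> (SUP i\<in>I. X i) * isum I A epowr s"
    unfolding isum_cmult using False by (intro mult_left_mono nn_integral_epowr_superadd) auto
  finally show ?thesis
    using False by (simp add: dual_def)
qed

text \<open>For s >= 1 unit vectors suffice. For s < 1 the equality case of Hoelder's inequality,
  A_i proportional to X_i^(1/(1-s)), is tested on finite sets J; there the normalising sum is
  finite, because unit vectors already give X_i <= K < infinity.\<close>

lemma dual_converse:
  assumes "0 < s"
  assumes K: "\<And>A. (\<And>i. A i < top) \<Longrightarrow> (\<And>i. i \<notin> I \<Longrightarrow> A i = 0) \<Longrightarrow> isum UNIV A \<le> 1 \<Longrightarrow>
    isum I (\<lambda>i. X i * A i epowr s) \<le> K"
  shows "dual s I X \<le> K"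
proof -
  have point: "X i \<le> K" if "i \<in> I" for i
  proof -
    have "X i = X i * (indicator {i} i :: ennreal) epowr s"
      by simp
    also have "\<dots> \<le> isum I (\<lambda>j. X j * (indicator {i} j) epowr s)"
      using that by (rule isum_point)
    also have "\<dots> \<le> K"
      using that isum_restrict[of "{i}" "\<lambda>_. 1"] by (intro K) (auto split: split_indicator)
    finally show ?thesis .
  qed
  show ?thesis
  proof (cases "s < 1 \<and> K < top")
    case False
    then show ?thesis
      using point by (auto simp: dual_def less_top[symmetric] intro!: SUP_least)
  next
    case True
    then have s: "0 < s" "s < 1" and "K < top" using assms by auto
    have "sum (\<lambda>i. X i epowr (1 / (1 - s))) J \<le> K epowr (1 / (1 - s))" if J: "finite J" "J \<subseteq> I" for J
    proof -
      let ?c = "\<lambda>i. X i epowr (1 / (1 - s))"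
      let ?Y = "sum ?c J"
      have fin: "?c i < top" if "i \<in> J" for i
        using point[of i] that J s \<open>K < top\<close> by (intro epowr_finite) auto
      then have "?Y < top" using J by auto
      show ?thesis
      proof (cases "?Y = 0")
        case False
        then have "0 < ?Y" by (auto simp: zero_less_iff_neq_zero)
        note Y = this \<open>?Y < top\<close>
        define A where "A i = ?c i * ?Y epowr (-1) * indicator J i" for i
        have "isum UNIV A = isum J (\<lambda>i. ?c i * ?Y epowr (-1))"
          unfolding A_def isum_restrict[of J] ..
        also have "\<dots> = ?Y * ?Y epowr (-1)"
          using J by (simp add: isum_multc nn_integral_count_space_finite)
        also have "\<dots> = 1"
          using epowr_minus[OF Y, of 1] by (simp add: mult.commute)
        finally have A: "isum UNIV A \<le> 1" by simp
        have "?Y epowr (1 - s) = ?Y * ?Y epowr (- s)"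
          using epowr_add'[OF Y, of 1 "- s"] by simp
        also have "\<dots> = isum J (\<lambda>i. ?c i * ?Y epowr (- s))"
          using J by (simp add: isum_multc nn_integral_count_space_finite)
        also have "\<dots> = isum J (\<lambda>i. X i * A i epowr s)"
        proof (rule isum_cong)
          fix i assume "i \<in> J"
          have "?c i = X i * ?c i epowr s"
          proof -
            have "1 / (1 - s) = 1 + s / (1 - s)"
              using s by (simp add: field_simps)
            then have "?c i = X i * X i epowr (s / (1 - s))"
              using epowr_add[of 1 "s / (1 - s)" "X i"] s by simp
            moreover have "?c i epowr s = X i epowr (s / (1 - s))"
              by (simp add: epowr_epowr)
            ultimately show ?thesis
              by (simp only:)
          qed
          then have "?c i * ?Y epowr (- s) = X i * ?c i epowr s * ?Y epowr (- s)"
            by metis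
          then show "?c i * ?Y epowr (- s) = X i * A i epowr s"
            using \<open>i \<in> J\<close> s by (simp add: A_def epowr_mult epowr_epowr mult.assoc)
        qed
        also have "\<dots> \<le> isum I (\<lambda>i. X i * A i epowr s)"
          using J by (intro isum_subset)
        also have "\<dots> \<le> K"
        proof (rule K[OF _ _ A])
          show "A i < top" for i
            using fin[of i] epowr_finite'[OF Y, of "-1"] by (auto simp: A_def ennreal_mult_less_top split: split_indicator)
        qed (use J in \<open>auto simp: A_def indicator_def\<close>)
        finally show ?thesis
          using s by (simp add: epowr_le_iff)
      qed simp
    qed
    then have "isum I (\<lambda>i. X i epowr (1 / (1 - s))) \<le> K epowr (1 / (1 - s))"
      unfolding isum_SUP_finite[of I] by (auto intro!: SUP_least)
    then show ?thesis
      using s by (simp add: dual_def epowr_le_iff)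
  qed
qed

text \<open>If every admissible A missed the norm by a factor of 2, \<open>dual_converse\<close>
  would bound the norm by half of itself.\<close>

lemma dual_attain:
  assumes "0 < s" "dual s I X < top"
  obtains A where "\<And>i. A i < top" "\<And>i. i \<notin> I \<Longrightarrow> A i = 0" "isum UNIV A \<le> 1"
    "dual s I X \<le> p2 1 * isum I (\<lambda>i. X i * A i epowr s)"
proof (cases "dual s I X = 0")
  case True
  then show ?thesis by (intro that[of "\<lambda>_. 0"]) auto
next
  case False
  have "\<exists>A. (\<forall>i. A i < top) \<and> (\<forall>i. i \<notin> I \<longrightarrow> A i = 0) \<and> isum UNIV A \<le> 1 \<and>
    dual s I X \<le> p2 1 * isum I (\<lambda>i. X i * A i epowr s)"
  proof (rule ccontr)
    assume *: "\<not> ?thesis"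
    have "dual s I X \<le> p2 (-1) * dual s I X"
    proof (rule dual_converse[OF assms(1)])
      fix A assume "\<And>i. A i < top" "\<And>i. i \<notin> I \<Longrightarrow> A i = 0" "isum UNIV A \<le> 1"
      then have "p2 1 * isum I (\<lambda>i. X i * A i epowr s) \<le> dual s I X"
        using * by (meson le_cases)
      from mult_left_mono[OF this, of "p2 (-1)"]
      show "isum I (\<lambda>i. X i * A i epowr s) \<le> p2 (-1) * dual s I X"
        by (simp add: p2_add_left)
    qed
    moreover have "p2 (-1) * dual s I X < 1 * dual s I X"
      using False assms(2) p2_less_iff[of "-1" 0]
      by (intro ennreal_mult_strict_right_mono) (auto simp: zero_less_iff_neq_zero)
    ultimately show False by simp
  qed
  then show ?thesis using that by blast
qed

subsection \<open>Integrals over intervals\<close>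

declare einterval_eq [simp del]

lemma ereal_real_trans:
  "x < ereal s \<Longrightarrow> s \<le> t \<Longrightarrow> x < ereal t"
  "x \<le> ereal s \<Longrightarrow> s \<le> t \<Longrightarrow> x \<le> ereal t"
  "ereal t < y \<Longrightarrow> s \<le> t \<Longrightarrow> ereal s < y"
  "ereal t \<le> y \<Longrightarrow> s \<le> t \<Longrightarrow> ereal s \<le> y"
  by (metis ereal_less_eq(3) less_le_trans order_trans le_less_trans)+

lemma einterval_lebesgue [measurable, simp]: "einterval x y \<in> sets lebesgue"
  by (intro sets_completionI_sets) simp

lemma einterval_subset: "x' \<le> x \<Longrightarrow> y \<le> y' \<Longrightarrow> einterval x y \<subseteq> einterval x' y'"
  by (auto simp: einterval_iff)

lemma einterval_empty: "y \<le> x \<Longrightarrow> einterval x y = {}"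
  by (auto simp: einterval_iff)

lemma space_lebesgue_on_einterval [simp]: "space (lebesgue_on (einterval x y)) = einterval x y"
  by (simp add: space_restrict_space)

lemma integ_empty [simp]: "y \<le> x \<Longrightarrow> integ x y g = 0"
  by (simp add: einterval_empty)

lemma integ_cong: "(\<And>t. t \<in> einterval x y \<Longrightarrow> f t = g t) \<Longrightarrow> integ x y f = integ x y g"
  by (auto intro!: nn_integral_cong split: split_indicator)

lemma integ_mono: "(\<And>t. t \<in> einterval x y \<Longrightarrow> f t \<le> g t) \<Longrightarrow> integ x y f \<le> integ x y g"
  by (auto intro!: nn_integral_mono split: split_indicator)

lemma integ_subset: "x' \<le> x \<Longrightarrow> y \<le> y' \<Longrightarrow> integ x y g \<le> integ x' y' g"
  using einterval_subset[of x' x y y'] by (auto intro!: nn_integral_mono split: split_indicator)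

lemma einterval_positive: "x < y \<Longrightarrow> einterval x y \<notin> null_sets lebesgue"
  using einterval_nonempty[of x y] open_not_negligible[of "einterval x y"]
  by (auto simp: negligible_iff_null_sets)

lemma AE_lebesgue_neq: "AE t in lebesgue. t \<noteq> c"
  by (rule AE_I'[of "{c}"]) (auto simp flip: negligible_iff_null_sets)

lemma einterval_convex:
  assumes "t1 \<in> einterval x y" "t2 \<in> einterval x y" "t1 \<le> s" "s \<le> t2"
  shows "s \<in> einterval x y"
proof -
  have "ereal t1 \<le> ereal s" "ereal s \<le> ereal t2" using assms by auto
  then show ?thesis
    using assms(1,2) unfolding einterval_iff by (meson le_less_trans less_le_trans)
qed

lemma einterval_dense: "(x::ereal) < y \<Longrightarrow> \<exists>t. x < ereal t \<and> ereal t < y"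
  using einterval_nonempty[of x y] by (auto simp: einterval_iff)

section \<open>Integrals over subintervals: additivity and continuity in the end points\<close>

locale interval =
  fixes a :: real and b :: ereal
  assumes ab: "ereal a < b"
begin

abbreviation "L \<equiv> lebesgue_on (einterval (ereal a) b)"

lemma integ_L: "ereal a \<le> x \<Longrightarrow> y \<le> b \<Longrightarrow> integ x y g = (\<integral>\<^sup>+t. g t * indicator (einterval x y) t \<partial>L)"
  using einterval_subset[of a x y b]
  by (subst nn_integral_restrict_space) (auto intro!: nn_integral_cong split: split_indicator)

lemma measurable_lebesgue_on_subset:
  "g \<in> borel_measurable L \<Longrightarrow> ereal a \<le> x \<Longrightarrow> y \<le> b \<Longrightarrow> g \<in> borel_measurable (lebesgue_on (einterval x y))"
  by (rule measurable_restrict_mono[of _ lebesgue "einterval a b"]) (auto dest: einterval_subset)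

lemma measurable_indicator [measurable]: "indicator (einterval x y) \<in> borel_measurable L"
  by (rule measurable_restrict_space1) simp

lemma AE_L_neq: "AE t in L. t \<noteq> c"
  using AE_lebesgue_neq[of c] by (simp add: AE_restrict_space_iff) (auto elim: eventually_mono)

lemma integ_cmult:
  assumes "g \<in> borel_measurable L" "ereal a \<le> x" "y \<le> b"
  shows "integ x y (\<lambda>t. c * g t) = c * integ x y g"
  using assms unfolding integ_L[OF assms(2,3)] by (simp add: nn_integral_cmult mult.assoc)

lemma integ_multc:
  assumes "g \<in> borel_measurable L" "ereal a \<le> x" "y \<le> b"
  shows "integ x y (\<lambda>t. g t * c) = integ x y g * c"
  using integ_cmult[OF assms, of c] by (simp add: mult.commute)

lemma integ_add:
  assumes [measurable]: "g \<in> borel_measurable L" "h \<in> borel_measurable L" and "ereal a \<le> x" "y \<le> b"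
  shows "integ x y (\<lambda>t. g t + h t) = integ x y g + integ x y h"
  using assms unfolding integ_L[OF assms(3,4)] by (simp add: nn_integral_add distrib_right)

lemma integ_isum:
  assumes [measurable]: "\<And>k. g k \<in> borel_measurable L" and "ereal a \<le> x" "y \<le> b"
  shows "integ x y (\<lambda>t. isum UNIV (\<lambda>k. g k t)) = isum UNIV (\<lambda>k. integ x y (g k))"
  using assms unfolding integ_L[OF assms(2,3)] by (simp add: isum_nn_integral flip: isum_multc)

lemma integ_emeasure:
  assumes "g \<in> borel_measurable L" "ereal a \<le> x" "y \<le> b"
  shows "integ x y g = emeasure (density L g) (einterval x y)"
proof -
  have "einterval x y \<in> sets L"
    using assms einterval_subset[of a x y b] by (simp add: sets_restrict_space_iff)
  then show ?thesis
    using assms by (simp add: integ_L emeasure_density)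
qed

lemma integ_split:
  assumes [measurable]: "g \<in> borel_measurable L" and "ereal a \<le> x" "x \<le> ereal y" "ereal y \<le> z" "z \<le> b"
  shows "integ x z g = integ x y g + integ y z g"
proof -
  have "integ x z g = (\<integral>\<^sup>+t. g t * indicator (einterval x z) t \<partial>L)"
    using assms by (intro integ_L) auto
  also have "\<dots> = (\<integral>\<^sup>+t. g t * indicator (einterval x y) t + g t * indicator (einterval y z) t \<partial>L)"
  proof (rule nn_integral_cong_AE)
    show "AE t in L. g t * indicator (einterval x z) t
      = g t * indicator (einterval x y) t + g t * indicator (einterval y z) t"
      using AE_L_neq[of y]
    proof eventually_elim
      case (elim t)
      have "t \<in> einterval x z \<longleftrightarrow> t \<in> einterval x y \<or> t \<in> einterval y z"
        "\<not> (t \<in> einterval x y \<and> t \<in> einterval y z)"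
        using assms(3,4) elim by (auto simp: einterval_iff) (metis ereal_less_eq(3) less_le_trans le_less_trans linorder_cases not_le)+
      then show ?case
        by (auto split: split_indicator)
    qed
  qed
  also have "\<dots> = integ x y g + integ y z g"
    using assms order_trans[OF assms(2,3)] order_trans[OF assms(4,5)]
    by (simp add: integ_L nn_integral_add)
  finally show ?thesis .
qed

lemma integ_pos:
  assumes [measurable]: "g \<in> borel_measurable L" and pos: "AE t in L. 0 < g t" and "ereal a \<le> x" "x < y" "y \<le> b"
  shows "0 < integ x y g"
proof (rule ccontr)
  assume "\<not> ?thesis"
  then have "(\<integral>\<^sup>+t. g t * indicator (einterval x y) t \<partial>L) = 0"
    using assms by (simp add: integ_L)
  then have "AE t in L. g t * indicator (einterval x y) t = 0"
    by (subst (asm) nn_integral_0_iff_AE) auto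
  then have "AE t in L. t \<notin> einterval x y"
    using pos by eventually_elim (auto split: split_indicator)
  then have "AE t in lebesgue. t \<notin> einterval x y"
    using einterval_subset[of a x y b] assms by (simp add: AE_restrict_space_iff) (auto elim!: eventually_mono)
  then have "einterval x y \<in> null_sets lebesgue"
    by (subst (asm) AE_iff_null_sets[symmetric]) auto
  then show False
    using einterval_positive assms by auto
qed

text \<open>Continuity from below of the measure with density g, along left end points that decrease
  to x.\<close>

lemma integ_less_left:
  assumes g: "g \<in> borel_measurable L" and "ereal a \<le> x" "y \<le> b" "c < integ x y g"
  obtains t where "x < ereal t" "ereal t < y" "c < integ t y g"
proof -
  have "x < y" using assms by (cases "x < y") auto
  obtain X :: "nat \<Rightarrow> real" where X: "decseq X" "\<And>i. x < X i" "\<And>i. X i < y" "X \<longlonglongrightarrow> x"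
    using ereal_decseq_approx[OF \<open>x < y\<close>] by blast
  have "integ x y g = emeasure (density L g) (\<Union>n. einterval (X n) y)"
  proof -
    have "(\<Union>n. einterval (X n) y) = einterval x y"
    proof (intro set_eqI iffI)
      fix t assume "t \<in> einterval x y"
      then have "\<forall>\<^sub>F n in sequentially. ereal (X n) < ereal t"
        using X(4) by (intro order_tendstoD) (auto simp: einterval_iff)
      then obtain n where "X n < t"
        by (auto simp: eventually_sequentially)
      then show "t \<in> (\<Union>n. einterval (X n) y)"
        using \<open>t \<in> einterval x y\<close> by (auto simp: einterval_iff)
    qed (use X(2) in \<open>auto simp: einterval_iff intro: ereal_real_trans(1)[OF _ less_imp_le]\<close>)
    then show ?thesis using assms by (simp add: integ_emeasure)
  qed
  also have "\<dots> = (SUP n. emeasure (density L g) (einterval (X n) y))"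
  proof (rule SUP_emeasure_incseq[symmetric])
    show "range (\<lambda>n. einterval (X n) y) \<subseteq> sets (density L g)"
    proof -
      have "einterval (X n) y \<subseteq> einterval a b" for n
        using less_imp_le[OF le_less_trans[OF assms(2) X(2)]] assms(3) by (rule einterval_subset)
      then show ?thesis by (auto simp: sets_restrict_space_iff)
    qed
    show "incseq (\<lambda>n. einterval (X n) y)"
    proof (rule monoI)
      fix m n :: nat assume "m \<le> n"
      then show "einterval (X m) y \<subseteq> einterval (X n) y"
        using X(1) by (intro einterval_subset) (auto simp: decseq_def)
    qed
  qed
  also have "\<dots> = (SUP n. integ (X n) y g)"
    using X(2) assms less_imp_le[OF le_less_trans[OF assms(2) X(2)]]
    by (auto intro!: SUP_cong integ_emeasure[symmetric])
  finally obtain n where "c < integ (X n) y g"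
    using assms(4) by (auto simp: less_SUP_iff)
  then show ?thesis using X that by blast
qed

lemma integ_less_right:
  assumes g: "g \<in> borel_measurable L" and "ereal a \<le> x" "y \<le> b" "c < integ x y g"
  obtains t where "x < ereal t" "ereal t < y" "c < integ x t g"
proof -
  have "x < y" using assms by (cases "x < y") auto
  obtain X :: "nat \<Rightarrow> real" where X: "incseq X" "\<And>i. x < X i" "\<And>i. X i < y" "X \<longlonglongrightarrow> y"
    using ereal_incseq_approx[OF \<open>x < y\<close>] by blast
  have "integ x y g = emeasure (density L g) (\<Union>n. einterval x (X n))"
  proof -
    have "(\<Union>n. einterval x (X n)) = einterval x y"
    proof (intro set_eqI iffI)
      fix t assume "t \<in> einterval x y"
      then have "\<forall>\<^sub>F n in sequentially. ereal t < ereal (X n)"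
        using X(4) by (intro order_tendstoD) (auto simp: einterval_iff)
      then obtain n where "t < X n"
        by (auto simp: eventually_sequentially)
      then show "t \<in> (\<Union>n. einterval x (X n))"
        using \<open>t \<in> einterval x y\<close> by (auto simp: einterval_iff)
    qed (use X(3) in \<open>auto simp: einterval_iff intro: ereal_real_trans(3)[OF _ less_imp_le]\<close>)
    then show ?thesis using assms by (simp add: integ_emeasure)
  qed
  also have "\<dots> = (SUP n. emeasure (density L g) (einterval x (X n)))"
  proof (rule SUP_emeasure_incseq[symmetric])
    show "range (\<lambda>n. einterval x (X n)) \<subseteq> sets (density L g)"
    proof -
      have "einterval x (X n) \<subseteq> einterval a b" for n
        using assms(2) less_imp_le[OF less_le_trans[OF X(3) assms(3)]] by (rule einterval_subset)
      then show ?thesis by (auto simp: sets_restrict_space_iff)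
    qed
    show "incseq (\<lambda>n. einterval x (X n))"
    proof (rule monoI)
      fix m n :: nat assume "m \<le> n"
      then show "einterval x (X m) \<subseteq> einterval x (X n)"
        using X(1) by (intro einterval_subset) (auto simp: incseq_def)
    qed
  qed
  also have "\<dots> = (SUP n. integ x (X n) g)"
    using X(3) assms less_imp_le[OF less_le_trans[OF X(3) assms(3)]]
    by (auto intro!: SUP_cong integ_emeasure[symmetric])
  finally obtain n where "c < integ x (X n) g"
    using assms(4) by (auto simp: less_SUP_iff)
  then show ?thesis using X that by blast
qed

text \<open>Since the total is finite, e can be subtracted from it: \<open>integ_less_right\<close>
  gives a point before which more than the difference lies, and less than e is left beyond
  it.\<close>

lemma integ_small_tail:
  assumes g: "g \<in> borel_measurable L" and x: "ereal a \<le> ereal x" "x < y" "y \<le> b"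
    and fin: "integ x y g < top" and e: "0 < e"
  obtains t where "x < t" "ereal t < y" "integ t y g < e"
proof (cases "integ x y g < e")
  case True
  obtain t :: real where t: "ereal x < t" "t < y" using einterval_dense[OF x(2)] by auto
  then have "integ t y g < e"
    using True integ_subset[of x t y y g] by (auto intro: le_less_trans)
  then show ?thesis using t that by auto
next
  case False
  let ?I = "integ x y g"
  have "e \<le> ?I" using False by simp
  have "?I - e < ?I"
    using fin e \<open>e \<le> ?I\<close> by (intro ennreal_between) auto
  then obtain t where t: "ereal x < t" "ereal t < y" "?I - e < integ x t g"
    using integ_less_right[OF g x(1,3)] by blast
  have "?I = integ x t g + integ t y g"
    using t x by (intro integ_split g) auto
  have "integ t y g < e"
  proof (rule ccontr)
    assume "\<not> ?thesis"
    then have "integ x t g + e \<le> ?I"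
      unfolding \<open>?I = integ x t g + integ t y g\<close> by (intro add_mono) auto
    also have "\<dots> = (?I - e) + e"
      using \<open>e \<le> ?I\<close> by (simp add: diff_add_cancel_ennreal)
    also have "\<dots> < integ x t g + e"
      using t(3) \<open>e \<le> ?I\<close> fin by (simp add: add.commute[of _ e] ennreal_add_left_cancel_less)
    finally show False by simp
  qed
  then show ?thesis using t that by auto
qed

text \<open>The solution is the supremum s of the points whose tail exceeds c. A tail above c at s
  would stay above c slightly to the right, by \<open>integ_less_left\<close>; a tail below c would
  stay below c slightly to the left, by \<open>integ_small_tail\<close>. Only tails at interior
  points are assumed finite, so infinite mass near x is allowed.\<close>

lemma integ_intermediate:
  assumes g: "g \<in> borel_measurable L" and x: "ereal a \<le> x" "x < y" "y \<le> b"
    and fin: "\<And>t. x < ereal t \<Longrightarrow> ereal t < y \<Longrightarrow> integ t y g < top"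
    and c: "0 < c" "c < integ x y g"
  obtains t where "x < ereal t" "ereal t < y" "integ t y g = c"
proof -
  let ?S = "{t. x < ereal t \<and> ereal t < y \<and> c < integ t y g}"
  obtain t0 where t0: "x < ereal t0" "ereal t0 < y" "c < integ t0 y g"
    using integ_less_left[OF g x(1,3) c(2)] by blast
  obtain t1 where t1: "t0 < t1" "ereal t1 < y" "integ t1 y g < c"
    using integ_small_tail[OF g _ t0(2) x(3) fin[OF t0(1,2)] c(1)] t0(1) x(1) by (metis le_less_trans less_imp_le)
  have ub: "t \<le> t1" if "t \<in> ?S" for t
  proof (rule ccontr)
    assume "\<not> ?thesis"
    then have "integ t y g \<le> integ t1 y g" by (intro integ_subset) auto
    then show False using that t1(3) by auto
  qed
  then have bdd: "bdd_above ?S" by (auto simp: bdd_above_def)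
  define s where "s = Sup ?S"
  have "t0 \<le> s" unfolding s_def using t0 bdd by (intro cSup_upper) auto
  have "s \<le> t1" unfolding s_def using t0 ub by (intro cSup_least) auto
  have s: "x < ereal s" "ereal s < y"
    using \<open>t0 \<le> s\<close> \<open>s \<le> t1\<close> t0(1) t1(2) by (meson ereal_less_eq(3) less_le_trans le_less_trans)+
  have as: "ereal a \<le> ereal s" using s x by (meson le_less_trans less_imp_le)
  have at0: "ereal a \<le> ereal t0" and sb: "ereal s \<le> b"
    using t0(1) x s(2) by (meson le_less_trans less_le_trans less_imp_le)+
  have "\<not> c < integ s y g"
  proof
    assume "c < integ s y g"
    then obtain t where t: "ereal s < t" "ereal t < y" "c < integ t y g"
      using integ_less_left[OF g as x(3)] by blast
    then have "t \<in> ?S" using s(1) by (auto intro: less_trans)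
    then have "t \<le> s" unfolding s_def using bdd by (intro cSup_upper)
    then show False using t by auto
  qed
  moreover have "\<not> integ s y g < c"
  proof
    assume *: "integ s y g < c"
    then have "t0 < s"
      using t0(3) \<open>t0 \<le> s\<close> by (cases "t0 = s") auto
    have "0 < c - integ s y g"
      using * by (simp add: diff_gr0_ennreal less_top[symmetric]) 
    moreover have "integ t0 s g < top"
      using integ_subset[of t0 t0 s y g] s fin[OF t0(1,2)] by (meson le_less_trans less_imp_le order_refl)
    ultimately obtain t where t: "t0 < t" "t < s" "integ t s g < c - integ s y g"
      using integ_small_tail[OF g at0, of s "c - integ s y g"] \<open>t0 < s\<close> sb by auto
    obtain t' where t': "t' \<in> ?S" "t < t'"
      using less_cSup_iff[of ?S t] t(2) bdd t0 unfolding s_def by auto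
    have "integ t' y g \<le> integ t y g"
      using t' by (intro integ_subset) auto
    also have "\<dots> = integ t s g + integ s y g"
      using t at0 s x by (intro integ_split g) (auto intro: less_imp_le)
    also have "\<dots> \<le> (c - integ s y g) + integ s y g"
      using t by (intro add_right_mono) auto
    also have "\<dots> = c"
      using * by (simp add: diff_add_cancel_ennreal)
    finally show False using t' by auto
  qed
  ultimately show ?thesis using s that[of s] by (metis linorder_cases)
qed

lemma integ_strict:
  assumes g: "g \<in> borel_measurable L" and pos: "AE t in L. 0 < g t" and "ereal a \<le> ereal s" "s < t" "ereal t \<le> y" "y \<le> b"
    and fin: "integ t y g < top"
  shows "integ t y g < integ s y g"
proof -
  have "integ s y g = integ s t g + integ t y g"
    using assms by (intro integ_split) auto
  moreover have "0 < integ s t g"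
    using assms order_trans[OF assms(5,6)] by (intro integ_pos) auto
  ultimately show ?thesis
    using fin by (simp add: add.commute[of "integ s t g"] ennreal_add_left_cancel_less[of _ 0, simplified] less_top[symmetric])
qed

end

subsection \<open>Essential suprema of semicontinuous functions\<close>

text \<open>Superlevel sets are convex, hence intervals, hence Borel sets.\<close>

lemma mono_on_einterval_measurable:
  fixes f :: "real \<Rightarrow> ennreal"
  assumes "(\<forall>s t. s \<in> einterval x y \<longrightarrow> t \<in> einterval x y \<longrightarrow> s \<le> t \<longrightarrow> f s \<le> f t) \<or>
    (\<forall>s t. s \<in> einterval x y \<longrightarrow> t \<in> einterval x y \<longrightarrow> s \<le> t \<longrightarrow> f t \<le> f s)"
  shows "f \<in> borel_measurable (lebesgue_on (einterval x y))"
proof (rule borel_measurableI_greater)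
  fix c
  let ?S = "{t \<in> einterval x y. c < f t}"
  have "s \<in> ?S" if "t1 \<in> ?S" "t2 \<in> ?S" "t1 \<le> s" "s \<le> t2" for s t1 t2
  proof -
    have "s \<in> einterval x y"
      using that einterval_convex by blast
    then show ?thesis
      using that assms by (auto intro: less_le_trans)
  qed
  then have "is_interval ?S"
    unfolding is_interval_1 by blast
  then have "?S \<in> sets borel"
    by (simp add: is_interval_convex_1 real_interval_borel_measurable is_interval_convex)
  then have "?S \<in> sets lebesgue" by (intro sets_completionI_sets) simp
  then show "{t \<in> space (lebesgue_on (einterval x y)). c < f t} \<in> sets (lebesgue_on (einterval x y))"
    by (subst sets_restrict_space_iff) auto
qed

lemmas mono_measurable = mono_on_einterval_measurable[OF disjI1, rule_format]
lemmas antimono_measurable = mono_on_einterval_measurable[OF disjI2, rule_format]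

lemma ess_sup_le:
  assumes "f \<in> borel_measurable (lebesgue_on (einterval x y))" "\<And>t. t \<in> einterval x y \<Longrightarrow> f t \<le> c"
  shows "ess_sup x y f \<le> c"
  using assms by (intro esssup_I AE_I2) auto

lemma le_ess_sup:
  assumes "x \<le> s1" "s1 < s2" "s2 \<le> y" "\<And>s. s \<in> einterval s1 s2 \<Longrightarrow> c \<le> f s"
  shows "c \<le> ess_sup x y f"
proof (rule ccontr)
  assume *: "\<not> ?thesis"
  have "AE s in lebesgue. s \<in> einterval x y \<longrightarrow> f s \<le> ess_sup x y f"
    using esssup_AE[of f "lebesgue_on (einterval x y)"] by (simp add: AE_restrict_space_iff)
  then have "AE s in lebesgue. s \<notin> einterval s1 s2"
    using einterval_subset[OF assms(1,3)] assms(4) *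
    by (auto elim!: eventually_mono dest: order_trans)
  then have "einterval s1 s2 \<in> null_sets lebesgue"
    by (subst (asm) AE_iff_null_sets[symmetric]) auto
  then show False
    using einterval_positive assms by auto
qed

text \<open>If f exceeds c at t, it is at least c on a nondegenerate interval, which is not a null
  set; so discarding null sets loses no value of f. The interval may lie on one side of t, or not
  even touch it.\<close>

lemma ess_sup_eq_SUP:
  assumes m: "f \<in> borel_measurable (lebesgue_on (einterval x y))"
    and lsc: "\<And>t c. t \<in> einterval x y \<Longrightarrow> c < f t \<Longrightarrow>
      \<exists>s1 s2. x \<le> s1 \<and> s1 < s2 \<and> s2 \<le> y \<and> (\<forall>s\<in>einterval s1 s2. c \<le> f s)"
  shows "ess_sup x y f = (SUP t\<in>einterval x y. f t)"
proof (rule antisym)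
  show "ess_sup x y f \<le> (SUP t\<in>einterval x y. f t)"
    using m by (rule ess_sup_le) (rule SUP_upper)
  show "(SUP t\<in>einterval x y. f t) \<le> ess_sup x y f"
  proof (rule SUP_least, rule dense_le)
    fix t c assume "t \<in> einterval x y" "c < f t"
    then show "c \<le> ess_sup x y f"
      using lsc[of t c] le_ess_sup[of x _ _ y c f] by blast
  qed
qed

lemma mult_less_left_approx:
  fixes A B c :: ennreal
  assumes "c < A * B"
  obtains A' where "A' < A" "c \<le> A' * B"
proof (cases "A = 0 \<or> B = 0")
  case False
  then have "A \<noteq> 0" by simp
  have "(SUP x\<in>{..<A}. x) = A"
    by (rule antisym, rule SUP_least, simp, rule dense_le, rule SUP_upper, simp)
  then have "c < (SUP x\<in>{..<A}. x) * B" using assms by (simp only:)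
  also have "\<dots> = (SUP x\<in>{..<A}. x * B)"
    using \<open>A \<noteq> 0\<close> by (subst SUP_mult_right_ennreal) (auto simp: zero_less_iff_neq_zero)
  finally show ?thesis
    using that by (auto simp: less_SUP_iff intro: less_imp_le)
qed (use assms in auto)

text \<open>
  One factor is monotone and may jump; the other is continuous, so that moving slightly in the
  direction in which the first one grows costs little.
\<close>

lemma ess_sup_right:
  assumes m: "(\<lambda>t. A t * B t) \<in> borel_measurable (lebesgue_on (einterval x y))"
    and A: "\<And>t c. t \<in> einterval x y \<Longrightarrow> c < A t \<Longrightarrow> \<exists>s>t. ereal s \<le> y \<and> (\<forall>s'\<in>{t<..<s}. c \<le> A s')"
    and B: "\<And>s t. s \<in> einterval x y \<Longrightarrow> t \<in> einterval x y \<Longrightarrow> s \<le> t \<Longrightarrow> B s \<le> B t"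
  shows "ess_sup x y (\<lambda>t. A t * B t) = (SUP t\<in>einterval x y. A t * B t)"
proof (rule ess_sup_eq_SUP[OF m])
  fix t c assume t: "t \<in> einterval x y" "c < A t * B t"
  obtain A' where A': "A' < A t" "c \<le> A' * B t"
    using mult_less_left_approx[OF t(2)] by blast
  then obtain s where s: "t < s" "ereal s \<le> y" "\<And>s'. s' \<in> {t<..<s} \<Longrightarrow> A' \<le> A s'"
    using A[OF t(1) A'(1)] by blast
  have "c \<le> A s' * B s'" if "s' \<in> einterval t s" for s'
  proof -
    have s': "s' \<in> einterval x y"
      using that s t(1) unfolding einterval_iff by (meson less_trans less_le_trans)
    have "c \<le> A' * B t" by fact
    also have "\<dots> \<le> A s' * B s'"
      using that s' t s(3)[of s'] by (intro mult_mono B) (auto simp: einterval_iff)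
    finally show ?thesis .
  qed
  then show "\<exists>s1 s2. x \<le> s1 \<and> s1 < s2 \<and> s2 \<le> y \<and> (\<forall>s\<in>einterval s1 s2. c \<le> A s * B s)"
    using s t(1) by (intro exI[of _ "ereal t"] exI[of _ "ereal s"]) (auto simp: einterval_iff)
qed

lemma ess_sup_left:
  assumes m: "(\<lambda>t. A t * B t) \<in> borel_measurable (lebesgue_on (einterval x y))"
    and A: "\<And>t c. t \<in> einterval x y \<Longrightarrow> c < A t \<Longrightarrow> \<exists>s<t. x \<le> ereal s \<and> (\<forall>s'\<in>{s<..<t}. c \<le> A s')"
    and B: "\<And>s t. s \<in> einterval x y \<Longrightarrow> t \<in> einterval x y \<Longrightarrow> s \<le> t \<Longrightarrow> B t \<le> B s"
  shows "ess_sup x y (\<lambda>t. A t * B t) = (SUP t\<in>einterval x y. A t * B t)"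
proof (rule ess_sup_eq_SUP[OF m])
  fix t c assume t: "t \<in> einterval x y" "c < A t * B t"
  obtain A' where A': "A' < A t" "c \<le> A' * B t"
    using mult_less_left_approx[OF t(2)] by blast
  then obtain s where s: "s < t" "x \<le> ereal s" "\<And>s'. s' \<in> {s<..<t} \<Longrightarrow> A' \<le> A s'"
    using A[OF t(1) A'(1)] by blast
  have "c \<le> A s' * B s'" if "s' \<in> einterval s t" for s'
  proof -
    have s': "s' \<in> einterval x y"
      using that s t(1) unfolding einterval_iff by (meson less_trans le_less_trans)
    have "c \<le> A' * B t" by fact
    also have "\<dots> \<le> A s' * B s'"
      using that s' t s(3)[of s'] by (intro mult_mono B) (auto simp: einterval_iff)
    finally show ?thesis .
  qed
  then show "\<exists>s1 s2. x \<le> s1 \<and> s1 < s2 \<and> s2 \<le> y \<and> (\<forall>s\<in>einterval s1 s2. c \<le> A s * B s)"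
    using s t(1) by (intro exI[of _ "ereal s"] exI[of _ "ereal t"]) (auto simp: einterval_iff)
qed

subsection \<open>Dyadic partitions\<close>

context interval
begin

definition partition :: "real \<Rightarrow> ereal \<Rightarrow> (int \<Rightarrow> real) \<Rightarrow> bool" where
  "partition x y \<tau> \<longleftrightarrow> (\<forall>k. x \<le> \<tau> k \<and> ereal (\<tau> k) < y) \<and> (\<forall>k. \<tau> k \<le> \<tau> (k + 1)) \<and>
     (\<forall>t. x < t \<and> ereal t < y \<longrightarrow> (\<exists>k. \<tau> k < t \<and> t \<le> \<tau> (k + 1)))"

text \<open>
  If \<open>g\<close> has finite mass, then \<open>\<tau> k = x\<close> for all small \<open>k\<close>, and blocks may be empty.  The first
  nonempty block has mass at least \<open>2\<^sup>-\<^sup>k\<^sup>-\<^sup>1\<close> because it absorbs a fraction of a dyadic step.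
\<close>

definition dyadic :: "(real \<Rightarrow> ennreal) \<Rightarrow> real \<Rightarrow> ereal \<Rightarrow> (int \<Rightarrow> real) \<Rightarrow> bool" where
  "dyadic g x y \<tau> \<longleftrightarrow> partition x y \<tau> \<and>
     (\<forall>k. x < \<tau> k \<longrightarrow> integ (\<tau> k) y g = p2 (- k)) \<and>
     (\<forall>k. integ (\<tau> k) y g \<le> p2 (1 - k)) \<and>
     (\<forall>k. \<tau> k < \<tau> (k + 1) \<longrightarrow> p2 (- k - 1) \<le> integ (\<tau> k) (\<tau> (k + 1)) g)"

lemma countable_null_sets_lebesgue: "countable A \<Longrightarrow> A \<in> null_sets lebesgue"
  by (intro null_sets_completionI countable_imp_null_set_lborel)

lemma partition_mono:
  assumes "partition x y \<tau>" "j \<le> k" shows "\<tau> j \<le> \<tau> k"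
  using assms(2)
proof (induction k rule: int_ge_induct)
  case (step i)
  then show ?case using assms(1) unfolding partition_def by (meson order_trans)
qed simp

lemma partition_index_le:
  assumes "partition x y \<tau>" "\<tau> j < t" "t \<le> \<tau> (k + 1)" shows "j \<le> k"
proof (rule ccontr)
  assume "\<not> ?thesis"
  then have "\<tau> (k + 1) \<le> \<tau> j" by (intro partition_mono[OF assms(1)]) auto
  then show False using assms by auto
qed

lemma partition_unique:
  assumes "partition x y \<tau>" "\<tau> j < t" "t \<le> \<tau> (j + 1)" "\<tau> k < t" "t \<le> \<tau> (k + 1)" shows "j = k"
  using partition_index_le[OF assms(1,2,5)] partition_index_le[OF assms(1,4,3)] by simp

lemma partition_bounds:
  assumes "partition x y \<tau>" shows "x \<le> \<tau> k" "ereal (\<tau> k) < y" "\<tau> k \<le> \<tau> (k + 1)"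
  using assms by (auto simp: partition_def)

lemma partition_obtain:
  assumes "partition x y \<tau>" "x < t" "ereal t < y"
  obtains k where "\<tau> k < t" "t \<le> \<tau> (k + 1)"
  using assms by (auto simp: partition_def)

lemma dyadicD:
  assumes "dyadic g x y \<tau>"
  shows "partition x y \<tau>" "x < \<tau> k \<Longrightarrow> integ (\<tau> k) y g = p2 (- k)" "integ (\<tau> k) y g \<le> p2 (1 - k)"
    "\<tau> k < \<tau> (k + 1) \<Longrightarrow> p2 (- k - 1) \<le> integ (\<tau> k) (\<tau> (k + 1)) g"
  using assms by (auto simp: dyadic_def)

text \<open>Once the points have left x, the tails are exactly 2^-k and therefore strictly
  decreasing, so no block after the first nonempty one is empty. The lower bound for the mass of the
  next block is what later index shifts are paid with.\<close>

lemma dyadic_next: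
  assumes d: "dyadic g x y \<tau>" and "\<tau> k < \<tau> (k + 1)"
  shows "x < \<tau> (k + 1)" "integ (\<tau> (k + 1)) y g = p2 (- k - 1)" "\<tau> (k + 1) < \<tau> (k + 2)"
    "p2 (- k - 2) \<le> integ (\<tau> (k + 1)) (\<tau> (k + 2)) g"
proof -
  show 1: "x < \<tau> (k + 1)"
    using assms partition_bounds[OF dyadicD(1)[OF d], of k] by auto
  show 2: "integ (\<tau> (k + 1)) y g = p2 (- k - 1)"
    using dyadicD(2)[OF d 1] by (simp add: algebra_simps)
  have "\<tau> (k + 1) \<le> \<tau> (k + 2)"
    by (rule partition_mono[OF dyadicD(1)[OF d]]) simp
  then have 3: "x < \<tau> (k + 2)" using 1 by simp
  then have "integ (\<tau> (k + 2)) y g = p2 (- k - 2)"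
    using dyadicD(2)[OF d 3] by (simp add: algebra_simps)
  then have "p2 (- k - 1) = p2 (- k - 2)" if "\<tau> (k + 1) = \<tau> (k + 2)"
    using 2 that by metis
  then have "\<tau> (k + 1) \<noteq> \<tau> (k + 2)"
    by (metis diff_left_imp_eq numeral_eq_one_iff of_int_eq_iff p2_eq_iff semiring_norm(85))
  then show 4: "\<tau> (k + 1) < \<tau> (k + 2)"
    using \<open>\<tau> (k + 1) \<le> \<tau> (k + 2)\<close> by simp
  show "p2 (- k - 2) \<le> integ (\<tau> (k + 1)) (\<tau> (k + 2)) g"
    using dyadicD(4)[OF d, of "k + 1"] 4 by (simp add: algebra_simps)
qed

lemma dyadic_block:
  assumes d: "dyadic g x y \<tau>" and "\<tau> k < t" "t \<le> \<tau> (k + 1)"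
  shows "p2 (- k - 1) \<le> integ t y g" "integ t y g \<le> p2 (1 - k)"
proof -
  have "p2 (- k - 1) = integ (\<tau> (k + 1)) y g"
    using dyadic_next(2)[OF d, of k] assms by simp
  also have "\<dots> \<le> integ t y g"
    using assms by (intro integ_subset) auto
  finally show "p2 (- k - 1) \<le> integ t y g" .
  have "integ t y g \<le> integ (\<tau> k) y g"
    using assms by (intro integ_subset) auto
  also have "\<dots> \<le> p2 (1 - k)" by (rule dyadicD(3)[OF d])
  finally show "integ t y g \<le> p2 (1 - k)" .
qed

lemma dyadic_block_mass:
  assumes d: "dyadic g x y \<tau>" shows "integ (\<tau> k) (\<tau> (k + 1)) g \<le> p2 (1 - k)"
  using integ_subset[of "\<tau> k" "\<tau> k" "\<tau> (k + 1)" y g] partition_bounds(2)[OF dyadicD(1)[OF d], of "k + 1"]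
    dyadicD(3)[OF d, of k] by (metis order_refl order_trans less_imp_le)

lemma dyadic_exists:
  assumes g: "g \<in> borel_measurable L" and pos: "AE t in L. 0 < g t"
    and x: "a \<le> x" "ereal x < y" "y \<le> b"
    and fin: "\<And>t. x < t \<Longrightarrow> ereal t < y \<Longrightarrow> integ t y g < top"
  obtains \<tau> where "dyadic g x y \<tau>"
proof
  let ?I = "integ x y g"
  \<comment> \<open>The total is compared with 2^(1-k) and not with 2^-k. The first point that
    leaves x, if there is one, then has at least as much mass on its left as on its right.\<close>
  let ?P = "\<lambda>k::int. p2 (1 - k) \<le> ?I"
  define \<tau> where "\<tau> k = (if ?P k then SOME t. x < t \<and> ereal t < y \<and> integ t y g = p2 (- k) else x)" for k :: int
  have P: "x < \<tau> k" "ereal (\<tau> k) < y" "integ (\<tau> k) y g = p2 (- k)" if "?P k" for k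
  proof -
    have "p2 (- k) < ?I"
      using that less_le_trans[of "p2 (- real_of_int k)" "p2 (1 - real_of_int k)" ?I] by simp
    then obtain t where "x < ereal t" "ereal t < y" "integ t y g = p2 (- k)"
      using integ_intermediate[OF g, of x y "p2 (-k)"] x fin by auto
    then have "\<exists>t. x < t \<and> ereal t < y \<and> integ t y g = p2 (- k)" by auto
    from someI_ex[OF this] show "x < \<tau> k" "ereal (\<tau> k) < y" "integ (\<tau> k) y g = p2 (- k)"
      using that by (auto simp: \<tau>_def)
  qed
  have N: "\<tau> k = x" "?I < p2 (1 - k)" if "\<not> ?P k" for k
    using that by (auto simp: \<tau>_def not_le)
  have bounds: "x \<le> \<tau> k" "ereal (\<tau> k) < y" for k
    using P[of k] N[of k] x by (cases "?P k"; simp)+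
  have less: "s < t" if "integ t y g < integ s y g" for s t :: real
  proof (rule ccontr)
    assume "\<not> ?thesis"
    then have "integ s y g \<le> integ t y g" by (intro integ_subset) auto
    then show False using that by auto
  qed
  have PS: "?P (k + 1)" if "?P k" for k :: int
    using that by (rule order_trans[rotated]) simp
  have mono: "\<tau> k \<le> \<tau> (k + 1)" for k
  proof (cases "?P k")
    case True
    have "p2 (- (k + 1)) < p2 (- k)" by (subst p2_less_iff) simp
    then show ?thesis
      using less[of "\<tau> (k + 1)" "\<tau> k"] P(3)[OF True] P(3)[OF PS[OF True]] by simp
  qed (simp add: N bounds)
  have mono': "\<tau> j \<le> \<tau> k" if "j \<le> k" for j k
    using that
  proof (induction k rule: int_ge_induct)
    case (step i)
    then show ?case using mono[of i] by simp
  qed simp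
  have cover: "\<exists>k. \<tau> k < t \<and> t \<le> \<tau> (k + 1)" if t: "x < t" "ereal t < y" for t
  proof (rule ccontr)
    assume *: "\<not> ?thesis"
    have It: "0 < integ t y g" "integ t y g < top" "integ t y g \<le> ?I"
      using t x pos fin by (auto intro!: integ_pos[OF g] integ_subset)
    obtain m :: int where m: "integ t y g < p2 m" using p2_unbounded[OF It(2)] by blast
    have k0: "\<tau> (- m) < t"
    proof (cases "?P (- m)")
      case True
      show ?thesis by (rule less) (use P(3)[OF True] m in simp)
    qed (use N t in simp)
    have up: "\<tau> k < t" if "- m \<le> k" for k
      using that
    proof (induction k rule: int_ge_induct)
      case (step i)
      then show ?case using * not_le by blast
    qed (rule k0)
    obtain l :: int where l: "p2 l < integ t y g" using p2_small[OF It(1)] by blast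
    have "?P (1 - l)" using l It(3) by simp
    moreover have "p2 (- (1 - l)) < integ t y g"
      using l by (rule less_trans[rotated]) (subst p2_less_iff, simp)
    ultimately have "t < \<tau> (1 - l)" using P(3)[of "1 - l"] by (intro less) simp
    moreover have "\<tau> (1 - l) \<le> \<tau> (max (- m) (1 - l))" by (rule mono') simp
    ultimately show False using up[of "max (- m) (1 - l)"] by simp
  qed
  have part: "partition x y \<tau>"
    unfolding partition_def using bounds mono cover by blast
  moreover have "integ (\<tau> k) y g = p2 (- k)" if "x < \<tau> k" for k
    using that P(3)[of k] N(1)[of k] by (cases "?P k") auto
  moreover have "integ (\<tau> k) y g \<le> p2 (1 - k)" for k
    using P(3)[of k] N[of k] by (cases "?P k") auto
  moreover have "p2 (- k - 1) \<le> integ (\<tau> k) (\<tau> (k + 1)) g" if "\<tau> k < \<tau> (k + 1)" for k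
  proof -
    have Pk: "?P (k + 1)" using that N(1)[of "k + 1"] bounds(1)[of k] by (cases "?P (k + 1)") auto
    have e: "p2 (- k) = p2 (- k - 1) + p2 (- k - 1)" by (simp add: p2_double)
    have "p2 (- k) \<le> integ (\<tau> k) y g"
      using Pk P(3)[of k] N(1)[of k] by (cases "?P k") (auto simp: algebra_simps)
    also have "\<dots> = integ (\<tau> (k + 1)) y g + integ (\<tau> k) (\<tau> (k + 1)) g"
      using that bounds[of k] bounds[of "k + 1"] x
      by (subst add.commute, intro integ_split g) (auto intro: less_imp_le)
    also have "integ (\<tau> (k + 1)) y g = p2 (- k - 1)" using P(3)[OF Pk] by (simp add: algebra_simps)
    finally show ?thesis
      unfolding e by (simp add: ennreal_add_left_cancel_le)
  qed
  ultimately show "dyadic g x y \<tau>" unfolding dyadic_def by blast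
qed

text \<open>The points of the partition form a countable and hence null set, so the pointwise
  estimate is required only inside the open blocks.\<close>

lemma partition_upper:
  assumes part: "partition x y \<tau>" and x: "a \<le> x" "y \<le> b"
    and g: "g \<in> borel_measurable L"
    and h: "\<And>k t. \<tau> k < t \<Longrightarrow> t < \<tau> (k + 1) \<Longrightarrow> h t \<le> H k * g t"
  shows "integ x y h \<le> isum UNIV (\<lambda>k. H k * integ (\<tau> k) (\<tau> (k + 1)) g)"
proof -
  let ?g = "\<lambda>k t. H k * (g t * indicator (einterval (\<tau> k) (\<tau> (k + 1))) t)"
  note [measurable] = g
  have sub: "ereal a \<le> \<tau> k" "ereal (\<tau> k) \<le> b" for k
    using partition_bounds[OF part, of k] x by (auto intro: less_imp_le less_le_trans)
  have "countable (range \<tau>)" by simp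
  then have "AE t in L. t \<notin> range \<tau>"
    using countable_null_sets_lebesgue[of "range \<tau>"]
    by (subst AE_restrict_space_iff) (auto intro!: AE_I'[of "range \<tau>"])
  then have "AE t in L. h t * indicator (einterval x y) t \<le> isum UNIV (\<lambda>k. ?g k t)"
  proof eventually_elim
    case (elim t)
    show ?case
    proof (cases "t \<in> einterval x y")
      case True
      then obtain k where k: "\<tau> k < t" "t \<le> \<tau> (k + 1)"
        using partition_obtain[OF part, of t] by (auto simp: einterval_iff)
      then have "t < \<tau> (k + 1)" using elim by (metis order_le_less rangeI)
      then have "h t * indicator (einterval x y) t \<le> ?g k t"
        using k h True by (auto simp: einterval_iff split: split_indicator)
      also have "\<dots> \<le> isum UNIV (\<lambda>k. ?g k t)" by (rule isum_point) simp
      finally show ?thesis .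
    qed simp
  qed
  then have "integ x y h \<le> (\<integral>\<^sup>+t. isum UNIV (\<lambda>k. ?g k t) \<partial>L)"
    using x by (subst integ_L) (auto intro!: nn_integral_mono_AE)
  also have "\<dots> = isum UNIV (\<lambda>k. H k * integ (\<tau> k) (\<tau> (k + 1)) g)"
    by (subst isum_nn_integral) (auto simp: integ_L[OF sub] nn_integral_cmult)
  finally show ?thesis .
qed

lemma partition_lower_gen:
  assumes part: "partition x y \<tau>" and x: "a \<le> x" "y \<le> b"
    and g[measurable]: "\<And>k. G k \<in> borel_measurable L"
    and h: "\<And>k t. \<tau> k < t \<Longrightarrow> t < \<tau> (k + 1) \<Longrightarrow> G k t \<le> h t"
  shows "isum UNIV (\<lambda>k. integ (\<tau> k) (\<tau> (k + 1)) (G k)) \<le> integ x y h"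
proof -
  let ?g = "\<lambda>k t. G k t * indicator (einterval (\<tau> k) (\<tau> (k + 1))) t"
  have sub: "ereal a \<le> \<tau> k" "ereal (\<tau> k) \<le> b" for k
    using partition_bounds[OF part, of k] x by (auto intro: less_imp_le less_le_trans)
  have "isum UNIV (\<lambda>k. integ (\<tau> k) (\<tau> (k + 1)) (G k)) = (\<integral>\<^sup>+t. isum UNIV (\<lambda>k. ?g k t) \<partial>L)"
    by (subst isum_nn_integral) (auto simp: integ_L[OF sub])
  also have "\<dots> \<le> (\<integral>\<^sup>+t. h t * indicator (einterval x y) t \<partial>L)"
  proof (rule nn_integral_mono)
    fix t
    show "isum UNIV (\<lambda>k. ?g k t) \<le> h t * indicator (einterval x y) t"
    proof (cases "\<exists>k. t \<in> einterval (\<tau> k) (\<tau> (k + 1))")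
      case True
      then obtain k where k: "t \<in> einterval (\<tau> k) (\<tau> (k + 1))" by blast
      have "t \<notin> einterval (\<tau> j) (\<tau> (j + 1))" if "j \<noteq> k" for j
        using that k partition_unique[OF part, of j t k] by (auto simp: einterval_iff)
      then have "isum UNIV (\<lambda>k. ?g k t) = isum {k} (\<lambda>k. ?g k t)"
        unfolding isum_restrict[of "{k}"] by (intro isum_cong) (simp add: indicator_def)
      also have "\<dots> = G k t" using k by simp
      also have "\<dots> \<le> h t" using k h by (auto simp: einterval_iff)
      also have "t \<in> einterval x y"
        using k partition_bounds[OF part, of k] partition_bounds(2)[OF part, of "k + 1"]
        by (auto simp: einterval_iff intro: ereal_real_trans(3)[OF _ less_imp_le])
      then have "h t = h t * indicator (einterval x y) t" by simp
      finally show ?thesis .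
    next
      case False
      then have "isum UNIV (\<lambda>k. ?g k t) = isum UNIV (\<lambda>k. 0)" by (intro isum_cong) auto
      then show ?thesis by simp
    qed
  qed
  also have "\<dots> = integ x y h" using x by (subst integ_L) auto
  finally show ?thesis .
qed

lemma partition_lower:
  assumes part: "partition x y \<tau>" and x: "a \<le> x" "y \<le> b"
    and g: "g \<in> borel_measurable L"
    and h: "\<And>k t. \<tau> k < t \<Longrightarrow> t < \<tau> (k + 1) \<Longrightarrow> H k * g t \<le> h t"
  shows "isum UNIV (\<lambda>k. H k * integ (\<tau> k) (\<tau> (k + 1)) g) \<le> integ x y h"
proof -
  have "ereal a \<le> \<tau> k" "ereal (\<tau> k) \<le> b" for k
    using partition_bounds[OF part, of k] x by (auto intro: less_imp_le less_le_trans)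
  then have "H k * integ (\<tau> k) (\<tau> (k + 1)) g = integ (\<tau> k) (\<tau> (k + 1)) (\<lambda>t. H k * g t)" for k
    using g by (intro integ_cmult[symmetric])
  then show ?thesis
    using partition_lower_gen[OF part x, of "\<lambda>k t. H k * g t" h] g h by simp
qed

lemma partition_integ_le:
  assumes part: "partition x y \<tau>" and x: "a \<le> x" "y \<le> b" and g: "g \<in> borel_measurable L"
    and t: "x \<le> t" "t \<le> \<tau> (k + 1)"
  shows "integ x t g \<le> isum {..k} (\<lambda>j. integ (\<tau> j) (\<tau> (j + 1)) g)"
proof -
  have "ereal t \<le> y"
    using t partition_bounds(2)[OF part, of "k + 1"] by (meson ereal_real_trans(4) less_imp_le)
  then have "integ x t g \<le> integ x y (\<lambda>s. g s * indicator {..<t} s)"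
    by (auto intro!: nn_integral_mono simp: einterval_iff ereal_real_trans(3) split: split_indicator)
      (metis less_ereal.simps(1) less_le_trans)
  also have "\<dots> \<le> isum UNIV (\<lambda>j. indicator {..k} j * integ (\<tau> j) (\<tau> (j + 1)) g)"
  proof (rule partition_upper[OF part x g])
    fix j s assume "\<tau> j < s" "s < \<tau> (j + 1)"
    then show "g s * indicator {..<t} s \<le> indicator {..k} j * g s"
      using partition_index_le[OF part, of j s k] t by (auto split: split_indicator)
  qed
  also have "\<dots> = isum {..k} (\<lambda>j. integ (\<tau> j) (\<tau> (j + 1)) g)"
    unfolding isum_restrict[of "{..k}"] by (simp add: mult.commute)
  finally show ?thesis .
qed

lemma partition_integ:
  assumes part: "partition x y \<tau>" and x: "a \<le> x" "y \<le> b" and g: "g \<in> borel_measurable L"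
  shows "integ x y g = isum UNIV (\<lambda>j. integ (\<tau> j) (\<tau> (j + 1)) g)"
  using partition_upper[OF part x g, of g "\<lambda>_. 1"] partition_lower[OF part x g, of "\<lambda>_. 1" g] by simp

end

subsection \<open>The functional V\<close>

locale V_weight = interval +
  fixes r :: real and v :: "real \<Rightarrow> ennreal"
  assumes r: "0 < r" "r \<le> 1" and v[measurable]: "v \<in> borel_measurable L" and v_pos: "AE t in L. 0 < v t"
begin

lemma V_empty: "y \<le> x \<Longrightarrow> V r v x y = 0"
proof -
  assume xy: "y \<le> x"
  have "ess_sup x y v \<le> 0"
    by (intro ess_sup_le mono_measurable) (auto simp: einterval_empty[OF xy])
  then show ?thesis
    using r xy by (auto simp: V_def)
qed

text \<open>Hoelder's inequality with exponents 1/r and 1/(1-r), whose limit r = 1 is the bound by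
  the essential supremum. \<open>V_attain\<close> shows that the factor V^r is sharp.\<close>

lemma V_Hoelder:
  assumes [measurable]: "f \<in> borel_measurable L" and x: "ereal a \<le> x" "y \<le> b"
  shows "integ x y (\<lambda>s. f s epowr r * v s) \<le> integ x y f epowr r * V r v x y epowr r"
proof (cases "r < 1")
  case True
  let ?v = "\<lambda>s. v s epowr (1 / (1 - r))" and ?i = "indicator (einterval x y)"
  have "integ x y (\<lambda>s. f s epowr r * v s)
    = (\<integral>\<^sup>+s. (f s * ?i s) epowr r * (?v s * ?i s) epowr (1 - r) \<partial>L)"
    unfolding integ_L[OF x] using r True by (auto intro!: nn_integral_cong simp: epowr_epowr split: split_indicator)
  also have "\<dots> \<le> integ x y f epowr r * integ x y ?v epowr (1 - r)"
    unfolding integ_L[OF x] using r True by (intro nn_integral_Hoelder) auto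
  also have "integ x y ?v epowr (1 - r) = V r v x y epowr r"
    using r True by (simp add: V_def epowr_epowr)
  finally show ?thesis .
next
  case False
  then have [simp]: "r = 1" using r by simp
  have "AE t in lebesgue_on (einterval x y). v t \<le> V r v x y"
    using esssup_AE by (simp add: V_def)
  then have "AE t in L. t \<in> einterval x y \<longrightarrow> v t \<le> V r v x y"
    using einterval_subset[OF x] by (auto simp: AE_restrict_space_iff elim!: eventually_mono)
  then have "integ x y (\<lambda>s. f s * v s) \<le> integ x y (\<lambda>s. f s * V r v x y)"
    unfolding integ_L[OF x] by (intro nn_integral_mono_AE) (auto elim!: eventually_mono intro: mult_left_mono split: split_indicator)
  also have "\<dots> = integ x y f * V r v x y"
    by (rule integ_multc) (auto simp: x)
  finally show ?thesis by simp
qed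

lemma V_mono:
  assumes "ereal a \<le> x'" "x' \<le> x" "y \<le> y'" "y' \<le> b"
  shows "V r v x y \<le> V r v x' y'"
proof (cases "r < 1")
  case True
  then show ?thesis using r assms by (auto simp: V_def intro!: epowr_mono integ_subset)
next
  case False
  have "AE t in lebesgue_on (einterval x' y'). v t \<le> ess_sup x' y' v"
    by (rule esssup_AE)
  then have "AE t in lebesgue_on (einterval x y). v t \<le> ess_sup x' y' v"
    using einterval_subset[OF assms(2,3)] by (auto simp: AE_restrict_space_iff elim!: eventually_mono)
  then show ?thesis
    using assms False measurable_lebesgue_on_subset[OF v, of x y]
    by (auto simp: V_def intro!: esssup_I intro: order_trans)
qed

text \<open>For r < 1 the extremal function is v^(1/(1-r)), normalised. Truncating v at height n and
  the interval to (-n, n) makes its integral finite, and monotone convergence recovers V. For r = 1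
  the normalised indicator of a part of {v > K} of finite positive measure serves.\<close>

lemma V_attain:
  assumes x: "ereal a \<le> x" "y \<le> b" and K: "K < V r v x y epowr r"
  obtains f where "f \<in> borel_measurable L" "\<And>t. t \<notin> einterval x y \<Longrightarrow> f t = 0" "integ x y f \<le> 1"
    "K \<le> integ x y (\<lambda>s. f s epowr r * v s)"
proof -
  let ?A = "\<lambda>n::nat. einterval (max x (- real n)) (min y (real n))"
  have Asub: "?A n \<subseteq> einterval x y" for n by (rule einterval_subset) auto
  have A1: "indicator (?A n) t * indicator (einterval x y) t = (indicator (?A n) t :: ennreal)" for n t
    using Asub[of n] by (auto split: split_indicator)
  have Afin: "emeasure L (?A n) < top" for n
  proof -
    have "emeasure L (?A n) = emeasure lebesgue (?A n)"
      using Asub[of n] einterval_subset[OF x] by (subst emeasure_restrict_space) auto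
    also have "\<dots> \<le> emeasure lebesgue {- real n .. real n}"
      by (intro emeasure_mono) (auto simp: einterval_iff)
    also have "\<dots> < top" by simp
    finally show ?thesis .
  qed
  have Aset: "?A n \<in> sets L" for n
    using Asub[of n] einterval_subset[OF x] by (auto simp: sets_restrict_space_iff)
  have cover: "\<exists>n0. \<forall>n\<ge>n0. t \<in> ?A n" if "t \<in> einterval x y" for t
  proof -
    obtain n0 :: nat where "\<bar>t\<bar> < real n0" using reals_Archimedean2 by blast
    then have "t \<in> ?A n" if "n \<ge> n0" for n
      using \<open>t \<in> einterval x y\<close> that by (auto simp: einterval_iff min_def max_def)
    then show ?thesis by blast
  qed
  show ?thesis
  proof (cases "r < 1")
    case True
    let ?s = "1 / (1 - r)"
    have s: "0 < ?s" using True by simp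
    define w where "w n t = min (v t) (of_nat n) epowr ?s * indicator (?A n) t" for n t
    have [measurable]: "w n \<in> borel_measurable L" for n
      unfolding w_def by measurable
    define I where "I n = (\<integral>\<^sup>+t. w n t \<partial>L)" for n
    have "(SUP n. w n t) = v t epowr ?s * indicator (einterval x y) t" for t
    proof (rule antisym)
      show "(SUP n. w n t) \<le> v t epowr ?s * indicator (einterval x y) t"
        unfolding w_def using s Asub
        by (intro SUP_least mult_mono epowr_mono) (auto split: split_indicator)
      show "v t epowr ?s * indicator (einterval x y) t \<le> (SUP n. w n t)"
      proof (cases "t \<in> einterval x y")
        case True
        then obtain n0 where n0: "\<And>n. n \<ge> n0 \<Longrightarrow> t \<in> ?A n" using cover by blast
        have "v t = (SUP n. min (v t) (of_nat n))"
        proof -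
          have "(SUP n. min (v t) (of_nat n)) = inf (v t) (SUP n. of_nat n)"
            by (simp add: inf_SUP flip: inf_min)
          then show ?thesis by (simp add: ennreal_SUP_of_nat_eq_top)
        qed
        then have "v t epowr ?s = (SUP n. min (v t) (of_nat n) epowr ?s)"
          using s epowr_SUP[of ?s UNIV "\<lambda>n. min (v t) (of_nat n)"] by simp
        also have "\<dots> \<le> (SUP n. w n t)"
        proof (rule SUP_least)
          fix n
          have "min (v t) (of_nat n) epowr ?s \<le> w (max n n0) t"
            using s n0[of "max n n0"] by (auto simp: w_def intro!: epowr_mono min.mono)
          also have "\<dots> \<le> (SUP n. w n t)" by (rule SUP_upper) simp
          finally show "min (v t) (of_nat n) epowr ?s \<le> (SUP n. w n t)" .
        qed
        finally show ?thesis using True by simp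
      qed simp
    qed
    then have "integ x y (\<lambda>t. v t epowr ?s) = (\<integral>\<^sup>+t. (SUP n. w n t) \<partial>L)"
      unfolding integ_L[OF x] by simp
    also have "\<dots> = (SUP n. I n)"
      unfolding I_def
    proof (rule nn_integral_monotone_convergence_SUP)
      show "incseq w"
      proof (intro monoI le_funI)
        fix m n :: nat and t assume "m \<le> n"
        have "?A m \<subseteq> ?A n" using \<open>m \<le> n\<close> by (intro einterval_subset max.mono min.mono) auto
        then show "w m t \<le> w n t"
          unfolding w_def using s \<open>m \<le> n\<close> by (intro mult_mono epowr_mono min.mono) (auto split: split_indicator)
      qed
    qed simp
    finally have "V r v x y epowr r = (SUP n. I n) epowr (1 - r)"
      using True r by (simp add: V_def epowr_epowr)
    also have "\<dots> = (SUP n. I n epowr (1 - r))" using True by (subst epowr_SUP) auto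
    finally obtain n where n: "K < I n epowr (1 - r)"
      using K by (auto simp: less_SUP_iff)
    have "I n \<le> (\<integral>\<^sup>+t. of_nat n epowr ?s * indicator (?A n) t \<partial>L)"
      unfolding I_def w_def using s by (intro nn_integral_mono mult_right_mono epowr_mono) auto
    also have "\<dots> = of_nat n epowr ?s * emeasure L (?A n)"
      using Aset by (rule nn_integral_cmult_indicator)
    also have "\<dots> < top"
      using Afin[of n] s by (auto simp: ennreal_mult_less_top of_nat_less_top intro!: epowr_finite)
    finally have "I n < top" .
    have "0 < I n" using n True by (cases "I n = 0") (auto simp: zero_less_iff_neq_zero)
    note I = \<open>0 < I n\<close> \<open>I n < top\<close>
    show ?thesis
    proof (rule that[of "\<lambda>t. I n epowr (-1) * w n t"])
      show "(\<lambda>t. I n epowr (-1) * w n t) \<in> borel_measurable L" by measurable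
      show "I n epowr (-1) * w n t = 0" if "t \<notin> einterval x y" for t
        using that Asub[of n] by (auto simp: w_def split: split_indicator)
      have w1: "w n t * indicator (einterval x y) t = w n t" for t
        by (simp add: w_def mult.assoc A1)
      have "integ x y (\<lambda>t. I n epowr (-1) * w n t) = I n epowr (-1) * I n"
        unfolding integ_L[OF x] I_def by (simp add: mult.assoc w1 nn_integral_cmult)
      also have "\<dots> = 1" using epowr_minus[OF I, of 1] by simp
      finally show "integ x y (\<lambda>t. I n epowr (-1) * w n t) \<le> 1" by simp
      have "K \<le> I n epowr (1 - r)" using n by simp
      also have "\<dots> = I n epowr (- r) * I n"
        using epowr_add'[OF I, of "-r" 1] by simp
      also have "\<dots> = (\<integral>\<^sup>+t. I n epowr (- r) * w n t \<partial>L)"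
        unfolding I_def by (simp add: nn_integral_cmult)
      also have "\<dots> \<le> integ x y (\<lambda>t. (I n epowr (-1) * w n t) epowr r * v t)"
        unfolding integ_L[OF x]
      proof (rule nn_integral_mono)
        fix t
        show "I n epowr (- r) * w n t \<le> (I n epowr (-1) * w n t) epowr r * v t * indicator (einterval x y) t"
        proof (cases "t \<in> ?A n")
          case True
          then have "t \<in> einterval x y" using Asub[of n] by blast
          let ?m = "min (v t) (of_nat n)"
          have "?s = ?s * r + 1"
            using \<open>r < 1\<close> by (simp add: field_simps)
          have "w n t = ?m epowr ?s"
            using True by (simp add: w_def)
          also have "\<dots> = ?m epowr (?s * r + 1)"
            using \<open>?s = ?s * r + 1\<close> by (rule arg_cong)
          also have "\<dots> = ?m epowr (?s * r) * ?m"
            using r \<open>r < 1\<close> by (subst epowr_add) auto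
          also have "\<dots> \<le> ?m epowr (?s * r) * v t" by (intro mult_left_mono) auto
          also have "\<dots> = w n t epowr r * v t" using True by (simp add: w_def epowr_epowr)
          finally have "w n t \<le> w n t epowr r * v t" .
          then show ?thesis
            using r \<open>t \<in> einterval x y\<close> mult_left_mono[of "w n t" "w n t epowr r * v t" "I n epowr (- r)"]
            by (simp add: epowr_mult epowr_epowr mult.assoc)
        qed (simp add: w_def)
      qed
      finally show "K \<le> integ x y (\<lambda>t. (I n epowr (-1) * w n t) epowr r * v t)" .
    qed
  next
    case False
    then have [simp]: "r = 1" using r by simp
    have vm: "v \<in> borel_measurable (lebesgue_on (einterval x y))"
      by (rule measurable_lebesgue_on_subset[OF v x])
    let ?B = "{t \<in> einterval x y. K < v t}"
    have "0 < emeasure (lebesgue_on (einterval x y)) ?B"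
      using esssup_pos_measure[OF vm, of K] K by (simp add: V_def)
    also have "emeasure (lebesgue_on (einterval x y)) ?B = emeasure lebesgue ?B"
      by (rule emeasure_restrict_space) auto
    also have "\<dots> = emeasure L ?B"
      using einterval_subset[OF x] by (intro emeasure_restrict_space[symmetric]) auto
    finally have B0: "0 < emeasure L ?B" .
    have Bset: "?B \<in> sets L"
    proof -
      have "?B = einterval x y \<inter> {t \<in> space L. K < v t}"
        using einterval_subset[OF x] by auto
      moreover have "einterval x y \<in> sets L" using einterval_subset[OF x] by (simp add: sets_restrict_space_iff)
      moreover have "{t \<in> space L. K < v t} \<in> sets L" by measurable
      ultimately show ?thesis by (metis sets.Int)
    qed
    have "\<exists>n. 0 < emeasure L (?B \<inter> ?A n)"
    proof (rule ccontr)
      assume "\<not> ?thesis"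
      then have "?B \<inter> ?A n \<in> null_sets L" for n
        using Bset Aset[of n] by (auto simp: null_sets_def)
      then have "(\<Union>n. ?B \<inter> ?A n) \<in> null_sets L" by (rule null_sets_UN)
      moreover have "(\<Union>n. ?B \<inter> ?A n) = ?B" using cover by blast
      ultimately show False using B0 by auto
    qed
    then obtain n where n: "0 < emeasure L (?B \<inter> ?A n)" by blast
    let ?C = "?B \<inter> ?A n"
    have Cset: "?C \<in> sets L" using Bset Aset by blast
    have "emeasure L ?C \<le> emeasure L (?A n)" using Aset by (intro emeasure_mono) auto
    also note Afin
    finally have fin: "emeasure L ?C < top" .
    let ?c = "emeasure L ?C epowr (-1)"
    have c: "?c * emeasure L ?C = 1" using epowr_minus[OF n fin, of 1] by simp
    have C1: "indicator ?C t * indicator (einterval x y) t = (indicator ?C t :: ennreal)" for t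
      by (auto split: split_indicator)
    have int: "integ x y (\<lambda>t. ?c * indicator ?C t) = 1"
      unfolding integ_L[OF x] using Cset c by (simp add: mult.assoc C1 nn_integral_cmult_indicator)
    show ?thesis
    proof (rule that[of "\<lambda>t. ?c * indicator ?C t"])
      show "(\<lambda>t. ?c * indicator ?C t) \<in> borel_measurable L" using Cset by measurable
      show "integ x y (\<lambda>t. ?c * indicator ?C t) \<le> 1" using int by simp
      have "K = K * integ x y (\<lambda>t. ?c * indicator ?C t)" using int by simp
      also have "\<dots> = integ x y (\<lambda>t. K * (?c * indicator ?C t))"
        using Cset x by (intro integ_cmult[symmetric]) auto
      also have "\<dots> \<le> integ x y (\<lambda>t. (?c * indicator ?C t) epowr r * v t)"
        by (intro integ_mono) (auto simp: mult.commute intro!: mult_right_mono split: split_indicator)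
      finally show "K \<le> integ x y (\<lambda>t. (?c * indicator ?C t) epowr r * v t)" .
    qed auto
  qed
qed

lemma V_half_attain:
  assumes x: "ereal a \<le> x" "y \<le> b" and fin: "V r v x y < top"
  obtains f where "f \<in> borel_measurable L" "\<And>t. t \<notin> einterval x y \<Longrightarrow> f t = 0" "integ x y f \<le> 1"
    "V r v x y epowr r \<le> p2 1 * integ x y (\<lambda>s. f s epowr r * v s)"
proof (cases "V r v x y = 0")
  case True
  then show ?thesis using r by (intro that[of "\<lambda>_. 0"]) auto
next
  case False
  have "p2 (-1) * V r v x y epowr r < 1 * V r v x y epowr r"
    using False fin r p2_less_iff[of "-1" 0]
    by (intro ennreal_mult_strict_right_mono) (auto intro!: epowr_pos epowr_finite simp: zero_less_iff_neq_zero epowr_eq_0_iff)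
  then have "p2 (-1) * V r v x y epowr r < V r v x y epowr r" by simp
  from V_attain[OF x this]
  obtain f where f: "f \<in> borel_measurable L" "\<And>t. t \<notin> einterval x y \<Longrightarrow> f t = 0" "integ x y f \<le> 1"
    "p2 (-1) * V r v x y epowr r \<le> integ x y (\<lambda>s. f s epowr r * v s)"
    by blast
  have "V r v x y epowr r \<le> p2 1 * integ x y (\<lambda>s. f s epowr r * v s)"
    using mult_left_mono[OF f(4), of "p2 1"] by (simp add: p2_add_left)
  then show ?thesis using f that by blast
qed

lemma V_le:
  assumes x: "ereal a \<le> x" "y \<le> b"
    and K: "\<And>f. f \<in> borel_measurable L \<Longrightarrow> (\<And>t. t \<notin> einterval x y \<Longrightarrow> f t = 0) \<Longrightarrow> integ x y f \<le> 1 \<Longrightarrow>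
      integ x y (\<lambda>s. f s epowr r * v s) \<le> K epowr r"
  shows "V r v x y \<le> K"
proof (rule ccontr)
  assume "\<not> ?thesis"
  then have "K epowr r < V r v x y epowr r"
    using r by (simp add: epowr_strict_mono_iff)
  then obtain c where c: "K epowr r < c" "c < V r v x y epowr r" using dense by blast
  then obtain f where "f \<in> borel_measurable L" "\<And>t. t \<notin> einterval x y \<Longrightarrow> f t = 0" "integ x y f \<le> 1"
    "c \<le> integ x y (\<lambda>s. f s epowr r * v s)"
    using V_attain[OF x] by blast
  then show False using K c by (meson leD less_le_trans)
qed

lemma V_pos:
  assumes x: "ereal a \<le> x" "x < y" "y \<le> b" shows "0 < V r v x y"
proof (cases "r < 1")
  case True
  have "0 < integ x y (\<lambda>s. v s epowr (1 / (1 - r)))"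
    using x v_pos True by (intro integ_pos) (auto elim!: eventually_mono intro!: epowr_pos)
  then show ?thesis using True r by (auto simp: V_def intro!: epowr_pos)
next
  case False
  show ?thesis
  proof (rule ccontr)
    assume "\<not> ?thesis"
    then have "ess_sup x y v = 0" using False by (simp add: V_def)
    then have "AE t in lebesgue. t \<in> einterval x y \<longrightarrow> v t = 0"
      using esssup_AE[of v "lebesgue_on (einterval x y)"] by (simp add: AE_restrict_space_iff)
    moreover have "AE t in lebesgue. t \<in> einterval x y \<longrightarrow> 0 < v t"
      using v_pos einterval_subset[OF x(1,3)] by (auto simp: AE_restrict_space_iff elim!: eventually_mono)
    ultimately have "AE t in lebesgue. t \<notin> einterval x y"
      by eventually_elim auto
    then have "einterval x y \<in> null_sets lebesgue" by (subst (asm) AE_iff_null_sets[symmetric]) auto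
    then show False using einterval_positive x by auto
  qed
qed

text \<open>The power for which V is subadditive over adjacent intervals: for r < 1 it turns V into
  an integral, and for r = 1 V itself is an essential supremum, at most the sum over the
  pieces.\<close>

definition rho :: real where "rho = (if r < 1 then r / (1 - r) else 1)"

lemma rho_pos: "0 < rho"
  using r by (auto simp: rho_def)

lemma V_rho_subadditive:
  assumes part: "partition x y \<tau>" and x: "a \<le> x" "y \<le> b" and z: "ereal z \<le> y"
  shows "V r v (\<tau> k) z epowr rho \<le> isum {k..} (\<lambda>j. V r v (\<tau> j) (min (\<tau> (j + 1)) z) epowr rho)"
proof -
  have sub: "ereal a \<le> \<tau> j" "ereal (\<tau> j) \<le> b" "ereal z \<le> b" for j
    using partition_bounds[OF part, of j] x z by (auto intro: less_imp_le less_le_trans)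
  show ?thesis
  proof (cases "r < 1")
    case True
    let ?v = "\<lambda>s. v s epowr (1 / (1 - r))"
    have eq: "V r v s t epowr rho = integ s t ?v" for s t
      using True r by (simp add: V_def rho_def epowr_epowr)
    have "integ (\<tau> k) z ?v \<le> integ x y (\<lambda>s. ?v s * indicator {\<tau> k<..<z} s)"
      using partition_bounds[OF part, of k] z
      by (auto intro!: nn_integral_mono simp: einterval_iff split: split_indicator)
        (metis less_ereal.simps(1) less_le_trans)
    also have "\<dots> \<le> isum UNIV (\<lambda>j. indicator {k..} j * integ (\<tau> j) (\<tau> (j + 1)) (\<lambda>s. ?v s * indicator {..<z} s))"
    proof (rule partition_upper[OF part x])
      have "indicator {..<z} \<in> borel_measurable L"
        by (intro measurable_restrict_space1 measurable_completion) simp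
      then show "(\<lambda>s. ?v s * indicator {..<z} s) \<in> borel_measurable L" by measurable
      fix j s assume s: "\<tau> j < s" "s < \<tau> (j + 1)"
      show "?v s * indicator {\<tau> k<..<z} s \<le> indicator {k..} j * (?v s * indicator {..<z} s)"
        using partition_index_le[OF part, of k s j] s by (auto split: split_indicator)
    qed
    also have "\<dots> \<le> isum UNIV (\<lambda>j. integ (\<tau> j) (min (\<tau> (j + 1)) z) ?v * indicator {k..} j)"
      by (auto intro!: nn_integral_mono simp: einterval_iff mult.commute split: split_indicator)
    finally show ?thesis
      unfolding eq isum_restrict[of "{k..}"] .
  next
    case False
    let ?S = "isum {k..} (\<lambda>j. V r v (\<tau> j) (min (\<tau> (j + 1)) z))"
    have "AE t in lebesgue. \<forall>j. t \<in> einterval (\<tau> j) (min (\<tau> (j + 1)) z) \<longrightarrow> v t \<le> V r v (\<tau> j) (min (\<tau> (j + 1)) z)"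
      unfolding AE_all_countable using esssup_AE False by (auto simp: V_def AE_restrict_space_iff[symmetric])
    moreover have "AE t in lebesgue. t \<notin> range \<tau>"
      using countable_null_sets_lebesgue[of "range \<tau>"] by (auto intro!: AE_I'[of "range \<tau>"])
    ultimately have "AE t in lebesgue. t \<in> einterval (\<tau> k) z \<longrightarrow> v t \<le> ?S"
    proof eventually_elim
      case (elim t)
      show ?case
      proof
        assume t: "t \<in> einterval (\<tau> k) z"
        then have "x < t" "ereal t < y"
          using partition_bounds[OF part, of k] z by (auto simp: einterval_iff) (metis less_ereal.simps(1) less_le_trans)
        then obtain j where j: "\<tau> j < t" "t \<le> \<tau> (j + 1)" using partition_obtain[OF part] by blast
        then have "t < \<tau> (j + 1)" using elim(2) by (metis order_le_less rangeI)
        then have "v t \<le> V r v (\<tau> j) (min (\<tau> (j + 1)) z)"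
          using elim(1) t j by (auto simp: einterval_iff)
        also have "\<dots> \<le> ?S"
          using partition_index_le[OF part, of k t j] t j by (intro isum_point) (auto simp: einterval_iff)
        finally show "v t \<le> ?S" .
      qed
    qed
    then have "V r v (\<tau> k) z \<le> ?S"
      using False sub measurable_lebesgue_on_subset[OF v, of "\<tau> k" z]
      by (auto simp: V_def AE_restrict_space_iff intro!: esssup_I)
    then show ?thesis using False by (simp add: rho_def)
  qed
qed

end

subsection \<open>The local Hardy inequality\<close>

lemma mult_le_iff_inverse:
  assumes "0 < x" "x < top"
  shows "x * y \<le> z \<longleftrightarrow> y \<le> z * x epowr (-1)"
proof -
  have x: "x epowr (-1) * x = 1" using epowr_minus[OF assms, of 1] by simp
  show ?thesis
  proof
    assume "x * y \<le> z"
    then have "x epowr (-1) * (x * y) \<le> x epowr (-1) * z" by (rule mult_left_mono) simp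
    moreover have "x epowr (-1) * (x * y) = y" using x by (simp flip: mult.assoc)
    ultimately show "y \<le> z * x epowr (-1)" by (simp add: mult.commute)
  next
    assume "y \<le> z * x epowr (-1)"
    then have "x * y \<le> x * (z * x epowr (-1))" by (rule mult_left_mono) simp
    also have "\<dots> = z * (x epowr (-1) * x)" by (simp add: ac_simps)
    finally show "x * y \<le> z" using x by simp
  qed
qed

lemma half_less: "0 < x \<Longrightarrow> x < top \<Longrightarrow> p2 (-1) * x < x"
  using p2_less_iff[of "-1" 0] ennreal_mult_strict_right_mono[of "p2 (-1)" 1 x] by auto

lemma SUP_half_attain:
  fixes f :: "'a \<Rightarrow> ennreal"
  assumes "I \<noteq> {}" "(SUP i\<in>I. f i) < top"
  obtains i where "i \<in> I" "(SUP i\<in>I. f i) \<le> p2 1 * f i"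
proof (cases "(SUP i\<in>I. f i) = 0")
  case True
  then show ?thesis using assms that by auto
next
  case False
  then have "p2 (-1) * (SUP i\<in>I. f i) < (SUP i\<in>I. f i)"
    using assms by (intro half_less) (auto simp: zero_less_iff_neq_zero)
  then obtain i where i: "i \<in> I" "p2 (-1) * (SUP i\<in>I. f i) < f i"
    by (auto simp: less_SUP_iff)
  have "(SUP i\<in>I. f i) \<le> p2 1 * f i"
    using mult_left_mono[OF less_imp_le[OF i(2)], of "p2 1"] by (simp add: p2_add_left)
  then show ?thesis using i that by blast
qed

locale uv_weights = V_weight +
  fixes q :: real and u :: "real \<Rightarrow> ennreal"
  assumes q: "0 < q" and u[measurable]: "u \<in> borel_measurable L" and u_pos: "AE t in L. 0 < u t"
begin

declare v [measurable] u [measurable]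

text \<open>The characteristic of the Hardy inequality on (x, y) with the plain integral of f on the
  right. For q < 1 it is the factor inside \<open>C2\<close>, and a power of it that inside
  \<open>C5\<close>; for q >= 1 the same holds for \<open>C1\<close> and \<open>C7\<close>.\<close>

definition E :: "ereal \<Rightarrow> ereal \<Rightarrow> ennreal" where
  "E x y = (if q < 1
     then integ x y (\<lambda>t. integ t y u epowr (q / (1 - q)) * u t * V r v x t epowr (q / (1 - q))) epowr ((1 - q) / q)
     else (SUP t\<in>einterval x y. integ t y u epowr (1 / q) * V r v x t))"

definition inner :: "(real \<Rightarrow> ennreal) \<Rightarrow> ereal \<Rightarrow> ereal \<Rightarrow> ennreal" where
  "inner f x y = integ x y (\<lambda>s. f s epowr r * v s)"

definition outer :: "(real \<Rightarrow> ennreal) \<Rightarrow> ereal \<Rightarrow> ereal \<Rightarrow> ennreal" where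
  "outer f x y = integ x y (\<lambda>t. inner f x t epowr (q / r) * u t)"

definition unit_ball :: "ereal \<Rightarrow> ereal \<Rightarrow> (real \<Rightarrow> ennreal) set" where
  "unit_ball x y = {f. f \<in> borel_measurable L \<and> (\<forall>t. t \<notin> einterval x y \<longrightarrow> f t = 0) \<and> integ x y f \<le> 1}"

text \<open>The q-th power of the best constant of the same inequality. B is what test functions
  reach, E is the explicit expression; by \<open>Hardy_upper\<close> and \<open>Hardy_lower\<close>,
  B and the q-th power of E are comparable as soon as the tails of u are finite.\<close>

definition B :: "ereal \<Rightarrow> ereal \<Rightarrow> ennreal" where
  "B x y = (SUP f\<in>unit_ball x y. outer f x y)"

lemma unit_ball_nonempty [simp]: "unit_ball x y \<noteq> {}"
  by (auto simp: unit_ball_def intro!: exI[of _ "\<lambda>_. 0"])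

lemma qr: "0 < q / r" using q r by simp

lemma E_empty: "y \<le> x \<Longrightarrow> E x y = 0"
  using q by (simp add: E_def einterval_empty bot_ennreal)

lemma E_mono:
  assumes "ereal a \<le> x'" "x' \<le> x" "y \<le> y'" "y' \<le> b"
  shows "E x y \<le> E x' y'"
proof -
  have V: "V r v x t \<le> V r v x' t" if "t \<in> einterval x y" for t
    using assms that by (intro V_mono) (auto simp: einterval_iff)
  have U: "integ t y u \<le> integ t y' u" for t
    using assms by (intro integ_subset) auto
  show ?thesis
  proof (cases "q < 1")
    case True
    have "integ x y (\<lambda>t. integ t y u epowr (q / (1 - q)) * u t * V r v x t epowr (q / (1 - q)))
      \<le> integ x y (\<lambda>t. integ t y' u epowr (q / (1 - q)) * u t * V r v x' t epowr (q / (1 - q)))"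
      using q True by (intro integ_mono mult_mono epowr_mono U V) auto
    also have "\<dots> \<le> integ x' y' (\<lambda>t. integ t y' u epowr (q / (1 - q)) * u t * V r v x' t epowr (q / (1 - q)))"
      using assms by (intro integ_subset)
    finally show ?thesis using True q by (auto simp: E_def intro!: epowr_mono)
  next
    case False
    have "einterval x y \<subseteq> einterval x' y'" using assms by (intro einterval_subset)
    then have "(SUP t\<in>einterval x y. integ t y u epowr (1 / q) * V r v x t)
      \<le> (SUP t\<in>einterval x' y'. integ t y' u epowr (1 / q) * V r v x' t)"
      using q V by (intro SUP_mono) (blast intro: mult_mono epowr_mono U less_imp_le divide_pos_pos zero_less_one zero_le)
    then show ?thesis using False by (simp add: E_def)
  qed
qed

lemma inner_le:
  assumes "f \<in> borel_measurable L" "ereal a \<le> x" "y \<le> b"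
  shows "inner f x y \<le> integ x y f epowr r * V r v x y epowr r"
  unfolding inner_def using assms by (rule V_Hoelder)

lemma inner_powr_le:
  assumes "f \<in> borel_measurable L" "ereal a \<le> x" "y \<le> b"
  shows "inner f x y epowr (q / r) \<le> integ x y f epowr q * V r v x y epowr q"
  using epowr_mono[OF inner_le[OF assms], of "q / r"] q r by (simp add: epowr_mult epowr_epowr)

lemma inner_measurable_fun:
  assumes [measurable]: "f \<in> borel_measurable L"
  shows "(\<lambda>s. f s epowr r * v s) \<in> borel_measurable L"
  by measurable

lemma inner_cmult:
  assumes "f \<in> borel_measurable L" "ereal a \<le> x" "y \<le> b"
  shows "inner (\<lambda>s. c * f s) x y = c epowr r * inner f x y"
proof -
  have "inner (\<lambda>s. c * f s) x y = integ x y (\<lambda>s. c epowr r * (f s epowr r * v s))"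
    using r by (simp add: inner_def epowr_mult mult.assoc)
  also have "\<dots> = c epowr r * inner f x y"
    unfolding inner_def using assms by (intro integ_cmult inner_measurable_fun)
  finally show ?thesis .
qed

lemma inner_mono: "(\<And>s. s \<in> einterval x y \<Longrightarrow> f s \<le> g s) \<Longrightarrow> inner f x y \<le> inner g x y"
  unfolding inner_def using r by (intro integ_mono mult_right_mono epowr_mono) auto

lemma inner_subset: "x' \<le> x \<Longrightarrow> y \<le> y' \<Longrightarrow> inner f x y \<le> inner f x' y'"
  unfolding inner_def by (rule integ_subset)

lemma outer_subset: "x' \<le> x \<Longrightarrow> y \<le> y' \<Longrightarrow> outer f x y \<le> outer f x' y'"
proof -
  assume x: "x' \<le> x" "y \<le> y'"
  have "outer f x y \<le> integ x y (\<lambda>t. inner f x' t epowr (q / r) * u t)"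
    unfolding outer_def using x qr by (intro integ_mono mult_right_mono epowr_mono inner_subset) auto
  also have "\<dots> \<le> outer f x' y'"
    unfolding outer_def using x by (intro integ_subset)
  finally show ?thesis .
qed

lemma outer_lower:
  assumes "ereal a \<le> x" "x \<le> ereal t" "y \<le> b"
  shows "integ t y u * inner f x t epowr (q / r) \<le> outer f x y"
proof -
  have t: "ereal a \<le> ereal t" using assms by (rule_tac order_trans)
  have "integ t y u * inner f x t epowr (q / r) = integ t y (\<lambda>s. inner f x t epowr (q / r) * u s)"
    using t assms by (subst integ_cmult) (auto simp: mult.commute)
  also have "\<dots> \<le> integ t y (\<lambda>s. inner f x s epowr (q / r) * u s)"
    using qr by (intro integ_mono mult_right_mono epowr_mono inner_subset) (auto simp: einterval_iff)
  also have "\<dots> \<le> outer f x y"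
    unfolding outer_def using assms by (intro integ_subset) auto
  finally show ?thesis .
qed

text \<open>A factor 2 comes from the bound 2^(1-j) for the mass of a block, a factor 4 from the
  shift by one block in the comparison with E.\<close>

definition cHU :: ennreal where "cHU = p2 3 * GH 1 (q / r)"

lemma cHU_finite: "cHU < top"
  using GH_finite[of 1 "q / r"] qr by (simp add: cHU_def ennreal_mult_less_top)

lemma Hardy_upper:
  assumes x: "a \<le> x" "y \<le> b" and f: "f \<in> borel_measurable L"
    and fin: "\<And>t. x < t \<Longrightarrow> ereal t < y \<Longrightarrow> integ t y u < top"
  shows "outer f x y \<le> cHU * E x y epowr q * integ x y f epowr q"
proof (cases "ereal x < y")
  case False
  then show ?thesis by (simp add: outer_def)
next
  case True
  obtain \<tau> where d: "dyadic u x y \<tau>"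
    using dyadic_exists[OF u u_pos x(1) True x(2) fin] by blast
  note part = dyadicD(1)[OF d]
  have sub: "ereal a \<le> \<tau> k" "ereal (\<tau> k) \<le> b" "ereal (\<tau> k) \<le> y" for k
    using partition_bounds[OF part, of k] x by (auto intro: less_imp_le less_le_trans)
  have ax: "ereal a \<le> ereal x" using x by simp
  define \<gamma> where "\<gamma> j = inner f (\<tau> j) (\<tau> (j + 1))" for j
  define \<alpha> where "\<alpha> j = integ (\<tau> j) (\<tau> (j + 1)) f" for j
  define VV where "VV j = V r v (\<tau> j) (\<tau> (j + 1))" for j
  define X where "X j = p2 (- j) * VV j epowr q" for j :: int
  have m: "(\<lambda>s. f s epowr r * v s) \<in> borel_measurable L" using f by measurable
  have "outer f x y \<le> isum UNIV (\<lambda>j. isum {..j} \<gamma> epowr (q / r) * integ (\<tau> j) (\<tau> (j + 1)) u)"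
    unfolding outer_def
  proof (rule partition_upper[OF part x u])
    fix j t assume t: "\<tau> j < t" "t < \<tau> (j + 1)"
    then have "inner f x t \<le> isum {..j} \<gamma>"
      unfolding inner_def \<gamma>_def using partition_bounds(1)[OF part, of j]
      by (intro partition_integ_le[OF part x m]) auto
    then show "inner f x t epowr (q / r) * u t \<le> isum {..j} \<gamma> epowr (q / r) * u t"
      using qr by (intro mult_right_mono epowr_mono) auto
  qed
  also have "\<dots> \<le> isum UNIV (\<lambda>j. p2 1 * (p2 (- 1 * j) * isum {..j} \<gamma> epowr (q / r)))"
  proof (rule isum_mono)
    fix j
    have "isum {..j} \<gamma> epowr (q / r) * integ (\<tau> j) (\<tau> (j + 1)) u \<le> isum {..j} \<gamma> epowr (q / r) * p2 (1 - j)"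
      using dyadic_block_mass[OF d, of j] by (intro mult_left_mono) auto
    then show "isum {..j} \<gamma> epowr (q / r) * integ (\<tau> j) (\<tau> (j + 1)) u
        \<le> p2 1 * (p2 (- 1 * j) * isum {..j} \<gamma> epowr (q / r))"
      by (simp add: p2_add_left mult.commute)
  qed
  also have "\<dots> \<le> p2 1 * (GH 1 (q / r) * isum UNIV (\<lambda>j. p2 (- 1 * j) * \<gamma> j epowr (q / r)))"
    unfolding isum_cmult[of _ "p2 1"] using qr geometric_Hardy[of 1 "q / r" \<gamma>]
    by (intro mult_left_mono) simp_all
  also have "isum UNIV (\<lambda>j. p2 (- 1 * j) * \<gamma> j epowr (q / r)) \<le> isum UNIV (\<lambda>j. X j * \<alpha> j epowr q)"
  proof (rule isum_mono)
    fix j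
    have "p2 (- 1 * j) * \<gamma> j epowr (q / r) \<le> p2 (- 1 * j) * (\<alpha> j epowr q * VV j epowr q)"
      unfolding \<gamma>_def \<alpha>_def VV_def using sub f by (intro mult_left_mono inner_powr_le) auto
    then show "p2 (- 1 * j) * \<gamma> j epowr (q / r) \<le> X j * \<alpha> j epowr q"
      by (simp add: X_def ac_simps)
  qed
  also have "\<dots> \<le> dual q UNIV X * isum UNIV \<alpha> epowr q"
    using q by (rule dual_Hoelder)
  also have "isum UNIV \<alpha> = integ x y f"
    unfolding \<alpha>_def by (rule partition_integ[OF part x f, symmetric])
  \<comment> \<open>X j contains V over block j, whereas E sees V from x up to a point t. Block j is
    therefore charged to block j + 1, or to its left end if q >= 1. The mass of that block is at
    least 2^(-j-2), whence the factor 4.\<close>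
  also have "dual q UNIV X \<le> p2 2 * E x y epowr q"
  proof -
    have VV: "VV j \<le> V r v x (\<tau> (j + 1))" for j
      unfolding VV_def using ax partition_bounds[OF part, of j] sub by (intro V_mono) auto
    have empty: "VV j = 0" if "\<not> \<tau> j < \<tau> (j + 1)" for j
      using that V_empty by (simp add: VV_def)
    show ?thesis
    proof (cases "q < 1")
      case False
      have "X j \<le> p2 2 * E x y epowr q" for j
      proof (cases "\<tau> j < \<tau> (j + 1)")
        case True
        have "\<tau> (j + 1) \<in> einterval x y"
          using dyadic_next[OF d True] partition_bounds[OF part, of "j + 1"] by (auto simp: einterval_iff)
        then have "integ (\<tau> (j + 1)) y u epowr (1 / q) * V r v x (\<tau> (j + 1)) \<le> E x y"
          using False by (auto simp: E_def intro!: SUP_upper)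
        then have "(integ (\<tau> (j + 1)) y u epowr (1 / q) * V r v x (\<tau> (j + 1))) epowr q \<le> E x y epowr q"
          using q by (intro epowr_mono) auto
        then have "p2 (- j - 1) * V r v x (\<tau> (j + 1)) epowr q \<le> E x y epowr q"
          using q dyadic_next(2)[OF d True] by (simp add: epowr_mult epowr_epowr)
        then have "p2 2 * (p2 (- j - 1) * V r v x (\<tau> (j + 1)) epowr q) \<le> p2 2 * E x y epowr q"
          by (intro mult_left_mono) auto
        moreover have "X j \<le> p2 2 * (p2 (- j - 1) * V r v x (\<tau> (j + 1)) epowr q)"
          unfolding X_def p2_add_left using VV[of j] q by (intro mult_mono epowr_mono) auto
        ultimately show ?thesis by (rule order_trans[rotated])
      qed (use empty q in \<open>simp add: X_def\<close>)
      then show ?thesis using False by (auto simp: dual_def intro!: SUP_least)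
    next
      case True
      let ?s = "q / (1 - q)" and ?k = "1 / (1 - q)"
      have s: "0 < ?s" "0 < ?k" "?k = ?s + 1" using q True by (auto simp: field_simps)
      let ?J = "integ x y (\<lambda>t. integ t y u epowr ?s * u t * V r v x t epowr ?s)"
      let ?H = "\<lambda>k::int. p2 ((- real_of_int k - 1) * ?s) * V r v x (\<tau> k) epowr ?s"
      have "isum UNIV (\<lambda>j. X j epowr ?k) \<le> isum UNIV (\<lambda>j. p2 (2 * ?k) * (?H (j + 1) * integ (\<tau> (j + 1)) (\<tau> (j + 1 + 1)) u))"
      proof (rule isum_mono)
        fix j
        show "X j epowr ?k \<le> p2 (2 * ?k) * (?H (j + 1) * integ (\<tau> (j + 1)) (\<tau> (j + 1 + 1)) u)"
        proof (cases "\<tau> j < \<tau> (j + 1)")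
          case T: True
          have "X j epowr ?k = p2 (- real_of_int j * ?k) * VV j epowr ?s"
            using s(1,2) by (simp add: X_def epowr_mult p2_epowr epowr_epowr)
          also have "\<dots> \<le> p2 (- real_of_int j * ?k) * V r v x (\<tau> (j + 1)) epowr ?s"
            using VV[of j] s by (intro mult_left_mono epowr_mono) auto
          also have "- real_of_int j * ?k = 2 * ?k + (- real_of_int (j + 1) - 1) * ?s + (- real_of_int j - 2)"
          proof -
            have "- real_of_int j * (S + 1) = 2 * (S + 1) + (- real_of_int (j + 1) - 1) * S + (- real_of_int j - 2)" for S :: real
              by (simp add: algebra_simps)
            then show ?thesis unfolding s(3) .
          qed
          also have "p2 (2 * ?k + (- real_of_int (j + 1) - 1) * ?s + (- real_of_int j - 2)) * V r v x (\<tau> (j + 1)) epowr ?s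
            = p2 (2 * ?k) * (?H (j + 1) * p2 (- real_of_int j - 2))"
            by (simp only: p2_add[symmetric] ac_simps)
          also have "\<dots> \<le> p2 (2 * ?k) * (?H (j + 1) * integ (\<tau> (j + 1)) (\<tau> (j + 1 + 1)) u)"
            using dyadic_next(4)[OF d T] by (intro mult_left_mono) (auto simp: add.assoc)
          finally show ?thesis .
        qed (use empty q s(1,2) in \<open>simp add: X_def epowr_mult\<close>)
      qed
      also have "\<dots> = p2 (2 * ?k) * isum UNIV (\<lambda>k. ?H k * integ (\<tau> k) (\<tau> (k + 1)) u)"
        unfolding isum_cmult isum_shift[of "\<lambda>k. ?H k * integ (\<tau> k) (\<tau> (k + 1)) u" 1] ..
      also have "\<dots> \<le> p2 (2 * ?k) * ?J"
      proof (intro mult_left_mono partition_lower[OF part x u])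
        fix k t assume t: "\<tau> k < t" "t < \<tau> (k + 1)"
        have "p2 ((- real_of_int k - 1) * ?s) = p2 (- real_of_int k - 1) epowr ?s" by (simp add: p2_epowr)
        also have "\<dots> \<le> integ t y u epowr ?s"
          using s t dyadic_block(1)[OF d, of k t] by (intro epowr_mono) auto
        finally have 1: "p2 ((- real_of_int k - 1) * ?s) \<le> integ t y u epowr ?s" .
        have "V r v x (\<tau> k) \<le> V r v x t"
          using ax t sub(2)[of "k + 1"] by (intro V_mono) (auto intro: ereal_real_trans(4)[OF _ less_imp_le])
        then have "?H k * u t \<le> integ t y u epowr ?s * V r v x t epowr ?s * u t"
          using 1 s by (intro mult_right_mono mult_mono epowr_mono) auto
        then show "?H k * u t \<le> integ t y u epowr ?s * u t * V r v x t epowr ?s"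
          by (simp add: ac_simps)
      qed simp
      finally have "dual q UNIV X \<le> (p2 (2 * ?k) * ?J) epowr (1 - q)"
        using True by (auto simp: dual_def intro!: epowr_mono)
      also have "\<dots> = p2 2 * E x y epowr q"
      proof -
        have "2 * ?k * (1 - q) = 2" "(1 - q) / q * q = 1 - q"
          using True q by (auto simp: field_simps)
        then show ?thesis
          using True q by (simp only: epowr_mult p2_epowr epowr_epowr E_def if_True)
      qed
      finally show ?thesis .
    qed
  qed
  finally have "outer f x y \<le> p2 1 * (GH 1 (q / r) * (p2 2 * E x y epowr q * integ x y f epowr q))"
    by (simp add: mult_left_mono mult_right_mono)
  also have "\<dots> = cHU * E x y epowr q * integ x y f epowr q"
    by (simp add: cHU_def ac_simps p2_add p2_add_left)
  finally show ?thesis .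
qed

lemma unit_ballD:
  assumes "f \<in> unit_ball x y"
  shows "f \<in> borel_measurable L" "t \<notin> einterval x y \<Longrightarrow> f t = 0" "integ x y f \<le> 1"
  using assms by (auto simp: unit_ball_def)

lemma integ_off:
  assumes "\<And>t. t \<notin> einterval x y \<Longrightarrow> f t = 0" "x' \<le> x" "y \<le> y'"
  shows "integ x' y' f = integ x y f"
  using einterval_subset[OF assms(2,3)] assms(1)
  by (auto intro!: nn_integral_cong split: split_indicator)

lemma unit_ball_mono:
  assumes "f \<in> unit_ball x y" "x' \<le> x" "y \<le> y'"
  shows "f \<in> unit_ball x' y'"
  using assms integ_off[of x y f x' y'] einterval_subset[OF assms(2,3)] by (auto simp: unit_ball_def)

text \<open>Beyond t the inner integral is at least its value at t, so K bounds that value for all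
  functions of norm at most 1 supported in (x, t); by \<open>V_le\<close> this is a bound for V.
  Division by the tail of u requires it to be positive and finite.\<close>

lemma V_point_le:
  assumes x: "ereal a \<le> x" "x < ereal t" "ereal t < y" "y \<le> b" and fin: "integ t y u < top"
    and K: "\<And>f. f \<in> unit_ball x t \<Longrightarrow> outer f x y \<le> K"
  shows "integ t y u * V r v x t epowr q \<le> K"
proof -
  let ?U = "integ t y u"
  have at: "ereal a \<le> ereal t" and tb: "ereal t \<le> b"
    using x by (meson le_less_trans less_le_trans less_imp_le)+
  have pos: "0 < ?U" using x at u_pos by (intro integ_pos) auto
  have "V r v x t \<le> (K * ?U epowr (-1)) epowr (1 / q)"
  proof (rule V_le[OF x(1) tb])
    fix f assume "f \<in> borel_measurable L" "\<And>s. s \<notin> einterval x t \<Longrightarrow> f s = 0" "integ x t f \<le> 1"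
    then have "f \<in> unit_ball x t" by (auto simp: unit_ball_def)
    then have "?U * inner f x t epowr (q / r) \<le> K"
      using K outer_lower[OF x(1) less_imp_le[OF x(2)] x(4)] by (meson order_trans)
    then have "inner f x t epowr (q / r) \<le> K * ?U epowr (-1)"
      unfolding mult_le_iff_inverse[OF pos fin] .
    then have "inner f x t \<le> (K * ?U epowr (-1)) epowr (1 / q * r)"
      using qr by (simp add: epowr_le_iff)
    then show "integ x t (\<lambda>s. f s epowr r * v s) \<le> ((K * ?U epowr (-1)) epowr (1 / q)) epowr r"
      by (simp add: inner_def epowr_epowr)
  qed
  then have "V r v x t epowr q \<le> K * ?U epowr (-1)"
    by (rule epowr_le_iff[OF q, THEN iffD2])
  then show ?thesis by (rule mult_le_iff_inverse[OF pos fin, THEN iffD2])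
qed

lemma V_point_le_B:
  assumes x: "ereal a \<le> x" "x < ereal t" "ereal t < y" "y \<le> b" and fin: "integ t y u < top"
  shows "integ t y u * V r v x t epowr q \<le> B x y"
proof (rule V_point_le[OF assms])
  fix f assume "f \<in> unit_ball x t"
  then have "f \<in> unit_ball x y" by (rule unit_ball_mono) (use x in auto)
  then show "outer f x y \<le> B x y" unfolding B_def by (rule SUP_upper)
qed

text \<open>For q >= 1 this is \<open>V_point_le_B\<close> at each t. For q < 1 the test function is
  a combination of near-extremal functions for V on the intervals from x to \<tau> (j + 1). Their
  overlap is harmless: the norm is an integral and adds up exactly, and the combination dominates
  each summand.\<close>

lemma Hardy_lower:
  assumes x: "a \<le> x" "y \<le> b" and fin: "\<And>t. x < t \<Longrightarrow> ereal t < y \<Longrightarrow> integ t y u < top"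
  shows "E x y epowr q \<le> p2 (4 + q / r) * B x y"
proof (cases "ereal x < y")
  case False
  then show ?thesis using q by (simp add: E_empty)
next
  case xy: True
  have ax: "ereal a \<le> ereal x" using x by simp
  show ?thesis
  proof (cases "q < 1")
    case False
    have "E x y epowr q = (SUP t\<in>einterval x y. (integ t y u epowr (1 / q) * V r v x t) epowr q)"
      using False q xy einterval_nonempty[OF xy] by (simp add: E_def, subst epowr_SUP) auto
    also have "\<dots> \<le> B x y"
      using V_point_le_B[OF ax _ _ x(2) fin] q
      by (intro SUP_least) (auto simp: einterval_iff epowr_mult epowr_epowr)
    also have "\<dots> \<le> p2 (4 + q / r) * B x y"
      using mult_right_mono[of 1 "p2 (4 + q / r)" "B x y"] p2_le_iff[of 0 "4 + q / r"] qr by simp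
    finally show ?thesis .
  next
    case True
    show ?thesis
    \<comment> \<open>A finite B forces every V r v x (\<tau> (j + 1)) to be finite, and only then
      do near-extremal functions exist.\<close>
    proof (cases "B x y < top")
      case False
      then show ?thesis by (simp add: less_top[symmetric] ennreal_mult_top)
    next
      case Bfin: True
      let ?s = "q / (1 - q)" and ?k = "1 / (1 - q)"
      have s: "0 < ?s" "0 < ?k" "?k = ?s + 1" using q True by (auto simp: field_simps)
      let ?J = "integ x y (\<lambda>t. integ t y u epowr ?s * u t * V r v x t epowr ?s)"
      obtain \<tau> where d: "dyadic u x y \<tau>"
        using dyadic_exists[OF u u_pos x(1) xy x(2) fin] by blast
      note part = dyadicD(1)[OF d]
      have sub: "ereal a \<le> \<tau> k" "ereal (\<tau> k) \<le> b" "ereal (\<tau> k) \<le> y" "ereal x \<le> \<tau> k" for k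
        using partition_bounds[OF part, of k] x by (auto intro: less_imp_le less_le_trans)
      define X where "X j = (if \<tau> j < \<tau> (j + 1) then p2 (- j) * V r v x (\<tau> (j + 1)) epowr q else 0)" for j :: int
      have "?J \<le> isum UNIV (\<lambda>j. (p2 ((1 - real_of_int j) * ?s) * V r v x (\<tau> (j + 1)) epowr ?s) * integ (\<tau> j) (\<tau> (j + 1)) u)"
      proof (rule partition_upper[OF part x u])
        fix j t assume t: "\<tau> j < t" "t < \<tau> (j + 1)"
        have "integ t y u epowr ?s \<le> p2 (1 - real_of_int j) epowr ?s"
          using s t dyadic_block(2)[OF d, of j t] by (intro epowr_mono) auto
        then have 1: "integ t y u epowr ?s \<le> p2 ((1 - real_of_int j) * ?s)" by (simp add: p2_epowr)
        have "V r v x t \<le> V r v x (\<tau> (j + 1))"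
          using ax t sub(2)[of "j + 1"] by (intro V_mono) auto
        then have "integ t y u epowr ?s * V r v x t epowr ?s * u t \<le> (p2 ((1 - real_of_int j) * ?s) * V r v x (\<tau> (j + 1)) epowr ?s) * u t"
          using 1 s by (intro mult_right_mono mult_mono epowr_mono) auto
        then show "integ t y u epowr ?s * u t * V r v x t epowr ?s \<le> (p2 ((1 - real_of_int j) * ?s) * V r v x (\<tau> (j + 1)) epowr ?s) * u t"
          by (simp add: ac_simps)
      qed
      also have "\<dots> \<le> isum UNIV (\<lambda>j. p2 ?k * X j epowr ?k)"
      proof (rule isum_mono)
        fix j
        show "(p2 ((1 - real_of_int j) * ?s) * V r v x (\<tau> (j + 1)) epowr ?s) * integ (\<tau> j) (\<tau> (j + 1)) u \<le> p2 ?k * X j epowr ?k"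
        proof (cases "\<tau> j < \<tau> (j + 1)")
          case T: True
          have "(p2 ((1 - real_of_int j) * ?s) * V r v x (\<tau> (j + 1)) epowr ?s) * integ (\<tau> j) (\<tau> (j + 1)) u
            \<le> (p2 ((1 - real_of_int j) * ?s) * V r v x (\<tau> (j + 1)) epowr ?s) * p2 (1 - real_of_int j)"
            using dyadic_block_mass[OF d, of j] by (intro mult_left_mono) auto
          also have "\<dots> = p2 ((1 - real_of_int j) * ?s + (1 - real_of_int j)) * V r v x (\<tau> (j + 1)) epowr ?s"
            by (simp add: ac_simps p2_add_left)
          also have "(1 - real_of_int j) * ?s + (1 - real_of_int j) = ?k + - real_of_int j * ?k"
          proof -
            have "(1 - real_of_int j) * S + (1 - real_of_int j) = (S + 1) + - real_of_int j * (S + 1)" for S :: real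
              by (simp add: algebra_simps)
            then show ?thesis unfolding s(3) .
          qed
          also have "p2 (?k + - real_of_int j * ?k) * V r v x (\<tau> (j + 1)) epowr ?s = p2 ?k * X j epowr ?k"
            using T s(1,2) by (simp add: X_def epowr_mult p2_epowr epowr_epowr p2_add_left)
          finally show ?thesis .
        qed simp
      qed
      finally have "?J \<le> p2 ?k * isum UNIV (\<lambda>j. X j epowr ?k)" by (simp add: isum_cmult)
      then have "?J epowr (1 - q) \<le> (p2 ?k * isum UNIV (\<lambda>j. X j epowr ?k)) epowr (1 - q)"
        using True by (intro epowr_mono) auto
      then have "E x y epowr q \<le> p2 1 * dual q UNIV X"
        using True q by (simp add: E_def dual_def epowr_epowr epowr_mult p2_epowr)
      also have "dual q UNIV X \<le> p2 (2 + q / r) * B x y"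
      proof (rule dual_converse[OF q])
        fix A :: "int \<Rightarrow> ennreal" assume A: "\<And>i. A i < top" "isum UNIV A \<le> 1"
        have "\<exists>f. f \<in> unit_ball x (\<tau> (j + 1)) \<and> V r v x (\<tau> (j + 1)) epowr r \<le> p2 1 * inner f x (\<tau> (j + 1))" for j
        proof (cases "x < \<tau> (j + 1)")
          case T: True
          have fj: "integ (\<tau> (j + 1)) y u < top" using T partition_bounds(2)[OF part] by (rule fin)
          have p: "0 < integ (\<tau> (j + 1)) y u"
            using sub partition_bounds(2)[OF part] x u_pos by (intro integ_pos) auto
          have "integ (\<tau> (j + 1)) y u * V r v x (\<tau> (j + 1)) epowr q < top"
            using V_point_le_B[OF ax _ partition_bounds(2)[OF part] x(2) fj] T Bfin by (auto intro: le_less_trans)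
          then have "V r v x (\<tau> (j + 1)) < top"
            using p q by (auto simp: ennreal_mult_less_top epowr_finite_iff epowr_eq_0_iff)
          from V_half_attain[OF ax sub(2) this]
          obtain f where "f \<in> borel_measurable L" "\<And>t. t \<notin> einterval x (\<tau> (j + 1)) \<Longrightarrow> f t = 0"
            "integ x (\<tau> (j + 1)) f \<le> 1"
            "V r v x (\<tau> (j + 1)) epowr r \<le> p2 1 * integ x (\<tau> (j + 1)) (\<lambda>s. f s epowr r * v s)"
            by blast
          then show ?thesis
            by (intro exI[of _ f]) (simp add: unit_ball_def inner_def)
        next
          case False
          then have "V r v x (\<tau> (j + 1)) = 0" by (intro V_empty) simp
          then show ?thesis
            using r by (intro exI[of _ "\<lambda>_. 0"]) (simp add: unit_ball_def)
        qed
        then obtain F where F: "\<And>j. F j \<in> unit_ball x (\<tau> (j + 1))"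
          "\<And>j. V r v x (\<tau> (j + 1)) epowr r \<le> p2 1 * inner (F j) x (\<tau> (j + 1))"
          by metis
        have Fm[measurable]: "F j \<in> borel_measurable L" for j using unit_ballD(1)[OF F(1)] .
        have F1: "integ x y (F j) \<le> 1" for j
          using unit_ball_mono[OF F(1)[of j], of "ereal x" y] sub unit_ballD(3) by auto
        define f where "f s = isum UNIV (\<lambda>j. A j * F j s)" for s
        have fm[measurable]: "f \<in> borel_measurable L" unfolding f_def by measurable
        have "integ x y f = isum UNIV (\<lambda>j. A j * integ x y (F j))"
          unfolding f_def using ax x by (subst integ_isum) (auto simp: integ_cmult)
        also have "\<dots> \<le> isum UNIV (\<lambda>j. A j * 1)" by (intro isum_mono mult_left_mono F1) auto
        also have "\<dots> \<le> 1" using A by simp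
        finally have "integ x y f \<le> 1" .
        moreover have "f t = 0" if "t \<notin> einterval x y" for t
        proof -
          have "F j t = 0" for j
            using unit_ballD(2)[OF unit_ball_mono[OF F(1)[of j], of "ereal x" y], of t] that sub by auto
          then show ?thesis by (simp add: f_def)
        qed
        ultimately have fB: "outer f x y \<le> B x y"
          unfolding B_def using fm by (intro SUP_upper) (auto simp: unit_ball_def)
        let ?H = "\<lambda>k::int. (A (k - 1) epowr q * V r v x (\<tau> k) epowr q) * p2 (- (q / r))"
        have "isum UNIV (\<lambda>j. X j * A j epowr q) \<le> isum UNIV (\<lambda>j. p2 (2 + q / r) * (?H (j + 1) * integ (\<tau> (j + 1)) (\<tau> (j + 1 + 1)) u))"
        proof (rule isum_mono)
          fix j
          show "X j * A j epowr q \<le> p2 (2 + q / r) * (?H (j + 1) * integ (\<tau> (j + 1)) (\<tau> (j + 1 + 1)) u)"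
          proof (cases "\<tau> j < \<tau> (j + 1)")
            case T: True
            have "X j * A j epowr q = p2 (- real_of_int j) * (A j epowr q * V r v x (\<tau> (j + 1)) epowr q)"
              using T by (simp add: X_def ac_simps)
            also have "- real_of_int j = 2 + q / r + (- (q / r)) + (- real_of_int j - 2)" by simp
            also have "p2 (2 + q / r + (- (q / r)) + (- real_of_int j - 2)) * (A j epowr q * V r v x (\<tau> (j + 1)) epowr q)
              = p2 (2 + q / r) * (?H (j + 1) * p2 (- real_of_int j - 2))"
              by (simp only: p2_add[symmetric] ac_simps add_diff_cancel_right' add_diff_cancel_left')
            also have "\<dots> \<le> p2 (2 + q / r) * (?H (j + 1) * integ (\<tau> (j + 1)) (\<tau> (j + 1 + 1)) u)"
              using dyadic_next(4)[OF d T] by (intro mult_left_mono) (auto simp: add.assoc)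
            finally show ?thesis .
          qed (simp add: X_def)
        qed
        also have "\<dots> = p2 (2 + q / r) * isum UNIV (\<lambda>k. ?H k * integ (\<tau> k) (\<tau> (k + 1)) u)"
          unfolding isum_cmult isum_shift[of "\<lambda>k. ?H k * integ (\<tau> k) (\<tau> (k + 1)) u" 1] ..
        also have "\<dots> \<le> p2 (2 + q / r) * outer f x y"
          unfolding outer_def
        proof (intro mult_left_mono partition_lower[OF part x u])
          fix k t assume t: "\<tau> k < t" "t < \<tau> (k + 1)"
          have "A (k - 1) epowr r * V r v x (\<tau> k) epowr r \<le> A (k - 1) epowr r * (p2 1 * inner (F (k - 1)) x (\<tau> k))"
            using F(2)[of "k - 1"] by (intro mult_left_mono) auto
          also have "\<dots> = p2 1 * inner (\<lambda>s. A (k - 1) * F (k - 1) s) x (\<tau> k)"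
            using ax sub by (subst inner_cmult) (auto simp: ac_simps)
          also have "\<dots> \<le> p2 1 * inner f x (\<tau> k)"
            unfolding f_def by (intro mult_left_mono inner_mono isum_point) auto
          also have "\<dots> \<le> p2 1 * inner f x t"
            using t by (intro mult_left_mono inner_subset) auto
          finally have "(A (k - 1) epowr r * V r v x (\<tau> k) epowr r) epowr (q / r) \<le> (p2 1 * inner f x t) epowr (q / r)"
            using qr by (intro epowr_mono) auto
          then have "A (k - 1) epowr q * V r v x (\<tau> k) epowr q \<le> p2 (q / r) * inner f x t epowr (q / r)"
            using qr r by (simp add: epowr_mult epowr_epowr p2_epowr)
          then have "?H k \<le> p2 (q / r) * inner f x t epowr (q / r) * p2 (- (q / r))"
            by (intro mult_right_mono) auto
          also have "\<dots> = inner f x t epowr (q / r)"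
            by (simp add: ac_simps p2_add_left)
          finally show "?H k * u t \<le> inner f x t epowr (q / r) * u t"
            by (intro mult_right_mono) auto
        qed simp
        also have "\<dots> \<le> p2 (2 + q / r) * B x y" using fB by (intro mult_left_mono) auto
        finally show "isum UNIV (\<lambda>j. X j * A j epowr q) \<le> p2 (2 + q / r) * B x y" .
      qed
      finally have "E x y epowr q \<le> p2 1 * (p2 (2 + q / r) * B x y)" by (simp add: mult_left_mono)
      also have "\<dots> \<le> p2 (4 + q / r) * B x y"
        unfolding p2_add_left by (intro mult_right_mono) auto
      finally show ?thesis .
    qed
  qed
qed

end

subsection \<open>Sufficiency\<close>

lemma isum_disjoint_le:
  assumes "\<And>i j j'. i \<in> A j \<Longrightarrow> i \<in> A j' \<Longrightarrow> j = j'"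
  shows "isum UNIV (\<lambda>j. isum (A j) n) \<le> isum UNIV n"
proof -
  have "isum UNIV (\<lambda>j. isum (A j) n) = isum UNIV (\<lambda>i. isum UNIV (\<lambda>j. n i * indicator (A j) i))"
    unfolding isum_restrict[of "A _"] by (rule isum_swap)
  also have "\<dots> \<le> isum UNIV n"
  proof (rule isum_mono)
    fix i
    show "isum UNIV (\<lambda>j. n i * indicator (A j) i) \<le> n i"
    proof (cases "\<exists>j. i \<in> A j")
      case True
      then obtain j where "i \<in> A j" by blast
      then have "isum UNIV (\<lambda>j. n i * indicator (A j) i) = isum UNIV (\<lambda>k. n i * indicator {j} k)"
        using assms by (intro isum_cong) (auto split: split_indicator)
      also have "\<dots> = n i" using isum_restrict[of "{j}" "\<lambda>_. n i"] by simp
      finally show ?thesis by simp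
    qed simp
  qed
  finally show ?thesis .
qed

lemma isum_cover_le:
  assumes "\<And>i. i \<in> I \<Longrightarrow> f i \<noteq> 0 \<Longrightarrow> \<exists>j\<in>J. i \<in> A j"
  shows "isum I f \<le> isum J (\<lambda>j. isum (A j) f)"
proof -
  have "isum I f = isum UNIV (\<lambda>i. f i * indicator I i)" by (rule isum_restrict)
  also have "\<dots> \<le> isum UNIV (\<lambda>i. isum UNIV (\<lambda>j. f i * indicator (A j) i * indicator J j))"
  proof (rule isum_mono)
    fix i
    show "f i * indicator I i \<le> isum UNIV (\<lambda>j. f i * indicator (A j) i * indicator J j)"
    proof (cases "i \<in> I \<and> f i \<noteq> 0")
      case True
      then obtain j where "j \<in> J" "i \<in> A j" using assms by blast
      then have "f i * indicator I i = f i * indicator (A j) i * indicator J j" using True by simp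
      also have "\<dots> \<le> isum UNIV (\<lambda>j. f i * indicator (A j) i * indicator J j)"
        by (rule isum_point) simp
      finally show ?thesis .
    next
      case False
      then have "f i * indicator I i = 0" by (auto split: split_indicator)
      then show ?thesis by (metis zero_le)
    qed
  qed
  also have "\<dots> = isum UNIV (\<lambda>j. isum UNIV (\<lambda>i. f i * indicator (A j) i * indicator J j))"
    by (rule isum_swap)
  also have "\<dots> = isum J (\<lambda>j. isum (A j) f)"
    unfolding isum_restrict[of J] isum_restrict[of "A _"] isum_multc ..
  finally show ?thesis .
qed

lemma isum_single_le:
  assumes "\<And>i j. i \<in> I \<Longrightarrow> j \<in> I \<Longrightarrow> i = j" "\<And>i. i \<in> I \<Longrightarrow> f i \<le> K"
  shows "isum I f \<le> K"
proof (cases "I = {}")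
  case False
  then obtain i where "i \<in> I" by blast
  then have "I = {i}" using assms(1) by blast
  then show ?thesis using assms(2) by simp
qed (simp add: nn_integral_empty)

section \<open>The inequality cut along the blocks of w and the levels of u\<close>

locale three_weights = uv_weights +
  fixes p :: real and w :: "real \<Rightarrow> ennreal"
  assumes p: "0 < p" and w[measurable]: "w \<in> borel_measurable L" and w_pos: "AE t in L. 0 < w t"
    and w_fin: "\<And>t. a < t \<Longrightarrow> ereal t < b \<Longrightarrow> integ t b w < top"
begin

declare w [measurable]

definition R :: "(real \<Rightarrow> ennreal) \<Rightarrow> ennreal" where
  "R f = integ a b (\<lambda>t. integ a t f epowr p * w t)"

lemma inner_measurable: "(\<lambda>t. inner f y (ereal t)) \<in> borel_measurable L"
  by (rule mono_measurable) (auto intro: inner_subset)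

lemma w_integ_pos: "a < t \<Longrightarrow> ereal t < b \<Longrightarrow> 0 < integ t b w"
  using w_pos by (intro integ_pos) auto

lemma outer_truncated:
  assumes f: "f \<in> borel_measurable L" "\<And>t. t \<le> a' \<Longrightarrow> f t = 0" and a': "a < a'" "ereal a' < b"
  shows "outer f a b = outer f a' b"
proof -
  have i: "inner f a t = inner f a' t" for t
    unfolding inner_def using f(2) a' r
    by (auto intro!: nn_integral_cong simp: einterval_iff split: split_indicator)
  have m: "(\<lambda>t. inner f a t epowr (q / r) * u t) \<in> borel_measurable L"
    using inner_measurable[of f a] by measurable
  have "inner f a' t = 0" if "t \<in> einterval a a'" for t
    unfolding inner_def using that by (simp add: einterval_iff)
  then have "integ a a' (\<lambda>t. inner f a t epowr (q / r) * u t) = integ a a' (\<lambda>t. 0)"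
    using qr by (intro integ_cong) (simp add: i)
  then have "outer f a b = integ a' b (\<lambda>t. inner f a t epowr (q / r) * u t)"
    unfolding outer_def using a' integ_split[OF m, of a a' b] by simp
  then show ?thesis unfolding outer_def i .
qed

text \<open>A block of w is assigned to the level of u that contains its right end, because only
  from there on is its full contribution present in the inner integral.\<close>

definition levels :: "(int \<Rightarrow> real) \<Rightarrow> (int \<Rightarrow> real) \<Rightarrow> int \<Rightarrow> int set" where
  "levels \<tau> x j = {i. \<tau> j < x (i + 1) \<and> x (i + 1) \<le> \<tau> (j + 1)}"

text \<open>The tail of w on block i is about 2^-i, so 2^(i/p) stands for W^(-1/p). The same factor
  absorbs the substitution n_i = 2^-i (integral of f over block i)^p, after which the right-hand
  side is an l1 sum.\<close>

definition vv :: "(int \<Rightarrow> real) \<Rightarrow> int \<Rightarrow> ennreal" where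
  "vv x i = p2 (real_of_int i / p) * V r v (x i) (x (i + 1))"

definition ee :: "(int \<Rightarrow> real) \<Rightarrow> int \<Rightarrow> ennreal" where
  "ee x i = p2 (real_of_int i / p) * E (x i) (x (i + 1))"

text \<open>The best constant in bounding the sum of vv_i^r n_i^(r/p) over one level by a multiple
  of (sum of n_i)^(r/p): the blocks of one level act together.\<close>

definition Theta :: "(int \<Rightarrow> real) \<Rightarrow> (int \<Rightarrow> real) \<Rightarrow> int \<Rightarrow> ennreal" where
  "Theta \<tau> x j = dual (r / p) (levels \<tau> x j) (\<lambda>i. vv x i epowr r)"

text \<open>The discrete characteristic constants: one is local to the blocks of \<open>w\<close>, the other is
  the constant of a discrete Hardy inequality linking different blocks.\<close>

definition local_const :: "(int \<Rightarrow> real) \<Rightarrow> ennreal" where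
  "local_const x = dual (q / p) UNIV (\<lambda>k. ee x k epowr q)"

definition global_const :: "(int \<Rightarrow> real) \<Rightarrow> (int \<Rightarrow> real) \<Rightarrow> ennreal" where
  "global_const \<tau> x = dual (q / p) UNIV (\<lambda>j. p2 (- real_of_int j) * Theta \<tau> x j epowr (q / r))"

lemma levels_unique:
  assumes "partition y z \<tau>" "i \<in> levels \<tau> x j" "i \<in> levels \<tau> x j'"
  shows "j = j'"
  using assms partition_unique[OF assms(1), of j "x (i + 1)" j'] by (auto simp: levels_def)

text \<open>\<open>p2 (q / r)\<close> comes from splitting the inner integral at the left end of a
  block, the bracket from the global and the local part, and \<open>p2 (2 * q / p)\<close> from the
  factor 4 in the bound of the block sum by \<open>R\<close>.\<close>

definition cS :: ennreal where
  "cS = p2 (q / r) * (p2 1 * GH 1 (q / r) + cHU) * p2 (2 * q / p)"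

lemma cS_finite: "cS < top"
  using cHU_finite GH_finite[of 1 "q / r"] qr by (auto simp: cS_def ennreal_mult_less_top)

lemma discrete_sufficiency:
  assumes a': "a < a'" "ereal a' < b" and f[measurable]: "f \<in> borel_measurable L" and f0: "\<And>t. t \<le> a' \<Longrightarrow> f t = 0"
    and fin: "\<And>t. a < t \<Longrightarrow> ereal t < b \<Longrightarrow> integ t b u < top"
    and dx: "dyadic w a' b x" and dt: "dyadic u a' b \<tau>"
  shows "outer f a b \<le> cS * (local_const x + global_const \<tau> x) * R f epowr (q / p)"
proof -
  note px = dyadicD(1)[OF dx] and pt = dyadicD(1)[OF dt]
  have a'2: "a \<le> a'" "b \<le> b" using a' by auto
  have sub: "ereal a \<le> x k" "ereal (x k) \<le> b" "a' \<le> x k" "x k \<le> x (k + 1)" for k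
    using partition_bounds[OF px, of k] a' by (auto intro: less_imp_le)
  define \<alpha> where "\<alpha> k = integ (x k) (x (k + 1)) f" for k
  define n where "n k = p2 (- real_of_int k) * \<alpha> k epowr p" for k
  define N where "N = isum UNIV n"
  define g where "g i = inner f (x i) (x (i + 1))" for i
  have \<alpha>0: "\<alpha> k = 0" "g k = 0" if "\<not> x k < x (k + 1)" for k
    using that by (simp_all add: \<alpha>_def g_def inner_def)
  \<comment> \<open>The integral of f over block k is fully present only from block k + 1 on, whose
    w-mass is at least 2^(-k-2); hence the factor 4.\<close>
  have N: "N \<le> p2 2 * R f"
  proof -
    have "N \<le> isum UNIV (\<lambda>k. p2 2 * (\<alpha> (k + 1 - 1) epowr p * integ (x (k + 1)) (x (k + 1 + 1)) w))"
      unfolding N_def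
    proof (rule isum_mono)
      fix k
      show "n k \<le> p2 2 * (\<alpha> (k + 1 - 1) epowr p * integ (x (k + 1)) (x (k + 1 + 1)) w)"
      proof (cases "x k < x (k + 1)")
        case True
        have "n k = p2 2 * (\<alpha> k epowr p * p2 (- real_of_int k - 2))"
          by (simp add: n_def ac_simps p2_add_left p2_add)
        also have "\<dots> \<le> p2 2 * (\<alpha> k epowr p * integ (x (k + 1)) (x (k + 2)) w)"
          using dyadic_next(4)[OF dx True] by (intro mult_left_mono) auto
        finally show ?thesis by (simp add: add.assoc)
      qed (use \<alpha>0 p in \<open>simp add: n_def\<close>)
    qed
    also have "\<dots> = p2 2 * isum UNIV (\<lambda>k. \<alpha> (k - 1) epowr p * integ (x k) (x (k + 1)) w)"
      unfolding isum_cmult isum_shift[of "\<lambda>k. \<alpha> (k - 1) epowr p * integ (x k) (x (k + 1)) w" 1] ..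
    also have "\<dots> \<le> p2 2 * integ a' b (\<lambda>t. integ a t f epowr p * w t)"
    proof (intro mult_left_mono partition_lower[OF px a'2 w] mult_right_mono epowr_mono)
      fix k t assume "x k < t" "t < x (k + 1)"
      then show "\<alpha> (k - 1) \<le> integ a t f"
        unfolding \<alpha>_def using sub[of "k - 1"] by (intro integ_subset) auto
    qed (use p in auto)
    also have "\<dots> \<le> p2 2 * R f"
      unfolding R_def using a'2 by (intro mult_left_mono integ_subset) auto
    finally show ?thesis .
  qed
  define h where "h t = inner f a' t epowr (q / r) * u t" for t
  have hm: "h \<in> borel_measurable L"
    unfolding h_def using inner_measurable[of f a'] by measurable
  have "outer f a b = integ a' b h"
    unfolding h_def using outer_truncated[OF f f0 a'] by (simp add: outer_def)
  also have "\<dots> = isum UNIV (\<lambda>k. integ (x k) (x (k + 1)) h)"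
    by (rule partition_integ[OF px a'2 hm])
  \<comment> \<open>Inside block k the inner integral is its value at x k, which carries all earlier
    blocks, plus the part inside the block: the global and the local term.\<close>
  also have "\<dots> \<le> isum UNIV (\<lambda>k. p2 (q / r) * (inner f a' (x k) epowr (q / r) * integ (x k) (x (k + 1)) u + outer f (x k) (x (k + 1))))"
  proof (rule isum_mono)
    fix k
    have m: "(\<lambda>t. inner f (x k) t epowr (q / r) * u t) \<in> borel_measurable L"
      using inner_measurable[of f "x k"] by measurable
    have "integ (x k) (x (k + 1)) h \<le> integ (x k) (x (k + 1))
        (\<lambda>t. p2 (q / r) * (inner f a' (x k) epowr (q / r) * u t + inner f (x k) t epowr (q / r) * u t))"
    proof (rule integ_mono)
      fix t assume t: "t \<in> einterval (x k) (x (k + 1))"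
      then have "inner f a' t = inner f a' (x k) + inner f (x k) t"
        unfolding inner_def using sub a'2 sub(2)[of "k + 1"]
        by (intro integ_split inner_measurable_fun f) (auto simp: einterval_iff intro: ereal_real_trans(4)[OF _ less_imp_le])
      then have "h t \<le> p2 (q / r) * (inner f a' (x k) epowr (q / r) + inner f (x k) t epowr (q / r)) * u t"
        unfolding h_def using epowr_sum_le_p2[of "q / r"] qr by (intro mult_right_mono) auto
      then show "h t \<le> p2 (q / r) * (inner f a' (x k) epowr (q / r) * u t + inner f (x k) t epowr (q / r) * u t)"
        by (simp add: distrib_left distrib_right mult.assoc)
    qed
    also have "\<dots> = p2 (q / r) * integ (x k) (x (k + 1))
        (\<lambda>t. inner f a' (x k) epowr (q / r) * u t + inner f (x k) t epowr (q / r) * u t)"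
      using sub m by (intro integ_cmult) auto
    also have "\<dots> = p2 (q / r) * (integ (x k) (x (k + 1)) (\<lambda>t. inner f a' (x k) epowr (q / r) * u t) + outer f (x k) (x (k + 1)))"
      unfolding outer_def using sub m by (subst integ_add) auto
    also have "integ (x k) (x (k + 1)) (\<lambda>t. inner f a' (x k) epowr (q / r) * u t) = inner f a' (x k) epowr (q / r) * integ (x k) (x (k + 1)) u"
      using sub by (intro integ_cmult u) auto
    finally show "integ (x k) (x (k + 1)) h \<le> p2 (q / r) * (inner f a' (x k) epowr (q / r) * integ (x k) (x (k + 1)) u + outer f (x k) (x (k + 1)))" .
  qed
  also have "\<dots> = p2 (q / r) * (isum UNIV (\<lambda>k. inner f a' (x k) epowr (q / r) * integ (x k) (x (k + 1)) u)
      + isum UNIV (\<lambda>k. outer f (x k) (x (k + 1))))"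
    by (simp add: isum_cmult isum_add)
  also have "isum UNIV (\<lambda>k. outer f (x k) (x (k + 1))) \<le> cHU * local_const x * N epowr (q / p)"
  proof -
    have "isum UNIV (\<lambda>k. outer f (x k) (x (k + 1))) \<le> isum UNIV (\<lambda>k. cHU * (ee x k epowr q * n k epowr (q / p)))"
    proof (rule isum_mono)
      fix k
      have "outer f (x k) (x (k + 1)) \<le> cHU * E (x k) (x (k + 1)) epowr q * \<alpha> k epowr q"
        unfolding \<alpha>_def
      proof (rule Hardy_upper)
        fix t assume t: "x k < t" "ereal t < ereal (x (k + 1))"
        then have "a < t" "ereal t < b"
          using a' sub(3)[of k] partition_bounds(2)[OF px, of "k + 1"] by (auto intro: less_trans ereal_real_trans(3)[OF _ less_imp_le])
        then have "integ t b u < top" by (rule fin)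
        moreover have "integ t (x (k + 1)) u \<le> integ t b u" using sub by (intro integ_subset) auto
        ultimately show "integ t (x (k + 1)) u < top" by (rule le_less_trans[rotated])
      qed (use sub in auto)
      also have "\<dots> = cHU * (ee x k epowr q * n k epowr (q / p))"
      proof -
        have "ee x k epowr q * n k epowr (q / p) = (p2 (real_of_int k / p * q) * p2 (- real_of_int k * (q / p))) * (E (x k) (x (k + 1)) epowr q * \<alpha> k epowr q)"
          unfolding ee_def n_def using p q by (simp add: epowr_mult epowr_epowr p2_epowr ac_simps)
        then show ?thesis by (simp add: p2_add mult.assoc)
      qed
      finally show "outer f (x k) (x (k + 1)) \<le> cHU * (ee x k epowr q * n k epowr (q / p))" .
    qed
    also have "\<dots> \<le> cHU * (local_const x * N epowr (q / p))"
      unfolding isum_cmult local_const_def N_def using p q by (intro mult_left_mono dual_Hoelder) auto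
    finally show ?thesis by (simp add: mult.assoc)
  qed
  also have "isum UNIV (\<lambda>k. inner f a' (x k) epowr (q / r) * integ (x k) (x (k + 1)) u)
      \<le> p2 1 * GH 1 (q / r) * global_const \<tau> x * N epowr (q / p)"
  proof -
    \<comment> \<open>S turns values attached to the points x k into a function of t, so that the
      integral can be cut a second time, now along the blocks of u.\<close>
    define S where "S t = (SUP k\<in>{k. x k < t}. inner f a' (x k))" for t
    define \<gamma> where "\<gamma> j = isum (levels \<tau> x j) g" for j
    have "isum UNIV (\<lambda>k. inner f a' (x k) epowr (q / r) * integ (x k) (x (k + 1)) u)
        \<le> integ a' b (\<lambda>t. S t epowr (q / r) * u t)"
    proof (rule partition_lower[OF px a'2 u])
      fix k t assume "x k < t" "t < x (k + 1)"
      then show "inner f a' (x k) epowr (q / r) * u t \<le> S t epowr (q / r) * u t"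
        unfolding S_def using qr by (intro mult_right_mono epowr_mono SUP_upper) auto
    qed
    also have "\<dots> \<le> isum UNIV (\<lambda>j. isum {..j} \<gamma> epowr (q / r) * integ (\<tau> j) (\<tau> (j + 1)) u)"
    proof (rule partition_upper[OF pt a'2 u])
      fix j t assume t: "\<tau> j < t" "t < \<tau> (j + 1)"
      have "inner f a' (x k) \<le> isum {..j} \<gamma>" if "x k < t" for k
      proof -
        have "inner f a' (x k) \<le> isum {..k - 1} g"
          unfolding inner_def g_def using sub
          by (intro partition_integ_le[OF px a'2 inner_measurable_fun[OF f]]) auto
        also have "\<dots> \<le> isum {..j} \<gamma>"
          unfolding \<gamma>_def
        proof (rule isum_cover_le)
          fix i assume i: "i \<in> {..k - 1}" "g i \<noteq> 0"
          then have ne: "x i < x (i + 1)" using \<alpha>0(2)[of i] by blast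
          have le: "x (i + 1) \<le> x k" using i by (intro partition_mono[OF px]) auto
          have "a' < x (i + 1)" "ereal (x (i + 1)) < b"
            using ne sub(3)[of i] partition_bounds(2)[OF px] by auto
          then obtain l where l: "\<tau> l < x (i + 1)" "x (i + 1) \<le> \<tau> (l + 1)"
            by (rule partition_obtain[OF pt])
          then have "l \<le> j" "i \<in> levels \<tau> x l"
            using that t le partition_index_le[OF pt, of l "x (i + 1)" j] by (auto simp: levels_def)
          then show "\<exists>l\<in>{..j}. i \<in> levels \<tau> x l" by blast
        qed
        finally show ?thesis .
      qed
      then have "S t \<le> isum {..j} \<gamma>" unfolding S_def by (intro SUP_least) auto
      then show "S t epowr (q / r) * u t \<le> isum {..j} \<gamma> epowr (q / r) * u t"
        using qr by (intro mult_right_mono epowr_mono) auto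
    qed
    also have "\<dots> \<le> isum UNIV (\<lambda>j. p2 1 * (p2 (- real_of_int j) * isum {..j} \<gamma> epowr (q / r)))"
    proof (rule isum_mono)
      fix j
      have "isum {..j} \<gamma> epowr (q / r) * integ (\<tau> j) (\<tau> (j + 1)) u \<le> isum {..j} \<gamma> epowr (q / r) * p2 (1 - real_of_int j)"
        using dyadic_block_mass[OF dt, of j] by (intro mult_left_mono) auto
      then show "isum {..j} \<gamma> epowr (q / r) * integ (\<tau> j) (\<tau> (j + 1)) u
          \<le> p2 1 * (p2 (- real_of_int j) * isum {..j} \<gamma> epowr (q / r))"
        by (simp add: p2_add_left mult.commute)
    qed
    also have "\<dots> \<le> p2 1 * (GH 1 (q / r) * isum UNIV (\<lambda>j. p2 (- real_of_int j) * \<gamma> j epowr (q / r)))"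
      unfolding isum_cmult[of _ "p2 1"] using qr geometric_Hardy[of 1 "q / r" \<gamma>]
      by (intro mult_left_mono) simp_all
    also have "isum UNIV (\<lambda>j. p2 (- real_of_int j) * \<gamma> j epowr (q / r))
        \<le> isum UNIV (\<lambda>j. (p2 (- real_of_int j) * Theta \<tau> x j epowr (q / r)) * isum (levels \<tau> x j) n epowr (q / p))"
    proof (rule isum_mono)
      fix j
      have "\<gamma> j \<le> isum (levels \<tau> x j) (\<lambda>i. vv x i epowr r * n i epowr (r / p))"
        unfolding \<gamma>_def
      proof (rule isum_mono)
        fix i
        have "g i \<le> \<alpha> i epowr r * V r v (x i) (x (i + 1)) epowr r"
          unfolding g_def \<alpha>_def using sub by (intro inner_le f) auto
        also have "\<dots> = (p2 (real_of_int i / p * r) * p2 (- real_of_int i * (r / p))) * (V r v (x i) (x (i + 1)) epowr r * \<alpha> i epowr r)"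
          by (simp add: p2_add mult.commute)
        also have "\<dots> = vv x i epowr r * n i epowr (r / p)"
          unfolding vv_def n_def using p r by (simp add: epowr_mult epowr_epowr p2_epowr ac_simps)
        finally show "g i \<le> vv x i epowr r * n i epowr (r / p)" .
      qed
      also have "\<dots> \<le> Theta \<tau> x j * isum (levels \<tau> x j) n epowr (r / p)"
        unfolding Theta_def using p r by (intro dual_Hoelder) auto
      finally have "\<gamma> j epowr (q / r) \<le> (Theta \<tau> x j * isum (levels \<tau> x j) n epowr (r / p)) epowr (q / r)"
        using qr by (intro epowr_mono) auto
      also have "\<dots> = Theta \<tau> x j epowr (q / r) * isum (levels \<tau> x j) n epowr (q / p)"
        using p q r by (simp add: epowr_mult epowr_epowr)
      finally have "p2 (- real_of_int j) * \<gamma> j epowr (q / r) \<le> p2 (- real_of_int j) * (Theta \<tau> x j epowr (q / r) * isum (levels \<tau> x j) n epowr (q / p))"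
        by (intro mult_left_mono) auto
      then show "p2 (- real_of_int j) * \<gamma> j epowr (q / r)
          \<le> (p2 (- real_of_int j) * Theta \<tau> x j epowr (q / r)) * isum (levels \<tau> x j) n epowr (q / p)"
        by (simp add: mult.assoc)
    qed
    also have "\<dots> \<le> global_const \<tau> x * isum UNIV (\<lambda>j. isum (levels \<tau> x j) n) epowr (q / p)"
      unfolding global_const_def using p q by (intro dual_Hoelder) auto
    also have "\<dots> \<le> global_const \<tau> x * N epowr (q / p)"
      unfolding N_def using p q levels_unique[OF pt]
      by (intro mult_left_mono epowr_mono isum_disjoint_le) auto
    finally show ?thesis by (simp add: mult_left_mono mult.assoc)
  qed
  finally have "outer f a b \<le> p2 (q / r) * (p2 1 * GH 1 (q / r) * global_const \<tau> x * N epowr (q / p) + cHU * local_const x * N epowr (q / p))"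
    by (simp add: mult_left_mono add_mono)
  also have "\<dots> \<le> p2 (q / r) * ((p2 1 * GH 1 (q / r) + cHU) * (local_const x + global_const \<tau> x) * N epowr (q / p))"
    by (intro mult_left_mono) (auto simp: distrib_left distrib_right ac_simps intro!: add_mono)
  also have "\<dots> \<le> p2 (q / r) * ((p2 1 * GH 1 (q / r) + cHU) * (local_const x + global_const \<tau> x) * (p2 2 * R f) epowr (q / p))"
    using N p q by (intro mult_left_mono epowr_mono) auto
  also have "\<dots> = cS * (local_const x + global_const \<tau> x) * R f epowr (q / p)"
    unfolding cS_def using p q by (simp add: epowr_mult p2_epowr ac_simps)
  finally show ?thesis .
qed

subsection \<open>Comparison of the discrete and continuous constants\<close>

lemma dual_eq:
  assumes "0 < s" "s < p"
  shows "dual (s / p) I X = isum I (\<lambda>i. X i epowr (p / (p - s))) epowr ((p - s) / p)"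
proof -
  have "1 / (1 - s / p) = p / (p - s)" "1 - s / p = (p - s) / p"
    using assms by (auto simp: field_simps)
  then show ?thesis using assms by (simp add: dual_def)
qed

definition TT :: "real \<Rightarrow> ennreal" where
  "TT z = integ a z (\<lambda>t. integ t b w epowr (- (p / (p - r))) * w t * V r v t z epowr (p * r / (p - r)))"

lemma TT_mono:
  assumes rp: "r < p" and y: "y \<le> z" "ereal z \<le> b"
  shows "TT y \<le> TT z"
proof -
  have "TT y \<le> integ a y (\<lambda>t. integ t b w epowr (- (p / (p - r))) * w t * V r v t z epowr (p * r / (p - r)))"
    unfolding TT_def using rp p r y
    by (intro integ_mono mult_left_mono epowr_mono V_mono) (auto simp: einterval_iff)
  also have "\<dots> \<le> TT z" unfolding TT_def using y by (intro integ_subset) auto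
  finally show ?thesis .
qed

text \<open>Up to the factor (p-q)/p, minus the derivative of the tail of u to the power
  p/(p-q).\<close>

definition Phi :: "real \<Rightarrow> ennreal" where
  "Phi t = integ t b u epowr (q / (p - q)) * u t"

text \<open>\<open>J4\<close>, \<open>J57\<close> and \<open>J6\<close> are the outer integrals of
  C4, of C5 and C7, and of C6 before the final power is taken, written with suprema. That the
  essential suprema agree with these is proved separately, by semicontinuity.\<close>

definition J4 :: ennreal where
  "J4 = integ a b (\<lambda>x. integ x b u epowr (q / (p - q)) * u x *
      (SUP t\<in>einterval a x. integ t b w epowr (- (q / (p - q))) * V r v t x epowr (p * q / (p - q))))"

definition J57 :: ennreal where
  "J57 = integ a b (\<lambda>x. w x *
      (SUP y\<in>einterval a x. integ y b w epowr (- (p / (p - q))) * E y x epowr (p * q / (p - q))))"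

definition J6 :: ennreal where
  "J6 = integ a b (\<lambda>x. w x *
      (SUP y\<in>einterval a x. integ y b w epowr (- 1) * integ y x Phi * TT y epowr (q * (p - r) / (r * (p - q)))))"

lemma Phi_measurable [measurable]: "Phi \<in> borel_measurable L"
proof -
  have "(\<lambda>t. integ t b u) \<in> borel_measurable L"
    by (rule antimono_measurable) (auto intro: integ_subset)
  then show ?thesis unfolding Phi_def by measurable
qed

text \<open>With this exponent a power of \<open>Theta\<close> becomes a plain sum over the level,
  see \<open>Theta_eq\<close>.\<close>

definition beta :: "(int \<Rightarrow> real) \<Rightarrow> int \<Rightarrow> ennreal" where
  "beta x i = vv x i epowr (p * r / (p - r))"

definition cT :: ennreal where "cT = p2 (2 * (p / (p - r)))"

text \<open>The factors are those of \<open>level_sum_le\<close>, of \<open>beta_sum_le\<close>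
  after taking the outer power, and of the final shift by one block of w.\<close>

definition c6 :: ennreal where
  "c6 = p2 (2 * (p / (p - q))) * (cT epowr (q * (p - r) / (r * (p - q))) * p2 3)"

lemma Theta_eq:
  assumes rp: "r < p"
  shows "Theta \<tau> x j epowr (q / r) = isum (levels \<tau> x j) (beta x) epowr (q * (p - r) / (p * r))"
proof -
  have "(vv x i epowr r) epowr (p / (p - r)) = beta x i" for i
    by (simp add: beta_def epowr_epowr mult.commute)
  then show ?thesis
    unfolding Theta_def dual_eq[OF r(1) rp] using p r by (simp add: epowr_epowr field_simps)
qed

end

text \<open>Because a' > a, every x k, even one equal to a', is an admissible point in the suprema
  over (a, b), and both tails are finite there.\<close>

locale dyadic_pair = three_weights +
  fixes a' :: real and x \<tau> :: "int \<Rightarrow> real"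
  assumes a': "a < a'" "ereal a' < b"
    and dx: "dyadic w a' b x" and dt: "dyadic u a' b \<tau>"
begin

lemmas px = dyadicD(1)[OF dx] and pt = dyadicD(1)[OF dt]

lemma a'_le: "a \<le> a'" "b \<le> b" "ereal a \<le> ereal a'" using a' by auto

lemma x_bounds: "a < x k" "ereal (x k) < b" "a' \<le> x k" "x k \<le> x (k + 1)" "ereal a \<le> x k" "ereal (x k) \<le> b"
  using partition_bounds[OF px, of k] a' by auto

lemma t_bounds: "a < \<tau> k" "ereal (\<tau> k) < b" "a' \<le> \<tau> k" "\<tau> k \<le> \<tau> (k + 1)" "ereal a \<le> \<tau> k" "ereal (\<tau> k) \<le> b"
  using partition_bounds[OF pt, of k] a' by auto

lemma W_power_ge:
  assumes "integ t b w \<le> p2 (1 - real_of_int i)" "0 \<le> e"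
  shows "p2 ((real_of_int i - 1) * e) \<le> integ t b w epowr (- e)"
proof -
  have "p2 (1 - real_of_int i) epowr (- e) \<le> integ t b w epowr (- e)"
    using assms by (intro epowr_antimono) auto
  then show ?thesis by (simp add: p2_epowr algebra_simps)
qed

lemma vv_empty: "\<not> x i < x (i + 1) \<Longrightarrow> vv x i = 0"
  using V_empty[of "x (i + 1)" "x i"] by (simp add: vv_def)

lemma local_const_le_sup:
  assumes pq: "p \<le> q"
    and K: "\<And>y. a < y \<Longrightarrow> ereal y < b \<Longrightarrow> integ y b w epowr (- (1 / p)) * E y b \<le> K"
  shows "local_const x \<le> p2 (q / p) * K epowr q"
proof -
  have "ee x k epowr q \<le> p2 (q / p) * K epowr q" for k
  proof -
    have "ee x k \<le> p2 (real_of_int k / p) * E (x k) b"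
      unfolding ee_def using x_bounds by (intro mult_left_mono E_mono) auto
    also have "real_of_int k / p = 1 / p + (real_of_int k - 1) * (1 / p)"
      using p by (simp add: field_simps)
    also have "p2 (1 / p + (real_of_int k - 1) * (1 / p)) * E (x k) b = p2 (1 / p) * (p2 ((real_of_int k - 1) * (1 / p)) * E (x k) b)"
      by (simp only: p2_add_left)
    also have "\<dots> \<le> p2 (1 / p) * (integ (x k) b w epowr (- (1 / p)) * E (x k) b)"
      using p dyadicD(3)[OF dx, of k] by (intro mult_left_mono mult_right_mono W_power_ge) auto
    also have "\<dots> \<le> p2 (1 / p) * K"
      using x_bounds by (intro mult_left_mono K) auto
    finally have "ee x k epowr q \<le> (p2 (1 / p) * K) epowr q"
      using q by (intro epowr_mono) auto
    then show ?thesis using q by (simp add: epowr_mult p2_epowr)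
  qed
  then show ?thesis
    unfolding local_const_def dual_def using pq p by (auto intro!: SUP_least)
qed

text \<open>The pointwise condition with y and t the two ends of block i. The tail of u at the right
  end is at least 2^(-j-1), because the block ends in level j.\<close>

lemma vv_level_le:
  assumes K1: "\<And>y t. a < y \<Longrightarrow> y < t \<Longrightarrow> ereal t < b \<Longrightarrow> integ t b u * V r v y t epowr q \<le> K1 * integ y b w epowr (q / p)"
    and i: "i \<in> levels \<tau> x j"
  shows "p2 (- real_of_int j) * vv x i epowr q \<le> p2 (1 + q / p) * K1"
proof (cases "x i < x (i + 1)")
  case True
  let ?V = "V r v (x i) (x (i + 1)) epowr q"
  have "p2 (- real_of_int j - 1) \<le> integ (x (i + 1)) b u"
    using i dyadic_block(1)[OF dt, of j "x (i + 1)"] by (simp add: levels_def)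
  then have "p2 (- real_of_int j - 1) * ?V \<le> integ (x (i + 1)) b u * ?V"
    by (rule mult_right_mono) simp
  also have "\<dots> \<le> K1 * integ (x i) b w epowr (q / p)"
    using x_bounds True by (intro K1) auto
  also have "\<dots> \<le> K1 * p2 (1 - real_of_int i) epowr (q / p)"
    using p q dyadicD(3)[OF dx, of i] by (intro mult_left_mono epowr_mono) auto
  finally have *: "p2 (- real_of_int j - 1) * ?V \<le> K1 * p2 ((1 - real_of_int i) * (q / p))"
    by (simp add: p2_epowr)
  have "p2 (- real_of_int j) * vv x i epowr q = p2 (1 + real_of_int i / p * q) * (p2 (- real_of_int j - 1) * ?V)"
    using q by (simp add: vv_def epowr_mult p2_epowr p2_add_left algebra_simps)
  also have "\<dots> \<le> p2 (1 + real_of_int i / p * q) * (K1 * p2 ((1 - real_of_int i) * (q / p)))"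
    by (rule mult_left_mono[OF *]) simp
  also have "\<dots> = (p2 (1 + real_of_int i / p * q) * p2 ((1 - real_of_int i) * (q / p))) * K1"
    by (simp only: ac_simps)
  also have "p2 (1 + real_of_int i / p * q) * p2 ((1 - real_of_int i) * (q / p)) = p2 (1 + q / p)"
    unfolding p2_add using p by (simp add: field_simps)
  finally show ?thesis .
qed (use vv_empty q in simp)

lemma p2_shift_le: "p2 (- real_of_int j) * y \<le> M \<longleftrightarrow> y \<le> p2 (real_of_int j) * M"
proof
  assume "p2 (- real_of_int j) * y \<le> M"
  then have "p2 (real_of_int j) * (p2 (- real_of_int j) * y) \<le> p2 (real_of_int j) * M" by (rule mult_left_mono) simp
  then show "y \<le> p2 (real_of_int j) * M" by (simp add: p2_add_left)
next
  assume "y \<le> p2 (real_of_int j) * M"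
  then have "p2 (- real_of_int j) * y \<le> p2 (- real_of_int j) * (p2 (real_of_int j) * M)" by (rule mult_left_mono) simp
  then show "p2 (- real_of_int j) * y \<le> M" by (simp add: p2_add_left)
qed

lemma global_const_le_sup:
  assumes pq: "p \<le> q" "p \<le> r"
    and K1: "\<And>y t. a < y \<Longrightarrow> y < t \<Longrightarrow> ereal t < b \<Longrightarrow> integ t b u * V r v y t epowr q \<le> K1 * integ y b w epowr (q / p)"
  shows "global_const \<tau> x \<le> p2 (1 + q / p) * K1"
proof -
  let ?M = "p2 (1 + q / p) * K1"
  have "p2 (- real_of_int j) * Theta \<tau> x j epowr (q / r) \<le> ?M" for j
  proof -
    have "Theta \<tau> x j \<le> (p2 (real_of_int j) * ?M) epowr (r / q)"
      unfolding Theta_def dual_def using pq p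
    proof (auto intro!: SUP_least)
      fix i assume "i \<in> levels \<tau> x j"
      then have "vv x i epowr q \<le> p2 (real_of_int j) * ?M"
        using vv_level_le[OF K1, of i j] by (simp only: p2_shift_le)
      then have "(vv x i epowr q) epowr (r / q) \<le> (p2 (real_of_int j) * ?M) epowr (r / q)"
        using q r by (intro epowr_mono) auto
      then show "vv x i epowr r \<le> (p2 (real_of_int j) * ?M) epowr (r / q)"
        using q by (simp add: epowr_epowr)
    qed
    then have "Theta \<tau> x j epowr (q / r) \<le> ((p2 (real_of_int j) * ?M) epowr (r / q)) epowr (q / r)"
      using q r by (intro epowr_mono) auto
    then show ?thesis
      using q r by (simp only: p2_shift_le epowr_epowr) simp
  qed
  then show ?thesis
    unfolding global_const_def dual_def using pq p by (auto intro!: SUP_least)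
qed

text \<open>At most one index. Its block has no predecessor in (a', b) to which it could be charged,
  so it escapes the estimate by \<open>TT\<close> and is bounded by the pointwise condition.\<close>

definition first :: "int set" where
  "first = {i. x i = a' \<and> a' < x (i + 1)}"

lemma first_unique: "i \<in> first \<Longrightarrow> j \<in> first \<Longrightarrow> i = j"
  using partition_mono[OF px, of "i + 1" j] partition_mono[OF px, of "j + 1" i]
  by (cases i j rule: linorder_cases) (auto simp: first_def)

text \<open>Otherwise x k = x (k + 1) > a' would have the two tails 2^-k and 2^(-k-1).\<close>

lemma previous_nonempty:
  assumes "x k' < x (k' + 1)" "k' = k + 1" "k' \<notin> first"
  shows "x k < x (k + 1)"
proof (rule ccontr)
  assume "\<not> ?thesis"
  then have eq: "x k = x (k + 1)" using x_bounds(4)[of k] by simp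
  have "a' < x (k + 1)"
    using assms x_bounds(3)[of "k + 1"] by (auto simp: first_def)
  then have "integ (x k) b w = p2 (- k)" "integ (x (k + 1)) b w = p2 (- (k + 1))"
    using dyadicD(2)[OF dx, of k] dyadicD(2)[OF dx, of "k + 1"] eq by auto
  then have "p2 (- k) = p2 (- (k + 1))" using eq by metis
  then show False by simp
qed

text \<open>Block k + 1 is charged to the w-mass of block k: for t in block k, V r v t z contains V
  over block k + 1, which ends no later than z. The index shift, together with the bound 2^(1-k) for
  the tail of w on block k, accounts for \<open>cT\<close>.\<close>

lemma beta_sum_le:
  assumes rp: "r < p" and z: "ereal z < b" and I: "\<And>i. i \<in> I \<Longrightarrow> x (i + 1) \<le> z"
  shows "isum (I - first) (beta x) \<le> cT * TT z"
proof -
  let ?e = "p / (p - r)" and ?t = "p * r / (p - r)"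
  have e: "0 < ?e" "0 < ?t" "?t / p = ?e - 1" using rp p r by (auto simp: field_simps)
  let ?H = "\<lambda>k. (if k + 1 \<in> I then p2 ((real_of_int k - 1) * ?e) * V r v (x (k + 1)) (x (k + 2)) epowr ?t else 0)"
  let ?h = "\<lambda>t. integ t b w epowr (- ?e) * w t * V r v t z epowr ?t"
  have "isum (I - first) (beta x) = isum UNIV (\<lambda>k. beta x (k + 1) * indicator (I - first) (k + 1))"
    unfolding isum_restrict[of "I - first"] isum_shift[of "\<lambda>k. beta x k * indicator (I - first) k" 1] ..
  also have "\<dots> \<le> isum UNIV (\<lambda>k. cT * (?H k * integ (x k) (x (k + 1)) w))"
  proof (rule isum_mono)
    fix k
    show "beta x (k + 1) * indicator (I - first) (k + 1) \<le> cT * (?H k * integ (x k) (x (k + 1)) w)"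
    proof (cases "k + 1 \<in> I - first \<and> x (k + 1) < x (k + 2)")
      case True
      then have ne: "x k < x (k + 1)"
        by (intro previous_nonempty[of "k + 1" k]) (auto simp: add.assoc)
      have "beta x (k + 1) = p2 ((real_of_int k + 1) * (?e - 1)) * V r v (x (k + 1)) (x (k + 2)) epowr ?t"
        unfolding beta_def vv_def e(3)[symmetric]
        using e(2) by (simp add: epowr_mult p2_epowr add.assoc mult.commute)
      also have "(real_of_int k + 1) * (?e - 1) = 2 * ?e + (real_of_int k - 1) * ?e + (- real_of_int k - 1)"
      proof -
        have "(real_of_int k + 1) * (S - 1) = 2 * S + (real_of_int k - 1) * S + (- real_of_int k - 1)" for S :: real
          by (simp add: algebra_simps)
        then show ?thesis .
      qed
      also have "p2 (2 * ?e + (real_of_int k - 1) * ?e + (- real_of_int k - 1)) * V r v (x (k + 1)) (x (k + 2)) epowr ?t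
        = cT * (?H k * p2 (- real_of_int k - 1))"
        using True unfolding cT_def by (simp only: p2_add[symmetric] ac_simps if_True Diff_iff)
      also have "\<dots> \<le> cT * (?H k * integ (x k) (x (k + 1)) w)"
        using dyadicD(4)[OF dx ne] by (intro mult_left_mono) auto
      finally show ?thesis using True by simp
    next
      case False
      then have "beta x (k + 1) * indicator (I - first) (k + 1) = 0"
        using vv_empty[of "k + 1"] e(2) by (auto simp: beta_def add.assoc split: split_indicator)
      then show ?thesis by (metis zero_le)
    qed
  qed
  also have "\<dots> = cT * isum UNIV (\<lambda>k. ?H k * integ (x k) (x (k + 1)) w)" by (rule isum_cmult)
  also have "\<dots> \<le> cT * integ a' b (\<lambda>t. ?h t * indicator {..<z} t)"
  proof (intro mult_left_mono partition_lower[OF px a'_le(1,2) w])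
    fix k t assume t: "x k < t" "t < x (k + 1)"
    show "?H k * w t \<le> ?h t * indicator {..<z} t"
    proof (cases "k + 1 \<in> I")
      case True
      have "x (k + 2) \<le> z" using I[OF True] by (simp add: add.assoc)
      moreover have "x (k + 1) \<le> x (k + 2)" by (rule partition_mono[OF px]) simp
      ultimately have tz: "t < z" using t by simp
      have "p2 ((real_of_int k - 1) * ?e) \<le> integ t b w epowr (- ?e)"
        using e dyadic_block(2)[OF dx, of k t] t by (intro W_power_ge) auto
      moreover have "V r v (x (k + 1)) (x (k + 2)) \<le> V r v t z"
        using t tz z \<open>x (k + 2) \<le> z\<close> x_bounds(1)[of k] by (intro V_mono) auto
      ultimately have "?H k * w t \<le> integ t b w epowr (- ?e) * V r v t z epowr ?t * w t"
        using True e by (auto intro!: mult_right_mono mult_mono epowr_mono)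
      then show ?thesis using tz by (simp add: ac_simps)
    qed simp
  qed simp
  also have "\<dots> \<le> cT * TT z"
    unfolding TT_def using a' z
    by (intro mult_left_mono nn_integral_mono) (auto simp: einterval_iff split: split_indicator)
  finally show ?thesis .
qed

lemma Theta_split:
  assumes rp: "r < p"
  defines "e2 \<equiv> q * (p - r) / (p * r)"
  shows "Theta \<tau> x j epowr (q / r) \<le> p2 e2 *
    (isum (levels \<tau> x j \<inter> first) (beta x) epowr e2 + isum (levels \<tau> x j - first) (beta x) epowr e2)"
proof -
  have "isum (levels \<tau> x j) (beta x) = isum (levels \<tau> x j \<inter> first) (beta x) + isum (levels \<tau> x j - first) (beta x)"
    unfolding isum_restrict[of "levels \<tau> x j"] isum_restrict[of "levels \<tau> x j \<inter> first"]
      isum_restrict[of "levels \<tau> x j - first"] isum_add[symmetric]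
    by (intro isum_cong) (auto split: split_indicator)
  then show ?thesis
    unfolding Theta_eq[OF rp] e2_def[symmetric] using rp p q r
    by (simp add: epowr_sum_le_p2 e2_def)
qed

lemma first_level_le:
  assumes rp: "r < p"
    and K1: "\<And>y t. a < y \<Longrightarrow> y < t \<Longrightarrow> ereal t < b \<Longrightarrow> integ t b u * V r v y t epowr q \<le> K1 * integ y b w epowr (q / p)"
  shows "p2 (- real_of_int j) * isum (levels \<tau> x j \<inter> first) (beta x) epowr (q * (p - r) / (p * r)) \<le> p2 (1 + q / p) * K1"
proof -
  let ?e = "q * (p - r) / (p * r)" and ?M = "p2 (real_of_int j) * (p2 (1 + q / p) * K1)"
  have e: "0 < ?e" "p * r / (p - r) * ?e = q" using rp p q r by (auto simp: field_simps)
  have "isum (levels \<tau> x j \<inter> first) (beta x) \<le> ?M epowr (1 / ?e)"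
  proof (rule isum_single_le)
    fix i assume i: "i \<in> levels \<tau> x j \<inter> first"
    then have "vv x i epowr q \<le> ?M"
      using vv_level_le[OF K1, of i j] by (simp only: p2_shift_le Int_iff)
    then have "beta x i epowr ?e \<le> ?M"
      unfolding beta_def epowr_epowr e(2) .
    then show "beta x i \<le> ?M epowr (1 / ?e)"
      by (rule epowr_le_iff[OF e(1), THEN iffD1])
  qed (use first_unique in blast)
  then have "isum (levels \<tau> x j \<inter> first) (beta x) epowr ?e \<le> ?M"
    by (rule epowr_le_iff[OF e(1), THEN iffD2])
  then show ?thesis by (simp only: p2_shift_le)
qed

lemma levels_empty: "\<not> \<tau> j < \<tau> (j + 1) \<Longrightarrow> levels \<tau> x j = {}"
  by (auto simp: levels_def)

lemma global_const_le_C3: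
  assumes pq: "p \<le> q" and rp: "r < p"
    and K1: "\<And>y t. a < y \<Longrightarrow> y < t \<Longrightarrow> ereal t < b \<Longrightarrow> integ t b u * V r v y t epowr q \<le> K1 * integ y b w epowr (q / p)"
    and K3: "\<And>z. a < z \<Longrightarrow> ereal z < b \<Longrightarrow> integ z b u * TT z epowr (q * (p - r) / (p * r)) \<le> K3"
  defines "e2 \<equiv> q * (p - r) / (p * r)"
  shows "global_const \<tau> x \<le> p2 e2 * (p2 (1 + q / p) * K1 + p2 1 * cT epowr e2 * K3)"
proof -
  have e2: "0 \<le> e2" using rp p q r by (simp add: e2_def)
  have "p2 (- real_of_int j) * Theta \<tau> x j epowr (q / r) \<le> p2 e2 * (p2 (1 + q / p) * K1 + p2 1 * cT epowr e2 * K3)" for j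
  proof -
    have 2: "p2 (- real_of_int j) * isum (levels \<tau> x j - first) (beta x) epowr e2 \<le> p2 1 * cT epowr e2 * K3"
    proof (cases "\<tau> j < \<tau> (j + 1)")
      case True
      have "isum (levels \<tau> x j - first) (beta x) \<le> cT * TT (\<tau> (j + 1))"
        using t_bounds by (intro beta_sum_le rp) (auto simp: levels_def)
      then have "isum (levels \<tau> x j - first) (beta x) epowr e2 \<le> cT epowr e2 * TT (\<tau> (j + 1)) epowr e2"
        using epowr_mono[OF _ e2] e2 by (fastforce simp: epowr_mult)
      then have "p2 (- real_of_int j) * isum (levels \<tau> x j - first) (beta x) epowr e2
        \<le> p2 (- real_of_int j) * (cT epowr e2 * TT (\<tau> (j + 1)) epowr e2)" by (rule mult_left_mono) simp
      also have "\<dots> = p2 1 * cT epowr e2 * (p2 (- real_of_int j - 1) * TT (\<tau> (j + 1)) epowr e2)"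
      proof -
        have "p2 (- real_of_int j) = p2 1 * p2 (- real_of_int j - 1)" by (simp add: p2_add)
        then show ?thesis by (simp only: ac_simps)
      qed
      also have "p2 (- real_of_int j - 1) = integ (\<tau> (j + 1)) b u"
        using dyadic_next(2)[OF dt True] by simp
      also have "p2 1 * cT epowr e2 * (integ (\<tau> (j + 1)) b u * TT (\<tau> (j + 1)) epowr e2) \<le> p2 1 * cT epowr e2 * K3"
        unfolding e2_def using t_bounds by (intro mult_left_mono K3) auto
      finally show ?thesis .
    next
      case False
      have "0 < e2" using rp p q r by (simp add: e2_def)
      then show ?thesis using levels_empty[OF False] by (simp add: nn_integral_empty)
    qed
    have "p2 (- real_of_int j) * Theta \<tau> x j epowr (q / r) \<le> p2 (- real_of_int j) * (p2 e2 *
      (isum (levels \<tau> x j \<inter> first) (beta x) epowr e2 + isum (levels \<tau> x j - first) (beta x) epowr e2))"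
      unfolding e2_def by (intro mult_left_mono Theta_split rp) simp
    also have "\<dots> = p2 e2 * (p2 (- real_of_int j) * isum (levels \<tau> x j \<inter> first) (beta x) epowr e2
      + p2 (- real_of_int j) * isum (levels \<tau> x j - first) (beta x) epowr e2)"
      by (simp only: distrib_left ac_simps)
    also have "\<dots> \<le> p2 e2 * (p2 (1 + q / p) * K1 + p2 1 * cT epowr e2 * K3)"
      using first_level_le[OF rp K1, of j] 2 by (intro mult_left_mono add_mono) (auto simp: e2_def)
    finally show ?thesis .
  qed
  then show ?thesis
    unfolding global_const_def dual_def using pq p by (auto intro!: SUP_least)
qed

text \<open>Block k is charged to the w-mass of block k + 1: for t there, y = x k is admissible in
  the supremum, and E from x k to t is at least E over block k.\<close>

lemma local_const_le_J57:
  assumes qp: "q < p"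
  shows "local_const x \<le> (p2 (2 * (p / (p - q)) + 1) * J57) epowr ((p - q) / p)"
proof -
  let ?k = "p / (p - q)" and ?s = "p * q / (p - q)"
  have k: "0 < ?k" "0 < ?s" "?s / p = ?k - 1" "q * ?k = ?s" using qp p q by (auto simp: field_simps)
  let ?H = "\<lambda>k::int. p2 ((real_of_int k - 2) * ?k) * E (x (k - 1)) (x k) epowr ?s"
  have "isum UNIV (\<lambda>k. (ee x k epowr q) epowr ?k) \<le> isum UNIV (\<lambda>k. p2 (2 * ?k + 1) * (?H (k + 1) * integ (x (k + 1)) (x (k + 1 + 1)) w))"
  proof (rule isum_mono)
    fix k
    show "(ee x k epowr q) epowr ?k \<le> p2 (2 * ?k + 1) * (?H (k + 1) * integ (x (k + 1)) (x (k + 1 + 1)) w)"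
    proof (cases "x k < x (k + 1)")
      case True
      have "(ee x k epowr q) epowr ?k = p2 (real_of_int k * (?k - 1)) * E (x k) (x (k + 1)) epowr ?s"
        unfolding epowr_epowr k(4) ee_def k(3)[symmetric] using k(2) by (simp add: epowr_mult p2_epowr)
      also have "\<dots> \<le> p2 (2 * ?k + 1 + (real_of_int k - 1) * ?k + (- real_of_int k - 2)) * E (x k) (x (k + 1)) epowr ?s"
      proof -
        have "real_of_int k * (S - 1) \<le> 2 * S + 1 + (real_of_int k - 1) * S + (- real_of_int k - 2)" if "1 \<le> S" for S :: real
          using that by (simp add: algebra_simps)
        moreover have "1 \<le> ?k" using qp p q by (simp add: field_simps)
        ultimately have "real_of_int k * (?k - 1) \<le> 2 * ?k + 1 + (real_of_int k - 1) * ?k + (- real_of_int k - 2)"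
          by blast
        then show ?thesis by (intro mult_right_mono) (simp_all only: p2_le_iff zero_le)
      qed
      also have "\<dots> = p2 (2 * ?k + 1) * ((p2 ((real_of_int k - 1) * ?k) * E (x k) (x (k + 1)) epowr ?s) * p2 (- real_of_int k - 2))"
        by (simp only: p2_add[symmetric] ac_simps)
      also have "\<dots> \<le> p2 (2 * ?k + 1) * ((p2 ((real_of_int k - 1) * ?k) * E (x k) (x (k + 1)) epowr ?s) * integ (x (k + 1)) (x (k + 2)) w)"
        using dyadic_next(4)[OF dx True] by (intro mult_left_mono) auto
      finally show ?thesis by (simp add: add.assoc)
    next
      case False
      then have "E (x k) (x (k + 1)) = 0" by (intro E_empty) simp
      then show ?thesis using q k(1) by (simp add: ee_def)
    qed
  qed
  also have "\<dots> = p2 (2 * ?k + 1) * isum UNIV (\<lambda>k. ?H k * integ (x k) (x (k + 1)) w)"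
    unfolding isum_cmult isum_shift[of "\<lambda>k. ?H k * integ (x k) (x (k + 1)) w" 1] ..
  also have "\<dots> \<le> p2 (2 * ?k + 1) * integ a' b (\<lambda>x. w x * (SUP y\<in>einterval a x. integ y b w epowr (- ?k) * E y x epowr ?s))"
  proof (intro mult_left_mono partition_lower[OF px a'_le(1,2) w])
    fix k t assume t: "x k < t" "t < x (k + 1)"
    have *: "x (k - 1) \<le> x k" by (rule partition_mono[OF px]) simp
    have "p2 ((real_of_int k - 2) * ?k) \<le> integ (x (k - 1)) b w epowr (- ?k)"
      using k(1) dyadicD(3)[OF dx, of "k - 1"] W_power_ge[of "x (k - 1)" "k - 1" ?k] by simp
    moreover have "E (x (k - 1)) (x k) \<le> E (x (k - 1)) t"
      using t x_bounds(2)[of "k + 1"] x_bounds(5) by (intro E_mono) (auto intro: ereal_real_trans(4)[OF _ less_imp_le] less_imp_le)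
    ultimately have "?H k \<le> integ (x (k - 1)) b w epowr (- ?k) * E (x (k - 1)) t epowr ?s"
      using k(2) by (intro mult_mono epowr_mono) auto
    also have "\<dots> \<le> (SUP y\<in>einterval a t. integ y b w epowr (- ?k) * E y t epowr ?s)"
      using t * x_bounds(1)[of "k - 1"] by (intro SUP_upper) (auto simp: einterval_iff)
    finally have "?H k * w t \<le> (SUP y\<in>einterval a t. integ y b w epowr (- ?k) * E y t epowr ?s) * w t"
      by (rule mult_right_mono) simp
    then show "?H k * w t \<le> w t * (SUP y\<in>einterval a t. integ y b w epowr (- ?k) * E y t epowr ?s)"
      by (simp only: mult.commute)
  qed simp
  also have "\<dots> \<le> p2 (2 * ?k + 1) * J57"
    unfolding J57_def using a'_le by (intro mult_left_mono integ_subset) auto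
  finally show ?thesis
    unfolding local_const_def dual_eq[OF q qp] using qp p by (intro epowr_mono) auto
qed

text \<open>Since p/(p-q) = q/(p-q) + 1, the weight of level j is a power of the tail of u times a
  mass of u, that is, comparable with the integral of \<open>Phi\<close> over block j + 1. That
  block lies to the right of every block of w in level j, so S has to dominate X j only
  there.\<close>

lemma level_sum_le:
  assumes qp: "q < p"
    and S: "\<And>j t. \<tau> (j + 1) < t \<Longrightarrow> t < \<tau> (j + 2) \<Longrightarrow> X j \<le> S t"
    and X0: "\<And>j. \<not> \<tau> j < \<tau> (j + 1) \<Longrightarrow> X j = 0"
  shows "isum UNIV (\<lambda>j. p2 (- real_of_int j * (p / (p - q))) * X j) \<le> p2 (2 * (p / (p - q))) * integ a' b (\<lambda>t. Phi t * S t)"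
proof -
  let ?k = "p / (p - q)" and ?e = "q / (p - q)"
  have k: "0 < ?k" "0 < ?e" "?k = ?e + 1" using qp p q by (auto simp: field_simps)
  let ?H = "\<lambda>k::int. p2 ((- real_of_int k - 1) * ?e) * X (k - 1)"
  have "isum UNIV (\<lambda>j. p2 (- real_of_int j * ?k) * X j)
    \<le> isum UNIV (\<lambda>j. p2 (2 * ?k) * (?H (j + 1) * integ (\<tau> (j + 1)) (\<tau> (j + 1 + 1)) u))"
  proof (rule isum_mono)
    fix j
    show "p2 (- real_of_int j * ?k) * X j \<le> p2 (2 * ?k) * (?H (j + 1) * integ (\<tau> (j + 1)) (\<tau> (j + 1 + 1)) u)"
    proof (cases "\<tau> j < \<tau> (j + 1)")
      case True
      have "- real_of_int j * ?k = 2 * ?k + (- real_of_int (j + 1) - 1) * ?e + (- real_of_int j - 2)"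
      proof -
        have "- real_of_int j * (S + 1) = 2 * (S + 1) + (- real_of_int (j + 1) - 1) * S + (- real_of_int j - 2)" for S :: real
          by (simp add: algebra_simps)
        then show ?thesis unfolding k(3) .
      qed
      then have "p2 (- real_of_int j * ?k) * X j = p2 (2 * ?k + (- real_of_int (j + 1) - 1) * ?e + (- real_of_int j - 2)) * X j"
        by (simp only:)
      also have "\<dots> = p2 (2 * ?k) * (?H (j + 1) * p2 (- real_of_int j - 2))"
        by (simp only: p2_add[symmetric] ac_simps add_diff_cancel_right' add_diff_cancel_left')
      also have "\<dots> \<le> p2 (2 * ?k) * (?H (j + 1) * integ (\<tau> (j + 1)) (\<tau> (j + 1 + 1)) u)"
        using dyadic_next(4)[OF dt True] by (intro mult_left_mono) (auto simp: add.assoc)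
      finally show ?thesis .
    qed (use X0 in simp)
  qed
  also have "\<dots> = p2 (2 * ?k) * isum UNIV (\<lambda>k. ?H k * integ (\<tau> k) (\<tau> (k + 1)) u)"
    unfolding isum_cmult isum_shift[of "\<lambda>k. ?H k * integ (\<tau> k) (\<tau> (k + 1)) u" 1] ..
  also have "\<dots> \<le> p2 (2 * ?k) * integ a' b (\<lambda>t. Phi t * S t)"
  proof (intro mult_left_mono partition_lower[OF pt a'_le(1,2) u])
    fix k t assume t: "\<tau> k < t" "t < \<tau> (k + 1)"
    have "p2 ((- real_of_int k - 1) * ?e) = p2 (- real_of_int k - 1) epowr ?e" by (simp add: p2_epowr)
    also have "\<dots> \<le> integ t b u epowr ?e"
      using k(2) t dyadic_block(1)[OF dt, of k t] by (intro epowr_mono) auto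
    finally have "p2 ((- real_of_int k - 1) * ?e) \<le> integ t b u epowr ?e" .
    moreover have "X (k - 1) \<le> S t"
      using S[of "k - 1" t] t by (simp add: add.commute)
    ultimately have "?H k * u t \<le> integ t b u epowr ?e * S t * u t"
      by (intro mult_right_mono mult_mono) auto
    then show "?H k * u t \<le> Phi t * S t" by (simp add: Phi_def ac_simps)
  qed simp
  finally show ?thesis .
qed

text \<open>\<open>Theta\<close> is a supremum because p <= r. A block i of level j ends to the left
  of every t in block j + 1 of u, so y = x i is admissible in the supremum in \<open>J4\<close>, and
  V from x i to t is at least V over block i.\<close>

lemma global_const_le_J4:
  assumes qp: "q < p" and pr: "p \<le> r"
  shows "global_const \<tau> x \<le> (p2 (2 * (p / (p - q)) + q / (p - q)) * J4) epowr ((p - q) / p)"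
proof -
  let ?k = "p / (p - q)" and ?e = "q / (p - q)" and ?s = "p * q / (p - q)"
  have k: "0 < ?k" "0 < ?e" "0 < ?s" "?s / p = ?e" using qp p q by (auto simp: field_simps)
  define S where "S t = (SUP y\<in>einterval a t. integ y b w epowr (- ?e) * V r v y (ereal t) epowr ?s)" for t :: real
  define X where "X j = Theta \<tau> x j epowr (?s / r)" for j
  have "isum UNIV (\<lambda>j. (p2 (- real_of_int j) * Theta \<tau> x j epowr (q / r)) epowr ?k)
    = isum UNIV (\<lambda>j. p2 (- real_of_int j * ?k) * X j)"
    unfolding X_def using k(1) by (intro isum_cong) (simp add: epowr_mult p2_epowr epowr_epowr mult.commute)
  also have "\<dots> \<le> p2 (2 * ?k) * integ a' b (\<lambda>t. Phi t * (p2 ?e * S t))"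
  proof (rule level_sum_le[OF qp])
    fix j t assume t: "\<tau> (j + 1) < t" "t < \<tau> (j + 2)"
    have "Theta \<tau> x j = (SUP i\<in>levels \<tau> x j. vv x i epowr r)"
      using pr p by (simp add: Theta_def dual_def)
    also have "\<dots> \<le> (p2 ?e * S t) epowr (r / ?s)"
    proof (rule SUP_least)
      fix i assume i: "i \<in> levels \<tau> x j"
      then have xt: "x (i + 1) < t" using t by (auto simp: levels_def)
      have "ereal t \<le> b" using t t_bounds(2)[of "j + 2"] by (meson ereal_real_trans(3) less_imp_le)
      then have V: "V r v (x i) (x (i + 1)) \<le> V r v (x i) t"
        using xt x_bounds by (intro V_mono) auto
      have "vv x i epowr ?s = p2 (real_of_int i * ?e) * V r v (x i) (x (i + 1)) epowr ?s"
        unfolding vv_def k(4)[symmetric] using k(3) by (simp add: epowr_mult p2_epowr)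
      also have "real_of_int i * ?e = ?e + (real_of_int i - 1) * ?e"
      proof -
        have "real_of_int i * S = S + (real_of_int i - 1) * S" for S :: real by (simp add: algebra_simps)
        then show ?thesis .
      qed
      also have "p2 (?e + (real_of_int i - 1) * ?e) * V r v (x i) (x (i + 1)) epowr ?s
        = p2 ?e * (p2 ((real_of_int i - 1) * ?e) * V r v (x i) (x (i + 1)) epowr ?s)"
        by (simp only: p2_add_left)
      also have "\<dots> \<le> p2 ?e * (integ (x i) b w epowr (- ?e) * V r v (x i) t epowr ?s)"
        using k V dyadicD(3)[OF dx, of i] by (intro mult_left_mono mult_mono epowr_mono W_power_ge) auto
      also have "\<dots> \<le> p2 ?e * S t"
        unfolding S_def using x_bounds(1)[of i] x_bounds(4)[of i] xt
        by (intro mult_left_mono SUP_upper) (auto simp: einterval_iff)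
      finally have "(vv x i epowr ?s) epowr (r / ?s) \<le> (p2 ?e * S t) epowr (r / ?s)"
        by (intro epowr_mono less_imp_le[OF divide_pos_pos] r k(3))
      moreover have "S * (r / S) = r" if "0 < S" for S :: real
        using that by simp
      note this[OF k(3)]
      ultimately show "vv x i epowr r \<le> (p2 ?e * S t) epowr (r / ?s)"
        by (simp only: epowr_epowr)
    qed
    finally have "X j \<le> ((p2 ?e * S t) epowr (r / ?s)) epowr (?s / r)"
      unfolding X_def by (intro epowr_mono less_imp_le[OF divide_pos_pos] r k(3))
    moreover have "r / S * (S / r) = 1" if "0 < S" for S :: real
      using that r(1) by simp
    note this[OF k(3)]
    ultimately show "X j \<le> p2 ?e * S t" by (simp only: epowr_epowr epowr_one)
  next
    fix j assume "\<not> \<tau> j < \<tau> (j + 1)"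
    then have "Theta \<tau> x j = 0"
      using levels_empty pr p by (simp add: Theta_def dual_def bot_ennreal)
    then show "X j = 0"
      unfolding X_def by (simp only: zero_epowr[OF divide_pos_pos[OF k(3) r(1)]])
  qed
  also have "\<dots> = p2 (2 * ?k) * (p2 ?e * integ a' b (\<lambda>t. Phi t * S t))"
  proof -
    have "S \<in> borel_measurable L"
      unfolding S_def
    proof (rule mono_measurable)
      fix s t assume st: "s \<in> einterval a b" "t \<in> einterval a b" "s \<le> t"
      show "(SUP y\<in>einterval a s. integ y b w epowr (- ?e) * V r v y (ereal s) epowr ?s)
        \<le> (SUP y\<in>einterval a t. integ y b w epowr (- ?e) * V r v y (ereal t) epowr ?s)"
      proof (rule SUP_mono)
        fix y assume y: "y \<in> einterval a s"
        have "V r v y s \<le> V r v y t"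
          using y st by (intro V_mono) (auto simp: einterval_iff)
        then show "\<exists>m\<in>einterval a t. integ y b w epowr (- ?e) * V r v y (ereal s) epowr ?s \<le> integ m b w epowr (- ?e) * V r v m (ereal t) epowr ?s"
          using y st k(3) by (intro bexI[of _ y] mult_left_mono epowr_mono) (auto simp: einterval_iff)
      qed
    qed
    then have "(\<lambda>t. Phi t * S t) \<in> borel_measurable L" by measurable
    then have "integ a' b (\<lambda>t. p2 ?e * (Phi t * S t)) = p2 ?e * integ a' b (\<lambda>t. Phi t * S t)"
      by (rule integ_cmult) (use a'_le in auto)
    then show ?thesis by (simp only: mult.left_commute)
  qed
  also have "\<dots> \<le> p2 (2 * ?k) * (p2 ?e * J4)"
    unfolding J4_def Phi_def S_def using a'_le by (intro mult_left_mono integ_subset) auto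
  also have "\<dots> = p2 (2 * ?k + ?e) * J4" by (simp only: p2_add_left)
  finally show ?thesis
    unfolding global_const_def dual_eq[OF q qp] using qp p by (intro epowr_mono) auto
qed

text \<open>Two conversions are combined. \<open>level_sum_le\<close> turns the sum over levels into
  an integral against \<open>Phi\<close>. This integral is then cut along the blocks of w, where S
  is at most the power of TT (x k), and block k is charged to the w-mass of block k + 1 with y = x k
  in the supremum.\<close>

lemma rest_level_sum_le:
  assumes qp: "q < p" and rp: "r < p"
  defines "e3 \<equiv> q * (p - r) / (r * (p - q))"
  shows "isum UNIV (\<lambda>j. p2 (- real_of_int j * (p / (p - q))) * isum (levels \<tau> x j - first) (beta x) epowr e3) \<le> c6 * J6"
proof -
  have e3: "0 < e3" using qp rp q r by (simp add: e3_def)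
  define S where "S t = (SUP k\<in>{k. x k < t}. TT (x k) epowr e3)" for t
  have "isum UNIV (\<lambda>j. p2 (- real_of_int j * (p / (p - q))) * isum (levels \<tau> x j - first) (beta x) epowr e3)
    \<le> p2 (2 * (p / (p - q))) * integ a' b (\<lambda>t. Phi t * (cT epowr e3 * S t))"
  proof (rule level_sum_le[OF qp])
    fix j t assume t: "\<tau> (j + 1) < t" "t < \<tau> (j + 2)"
    have "a' < t" "ereal t < b"
      using t t_bounds(3)[of "j + 1"] t_bounds(2)[of "j + 2"] by (auto intro: ereal_real_trans(3)[OF _ less_imp_le])
    then obtain k where k: "x k < t" "t \<le> x (k + 1)" using partition_obtain[OF px] by blast
    have "isum (levels \<tau> x j - first) (beta x) \<le> cT * TT (x k)"
    proof (rule beta_sum_le[OF rp x_bounds(2)])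
      fix i assume "i \<in> levels \<tau> x j"
      then have "x (i + 1) < t" using t by (auto simp: levels_def)
      then have "i + 1 \<le> k" using k(2) by (rule partition_index_le[OF px])
      then show "x (i + 1) \<le> x k" by (rule partition_mono[OF px])
    qed
    then have "isum (levels \<tau> x j - first) (beta x) epowr e3 \<le> (cT * TT (x k)) epowr e3"
      using e3 by (intro epowr_mono) auto
    also have "\<dots> = cT epowr e3 * TT (x k) epowr e3" using e3 by (intro epowr_mult) auto
    also have "\<dots> \<le> cT epowr e3 * S t" unfolding S_def using k by (intro mult_left_mono SUP_upper) auto
    finally show "isum (levels \<tau> x j - first) (beta x) epowr e3 \<le> cT epowr e3 * S t" .
  next
    fix j assume "\<not> \<tau> j < \<tau> (j + 1)"
    then show "isum (levels \<tau> x j - first) (beta x) epowr e3 = 0"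
      using levels_empty e3 by (simp add: nn_integral_empty)
  qed
  also have "integ a' b (\<lambda>t. Phi t * (cT epowr e3 * S t))
    \<le> isum UNIV (\<lambda>k. (cT epowr e3 * TT (x k) epowr e3) * integ (x k) (x (k + 1)) Phi)"
  proof (rule partition_upper[OF px a'_le(1,2) Phi_measurable])
    fix k t assume t: "x k < t" "t < x (k + 1)"
    have "S t \<le> TT (x k) epowr e3"
      unfolding S_def
    proof (rule SUP_least)
      fix l assume "l \<in> {k. x k < t}"
      then have "l \<le> k" using t by (intro partition_index_le[OF px, of l t k]) auto
      then have le: "x l \<le> x k" by (rule partition_mono[OF px])
      have "TT (x l) \<le> TT (x k)" using le x_bounds by (intro TT_mono rp) auto
      then show "TT (x l) epowr e3 \<le> TT (x k) epowr e3" using e3 by (intro epowr_mono) auto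
    qed
    then have "Phi t * (cT epowr e3 * S t) \<le> Phi t * (cT epowr e3 * TT (x k) epowr e3)"
      by (intro mult_left_mono) auto
    then show "Phi t * (cT epowr e3 * S t) \<le> cT epowr e3 * TT (x k) epowr e3 * Phi t"
      by (simp only: mult.commute)
  qed
  also have "\<dots> \<le> cT epowr e3 * (p2 3 * J6)"
  proof -
    let ?H = "\<lambda>k::int. p2 (real_of_int k - 2) * integ (x (k - 1)) (x k) Phi * TT (x (k - 1)) epowr e3"
    have "isum UNIV (\<lambda>k. TT (x k) epowr e3 * integ (x k) (x (k + 1)) Phi)
      \<le> isum UNIV (\<lambda>k. p2 3 * (?H (k + 1) * integ (x (k + 1)) (x (k + 1 + 1)) w))"
    proof (rule isum_mono)
      fix k
      show "TT (x k) epowr e3 * integ (x k) (x (k + 1)) Phi \<le> p2 3 * (?H (k + 1) * integ (x (k + 1)) (x (k + 1 + 1)) w)"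
      proof (cases "x k < x (k + 1)")
        case True
        let ?Y = "integ (x k) (x (k + 1)) Phi * TT (x k) epowr e3"
        have "TT (x k) epowr e3 * integ (x k) (x (k + 1)) Phi = p2 (3 + (real_of_int k - 1) + (- real_of_int k - 2)) * ?Y"
          by (simp add: mult.commute)
        also have "\<dots> = p2 3 * ((p2 (real_of_int k - 1) * ?Y) * p2 (- real_of_int k - 2))"
          by (simp only: p2_add[symmetric] ac_simps)
        also have "\<dots> \<le> p2 3 * ((p2 (real_of_int k - 1) * ?Y) * integ (x (k + 1)) (x (k + 2)) w)"
          using dyadic_next(4)[OF dx True] by (intro mult_left_mono) auto
        finally show ?thesis by (simp add: add.assoc mult.assoc)
      qed simp
    qed
    also have "\<dots> = p2 3 * isum UNIV (\<lambda>k. ?H k * integ (x k) (x (k + 1)) w)"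
      unfolding isum_cmult isum_shift[of "\<lambda>k. ?H k * integ (x k) (x (k + 1)) w" 1] ..
    also have "\<dots> \<le> p2 3 * integ a' b (\<lambda>x. w x * (SUP y\<in>einterval a x. integ y b w epowr (- 1) * integ y x Phi * TT y epowr e3))"
    proof (intro mult_left_mono partition_lower[OF px a'_le(1,2) w])
      fix k t assume t: "x k < t" "t < x (k + 1)"
      have *: "x (k - 1) \<le> x k" by (rule partition_mono[OF px]) simp
      have "p2 (real_of_int k - 2) \<le> integ (x (k - 1)) b w epowr (- 1)"
        using dyadicD(3)[OF dx, of "k - 1"] W_power_ge[of "x (k - 1)" "k - 1" 1] by simp
      moreover have "integ (x (k - 1)) (x k) Phi \<le> integ (x (k - 1)) t Phi"
        using t by (intro integ_subset) auto
      ultimately have "?H k \<le> integ (x (k - 1)) b w epowr (- 1) * integ (x (k - 1)) t Phi * TT (x (k - 1)) epowr e3"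
        by (intro mult_right_mono mult_mono) auto
      also have "\<dots> \<le> (SUP y\<in>einterval a t. integ y b w epowr (- 1) * integ y t Phi * TT y epowr e3)"
        using t * x_bounds(1)[of "k - 1"] by (intro SUP_upper2[of "x (k - 1)"]) (auto simp: einterval_iff)
      finally have "?H k * w t \<le> (SUP y\<in>einterval a t. integ y b w epowr (- 1) * integ y t Phi * TT y epowr e3) * w t"
        by (rule mult_right_mono) simp
      then show "?H k * w t \<le> w t * (SUP y\<in>einterval a t. integ y b w epowr (- 1) * integ y t Phi * TT y epowr e3)"
        by (simp only: mult.commute)
    qed simp
    also have "\<dots> \<le> p2 3 * J6"
      unfolding J6_def e3_def using a'_le by (intro mult_left_mono integ_subset) auto
    finally show ?thesis
      unfolding mult.assoc isum_cmult by (intro mult_left_mono) auto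
  qed
  finally show ?thesis
    unfolding c6_def e3_def by (simp add: mult_left_mono mult.assoc)
qed

text \<open>The two parts of each level are summed separately. At most one level contains the first
  block, so the sum of the first parts has at most one nonzero term, and the pointwise bound K1
  suffices for it although q < p would otherwise require summability.\<close>

lemma global_const_le_J6:
  assumes qp: "q < p" and rp: "r < p"
    and K1: "\<And>y t. a < y \<Longrightarrow> y < t \<Longrightarrow> ereal t < b \<Longrightarrow> integ t b u * V r v y t epowr q \<le> K1 * integ y b w epowr (q / p)"
  defines "e2 \<equiv> q * (p - r) / (p * r)" and "k \<equiv> p / (p - q)"
  shows "global_const \<tau> x \<le> (p2 (e2 * k + k) * ((p2 (1 + q / p) * K1) epowr k + c6 * J6)) epowr ((p - q) / p)"
proof -
  let ?e3 = "q * (p - r) / (r * (p - q))"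
  have k: "0 < k" using qp p by (simp add: k_def)
  have e2: "0 < e2" using rp p q r by (simp add: e2_def)
  have e3: "e2 * k = ?e3" using p qp rp r by (simp add: e2_def k_def)
  define A where "A j = isum (levels \<tau> x j \<inter> first) (beta x) epowr e2" for j
  define C where "C j = isum (levels \<tau> x j - first) (beta x) epowr e2" for j
  have "isum UNIV (\<lambda>j. (p2 (- real_of_int j) * Theta \<tau> x j epowr (q / r)) epowr k)
    \<le> isum UNIV (\<lambda>j. p2 (e2 * k + k) * ((p2 (- real_of_int j) * A j) epowr k + p2 (- real_of_int j * k) * C j epowr k))"
  proof (rule isum_mono)
    fix j
    have "p2 (- real_of_int j) * Theta \<tau> x j epowr (q / r) \<le> p2 (- real_of_int j) * (p2 e2 * (A j + C j))"
      unfolding A_def C_def e2_def by (intro mult_left_mono Theta_split rp) simp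
    also have "\<dots> = p2 e2 * (p2 (- real_of_int j) * A j + p2 (- real_of_int j) * C j)"
      by (simp only: distrib_left ac_simps)
    finally have "(p2 (- real_of_int j) * Theta \<tau> x j epowr (q / r)) epowr k
      \<le> (p2 e2 * (p2 (- real_of_int j) * A j + p2 (- real_of_int j) * C j)) epowr k"
      using k by (intro epowr_mono) auto
    also have "\<dots> = p2 (e2 * k) * (p2 (- real_of_int j) * A j + p2 (- real_of_int j) * C j) epowr k"
      using k by (simp add: epowr_mult p2_epowr)
    also have "\<dots> \<le> p2 (e2 * k) * (p2 k * ((p2 (- real_of_int j) * A j) epowr k + (p2 (- real_of_int j) * C j) epowr k))"
      using k by (intro mult_left_mono epowr_sum_le_p2) auto
    finally show "(p2 (- real_of_int j) * Theta \<tau> x j epowr (q / r)) epowr k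
      \<le> p2 (e2 * k + k) * ((p2 (- real_of_int j) * A j) epowr k + p2 (- real_of_int j * k) * C j epowr k)"
      using k by (simp add: p2_add_left epowr_mult p2_epowr)
  qed
  also have "\<dots> = p2 (e2 * k + k) * (isum UNIV (\<lambda>j. (p2 (- real_of_int j) * A j) epowr k) + isum UNIV (\<lambda>j. p2 (- real_of_int j * k) * C j epowr k))"
    by (simp only: isum_cmult isum_add)
  also have "isum UNIV (\<lambda>j. (p2 (- real_of_int j) * A j) epowr k) \<le> (p2 (1 + q / p) * K1) epowr k"
  proof -
    let ?J = "{j. levels \<tau> x j \<inter> first \<noteq> {}}"
    have "A j = 0" if "j \<notin> ?J" for j
      using that e2 by (simp add: A_def nn_integral_empty)
    then have "isum UNIV (\<lambda>j. (p2 (- real_of_int j) * A j) epowr k) = isum ?J (\<lambda>j. (p2 (- real_of_int j) * A j) epowr k)"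
      unfolding isum_restrict[of ?J] using k by (intro isum_cong) (auto split: split_indicator)
    also have "\<dots> \<le> (p2 (1 + q / p) * K1) epowr k"
    proof (rule isum_single_le)
      fix j j' assume "j \<in> ?J" "j' \<in> ?J"
      then show "j = j'" using first_unique levels_unique[OF pt] by blast
    next
      fix j
      show "(p2 (- real_of_int j) * A j) epowr k \<le> (p2 (1 + q / p) * K1) epowr k"
        using first_level_le[OF rp K1, of j] k unfolding A_def e2_def by (intro epowr_mono) auto
    qed
    finally show ?thesis .
  qed
  also have "isum UNIV (\<lambda>j. p2 (- real_of_int j * k) * C j epowr k) \<le> c6 * J6"
    using rest_level_sum_le[OF qp rp] unfolding C_def epowr_epowr e3 unfolding k_def .
  finally have "isum UNIV (\<lambda>j. (p2 (- real_of_int j) * Theta \<tau> x j epowr (q / r)) epowr k)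
    \<le> p2 (e2 * k + k) * ((p2 (1 + q / p) * K1) epowr k + c6 * J6)"
    by (simp add: mult_left_mono)
  then show ?thesis
    unfolding global_const_def dual_eq[OF q qp] k_def using qp p by (intro epowr_mono) auto
qed

end

subsection \<open>Necessity\<close>

lemma p2_linear_bound:
  fixes d :: real
  assumes "0 < d"
  obtains M where "M < top" "\<And>n::nat. of_nat (n + 1) \<le> M * p2 (n * d)"
proof -
  let ?e = "d * ln 2" let ?M = "max 1 (1 / ?e)"
  have e: "0 < ?e" using assms by simp
  have real: "real (n + 1) \<le> ?M * 2 powr (n * d)" for n :: nat
  proof -
    have "1 \<le> ?M * ?e"
      using e assms mult_right_mono[of "1 / ?e" ?M ?e] by simp
    then have "real n * 1 \<le> real n * (?M * ?e)" by (intro mult_left_mono) auto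
    then have "real (n + 1) \<le> ?M * (1 + n * d * ln 2)"
      by (simp add: algebra_simps add_mono)
    also have "\<dots> \<le> ?M * exp (n * d * ln 2)"
      by (intro mult_left_mono exp_ge_add_one_self) auto
    finally show ?thesis by (simp add: powr_def)
  qed
  show ?thesis
  proof (rule that[of "ennreal ?M"])
    fix n :: nat
    have "ennreal (real (n + 1)) \<le> ennreal (?M * 2 powr (n * d))"
      using real by (intro ennreal_leI)
    then show "of_nat (n + 1) \<le> ennreal ?M * p2 (n * d)"
      by (simp add: p2_def ennreal_of_nat_eq_real_of_nat ennreal_mult'')
  qed simp
qed

text \<open>Arises in \<open>J57_le\<close>: intervals made of n + 1 consecutive blocks overlap n +
  1 times, which costs (n + 1)^k against the decay 2^-n of the mass of w.\<close>

definition polygeo :: "real \<Rightarrow> ennreal" where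
  "polygeo k = (\<Sum>n::nat. p2 (- real n) * of_nat (n + 1) epowr k)"

lemma polygeo_finite:
  assumes "0 < k" shows "polygeo k < top"
proof -
  obtain M where M: "M < top" "\<And>n::nat. of_nat (n + 1) \<le> M * p2 (n * (1 / (2 * k)))"
    using p2_linear_bound[of "1 / (2 * k)"] assms by auto
  have "polygeo k \<le> (\<Sum>n::nat. M epowr k * p2 (- (n * (1 / 2))))"
    unfolding polygeo_def
  proof (intro suminf_le)
    fix n :: nat
    have "of_nat (n + 1) epowr k \<le> (M * p2 (n * (1 / (2 * k)))) epowr k"
      using M(2)[of n] assms by (intro epowr_mono) auto
    also have "\<dots> = M epowr k * p2 (n * (1 / 2))"
      using assms by (simp add: epowr_mult p2_epowr)
    finally have "p2 (- real n) * of_nat (n + 1) epowr k \<le> p2 (- real n) * (M epowr k * p2 (n * (1 / 2)))"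
      by (rule mult_left_mono) simp
    also have "\<dots> = M epowr k * p2 (- (n * (1 / 2)))"
      by (simp add: mult.left_commute p2_add)
    finally show "p2 (- real n) * of_nat (n + 1) epowr k \<le> M epowr k * p2 (- (n * (1 / 2)))" .
  qed auto
  also have "\<dots> = M epowr k * geo (1 / 2)"
    by (simp add: geo_def)
  also have "\<dots> < top"
    using M(1) geo_finite[of "1/2"] assms by (auto simp: ennreal_mult_less_top intro!: epowr_finite)
  finally show ?thesis .
qed

section \<open>Both sides of the inequality on combinations of test functions\<close>

context three_weights
begin

lemma outer_cmult:
  assumes f: "f \<in> borel_measurable L" and x: "ereal a \<le> x" "y \<le> b"
  shows "outer (\<lambda>s. c * f s) x y = c epowr q * outer f x y"
proof -
  have "outer (\<lambda>s. c * f s) x y = integ x y (\<lambda>t. c epowr q * (inner f x t epowr (q / r) * u t))"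
    unfolding outer_def
  proof (rule integ_cong)
    fix t assume "t \<in> einterval x y"
    then have "ereal t \<le> b" using x by (auto simp: einterval_iff)
    then have "inner (\<lambda>s. c * f s) x t = c epowr r * inner f x t" using x f by (intro inner_cmult)
    then show "inner (\<lambda>s. c * f s) x t epowr (q / r) * u t = c epowr q * (inner f x t epowr (q / r) * u t)"
      using q r by (simp add: epowr_mult epowr_epowr mult.assoc)
  qed
  also have "\<dots> = c epowr q * outer f x y"
    unfolding outer_def using x inner_measurable[of f x] by (intro integ_cmult) auto
  finally show ?thesis .
qed

lemma outer_mono:
  assumes "\<And>s. s \<in> einterval x y \<Longrightarrow> f s \<le> g s"
  shows "outer f x y \<le> outer g x y"
proof -
  have le: "inner f x t \<le> inner g x t" if t: "t \<in> einterval x y" for t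
  proof (rule inner_mono)
    fix s assume "s \<in> einterval x t"
    then have "s \<in> einterval x y" using t unfolding einterval_iff by (meson less_trans)
    then show "f s \<le> g s" by (rule assms)
  qed
  show ?thesis
    unfolding outer_def
  proof (rule integ_mono)
    fix t assume "t \<in> einterval x y"
    then have "inner f x t \<le> inner g x t" by (rule le)
    then have "inner f x t epowr (q / r) \<le> inner g x t epowr (q / r)"
      by (rule epowr_mono) (rule less_imp_le[OF qr])
    then show "inner f x t epowr (q / r) * u t \<le> inner g x t epowr (q / r) * u t"
      by (rule mult_right_mono) simp
  qed
qed

lemma B_mono:
  assumes "x' \<le> x" "y \<le> y'" shows "B x y \<le> B x' y'"
  unfolding B_def
proof (rule SUP_mono)
  fix f assume "f \<in> unit_ball x y"
  then have "f \<in> unit_ball x' y'" using assms by (rule unit_ball_mono)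
  then show "\<exists>g\<in>unit_ball x' y'. outer f x y \<le> outer g x' y'"
    using outer_subset[OF assms] by blast
qed

lemma unit_ball_integ_le:
  assumes f: "f \<in> unit_ball x y" and x: "ereal a \<le> x" "y \<le> b"
  shows "integ a t f \<le> (if x < ereal t then 1 else 0)"
proof (cases "x < ereal t")
  case True
  have "integ a t f \<le> integ a (max t y) f" by (intro integ_subset) auto
  also have "\<dots> = integ x y f" using unit_ballD(2)[OF f] x by (intro integ_off) auto
  finally show ?thesis using True unit_ballD(3)[OF f] by (auto intro: order_trans)
next
  case False
  have "s \<notin> einterval x y" if "s \<in> einterval a t" for s
    using that False unfolding einterval_iff by (meson less_trans)
  then have "integ a t f = integ a t (\<lambda>_. 0)"
    using unit_ballD(2)[OF f] by (intro integ_cong) blast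
  then show ?thesis by simp
qed

lemma indicator_w_integ: "a \<le> y \<Longrightarrow> integ a b (\<lambda>t. indicator {y<..} t * w t) \<le> integ y b w"
  by (auto intro!: nn_integral_mono simp: einterval_iff split: split_indicator)

lemma R_unit_ball:
  assumes f: "f \<in> unit_ball y b" and y: "a \<le> y"
  shows "R f \<le> integ y b w"
proof -
  have "R f \<le> integ a b (\<lambda>t. indicator {y<..} t * w t)"
    unfolding R_def
  proof (rule integ_mono)
    fix t
    have "integ a t f epowr p \<le> (if ereal y < ereal t then 1 else 0) epowr p"
      using unit_ball_integ_le[OF f, of t] y p by (intro epowr_mono) auto
    then show "integ a t f epowr p * w t \<le> indicator {y<..} t * w t"
      using p by (intro mult_right_mono) (auto split: if_splits)
  qed
  also have "\<dots> \<le> integ y b w" by (rule indicator_w_integ[OF y])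
  finally show ?thesis .
qed

definition cR :: ennreal where "cR = p2 1 * GH 1 p"

lemma R_le:
  assumes dx: "dyadic w a b x"
    and F: "\<And>k t. x k < t \<Longrightarrow> t < x (k + 1) \<Longrightarrow> integ a t f \<le> isum {..k} c"
  shows "R f \<le> cR * isum UNIV (\<lambda>k. p2 (- real_of_int k) * c k epowr p)"
proof -
  have "R f \<le> isum UNIV (\<lambda>k. isum {..k} c epowr p * integ (x k) (x (k + 1)) w)"
    unfolding R_def using F p
    by (intro partition_upper[OF dyadicD(1)[OF dx]] mult_right_mono epowr_mono) auto
  also have "\<dots> \<le> isum UNIV (\<lambda>k. p2 1 * (p2 (- 1 * real_of_int k) * isum {..k} c epowr p))"
  proof (rule isum_mono)
    fix k
    have "isum {..k} c epowr p * integ (x k) (x (k + 1)) w \<le> isum {..k} c epowr p * p2 (1 - real_of_int k)"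
      using dyadic_block_mass[OF dx, of k] by (intro mult_left_mono) auto
    then show "isum {..k} c epowr p * integ (x k) (x (k + 1)) w \<le> p2 1 * (p2 (- 1 * real_of_int k) * isum {..k} c epowr p)"
      by (simp add: p2_add_left mult.commute)
  qed
  also have "\<dots> \<le> p2 1 * (GH 1 p * isum UNIV (\<lambda>k. p2 (- 1 * real_of_int k) * c k epowr p))"
    unfolding isum_cmult[of _ "p2 1"] using p by (intro mult_left_mono geometric_Hardy) auto
  finally show ?thesis by (simp add: cR_def mult.assoc)
qed

text \<open>For t in block k only the g_i with i <= k have started, and each has integral at most 1.
  Only the left ends of the supports matter, so the g_i may extend over many blocks, as they do in
  \<open>YB_dual_le\<close>.\<close>

lemma R_le_unit_balls:
  assumes dx: "dyadic w a b x"
    and g: "\<And>i. g i \<in> unit_ball (x i) b"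
  shows "R (\<lambda>s. isum UNIV (\<lambda>i. c i * g i s)) \<le> cR * isum UNIV (\<lambda>k. p2 (- real_of_int k) * c k epowr p)"
proof (rule R_le[OF dx])
  fix k t assume t: "x k < t" "t < x (k + 1)"
  note px = dyadicD(1)[OF dx]
  have sub: "ereal a \<le> x i" "ereal t \<le> b" for i
    using partition_bounds[OF px, of i] partition_bounds(2)[OF px, of "k + 1"] t
    by (auto intro: ereal_real_trans(4)[OF less_imp_le])
  have m: "g i \<in> borel_measurable L" for i using unit_ballD(1)[OF g] .
  have "integ a t (\<lambda>s. isum UNIV (\<lambda>i. c i * g i s)) = isum UNIV (\<lambda>i. c i * integ a t (g i))"
    using sub m by (subst integ_isum) (auto simp: integ_cmult)
  also have "\<dots> \<le> isum UNIV (\<lambda>i. c i * indicator {..k} i)"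
  proof (intro isum_mono mult_left_mono)
    fix i
    show "integ a t (g i) \<le> indicator {..k} i"
      using unit_ball_integ_le[OF g[of i], of t] sub partition_index_le[OF px, of i t k] t
      by (auto split: split_indicator if_splits)
  qed simp
  also have "\<dots> = isum {..k} c" by (rule isum_restrict[symmetric])
  finally show "integ a t (\<lambda>s. isum UNIV (\<lambda>i. c i * g i s)) \<le> isum {..k} c" .
qed

text \<open>Level j is charged to the u-mass of block j + 1, on which the inner integral is at least
  its value at \<tau> (j + 1).\<close>

lemma outer_ge_levels:
  assumes dt: "dyadic u a b \<tau>"
    and G: "\<And>j. \<tau> j < \<tau> (j + 1) \<Longrightarrow> G j \<le> inner f a (\<tau> (j + 1))"
    and G0: "\<And>j. \<not> \<tau> j < \<tau> (j + 1) \<Longrightarrow> G j = 0"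
  shows "isum UNIV (\<lambda>j. p2 (- real_of_int j) * G j epowr (q / r)) \<le> p2 2 * outer f a b"
proof -
  note pt = dyadicD(1)[OF dt]
  let ?H = "\<lambda>k::int. G (k - 1) epowr (q / r)"
  have "isum UNIV (\<lambda>j. p2 (- real_of_int j) * G j epowr (q / r))
    \<le> isum UNIV (\<lambda>j. p2 2 * (?H (j + 1) * integ (\<tau> (j + 1)) (\<tau> (j + 1 + 1)) u))"
  proof (rule isum_mono)
    fix j
    show "p2 (- real_of_int j) * G j epowr (q / r) \<le> p2 2 * (?H (j + 1) * integ (\<tau> (j + 1)) (\<tau> (j + 1 + 1)) u)"
    proof (cases "\<tau> j < \<tau> (j + 1)")
      case True
      have "p2 (- real_of_int j) * G j epowr (q / r) = p2 (2 + (- real_of_int j - 2)) * G j epowr (q / r)" by simp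
      also have "\<dots> = p2 2 * (?H (j + 1) * p2 (- real_of_int j - 2))"
        by (simp only: p2_add[symmetric] ac_simps add_diff_cancel_right' add_diff_cancel_left')
      also have "\<dots> \<le> p2 2 * (?H (j + 1) * integ (\<tau> (j + 1)) (\<tau> (j + 1 + 1)) u)"
        using dyadic_next(4)[OF dt True] by (intro mult_left_mono) (auto simp: add.assoc)
      finally show ?thesis .
    qed (use G0 qr in simp)
  qed
  also have "\<dots> = p2 2 * isum UNIV (\<lambda>k. ?H k * integ (\<tau> k) (\<tau> (k + 1)) u)"
    unfolding isum_cmult isum_shift[of "\<lambda>k. ?H k * integ (\<tau> k) (\<tau> (k + 1)) u" 1] ..
  also have "\<dots> \<le> p2 2 * outer f a b"
    unfolding outer_def
  proof (intro mult_left_mono partition_lower[OF pt _ _ u] mult_right_mono)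
    fix k t assume t: "\<tau> k < t" "t < \<tau> (k + 1)"
    have "G (k - 1) \<le> inner f a t"
    proof (cases "\<tau> (k - 1) < \<tau> (k - 1 + 1)")
      case True
      have "G (k - 1) \<le> inner f a (\<tau> (k - 1 + 1))" by (rule G[OF True])
      also have "\<dots> \<le> inner f a t" using t by (intro inner_subset) auto
      finally show ?thesis .
    qed (use G0[of "k - 1"] in simp)
    then show "?H k \<le> inner f a t epowr (q / r)" using qr by (intro epowr_mono) auto
  qed auto
  finally show ?thesis .
qed

end

section \<open>Pointwise consequences of the inequality, and necessity of C4\<close>

locale necessity = three_weights +
  fixes C :: ennreal
  assumes C: "C < top"
    and ineq: "\<And>f. f \<in> borel_measurable L \<Longrightarrow> outer f a b epowr (1 / q) \<le> C * R f epowr (1 / p)"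
begin

lemma outer_le:
  assumes "f \<in> borel_measurable L" shows "outer f a b \<le> C epowr q * R f epowr (q / p)"
proof -
  have "(outer f a b epowr (1 / q)) epowr q \<le> (C * R f epowr (1 / p)) epowr q"
    using ineq[OF assms] q by (intro epowr_mono) auto
  then show ?thesis using q by (simp add: epowr_mult epowr_epowr)
qed

lemma outer_unit_ball_le:
  assumes f: "f \<in> unit_ball y b" and y: "a \<le> y"
  shows "outer f y b \<le> C epowr q * integ y b w epowr (q / p)"
proof -
  have "outer f y b \<le> outer f a b" using y by (intro outer_subset) auto
  also have "\<dots> \<le> C epowr q * R f epowr (q / p)" by (rule outer_le[OF unit_ballD(1)[OF f]])
  also have "\<dots> \<le> C epowr q * integ y b w epowr (q / p)"
    using R_unit_ball[OF f y] p q by (intro mult_left_mono epowr_mono) auto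
  finally show ?thesis .
qed

lemma B_le: "a \<le> y \<Longrightarrow> B y b \<le> C epowr q * integ y b w epowr (q / p)"
  unfolding B_def by (intro SUP_least outer_unit_ball_le)

text \<open>V is positive on (s, t), so some function of norm at most 1 supported there has a
  positive inner integral from t on. An infinite tail of u at t would make the left side infinite,
  while the right side is bounded by means of the finite tail of w at s.\<close>

lemma u_fin:
  assumes t: "a < t" "ereal t < b" shows "integ t b u < top"
proof -
  obtain s where s: "a < s" "s < t" using dense[OF t(1)] by blast
  have sb: "ereal s < b" using s t by (auto intro: ereal_real_trans(3)[OF _ less_imp_le])
  have "0 < V r v s t epowr r"
    using s t r by (intro epowr_pos V_pos) auto
  then obtain K where K: "0 < K" "K < V r v s t epowr r" using dense by blast
  obtain f where f: "f \<in> borel_measurable L" "\<And>y. y \<notin> einterval s t \<Longrightarrow> f y = 0" "integ s t f \<le> 1"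
    "K \<le> integ s t (\<lambda>y. f y epowr r * v y)"
    using V_attain[OF _ _ K(2)] s t by (auto intro: less_imp_le)
  then have "f \<in> unit_ball s t" by (auto simp: unit_ball_def)
  then have "f \<in> unit_ball s b" by (rule unit_ball_mono) (use t in auto)
  then have "outer f s b \<le> C epowr q * integ s b w epowr (q / p)"
    using s by (intro outer_unit_ball_le) auto
  also have "\<dots> < top"
    using C w_fin[OF s(1) sb] p q by (auto simp: ennreal_mult_less_top intro!: epowr_finite)
  finally have "outer f s b < top" .
  moreover have "integ t b u * inner f s t epowr (q / r) \<le> outer f s b"
    using s by (intro outer_lower) auto
  moreover have "0 < inner f s t epowr (q / r)"
    using f(4) K(1) qr unfolding inner_def by (intro epowr_pos) (auto intro: less_le_trans)
  ultimately show ?thesis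
    by (auto simp: ennreal_mult_less_top dest!: le_less_trans)
qed

lemma point_le:
  assumes y: "a \<le> y" "y < t" "ereal t < b"
  shows "integ t b u * V r v y t epowr q \<le> C epowr q * integ y b w epowr (q / p)"
proof (rule V_point_le)
  show "integ t b u < top" using y by (intro u_fin) auto
  fix f assume "f \<in> unit_ball y t"
  then have "f \<in> unit_ball y b" by (rule unit_ball_mono) (use y in auto)
  then show "outer f y b \<le> C epowr q * integ y b w epowr (q / p)"
    using y by (intro outer_unit_ball_le) auto
qed (use y in auto)

lemma V_fin:
  assumes y: "a \<le> y" "ereal t < b" and W: "integ y b w < top"
  shows "V r v y t < top"
proof (cases "y < t")
  case True
  have "integ t b u * V r v y t epowr q \<le> C epowr q * integ y b w epowr (q / p)"
    using True y by (intro point_le) auto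
  also have "\<dots> < top" using C W p q by (auto simp: ennreal_mult_less_top intro!: epowr_finite)
  finally have "integ t b u * V r v y t epowr q < top" .
  moreover have "0 < integ t b u" using True y u_pos by (intro integ_pos) auto
  ultimately show ?thesis using q by (auto simp: ennreal_mult_less_top epowr_finite_iff epowr_eq_0_iff)
qed (use V_empty[of "ereal t" "ereal y"] in simp)

lemma unit_ball_half:
  assumes y: "a \<le> y" "ereal t < b" and W: "integ y b w < top"
  obtains f where "f \<in> unit_ball y t" "V r v y t epowr r \<le> p2 1 * inner f y t"
proof -
  have "ereal a \<le> ereal y" "ereal t \<le> b" using y by auto
  from V_half_attain[OF this V_fin[OF assms]]
  obtain f where "f \<in> borel_measurable L" "\<And>s. s \<notin> einterval y t \<Longrightarrow> f s = 0"
    "integ y t f \<le> 1" "V r v y t epowr r \<le> p2 1 * integ y t (\<lambda>s. f s epowr r * v s)" by blast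
  then show ?thesis by (intro that[of f]) (auto simp: unit_ball_def inner_def)
qed

lemma E_le: "a \<le> y \<Longrightarrow> E y b epowr q \<le> p2 (4 + q / r) * (C epowr q * integ y b w epowr (q / p))"
proof -
  assume y: "a \<le> y"
  have "E y b epowr q \<le> p2 (4 + q / r) * B y b"
    using y u_fin by (intro Hardy_lower) auto
  also have "\<dots> \<le> p2 (4 + q / r) * (C epowr q * integ y b w epowr (q / p))"
    using B_le[OF y] by (rule mult_left_mono) simp
  finally show ?thesis .
qed

text \<open>
  For \<open>q < p\<close> and \<open>p \<le> 1\<close> no discretization of \<open>w\<close> is needed: the test functions may overlap,
  since the \<open>p\<close>-th power is subadditive.
\<close>

lemma J4_le:
  assumes qp: "q < p" and p1: "p \<le> 1"
  shows "J4 \<le> p2 (p / (p - q)) * (p2 (4 + q / r) * C epowr q) epowr (p / (p - q))"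
proof -
  let ?k = "p / (p - q)" and ?e = "q / (p - q)" and ?s = "p * q / (p - q)"
  have k: "0 < ?k" "0 < ?e" "0 < ?s" "?k = ?e + 1" "q * ?k = ?s" "- (q / p) * ?k = - ?e"
    using qp p q by (auto simp: field_simps)
  obtain \<tau> where dt: "dyadic u a b \<tau>"
    using dyadic_exists[OF u u_pos, of a b] ab u_fin by auto
  note pt = dyadicD(1)[OF dt]
  have sub: "ereal a \<le> \<tau> j" "ereal (\<tau> j) \<le> b" "ereal (\<tau> j) < b" for j
    using partition_bounds[OF pt, of j] by auto
  \<comment> \<open>The supremum in \<open>J4\<close> for points of block j, frozen at the right end
    of the block and normalised so that its power p/(p-q) appears. Y below is set to 0 on empty
    levels, where no test function is constructed.\<close>
  define Z where "Z j = (SUP y\<in>einterval a (\<tau> (j + 1)). integ y b w epowr (- (q / p)) * V r v y (\<tau> (j + 1)) epowr q)" for j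
  define Y where "Y j = (if \<tau> j < \<tau> (j + 1) then p2 (- real_of_int j) * Z j else 0)" for j
  have "J4 \<le> isum UNIV (\<lambda>j. (p2 ((1 - real_of_int j) * ?e) * Z j epowr ?k) * integ (\<tau> j) (\<tau> (j + 1)) u)"
    unfolding J4_def
  proof (rule partition_upper[OF pt _ _ u])
    fix j t assume t: "\<tau> j < t" "t < \<tau> (j + 1)"
    have "integ t b u epowr ?e \<le> p2 (1 - real_of_int j) epowr ?e"
      using dyadic_block(2)[OF dt, of j t] t k(2) by (intro epowr_mono) auto
    then have 1: "integ t b u epowr ?e \<le> p2 ((1 - real_of_int j) * ?e)" by (simp add: p2_epowr)
    have 2: "(SUP y\<in>einterval a t. integ y b w epowr (- ?e) * V r v y t epowr ?s) \<le> Z j epowr ?k"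
    proof (rule SUP_least)
      fix y assume y: "y \<in> einterval a t"
      have "integ y b w epowr (- ?e) * V r v y t epowr ?s \<le> integ y b w epowr (- ?e) * V r v y (\<tau> (j + 1)) epowr ?s"
        using y t sub k(3) by (intro mult_left_mono epowr_mono V_mono) (auto simp: einterval_iff)
      also have "\<dots> = (integ y b w epowr (- (q / p)) * V r v y (\<tau> (j + 1)) epowr q) epowr ?k"
        using k(1) by (simp only: epowr_mult[OF less_imp_le] epowr_epowr k(5,6))
      also have "\<dots> \<le> Z j epowr ?k"
        unfolding Z_def using y t k(1) by (intro epowr_mono SUP_upper) (auto simp: einterval_iff)
      finally show "integ y b w epowr (- ?e) * V r v y t epowr ?s \<le> Z j epowr ?k" .
    qed
    have "integ t b u epowr ?e * u t * (SUP y\<in>einterval a t. integ y b w epowr (- ?e) * V r v y t epowr ?s)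
      \<le> p2 ((1 - real_of_int j) * ?e) * u t * Z j epowr ?k"
      using 1 2 by (intro mult_mono) auto
    then show "integ t b u epowr ?e * u t * (SUP y\<in>einterval a t. integ y b w epowr (- ?e) * V r v y t epowr ?s)
      \<le> p2 ((1 - real_of_int j) * ?e) * Z j epowr ?k * u t" by (simp only: ac_simps)
  qed auto
  also have "\<dots> \<le> isum UNIV (\<lambda>j. p2 ?k * Y j epowr ?k)"
  proof (rule isum_mono)
    fix j
    show "(p2 ((1 - real_of_int j) * ?e) * Z j epowr ?k) * integ (\<tau> j) (\<tau> (j + 1)) u \<le> p2 ?k * Y j epowr ?k"
    proof (cases "\<tau> j < \<tau> (j + 1)")
      case True
      have "(p2 ((1 - real_of_int j) * ?e) * Z j epowr ?k) * integ (\<tau> j) (\<tau> (j + 1)) u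
        \<le> (p2 ((1 - real_of_int j) * ?e) * Z j epowr ?k) * p2 (1 - real_of_int j)"
        using dyadic_block_mass[OF dt, of j] by (intro mult_left_mono) auto
      also have "\<dots> = p2 ((1 - real_of_int j) * ?e + (1 - real_of_int j)) * Z j epowr ?k"
        by (simp only: p2_add[symmetric] ac_simps)
      also have "(1 - real_of_int j) * ?e + (1 - real_of_int j) = ?k + - real_of_int j * ?k"
      proof -
        have "(1 - real_of_int j) * S + (1 - real_of_int j) = (S + 1) + - real_of_int j * (S + 1)" for S :: real
          by (simp add: algebra_simps)
        then show ?thesis unfolding k(4) .
      qed
      also have "p2 (?k + - real_of_int j * ?k) * Z j epowr ?k = p2 ?k * Y j epowr ?k"
        using True k(1) by (simp only: Y_def if_True epowr_mult[OF less_imp_le] p2_epowr p2_add_left)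
      finally show ?thesis .
    qed simp
  qed
  also have "\<dots> = p2 ?k * isum UNIV (\<lambda>j. Y j epowr ?k)" by (rule isum_cmult)
  also have "isum UNIV (\<lambda>j. Y j epowr ?k) \<le> (p2 (4 + q / r) * C epowr q) epowr ?k"
  proof -
    have "dual (q / p) UNIV Y \<le> p2 (4 + q / r) * C epowr q"
    proof (rule dual_converse)
      fix A :: "int \<Rightarrow> ennreal" assume A: "\<And>i. A i < top" "isum UNIV A \<le> 1"
      have "\<exists>y g. a < y \<and> ereal y < b \<and> g \<in> unit_ball y (\<tau> (j + 1)) \<and>
        Z j \<le> p2 (1 + q / r) * integ y b w epowr (- (q / p)) * inner g y (\<tau> (j + 1)) epowr (q / r)"
        if T: "\<tau> j < \<tau> (j + 1)" for j
      proof -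
        have at: "a < \<tau> (j + 1)" using dyadic_next(1)[OF dt T] .
        \<comment> \<open>\<open>point_le\<close> at t = \<tau> (j + 1), where the tail of u is
          2^(-j-1). It shows that Z j is finite, so that the supremum is attained up to a factor of
          2.\<close>
        have "p2 (- real_of_int j - 1) * Z j \<le> C epowr q"
          unfolding Z_def SUP_mult_left_ennreal[symmetric]
        proof (subst SUP_mult_left_ennreal, rule SUP_least)
          fix y assume y: "y \<in> einterval a (\<tau> (j + 1))"
          then have y': "a < y" "y < \<tau> (j + 1)" "ereal y < b"
            using sub(3)[of "j + 1"] by (auto simp: einterval_iff intro: ereal_real_trans(3)[OF _ less_imp_le])
          note W = w_integ_pos[OF y'(1,3)] w_fin[OF y'(1,3)]
          have "p2 (- real_of_int j - 1) * V r v y (\<tau> (j + 1)) epowr q \<le> C epowr q * integ y b w epowr (q / p)"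
            using point_le[of y "\<tau> (j + 1)"] y' sub(3) dyadic_next(2)[OF dt T] by simp
          then have "integ y b w epowr (- (q / p)) * (p2 (- real_of_int j - 1) * V r v y (\<tau> (j + 1)) epowr q)
            \<le> integ y b w epowr (- (q / p)) * (C epowr q * integ y b w epowr (q / p))" by (rule mult_left_mono) simp
          also have "\<dots> = C epowr q * (integ y b w epowr (- (q / p)) * integ y b w epowr (q / p))" by (simp only: ac_simps)
          also have "integ y b w epowr (- (q / p)) * integ y b w epowr (q / p) = 1" using epowr_minus[OF W] .
          finally show "p2 (- real_of_int j - 1) * (integ y b w epowr (- (q / p)) * V r v y (\<tau> (j + 1)) epowr q) \<le> C epowr q"
            by (simp add: ac_simps)
        qed
        also have "\<dots> < top" using C q by (intro epowr_finite) auto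
        finally have Zfin: "Z j < top" by (auto simp: ennreal_mult_less_top)
        have ne: "einterval a (\<tau> (j + 1)) \<noteq> {}" using einterval_nonempty[of a "\<tau> (j + 1)"] at by auto
        obtain y where y: "y \<in> einterval a (\<tau> (j + 1))"
          "Z j \<le> p2 1 * (integ y b w epowr (- (q / p)) * V r v y (\<tau> (j + 1)) epowr q)"
          using SUP_half_attain[OF ne Zfin[unfolded Z_def]] unfolding Z_def by blast
        have y': "a < y" "y < \<tau> (j + 1)" "ereal y < b"
          using sub(3)[of "j + 1"] y by (auto simp: einterval_iff intro: ereal_real_trans(3)[OF _ less_imp_le])
        obtain g where g: "g \<in> unit_ball y (\<tau> (j + 1))" "V r v y (\<tau> (j + 1)) epowr r \<le> p2 1 * inner g y (\<tau> (j + 1))"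
          using unit_ball_half[OF less_imp_le[OF y'(1)] sub(3) w_fin[OF y'(1,3)]] by blast
        have "V r v y (\<tau> (j + 1)) epowr q = (V r v y (\<tau> (j + 1)) epowr r) epowr (q / r)"
          using r by (simp add: epowr_epowr)
        also have "\<dots> \<le> (p2 1 * inner g y (\<tau> (j + 1))) epowr (q / r)"
          using g(2) qr by (intro epowr_mono) auto
        also have "\<dots> = p2 (q / r) * inner g y (\<tau> (j + 1)) epowr (q / r)"
          using qr by (simp add: epowr_mult p2_epowr)
        finally have "p2 1 * (integ y b w epowr (- (q / p)) * V r v y (\<tau> (j + 1)) epowr q)
          \<le> p2 1 * (integ y b w epowr (- (q / p)) * (p2 (q / r) * inner g y (\<tau> (j + 1)) epowr (q / r)))"
          by (intro mult_left_mono) auto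
        also have "\<dots> = p2 (1 + q / r) * integ y b w epowr (- (q / p)) * inner g y (\<tau> (j + 1)) epowr (q / r)"
          by (simp only: p2_add[symmetric] ac_simps)
        finally have "Z j \<le> p2 (1 + q / r) * integ y b w epowr (- (q / p)) * inner g y (\<tau> (j + 1)) epowr (q / r)"
          by (rule order_trans[OF y(2)])
        then show ?thesis using y'(1,3) g(1) by blast
      qed
      then have "\<forall>j. \<exists>z. \<tau> j < \<tau> (j + 1) \<longrightarrow> a < fst z \<and> ereal (fst z) < b \<and> snd z \<in> unit_ball (fst z) (\<tau> (j + 1)) \<and>
        Z j \<le> p2 (1 + q / r) * integ (fst z) b w epowr (- (q / p)) * inner (snd z) (fst z) (\<tau> (j + 1)) epowr (q / r)"
        by (simp only: split_paired_Ex fst_conv snd_conv) blast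
      from choice[OF this] obtain z where z: "\<forall>j. \<tau> j < \<tau> (j + 1) \<longrightarrow>
        a < fst (z j) \<and> ereal (fst (z j)) < b \<and> snd (z j) \<in> unit_ball (fst (z j)) (\<tau> (j + 1)) \<and>
        Z j \<le> p2 (1 + q / r) * integ (fst (z j)) b w epowr (- (q / p)) * inner (snd (z j)) (fst (z j)) (\<tau> (j + 1)) epowr (q / r)" ..
      define ys gs where "ys j = fst (z j)" and "gs j = snd (z j)" for j
      have yg: "a < ys j \<and> ereal (ys j) < b \<and> gs j \<in> unit_ball (ys j) (\<tau> (j + 1)) \<and>
        Z j \<le> p2 (1 + q / r) * integ (ys j) b w epowr (- (q / p)) * inner (gs j) (ys j) (\<tau> (j + 1)) epowr (q / r)"
        if "\<tau> j < \<tau> (j + 1)" for j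
        unfolding ys_def gs_def using z that by blast
      \<comment> \<open>Chosen so that c_j^p times the tail of w at \<open>ys j\<close> equals A_j.
        Each summand of f then contributes at most A_j to the right-hand side.\<close>
      define c where "c j = (A j * integ (ys j) b w epowr (-1)) epowr (1 / p)" for j
      define h where "h j s = (if \<tau> j < \<tau> (j + 1) then c j * gs j s else 0)" for j s
      have hm[measurable]: "h j \<in> borel_measurable L" for j
        unfolding h_def using yg[of j] unit_ballD(1)[of "gs j"] by (cases "\<tau> j < \<tau> (j + 1)") auto
      define f where "f s = isum UNIV (\<lambda>j. h j s)" for s
      have fm: "f \<in> borel_measurable L" unfolding f_def by measurable
      have "R f \<le> isum UNIV A"
      proof -
        have "integ a t f epowr p * w t \<le> isum UNIV (\<lambda>j. (if \<tau> j < \<tau> (j + 1) then c j epowr p * (indicator {ys j<..} t * w t) else 0))"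
          if t: "t \<in> einterval a b" for t
        proof -
          have tb: "ereal t \<le> b" using t by (auto simp: einterval_iff)
          have "integ a t f = isum UNIV (\<lambda>j. integ a t (h j))"
            unfolding f_def using tb by (intro integ_isum hm) auto
          also have "\<dots> \<le> isum UNIV (\<lambda>j. (if \<tau> j < \<tau> (j + 1) then c j * indicator {ys j<..} t else 0))"
          proof (rule isum_mono)
            fix j
            show "integ a t (h j) \<le> (if \<tau> j < \<tau> (j + 1) then c j * indicator {ys j<..} t else 0)"
            proof (cases "\<tau> j < \<tau> (j + 1)")
              case True
              note y = yg[OF True]
              have gm: "gs j \<in> borel_measurable L" using y unit_ballD(1) by blast
              have "integ a t (h j) = integ a t (\<lambda>s. c j * gs j s)"
                using True by (simp add: h_def)
              also have "\<dots> = c j * integ a t (gs j)"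
                using tb by (intro integ_cmult gm) auto
              also have "\<dots> \<le> c j * indicator {ys j<..} t"
                using unit_ball_integ_le[of "gs j" "ys j" "\<tau> (j + 1)" t] y sub by (intro mult_left_mono) (auto split: if_splits)
              finally show ?thesis using True by simp
            qed (simp add: h_def)
          qed
          finally have "integ a t f epowr p \<le> isum UNIV (\<lambda>j. (if \<tau> j < \<tau> (j + 1) then c j * indicator {ys j<..} t else 0)) epowr p"
            using p by (intro epowr_mono) auto
          also have "\<dots> \<le> isum UNIV (\<lambda>j. (if \<tau> j < \<tau> (j + 1) then c j * indicator {ys j<..} t else 0) epowr p)"
            using p p1 by (rule nn_integral_epowr_subadd)
          also have "\<dots> = isum UNIV (\<lambda>j. (if \<tau> j < \<tau> (j + 1) then c j epowr p * indicator {ys j<..} t else 0))"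
            using p by (intro isum_cong) (auto split: split_indicator)
          finally have "integ a t f epowr p * w t \<le> isum UNIV (\<lambda>j. (if \<tau> j < \<tau> (j + 1) then c j epowr p * indicator {ys j<..} t else 0)) * w t"
            by (rule mult_right_mono) simp
          also have "\<dots> = isum UNIV (\<lambda>j. (if \<tau> j < \<tau> (j + 1) then c j epowr p * (indicator {ys j<..} t * w t) else 0))"
            unfolding isum_multc[symmetric] by (intro isum_cong) (auto simp: mult.assoc)
          finally show ?thesis .
        qed
        then have "R f \<le> integ a b (\<lambda>t. isum UNIV (\<lambda>j. (if \<tau> j < \<tau> (j + 1) then c j epowr p * (indicator {ys j<..} t * w t) else 0)))"
          unfolding R_def by (rule integ_mono)
        also have "\<dots> = isum UNIV (\<lambda>j. integ a b (\<lambda>t. if \<tau> j < \<tau> (j + 1) then c j epowr p * (indicator {ys j<..} t * w t) else 0))"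
        proof (rule integ_isum)
          fix j
          have "indicator {ys j<..} \<in> borel_measurable L"
            by (intro measurable_restrict_space1 measurable_completion) simp
          then show "(\<lambda>t. if \<tau> j < \<tau> (j + 1) then c j epowr p * (indicator {ys j<..} t * w t) else 0) \<in> borel_measurable L"
            by measurable
        qed auto
        also have "\<dots> \<le> isum UNIV A"
        proof (rule isum_mono)
          fix j
          show "integ a b (\<lambda>t. if \<tau> j < \<tau> (j + 1) then c j epowr p * (indicator {ys j<..} t * w t) else 0) \<le> A j"
          proof (cases "\<tau> j < \<tau> (j + 1)")
            case True
            note y = yg[OF True]
            have [measurable]: "indicator {ys j<..} \<in> borel_measurable L"
              by (intro measurable_restrict_space1 measurable_completion) simp
            have "(\<lambda>t. indicator {ys j<..} t * w t) \<in> borel_measurable L" by measurable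
            then have "integ a b (\<lambda>t. c j epowr p * (indicator {ys j<..} t * w t)) = c j epowr p * integ a b (\<lambda>t. indicator {ys j<..} t * w t)"
              by (rule integ_cmult) auto
            also have "\<dots> \<le> c j epowr p * integ (ys j) b w"
              using y by (intro mult_left_mono indicator_w_integ) auto
            also have "\<dots> = A j * (integ (ys j) b w epowr (-1) * integ (ys j) b w epowr 1)"
              unfolding c_def using p by (simp add: epowr_epowr mult.assoc)
            also have "integ (ys j) b w epowr (-1) * integ (ys j) b w epowr 1 = 1"
              using y w_integ_pos w_fin by (intro epowr_minus) auto
            finally show ?thesis using True by simp
          qed simp
        qed
        finally show ?thesis .
      qed
      then have R1: "R f \<le> 1" using A(2) by (rule order_trans)
      define G where "G j = (if \<tau> j < \<tau> (j + 1) then c j epowr r * inner (gs j) (ys j) (\<tau> (j + 1)) else 0)" for j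
      have "isum UNIV (\<lambda>j. Y j * A j epowr (q / p)) \<le> isum UNIV (\<lambda>j. p2 (1 + q / r) * (p2 (- real_of_int j) * G j epowr (q / r)))"
      proof (rule isum_mono)
        fix j
        show "Y j * A j epowr (q / p) \<le> p2 (1 + q / r) * (p2 (- real_of_int j) * G j epowr (q / r))"
        proof (cases "\<tau> j < \<tau> (j + 1)")
          case True
          let ?W = "integ (ys j) b w"
          have "G j epowr (q / r) = c j epowr q * inner (gs j) (ys j) (\<tau> (j + 1)) epowr (q / r)"
            using True r q by (simp add: G_def epowr_mult epowr_epowr)
          also have "c j epowr q = A j epowr (q / p) * ?W epowr (- (q / p))"
            unfolding c_def using p q by (simp add: epowr_epowr epowr_mult)
          finally have G: "G j epowr (q / r) = A j epowr (q / p) * ?W epowr (- (q / p)) * inner (gs j) (ys j) (\<tau> (j + 1)) epowr (q / r)" .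
          have "Y j * A j epowr (q / p) = p2 (- real_of_int j) * A j epowr (q / p) * Z j"
            using True by (simp add: Y_def ac_simps)
          also have "\<dots> \<le> p2 (- real_of_int j) * A j epowr (q / p) * (p2 (1 + q / r) * ?W epowr (- (q / p)) * inner (gs j) (ys j) (\<tau> (j + 1)) epowr (q / r))"
            using yg[OF True] by (intro mult_left_mono) auto
          also have "\<dots> = p2 (1 + q / r) * (p2 (- real_of_int j) * G j epowr (q / r))"
            unfolding G by (simp only: ac_simps)
          finally show ?thesis .
        qed (simp add: Y_def)
      qed
      also have "\<dots> = p2 (1 + q / r) * isum UNIV (\<lambda>j. p2 (- real_of_int j) * G j epowr (q / r))" by (rule isum_cmult)
      also have "\<dots> \<le> p2 (1 + q / r) * (p2 2 * outer f a b)"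
      proof (intro mult_left_mono outer_ge_levels[OF dt])
        fix j assume T: "\<tau> j < \<tau> (j + 1)"
        note y = yg[OF T]
        have gm: "gs j \<in> borel_measurable L" using y unit_ballD(1) by blast
        have "G j = c j epowr r * inner (gs j) (ys j) (\<tau> (j + 1))" using T by (simp add: G_def)
        also have "\<dots> = inner (\<lambda>s. c j * gs j s) (ys j) (\<tau> (j + 1))"
          using y gm sub by (intro inner_cmult[symmetric]) auto
        also have "\<dots> \<le> inner f (ys j) (\<tau> (j + 1))"
        proof (rule inner_mono)
          fix s
          have "c j * gs j s = h j s" using T by (simp add: h_def)
          also have "\<dots> \<le> f s" unfolding f_def by (rule isum_point) simp
          finally show "c j * gs j s \<le> f s" .
        qed
        also have "\<dots> \<le> inner f a (\<tau> (j + 1))" using y by (intro inner_subset) auto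
        finally show "G j \<le> inner f a (\<tau> (j + 1))" .
      qed (auto simp: G_def)
      also have "\<dots> \<le> p2 (1 + q / r) * (p2 2 * (C epowr q * 1 epowr (q / p)))"
      proof (intro mult_left_mono)
        have "outer f a b \<le> C epowr q * R f epowr (q / p)" by (rule outer_le[OF fm])
        also have "\<dots> \<le> C epowr q * 1 epowr (q / p)" using R1 p q by (intro mult_left_mono epowr_mono) auto
        finally show "outer f a b \<le> C epowr q * 1 epowr (q / p)" .
      qed auto
      also have "\<dots> \<le> p2 (4 + q / r) * C epowr q"
        by (simp add: p2_add_left mult_right_mono)
      finally show "isum UNIV (\<lambda>j. Y j * A j epowr (q / p)) \<le> p2 (4 + q / r) * C epowr q" .
    qed (use p q in simp)
    then have "isum UNIV (\<lambda>j. Y j epowr ?k) epowr ((p - q) / p) \<le> p2 (4 + q / r) * C epowr q"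
      unfolding dual_eq[OF q qp] .
    then have "isum UNIV (\<lambda>j. Y j epowr ?k) \<le> (p2 (4 + q / r) * C epowr q) epowr (1 / ((p - q) / p))"
      by (rule epowr_le_iff[THEN iffD1, rotated]) (use qp p in simp)
    then show ?thesis by simp
  qed
  finally show ?thesis by (simp add: mult_left_mono)
qed

end

section \<open>Necessity of C5 and C7\<close>

locale necessity_dyadic = necessity +
  fixes x :: "int \<Rightarrow> real" and \<tau> :: "int \<Rightarrow> real"
  assumes dx: "dyadic w a b x" and dt: "dyadic u a b \<tau>"
begin

lemmas px = dyadicD(1)[OF dx] and pt = dyadicD(1)[OF dt]

lemma x_bounds: "a \<le> x k" "ereal (x k) < b" "x k \<le> x (k + 1)" "ereal a \<le> x k" "ereal (x k) \<le> b"
  using partition_bounds[OF px, of k] by auto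

lemma t_bounds: "a \<le> \<tau> k" "ereal (\<tau> k) < b" "\<tau> k \<le> \<tau> (k + 1)" "ereal a \<le> \<tau> k" "ereal (\<tau> k) \<le> b"
  using partition_bounds[OF pt, of k] by auto

lemma W_x: "integ (x k) b w \<le> p2 (1 - real_of_int k)" "integ (x k) b w < top"
  using dyadicD(3)[OF dx, of k] p2_finite[of "1 - real_of_int k"] by (auto intro: le_less_trans)

text \<open>The discrete form of the quantity in \<open>J57\<close> for y in block i and the outer
  variable in block i + n. B replaces E because it is a supremum over test functions.\<close>

definition YB :: "nat \<Rightarrow> int \<Rightarrow> ennreal" where
  "YB n i = (if x i < x (i + 1) then p2 (real_of_int i * (q / p)) * B (x i) (x (i + 1 + int n)) else 0)"

text \<open>Apart from the points of the partition, each point lies in n + 1 of the intervals; the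
  proof adds one block at a time.\<close>

lemma overlap_sum:
  assumes h: "h \<in> borel_measurable L"
  shows "isum UNIV (\<lambda>i. integ (x i) (x (i + 1 + int n)) h) = of_nat (n + 1) * integ a b h"
proof (induction n)
  case 0
  show ?case using partition_integ[OF px _ _ h] by simp
next
  case (Suc n)
  have "integ (x i) (x (i + 1 + int (Suc n))) h = integ (x i) (x (i + 1 + int n)) h + integ (x (i + (1 + int n))) (x (i + (1 + int n) + 1)) h" for i
  proof -
    have eq: "i + 1 + int (Suc n) = i + 1 + int n + 1" by simp
    have "x i \<le> x (i + 1 + int n)" by (rule partition_mono[OF px]) simp
    then have "integ (x i) (x (i + 1 + int n + 1)) h = integ (x i) (x (i + 1 + int n)) h + integ (x (i + 1 + int n)) (x (i + 1 + int n + 1)) h"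
      using x_bounds(2,4,5) x_bounds(3)[of "i + 1 + int n"] by (intro integ_split h) auto
    then show ?thesis unfolding eq by (simp add: add.assoc)
  qed
  then have "isum UNIV (\<lambda>i. integ (x i) (x (i + 1 + int (Suc n))) h)
    = of_nat (n + 1) * integ a b h + isum UNIV (\<lambda>i. integ (x (i + (1 + int n))) (x (i + (1 + int n) + 1)) h)"
    by (simp add: isum_add Suc)
  also have "isum UNIV (\<lambda>i. integ (x (i + (1 + int n))) (x (i + (1 + int n) + 1)) h) = integ a b h"
    using isum_shift[of "\<lambda>i. integ (x i) (x (i + 1)) h" "1 + int n"] partition_integ[OF px _ _ h] by simp
  finally show ?case by (simp add: distrib_right)
qed

text \<open>The test function combines near-extremal functions for B on intervals of n + 1 blocks,
  with coefficients such that 2^-i c_i^p = A_i. On the right the overlap costs nothing, by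
  \<open>R_le_unit_balls\<close>; on the left each point is counted n + 1 times.\<close>

lemma YB_dual_le: "dual (q / p) UNIV (YB n) \<le> of_nat (n + 1) * (p2 1 * cR epowr (q / p) * C epowr q)"
proof (rule dual_converse)
  fix A :: "int \<Rightarrow> ennreal" assume A: "\<And>i. A i < top" "isum UNIV A \<le> 1"
  let ?y = "\<lambda>i. x (i + 1 + int n)"
  have "\<exists>g. g \<in> unit_ball (x i) (?y i) \<and> B (x i) (?y i) \<le> p2 1 * outer g (x i) (?y i)" for i
  proof -
    have "B (x i) (?y i) \<le> B (x i) b" using x_bounds by (intro B_mono) auto
    also have "\<dots> \<le> C epowr q * integ (x i) b w epowr (q / p)" using x_bounds by (intro B_le)
    also have "\<dots> < top" using C W_x(2) p q by (auto simp: ennreal_mult_less_top intro!: epowr_finite)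
    finally have fin: "(SUP f\<in>unit_ball (x i) (?y i). outer f (x i) (?y i)) < top" by (simp add: B_def)
    show ?thesis
      using SUP_half_attain[OF unit_ball_nonempty fin] by (auto simp: B_def)
  qed
  then obtain g where g: "\<And>i. g i \<in> unit_ball (x i) (?y i)" "\<And>i. B (x i) (?y i) \<le> p2 1 * outer (g i) (x i) (?y i)"
    by metis
  have gm[measurable]: "g i \<in> borel_measurable L" for i using unit_ballD(1)[OF g(1)] .
  define c where "c i = (p2 (real_of_int i) * A i) epowr (1 / p)" for i
  define f where "f s = isum UNIV (\<lambda>i. c i * g i s)" for s
  have fm: "f \<in> borel_measurable L" unfolding f_def by measurable
  have cp: "p2 (- real_of_int k) * c k epowr p = A k" for k
    unfolding c_def using p by (simp add: epowr_epowr p2_add_left)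
  have "R f \<le> cR * isum UNIV (\<lambda>k. p2 (- real_of_int k) * c k epowr p)"
    unfolding f_def
  proof (rule R_le_unit_balls[OF dx])
    show "g i \<in> unit_ball (x i) b" for i using g(1) by (rule unit_ball_mono) (use x_bounds in auto)
  qed
  also have "\<dots> \<le> cR * 1" unfolding cp using A(2) by (rule mult_left_mono) simp
  finally have Rf: "R f \<le> cR" by simp
  have "isum UNIV (\<lambda>i. YB n i * A i epowr (q / p)) \<le> isum UNIV (\<lambda>i. p2 1 * outer f (x i) (?y i))"
  proof (rule isum_mono)
    fix i
    have "YB n i * A i epowr (q / p) \<le> (p2 (real_of_int i * (q / p)) * A i epowr (q / p)) * B (x i) (?y i)"
      by (simp add: YB_def ac_simps)
    also have "p2 (real_of_int i * (q / p)) * A i epowr (q / p) = c i epowr q"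
      unfolding c_def using p q by (simp add: epowr_epowr epowr_mult p2_epowr)
    also have "c i epowr q * B (x i) (?y i) \<le> c i epowr q * (p2 1 * outer (g i) (x i) (?y i))"
      using g(2) by (rule mult_left_mono) simp
    also have "\<dots> = p2 1 * outer (\<lambda>s. c i * g i s) (x i) (?y i)"
      using x_bounds by (subst outer_cmult) (auto simp: ac_simps)
    also have "\<dots> \<le> p2 1 * outer f (x i) (?y i)"
      unfolding f_def by (intro mult_left_mono outer_mono isum_point) auto
    finally show "YB n i * A i epowr (q / p) \<le> p2 1 * outer f (x i) (?y i)" .
  qed
  also have "\<dots> = p2 1 * isum UNIV (\<lambda>i. outer f (x i) (?y i))" by (rule isum_cmult)
  also have "\<dots> \<le> p2 1 * isum UNIV (\<lambda>i. integ (x i) (?y i) (\<lambda>t. inner f a t epowr (q / r) * u t))"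
    unfolding outer_def using x_bounds qr
    by (intro mult_left_mono isum_mono integ_mono mult_right_mono epowr_mono inner_subset) auto
  also have "isum UNIV (\<lambda>i. integ (x i) (?y i) (\<lambda>t. inner f a t epowr (q / r) * u t)) = of_nat (n + 1) * outer f a b"
  proof -
    have "(\<lambda>t. inner f a t epowr (q / r) * u t) \<in> borel_measurable L"
      using inner_measurable[of f a] by measurable
    then show ?thesis unfolding outer_def by (rule overlap_sum)
  qed
  also have "p2 1 * (of_nat (n + 1) * outer f a b) \<le> p2 1 * (of_nat (n + 1) * (C epowr q * cR epowr (q / p)))"
  proof (intro mult_left_mono)
    have "outer f a b \<le> C epowr q * R f epowr (q / p)" by (rule outer_le[OF fm])
    also have "\<dots> \<le> C epowr q * cR epowr (q / p)" using Rf p q by (intro mult_left_mono epowr_mono) auto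
    finally show "outer f a b \<le> C epowr q * cR epowr (q / p)" .
  qed auto
  finally show "isum UNIV (\<lambda>i. YB n i * A i epowr (q / p)) \<le> of_nat (n + 1) * (p2 1 * cR epowr (q / p) * C epowr q)"
    by (simp add: ac_simps)
qed (use p q in simp)

lemma YB_sum_le:
  assumes qp: "q < p"
  shows "isum UNIV (\<lambda>i. YB n i epowr (p / (p - q)))
    \<le> of_nat (n + 1) epowr (p / (p - q)) * (p2 1 * cR epowr (q / p) * C epowr q) epowr (p / (p - q))"
proof -
  have "isum UNIV (\<lambda>i. YB n i epowr (p / (p - q))) epowr ((p - q) / p) \<le> of_nat (n + 1) * (p2 1 * cR epowr (q / p) * C epowr q)"
    using YB_dual_le[of n] unfolding dual_eq[OF q qp] .
  then have "isum UNIV (\<lambda>i. YB n i epowr (p / (p - q))) \<le> (of_nat (n + 1) * (p2 1 * cR epowr (q / p) * C epowr q)) epowr (1 / ((p - q) / p))"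
    by (rule epowr_le_iff[THEN iffD1, rotated]) (use qp p in simp)
  then show ?thesis using qp p by (simp add: epowr_mult)
qed

lemma W_power_le:
  assumes "x i < y" "y \<le> x (i + 1)" "0 \<le> e"
  shows "integ y b w epowr (- e) \<le> p2 ((real_of_int i + 1) * e)"
proof -
  have "integ y b w epowr (- e) \<le> p2 (- real_of_int i - 1) epowr (- e)"
    using assms dyadic_block(1)[OF dx, of i y] by (intro epowr_antimono) auto
  also have "\<dots> = p2 ((real_of_int i + 1) * e)" by (simp add: p2_epowr algebra_simps)
  finally show ?thesis .
qed

text \<open>The supremum over y is replaced by a sum over the blocks i that may contain y. With the
  outer variable in block m = i + n and k = p/(p-q), the weights 2^(i k) 2^-m equal 2^-n 2^(i
  (k-1)), so for each n the sum over i is that of \<open>YB_sum_le\<close>, and the decay 2^-n beats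
  its factor (n + 1)^k.\<close>

lemma J57_le:
  assumes qp: "q < p"
  defines "k \<equiv> p / (p - q)"
  shows "J57 \<le> p2 (1 + k + (4 + q / r) * k) * polygeo k * (p2 1 * cR epowr (q / p) * C epowr q) epowr k"
proof -
  let ?s = "p * q / (p - q)"
  have k: "0 < k" "0 < ?s" "q * k = ?s" "q / p * k = k - 1"
    using qp p q by (auto simp: k_def field_simps)
  define g where "g i m = (if x i < x (i + 1) then p2 ((real_of_int i + 1) * k) * E (x i) (x (m + 1)) epowr ?s else 0)" for i m
  have "J57 \<le> isum UNIV (\<lambda>m. isum {..m} (\<lambda>i. g i m) * integ (x m) (x (m + 1)) w)"
    unfolding J57_def
  proof (rule partition_upper[OF px _ _ w])
    fix m t assume t: "x m < t" "t < x (m + 1)"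
    have "(SUP y\<in>einterval a t. integ y b w epowr (- k) * E y t epowr ?s) \<le> isum {..m} (\<lambda>i. g i m)"
    proof (rule SUP_least)
      \<comment> \<open>The partition starts at a itself, unlike in the sufficiency part, so every y
        lies in some block.\<close>
      fix y assume "y \<in> einterval a t"
      then have y: "a < y" "y < t" by (auto simp: einterval_iff)
      have "y \<le> x (m + 1)" using t y by simp
      with x_bounds(2)[of "m + 1"] have "ereal y < b" by (rule ereal_real_trans(3))
      then obtain i where i: "x i < y" "y \<le> x (i + 1)" using partition_obtain[OF px y(1)] by blast
      then have im: "i \<le> m" using y t by (intro partition_index_le[OF px, of i y m]) auto
      have "integ y b w epowr (- k) * E y t epowr ?s \<le> p2 ((real_of_int i + 1) * k) * E (x i) (x (m + 1)) epowr ?s"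
        using i y t k x_bounds by (intro mult_mono W_power_le epowr_mono E_mono) auto
      also have "\<dots> = g i m" using i by (simp add: g_def)
      also have "\<dots> \<le> isum {..m} (\<lambda>i. g i m)" using im by (intro isum_point) auto
      finally show "integ y b w epowr (- k) * E y t epowr ?s \<le> isum {..m} (\<lambda>i. g i m)" .
    qed
    then have "w t * (SUP y\<in>einterval a t. integ y b w epowr (- k) * E y t epowr ?s) \<le> w t * isum {..m} (\<lambda>i. g i m)"
      by (rule mult_left_mono) simp
    then show "w t * (SUP y\<in>einterval a t. integ y b w epowr (- (p / (p - q))) * E y t epowr ?s) \<le> isum {..m} (\<lambda>i. g i m) * w t"
      unfolding k_def by (simp only: mult.commute)
  qed auto
  also have "\<dots> \<le> isum UNIV (\<lambda>m. (\<Sum>n. g (m - int n) m) * p2 (1 - real_of_int m))"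
    unfolding isum_atMost using dyadic_block_mass[OF dx] by (intro isum_mono mult_left_mono) auto
  also have "\<dots> = isum UNIV (\<lambda>m. (\<Sum>n. g (m - int n) m * p2 (1 - real_of_int m)))"
    by simp
  also have "\<dots> = (\<Sum>n. isum UNIV (\<lambda>m. g (m - int n) m * p2 (1 - real_of_int m)))"
    by (rule isum_nat_swap)
  also have "\<dots> = (\<Sum>n. isum UNIV (\<lambda>i. g i (i + int n) * p2 (1 - real_of_int (i + int n))))"
  proof (intro suminf_cong)
    fix n
    show "isum UNIV (\<lambda>m. g (m - int n) m * p2 (1 - real_of_int m)) = isum UNIV (\<lambda>i. g i (i + int n) * p2 (1 - real_of_int (i + int n)))"
      using isum_shift[of "\<lambda>m. g (m - int n) m * p2 (1 - real_of_int m)" "int n"] by simp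
  qed
  also have "\<dots> \<le> (\<Sum>n. (p2 (1 + k + (4 + q / r) * k) * (p2 1 * cR epowr (q / p) * C epowr q) epowr k) * (p2 (- real n) * of_nat (n + 1) epowr k))"
  proof (intro suminf_le)
    fix n
    have "isum UNIV (\<lambda>i. g i (i + int n) * p2 (1 - real_of_int (i + int n)))
      \<le> isum UNIV (\<lambda>i. p2 (1 + k + (4 + q / r) * k - real n) * YB n i epowr k)"
    proof (rule isum_mono)
      fix i
      show "g i (i + int n) * p2 (1 - real_of_int (i + int n)) \<le> p2 (1 + k + (4 + q / r) * k - real n) * YB n i epowr k"
      proof (cases "x i < x (i + 1)")
        case True
        let ?y = "x (i + 1 + int n)"
        have y: "x (i + int n + 1) = ?y" by (simp add: ac_simps)
        have "E (x i) ?y epowr q \<le> p2 (4 + q / r) * B (x i) ?y"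
        proof (rule Hardy_lower)
          fix t assume "x i < t" "ereal t < ereal ?y"
          then have "a < t" "ereal t < b" using x_bounds(1)[of i] x_bounds(2)[of "i + 1 + int n"]
            by (auto intro: ereal_real_trans(3)[OF _ less_imp_le])
          then have "integ t b u < top" by (rule u_fin)
          moreover have "integ t ?y u \<le> integ t b u" using x_bounds by (intro integ_subset) auto
          ultimately show "integ t ?y u < top" by (rule le_less_trans[rotated])
        qed (use x_bounds in auto)
        then have "(E (x i) ?y epowr q) epowr k \<le> (p2 (4 + q / r) * B (x i) ?y) epowr k"
          using k by (intro epowr_mono) auto
        then have Ek: "E (x i) ?y epowr ?s \<le> p2 ((4 + q / r) * k) * B (x i) ?y epowr k"
          using k by (simp add: epowr_epowr epowr_mult p2_epowr)
        have "g i (i + int n) * p2 (1 - real_of_int (i + int n)) = p2 ((real_of_int i + 1) * k + (1 - real_of_int i - real n)) * E (x i) ?y epowr ?s"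
          using True y by (simp add: g_def p2_add[symmetric] ac_simps) (simp add: p2_add algebra_simps)
        also have "\<dots> \<le> p2 ((real_of_int i + 1) * k + (1 - real_of_int i - real n)) * (p2 ((4 + q / r) * k) * B (x i) ?y epowr k)"
          using Ek by (rule mult_left_mono) simp
        also have "\<dots> = p2 ((1 + k + (4 + q / r) * k - real n) + real_of_int i * (k - 1)) * B (x i) ?y epowr k"
          by (simp add: p2_add_left algebra_simps)
        also have "\<dots> = p2 (1 + k + (4 + q / r) * k - real n) * YB n i epowr k"
        proof -
          have "real_of_int i * (q / p) * k = real_of_int i * (k - 1)"
            unfolding k(4)[symmetric] by (simp only: mult.assoc)
          then show ?thesis
            using True unfolding YB_def by (simp only: if_True epowr_mult[OF less_imp_le[OF k(1)]] p2_epowr p2_add_left)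
        qed
        finally show ?thesis .
      qed (simp add: g_def)
    qed
    also have "\<dots> \<le> p2 (1 + k + (4 + q / r) * k - real n) * (of_nat (n + 1) epowr k * (p2 1 * cR epowr (q / p) * C epowr q) epowr k)"
      unfolding isum_cmult k_def by (intro mult_left_mono YB_sum_le qp) auto
    also have "p2 (1 + k + (4 + q / r) * k - real n) = p2 (1 + k + (4 + q / r) * k) * p2 (- real n)"
      by (simp add: p2_add)
    finally show "isum UNIV (\<lambda>i. g i (i + int n) * p2 (1 - real_of_int (i + int n)))
      \<le> (p2 (1 + k + (4 + q / r) * k) * (p2 1 * cR epowr (q / p) * C epowr q) epowr k) * (p2 (- real n) * of_nat (n + 1) epowr k)"
      by (simp only: ac_simps)
  qed auto
  also have "\<dots> = (p2 (1 + k + (4 + q / r) * k) * (p2 1 * cR epowr (q / p) * C epowr q) epowr k) * polygeo k"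
    by (simp add: polygeo_def)
  finally show ?thesis by (simp only: ac_simps)
qed

end

context three_weights
begin

definition cL :: ennreal where
  "cL = p2 (1 + p / (p - r)) * GH (p / (p - r) - 1) (p * r / (p - r) / rho)"

definition A6 :: ennreal where
  "A6 = p2 (2 * (p / (p - q))) * (GH (p / (p - q)) (q * (p - r) / (r * (p - q))) *
    (p2 (2 + 2 * q / r) * cR epowr (q / p)) epowr (p / (p - q)))"

text \<open>The three summands in the last bracket belong to the blocks before the one containing y,
  to the part of that block where u inside the block dominates, and to the part where the tail of u
  beyond the block dominates.\<close>

definition K6 :: ennreal where
  "K6 = p2 2 * GH 1 1 * geo 1 * (cL epowr (q * (p - r) / (r * (p - q))) * p2 (q * (p - r) / (r * (p - q)) + 1) *
    (A6 + (p2 (q / (p - q)) * (p2 1 * cR epowr (q / p)) epowr (p / (p - q)) + A6)))"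

end

section \<open>Necessity of C3 and boundedness of the discrete global constant\<close>

context necessity_dyadic
begin

definition bz :: "real \<Rightarrow> int \<Rightarrow> ennreal" where
  "bz z i = p2 (real_of_int i / p) * V r v (x i) (min (x (i + 1)) z)"

text \<open>V from a block up to z involves all the blocks between. \<open>V_rho_subadditive\<close>
  bounds it by a sum over these, and since the weights 2^(k (e-1)) with e = p/(p-r) > 1 increase
  with k, the dual geometric Hardy inequality leaves only the value of each block itself.\<close>

lemma TT_le:
  assumes rp: "r < p" and z: "a \<le> z" "ereal z < b"
  shows "TT z \<le> cL * isum UNIV (\<lambda>i. bz z i epowr (p * r / (p - r)))"
proof -
  let ?e = "p / (p - r)" and ?t = "p * r / (p - r)"
  have e: "0 < ?e" "0 < ?t" "?t / p = ?e - 1" using rp p r by (auto simp: field_simps)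
  have e1: "0 < ?e - 1" using rp r p by (simp add: field_simps)
  let ?V = "\<lambda>j. V r v (x j) (min (x (j + 1)) z)"
  have "TT z \<le> integ a b (\<lambda>t. integ t b w epowr (- ?e) * w t * V r v t z epowr ?t * indicator {..<z} t)"
    unfolding TT_def using z
    by (intro nn_integral_mono) (auto simp: einterval_iff intro: ereal_real_trans(3)[OF _ less_imp_le] split: split_indicator)
  also have "\<dots> \<le> isum UNIV (\<lambda>k. (p2 ((real_of_int k + 1) * ?e) * V r v (x k) z epowr ?t) * integ (x k) (x (k + 1)) w)"
  proof (rule partition_upper[OF px _ _ w])
    fix k t assume t: "x k < t" "t < x (k + 1)"
    have "integ t b w epowr (- ?e) \<le> p2 ((real_of_int k + 1) * ?e)"
      using t e by (intro W_power_le) auto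
    moreover have "V r v t z \<le> V r v (x k) z"
      using t z x_bounds by (intro V_mono) auto
    ultimately have "integ t b w epowr (- ?e) * V r v t z epowr ?t * w t
      \<le> p2 ((real_of_int k + 1) * ?e) * V r v (x k) z epowr ?t * w t"
      using e by (intro mult_right_mono mult_mono epowr_mono) auto
    then have "integ t b w epowr (- ?e) * w t * V r v t z epowr ?t
      \<le> p2 ((real_of_int k + 1) * ?e) * V r v (x k) z epowr ?t * w t" by (simp only: ac_simps)
    then show "integ t b w epowr (- ?e) * w t * V r v t z epowr ?t * indicator {..<z} t
      \<le> p2 ((real_of_int k + 1) * ?e) * V r v (x k) z epowr ?t * w t" by (auto split: split_indicator)
  qed auto
  also have "\<dots> \<le> isum UNIV (\<lambda>k. p2 (1 + ?e) * (p2 ((?e - 1) * real_of_int k) * isum {k..} (\<lambda>j. ?V j epowr rho) epowr (?t / rho)))"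
  proof (rule isum_mono)
    fix k
    have "V r v (x k) z epowr ?t = (V r v (x k) z epowr rho) epowr (?t / rho)"
      using rho_pos by (simp add: epowr_epowr)
    also have "\<dots> \<le> isum {k..} (\<lambda>j. ?V j epowr rho) epowr (?t / rho)"
      using z by (intro epowr_mono V_rho_subadditive[OF px] less_imp_le[OF divide_pos_pos[OF e(2) rho_pos]]) auto
    finally have V: "V r v (x k) z epowr ?t \<le> isum {k..} (\<lambda>j. ?V j epowr rho) epowr (?t / rho)" .
    have "(p2 ((real_of_int k + 1) * ?e) * V r v (x k) z epowr ?t) * integ (x k) (x (k + 1)) w
      \<le> (p2 ((real_of_int k + 1) * ?e) * isum {k..} (\<lambda>j. ?V j epowr rho) epowr (?t / rho)) * p2 (1 - real_of_int k)"
      using V dyadic_block_mass[OF dx, of k] by (intro mult_mono) auto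
    also have "\<dots> = p2 ((real_of_int k + 1) * ?e + (1 - real_of_int k)) * isum {k..} (\<lambda>j. ?V j epowr rho) epowr (?t / rho)"
      by (simp only: p2_add[symmetric] ac_simps)
    also have "(real_of_int k + 1) * ?e + (1 - real_of_int k) = (1 + ?e) + (?e - 1) * real_of_int k"
    proof -
      have "(real_of_int k + 1) * S + (1 - real_of_int k) = (1 + S) + (S - 1) * real_of_int k" for S :: real
        by (simp add: algebra_simps)
      then show ?thesis .
    qed
    finally show "(p2 ((real_of_int k + 1) * ?e) * V r v (x k) z epowr ?t) * integ (x k) (x (k + 1)) w
      \<le> p2 (1 + ?e) * (p2 ((?e - 1) * real_of_int k) * isum {k..} (\<lambda>j. ?V j epowr rho) epowr (?t / rho))"
      by (simp only: p2_add_left)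
  qed
  also have "\<dots> \<le> p2 (1 + ?e) * (GH (?e - 1) (?t / rho) * isum UNIV (\<lambda>k. p2 ((?e - 1) * real_of_int k) * (?V k epowr rho) epowr (?t / rho)))"
    unfolding isum_cmult[of _ "p2 (1 + ?e)"]
    by (intro mult_left_mono geometric_Hardy_dual e1 divide_pos_pos[OF e(2) rho_pos]) simp
  also have "(\<lambda>k. p2 ((?e - 1) * real_of_int k) * (?V k epowr rho) epowr (?t / rho)) = (\<lambda>i. bz z i epowr ?t)"
  proof
    fix k
    have "bz z k epowr ?t = p2 (real_of_int k * (?t / p)) * ?V k epowr ?t"
      using e(2) by (simp add: bz_def epowr_mult p2_epowr)
    then show "p2 ((?e - 1) * real_of_int k) * (?V k epowr rho) epowr (?t / rho) = bz z k epowr ?t"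
      unfolding e(3) using rho_pos by (simp add: epowr_epowr mult.commute)
  qed
  finally show ?thesis by (simp only: cL_def mult.assoc)
qed

lemma block_functions:
  obtains g where "\<And>i. g i \<in> unit_ball (x i) (min (x (i + 1)) (z i))"
    "\<And>i. V r v (x i) (min (x (i + 1)) (z i)) epowr r \<le> p2 1 * inner (g i) (x i) (min (x (i + 1)) (z i))"
proof -
  have "\<exists>g. g \<in> unit_ball (x i) (min (x (i + 1)) (z i)) \<and>
    V r v (x i) (min (x (i + 1)) (z i)) epowr r \<le> p2 1 * inner g (x i) (min (x (i + 1)) (z i))" for i
  proof -
    have "ereal (min (x (i + 1)) (z i)) < b"
      by (rule ereal_real_trans(3)[OF x_bounds(2)[of "i + 1"]]) simp
    from unit_ball_half[OF x_bounds(1) this W_x(2)] show ?thesis by blast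
  qed
  then show ?thesis using that by metis
qed

text \<open>The coefficients are normalised by 2^-i c_i^p = n_i, so that any sequence n can be
  prescribed as the discrete right-hand side.\<close>

lemma combination_R_le:
  fixes y :: "int \<Rightarrow> real"
  assumes g: "\<And>i. g i \<in> unit_ball (x i) (y i)" and y: "\<And>i. y i \<le> x (i + 1)"
    and c: "\<And>i. c i = (p2 (real_of_int i) * n i) epowr (1 / p)"
  shows "R (\<lambda>s. isum UNIV (\<lambda>i. c i * g i s)) \<le> cR * isum UNIV n"
proof -
  have cp: "p2 (- real_of_int k) * c k epowr p = n k" for k
    unfolding c using p by (simp add: epowr_epowr p2_add_left)
  have "R (\<lambda>s. isum UNIV (\<lambda>i. c i * g i s)) \<le> cR * isum UNIV (\<lambda>k. p2 (- real_of_int k) * c k epowr p)"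
  proof (rule R_le_unit_balls[OF dx])
    fix i
    have "ereal (y i) \<le> b" using y[of i] x_bounds(5)[of "i + 1"] by (rule ereal_real_trans(4)[rotated])
    with g[of i] show "g i \<in> unit_ball (x i) b" by (rule unit_ball_mono[OF _ order_refl])
  qed
  then show ?thesis unfolding cp .
qed

text \<open>The combination dominates each summand c_i g_i, and the supports lie in disjoint blocks,
  so their contributions to the inner integral add up. The factor 1/2 is the price for near-extremal
  functions.\<close>

lemma combination_inner_ge:
  fixes y :: "int \<Rightarrow> real"
  assumes g: "\<And>i. g i \<in> unit_ball (x i) (y i)" and y: "\<And>i. y i \<le> x (i + 1)"
    and c: "\<And>i. c i = (p2 (real_of_int i) * n i) epowr (1 / p)"
    and V: "\<And>i. V r v (x i) (y i) epowr r \<le> p2 1 * inner (g i) (x i) (y i)"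
    and t: "\<And>i. i \<in> I \<Longrightarrow> y i \<le> t" "ereal t \<le> b"
  shows "p2 (-1) * isum I (\<lambda>i. (p2 (real_of_int i / p) * V r v (x i) (y i)) epowr r * n i epowr (r / p))
    \<le> inner (\<lambda>s. isum UNIV (\<lambda>i. c i * g i s)) a t"
proof -
  let ?f = "\<lambda>s. isum UNIV (\<lambda>i. c i * g i s)"
  have gm[measurable]: "g i \<in> borel_measurable L" for i using unit_ballD(1)[OF g] .
  have fm: "?f \<in> borel_measurable L" by measurable
  have yb: "ereal (y i) \<le> b" for i using y[of i] x_bounds(5)[of "i + 1"] by (rule ereal_real_trans(4)[rotated])
  have ind[measurable]: "indicator (einterval (x i) (y i)) \<in> borel_measurable L" for i by measurable
  have summand: "(p2 (real_of_int i / p) * V r v (x i) (y i)) epowr r * n i epowr (r / p) \<le> p2 1 * inner ?f (x i) (y i)" for i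
  proof -
    have "(p2 (real_of_int i / p) * V r v (x i) (y i)) epowr r * n i epowr (r / p) = c i epowr r * V r v (x i) (y i) epowr r"
      unfolding c using p r by (simp add: epowr_mult epowr_epowr p2_epowr ac_simps)
    also have "\<dots> \<le> c i epowr r * (p2 1 * inner (g i) (x i) (y i))"
      using V by (rule mult_left_mono) simp
    also have "\<dots> = p2 1 * inner (\<lambda>s. c i * g i s) (x i) (y i)"
      using x_bounds yb by (subst inner_cmult) (auto simp: ac_simps)
    also have "\<dots> \<le> p2 1 * inner ?f (x i) (y i)"
      by (intro mult_left_mono inner_mono isum_point) auto
    finally show ?thesis .
  qed
  have "isum I (\<lambda>i. inner ?f (x i) (y i)) = isum UNIV (\<lambda>i. inner ?f (x i) (y i) * indicator I i)"
    by (rule isum_restrict)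
  also have "\<dots> \<le> isum UNIV (\<lambda>i. integ (x i) (x (i + 1)) (\<lambda>s. indicator I i * (?f s epowr r * v s * indicator (einterval (x i) (y i)) s)))"
  proof (rule isum_mono)
    fix i
    have "ereal (y i) \<le> x (i + 1)" using y by simp
    then show "inner ?f (x i) (y i) * indicator I i \<le> integ (x i) (x (i + 1)) (\<lambda>s. indicator I i * (?f s epowr r * v s * indicator (einterval (x i) (y i)) s))"
      unfolding inner_def by (auto intro!: nn_integral_mono simp: einterval_iff split: split_indicator)
  qed
  also have "\<dots> \<le> integ a b (\<lambda>s. ?f s epowr r * v s * indicator {..<t} s)"
  proof (rule partition_lower_gen[OF px])
    fix i s
    show "indicator I i * (?f s epowr r * v s * indicator (einterval (x i) (y i)) s) \<le> ?f s epowr r * v s * indicator {..<t} s"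
      using t(1)[of i] by (auto simp: einterval_iff split: split_indicator)
  qed (use fm in \<open>auto intro!: borel_measurable_times measurable_epowr\<close>)
  also have "\<dots> \<le> inner ?f a t"
    unfolding inner_def by (auto intro!: nn_integral_mono simp: einterval_iff split: split_indicator)
  finally have "p2 (-1) * (p2 1 * isum I (\<lambda>i. inner ?f (x i) (y i))) \<le> p2 (-1) * (p2 1 * inner ?f a t)"
    by (intro mult_left_mono) auto
  moreover have "p2 (-1) * isum I (\<lambda>i. (p2 (real_of_int i / p) * V r v (x i) (y i)) epowr r * n i epowr (r / p))
    \<le> p2 (-1) * (p2 1 * isum I (\<lambda>i. inner ?f (x i) (y i)))"
    using summand by (intro mult_left_mono) (auto simp: isum_cmult[symmetric] intro!: isum_mono)
  ultimately show ?thesis by (simp add: p2_add_left)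
qed

lemma combination_measurable:
  assumes g: "\<And>i. g i \<in> unit_ball (x i) (y i)"
  shows "(\<lambda>s. isum UNIV (\<lambda>i. c i * g i s)) \<in> borel_measurable L"
proof -
  have [measurable]: "g i \<in> borel_measurable L" for i using unit_ballD(1)[OF g] .
  show ?thesis by measurable
qed

text \<open>By \<open>TT_le\<close> it suffices to bound a power of the dual norm of the numbers bz.
  \<open>dual_converse\<close> reduces this to combinations of near-extremal functions on the blocks
  cut off at z, which \<open>outer_lower\<close> tests at t = z.\<close>

lemma TT_point_le:
  assumes rp: "r < p" and z: "a < z" "ereal z < b"
  defines "e2 \<equiv> q * (p - r) / (p * r)"
  shows "integ z b u * TT z epowr e2 \<le> cL epowr e2 * p2 (q / r) * cR epowr (q / p) * C epowr q"
proof -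
  let ?U = "integ z b u"
  have U: "0 < ?U" "?U < top" using z u_pos u_fin by (auto intro!: integ_pos)
  have e2: "0 < e2" "(p - r) / p * (q / r) = e2" using rp p q r by (auto simp: e2_def field_simps)
  define M where "M = p2 (q / r) * (C epowr q * cR epowr (q / p))"
  let ?y = "\<lambda>i. min (x (i + 1)) z"
  obtain g where g: "\<And>i. g i \<in> unit_ball (x i) (?y i)"
    "\<And>i. V r v (x i) (?y i) epowr r \<le> p2 1 * inner (g i) (x i) (?y i)"
    using block_functions[of "\<lambda>_. z"] by blast
  have "dual (r / p) UNIV (\<lambda>i. bz z i epowr r) \<le> (M * ?U epowr (-1)) epowr (r / q)"
  proof (rule dual_converse)
    fix A :: "int \<Rightarrow> ennreal" assume A: "\<And>i. A i < top" "isum UNIV A \<le> 1"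
    define c where "c i = (p2 (real_of_int i) * A i) epowr (1 / p)" for i
    let ?f = "\<lambda>s. isum UNIV (\<lambda>i. c i * g i s)"
    let ?S = "isum UNIV (\<lambda>i. bz z i epowr r * A i epowr (r / p))"
    have fm: "?f \<in> borel_measurable L" by (rule combination_measurable[OF g(1)])
    have "R ?f \<le> cR * isum UNIV A" by (rule combination_R_le[OF g(1) _ c_def]) simp
    also have "\<dots> \<le> cR * 1" using A(2) by (rule mult_left_mono) simp
    finally have Rf: "R ?f \<le> cR" by simp
    have "p2 (-1) * ?S \<le> inner ?f a z"
      unfolding bz_def using z by (intro combination_inner_ge[OF g(1) _ c_def g(2)]) auto
    then have "(p2 (-1) * ?S) epowr (q / r) \<le> inner ?f a z epowr (q / r)"
      using qr by (intro epowr_mono) auto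
    then have "?U * (p2 (-1) * ?S) epowr (q / r) \<le> ?U * inner ?f a z epowr (q / r)"
      by (rule mult_left_mono) simp
    also have "\<dots> \<le> outer ?f a b" using z by (intro outer_lower) auto
    also have "\<dots> \<le> C epowr q * R ?f epowr (q / p)" by (rule outer_le[OF fm])
    also have "\<dots> \<le> C epowr q * cR epowr (q / p)" using Rf p q by (intro mult_left_mono epowr_mono) auto
    finally have "p2 (q / r) * (?U * (p2 (-1) * ?S) epowr (q / r)) \<le> M"
      unfolding M_def by (rule mult_left_mono) simp
    then have "?U * ?S epowr (q / r) \<le> M"
      using qr by (simp add: epowr_mult p2_epowr mult.left_commute[of ?U] p2_add_left)
    then have "?S epowr (q / r) \<le> M * ?U epowr (-1)"
      by (rule mult_le_iff_inverse[OF U, THEN iffD1])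
    then have "?S \<le> (M * ?U epowr (-1)) epowr (1 / (q / r))"
      by (rule epowr_le_iff[OF qr, THEN iffD1])
    then show "?S \<le> (M * ?U epowr (-1)) epowr (r / q)" by simp
  qed (use p r in simp)
  then have *: "isum UNIV (\<lambda>i. bz z i epowr (p * r / (p - r))) epowr ((p - r) / p) \<le> (M * ?U epowr (-1)) epowr (r / q)"
    unfolding dual_eq[OF r(1) rp] by (simp add: epowr_epowr mult.commute)
  have "(isum UNIV (\<lambda>i. bz z i epowr (p * r / (p - r))) epowr ((p - r) / p)) epowr (q / r) \<le> ((M * ?U epowr (-1)) epowr (r / q)) epowr (q / r)"
    using * by (rule epowr_mono) (use qr in simp)
  then have "isum UNIV (\<lambda>i. bz z i epowr (p * r / (p - r))) epowr e2 \<le> M * ?U epowr (-1)"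
    unfolding epowr_epowr e2(2) using q r by simp
  then have S: "?U * isum UNIV (\<lambda>i. bz z i epowr (p * r / (p - r))) epowr e2 \<le> M"
    by (rule mult_le_iff_inverse[OF U, THEN iffD2])
  have "?U * TT z epowr e2 \<le> ?U * (cL * isum UNIV (\<lambda>i. bz z i epowr (p * r / (p - r)))) epowr e2"
    using TT_le[OF rp, of z] z e2(1) by (intro mult_left_mono epowr_mono) auto
  also have "\<dots> = cL epowr e2 * (?U * isum UNIV (\<lambda>i. bz z i epowr (p * r / (p - r))) epowr e2)"
    using e2(1) by (simp add: epowr_mult mult.left_commute)
  also have "\<dots> \<le> cL epowr e2 * M" using S by (rule mult_left_mono) simp
  finally show ?thesis by (simp add: M_def ac_simps)
qed

text \<open>The discrete inequality behind \<open>global_const\<close>. The blocks of level j end no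
  later than \<tau> (j + 1), so the inner integral of the combination contains all of them at that
  point.\<close>

lemma level_inequality:
  "isum UNIV (\<lambda>j. p2 (- real_of_int j) * isum (levels \<tau> x j) (\<lambda>i. vv x i epowr r * n i epowr (r / p)) epowr (q / r))
    \<le> p2 (2 + q / r) * (C epowr q * (cR * isum UNIV n) epowr (q / p))"
proof -
  obtain g where g: "\<And>i. g i \<in> unit_ball (x i) (min (x (i + 1)) (x (i + 1)))"
    "\<And>i. V r v (x i) (min (x (i + 1)) (x (i + 1))) epowr r \<le> p2 1 * inner (g i) (x i) (min (x (i + 1)) (x (i + 1)))"
    using block_functions[of "\<lambda>i. x (i + 1)"] by blast
  note g = g[unfolded min.idem]
  define c where "c i = (p2 (real_of_int i) * n i) epowr (1 / p)" for i
  let ?f = "\<lambda>s. isum UNIV (\<lambda>i. c i * g i s)"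
  let ?G = "\<lambda>j. p2 (-1) * isum (levels \<tau> x j) (\<lambda>i. vv x i epowr r * n i epowr (r / p))"
  have "isum UNIV (\<lambda>j. p2 (- real_of_int j) * ?G j epowr (q / r)) \<le> p2 2 * outer ?f a b"
  proof (rule outer_ge_levels[OF dt])
    fix j
    show "?G j \<le> inner ?f a (\<tau> (j + 1))"
      unfolding vv_def using t_bounds
      by (intro combination_inner_ge[OF g(1) _ c_def g(2)]) (auto simp: levels_def)
  next
    fix j assume "\<not> \<tau> j < \<tau> (j + 1)"
    then have "levels \<tau> x j = {}" by (auto simp: levels_def)
    then show "?G j = 0" by (simp add: nn_integral_empty)
  qed
  also have "\<dots> \<le> p2 2 * (C epowr q * R ?f epowr (q / p))"
    by (intro mult_left_mono outer_le combination_measurable[OF g(1)]) simp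
  also have "\<dots> \<le> p2 2 * (C epowr q * (cR * isum UNIV n) epowr (q / p))"
    using p q by (intro mult_left_mono epowr_mono combination_R_le[OF g(1) _ c_def]) auto
  finally have "p2 (q / r) * isum UNIV (\<lambda>j. p2 (- real_of_int j) * ?G j epowr (q / r))
    \<le> p2 (q / r) * (p2 2 * (C epowr q * (cR * isum UNIV n) epowr (q / p)))" by (rule mult_left_mono) simp
  moreover have "isum UNIV (\<lambda>j. p2 (q / r) * (p2 (- real_of_int j) * ?G j epowr (q / r)))
    = isum UNIV (\<lambda>j. p2 (- real_of_int j) * isum (levels \<tau> x j) (\<lambda>i. vv x i epowr r * n i epowr (r / p)) epowr (q / r))"
    using qr by (intro isum_cong) (simp add: epowr_mult p2_epowr p2_add_left)
  then have "p2 (q / r) * isum UNIV (\<lambda>j. p2 (- real_of_int j) * ?G j epowr (q / r))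
    = isum UNIV (\<lambda>j. p2 (- real_of_int j) * isum (levels \<tau> x j) (\<lambda>i. vv x i epowr r * n i epowr (r / p)) epowr (q / r))"
    by (simp only: isum_cmult)
  ultimately show ?thesis by (simp add: p2_add_left add.commute)
qed

text \<open>Two nested dual norms are tested at once: \<alpha> j is near-optimal inside level j with
  sum at most 1, and n distributes the mass A j over level j according to \<alpha> j. Near-optimal
  sequences exist only if \<open>Theta\<close> is finite, which is shown first by keeping a single
  term of \<open>level_inequality\<close>.\<close>

lemma global_const_le: "global_const \<tau> x \<le> p2 (2 + 2 * q / r) * (C epowr q * cR epowr (q / p))"
proof -
  let ?K = "C epowr q * cR epowr (q / p)"
  have cRf: "cR < top" using GH_finite[of 1 p] p by (simp add: cR_def ennreal_mult_less_top)
  have Kf: "?K < top" using C cRf p q by (auto simp: ennreal_mult_less_top intro!: epowr_finite)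
  have Tfin: "Theta \<tau> x j < top" for j
  proof -
    let ?M = "p2 (real_of_int j) * (p2 (2 + q / r) * ?K)"
    have "Theta \<tau> x j \<le> ?M epowr (1 / (q / r))"
      unfolding Theta_def
    proof (rule dual_converse)
      fix A :: "int \<Rightarrow> ennreal" assume A: "isum UNIV A \<le> 1"
      let ?S = "isum (levels \<tau> x j) (\<lambda>i. vv x i epowr r * A i epowr (r / p))"
      have "p2 (- real_of_int j) * ?S epowr (q / r) \<le> isum UNIV (\<lambda>j. p2 (- real_of_int j) * isum (levels \<tau> x j) (\<lambda>i. vv x i epowr r * A i epowr (r / p)) epowr (q / r))"
        by (rule isum_point) simp
      also have "\<dots> \<le> p2 (2 + q / r) * (C epowr q * (cR * isum UNIV A) epowr (q / p))" by (rule level_inequality)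
      also have "\<dots> \<le> p2 (2 + q / r) * (C epowr q * (cR * 1) epowr (q / p))"
        using A p q by (intro mult_left_mono epowr_mono) auto
      finally have "p2 (real_of_int j) * (p2 (- real_of_int j) * ?S epowr (q / r)) \<le> ?M"
        by (intro mult_left_mono) auto
      then have "?S epowr (q / r) \<le> ?M" by (simp add: p2_add_left)
      then show "?S \<le> ?M epowr (1 / (q / r))" by (rule epowr_le_iff[OF qr, THEN iffD1])
    qed (use p r in simp)
    also have "\<dots> < top"
      using Kf by (intro epowr_finite less_imp_le[OF divide_pos_pos[OF _ qr]]) (auto simp: ennreal_mult_less_top)
    finally show ?thesis .
  qed
  have rp: "0 < r / p" using r p by simp
  have "\<exists>\<alpha>. (\<forall>i. i \<notin> levels \<tau> x j \<longrightarrow> \<alpha> i = 0) \<and> isum UNIV \<alpha> \<le> 1 \<and>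
    Theta \<tau> x j \<le> p2 1 * isum (levels \<tau> x j) (\<lambda>i. vv x i epowr r * \<alpha> i epowr (r / p))" for j
  proof -
    obtain \<alpha> where "\<And>i. i \<notin> levels \<tau> x j \<Longrightarrow> \<alpha> i = 0" "isum UNIV \<alpha> \<le> 1"
      "dual (r / p) (levels \<tau> x j) (\<lambda>i. vv x i epowr r) \<le> p2 1 * isum (levels \<tau> x j) (\<lambda>i. vv x i epowr r * \<alpha> i epowr (r / p))"
      by (rule dual_attain[OF rp Tfin[unfolded Theta_def]]) blast
    then show ?thesis unfolding Theta_def by blast
  qed
  then obtain \<alpha> where \<alpha>: "\<And>j i. i \<notin> levels \<tau> x j \<Longrightarrow> \<alpha> j i = 0" "\<And>j. isum UNIV (\<alpha> j) \<le> 1"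
    "\<And>j. Theta \<tau> x j \<le> p2 1 * isum (levels \<tau> x j) (\<lambda>i. vv x i epowr r * \<alpha> j i epowr (r / p))"
    by metis
  show ?thesis
    unfolding global_const_def
  proof (rule dual_converse)
    fix A :: "int \<Rightarrow> ennreal" assume A: "isum UNIV A \<le> 1"
    define n where "n i = isum UNIV (\<lambda>j. A j * \<alpha> j i)" for i
    have "isum UNIV n = isum UNIV (\<lambda>j. A j * isum UNIV (\<alpha> j))"
      unfolding n_def isum_cmult[symmetric] by (rule isum_swap)
    also have "\<dots> \<le> isum UNIV (\<lambda>j. A j * 1)" using \<alpha>(2) by (intro isum_mono mult_left_mono) auto
    also have "\<dots> \<le> 1" using A by simp
    finally have n1: "isum UNIV n \<le> 1" .
    have "isum UNIV (\<lambda>j. p2 (- real_of_int j) * Theta \<tau> x j epowr (q / r) * A j epowr (q / p))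
      \<le> isum UNIV (\<lambda>j. p2 (q / r) * (p2 (- real_of_int j) * isum (levels \<tau> x j) (\<lambda>i. vv x i epowr r * n i epowr (r / p)) epowr (q / r)))"
    proof (rule isum_mono)
      fix j
      have "Theta \<tau> x j * A j epowr (r / p) \<le> p2 1 * isum (levels \<tau> x j) (\<lambda>i. vv x i epowr r * \<alpha> j i epowr (r / p)) * A j epowr (r / p)"
        by (rule mult_right_mono[OF \<alpha>(3)]) simp
      also have "\<dots> = p2 1 * isum (levels \<tau> x j) (\<lambda>i. vv x i epowr r * (A j * \<alpha> j i) epowr (r / p))"
        using rp by (simp add: epowr_mult mult.assoc flip: isum_multc) (simp add: ac_simps)
      also have "\<dots> \<le> p2 1 * isum (levels \<tau> x j) (\<lambda>i. vv x i epowr r * n i epowr (r / p))"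
        unfolding n_def using rp by (intro mult_left_mono isum_mono epowr_mono isum_point) auto
      finally have "(Theta \<tau> x j * A j epowr (r / p)) epowr (q / r)
        \<le> (p2 1 * isum (levels \<tau> x j) (\<lambda>i. vv x i epowr r * n i epowr (r / p))) epowr (q / r)"
        using qr by (intro epowr_mono) auto
      then have "Theta \<tau> x j epowr (q / r) * A j epowr (q / p)
        \<le> p2 (q / r) * isum (levels \<tau> x j) (\<lambda>i. vv x i epowr r * n i epowr (r / p)) epowr (q / r)"
        using qr r by (simp add: epowr_mult epowr_epowr p2_epowr)
      then have "p2 (- real_of_int j) * (Theta \<tau> x j epowr (q / r) * A j epowr (q / p))
        \<le> p2 (- real_of_int j) * (p2 (q / r) * isum (levels \<tau> x j) (\<lambda>i. vv x i epowr r * n i epowr (r / p)) epowr (q / r))"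
        by (rule mult_left_mono) simp
      then show "p2 (- real_of_int j) * Theta \<tau> x j epowr (q / r) * A j epowr (q / p)
        \<le> p2 (q / r) * (p2 (- real_of_int j) * isum (levels \<tau> x j) (\<lambda>i. vv x i epowr r * n i epowr (r / p)) epowr (q / r))"
        by (simp only: ac_simps)
    qed
    also have "\<dots> \<le> p2 (q / r) * (p2 (2 + q / r) * (C epowr q * (cR * isum UNIV n) epowr (q / p)))"
      unfolding isum_cmult by (rule mult_left_mono[OF level_inequality]) simp
    also have "\<dots> \<le> p2 (q / r) * (p2 (2 + q / r) * (C epowr q * (cR * 1) epowr (q / p)))"
      using n1 p q by (intro mult_left_mono epowr_mono) auto
    also have "\<dots> = p2 (2 + 2 * q / r) * ?K"
      by (simp add: p2_add_left add.commute)
    finally show "isum UNIV (\<lambda>j. p2 (- real_of_int j) * Theta \<tau> x j epowr (q / r) * A j epowr (q / p)) \<le> p2 (2 + 2 * q / r) * ?K" .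
  qed (use p q in simp)
qed

subsection \<open>Necessity of the sixth condition\<close>

definition Ts :: "int \<Rightarrow> ennreal" where
  "Ts i = isum {..i - 1} (beta x)"

definition lo :: "int \<Rightarrow> real \<Rightarrow> ennreal" where
  "lo i t = Phi t * (if integ t b u \<le> p2 1 * integ (x (i + 1)) b u then 1 else 0)"

lemma lo_measurable: "lo i \<in> borel_measurable L"
proof -
  have [measurable]: "(\<lambda>t. integ t b u) \<in> borel_measurable L"
    by (rule antimono_measurable) (auto intro: integ_subset)
  show ?thesis unfolding lo_def by measurable
qed

lemma bz_below: "l \<le> i - 1 \<Longrightarrow> x i \<le> y \<Longrightarrow> bz y l = vv x l"
  using partition_mono[OF px, of "l + 1" i] by (simp add: bz_def vv_def min_absorb1)

lemma bz_above: "y \<le> x l \<Longrightarrow> bz y l = 0"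
proof -
  assume "y \<le> x l"
  then have "ereal (min (x (l + 1)) y) \<le> x l" by (simp add: min_le_iff_disj)
  then show ?thesis using V_empty by (simp add: bz_def)
qed

lemma bz_sum_le:
  assumes rp: "r < p" and y: "x i < y" "y \<le> x (i + 1)"
  shows "isum UNIV (\<lambda>l. bz y l epowr (p * r / (p - r))) \<le> Ts i + bz y i epowr (p * r / (p - r))"
proof -
  let ?f = "\<lambda>l. bz y l epowr (p * r / (p - r))"
  have t: "0 < p * r / (p - r)" using rp p r by simp
  have "?f l = ?f l * indicator {..i} l" for l
  proof (cases "l \<le> i")
    case False
    then have "x (i + 1) \<le> x l" by (intro partition_mono[OF px]) simp
    then show ?thesis using bz_above[of y l] y t by simp
  qed simp
  then have "isum UNIV ?f = isum {..i} ?f"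
    unfolding isum_restrict[of "{..i}"] by (rule isum_cong)
  also have "{..i} = insert i {..i - 1}" by auto
  also have "isum (insert i {..i - 1}) ?f \<le> ?f i + isum {..i - 1} ?f" by (rule isum_insert_le)
  also have "isum {..i - 1} ?f = Ts i"
    unfolding Ts_def beta_def using bz_below[of _ i y] y by (intro isum_cong) auto
  finally show ?thesis by (simp add: add.commute)
qed

lemma TT_block_le:
  assumes rp: "r < p" and y: "x i < y" "y \<le> x (i + 1)"
  shows "TT y \<le> cL * (Ts i + bz y i epowr (p * r / (p - r)))"
proof -
  have "ereal y < b" using x_bounds(2)[of "i + 1"] y(2) by (rule ereal_real_trans(3))
  then have "TT y \<le> cL * isum UNIV (\<lambda>l. bz y l epowr (p * r / (p - r)))"
    using y x_bounds(1)[of i] by (intro TT_le rp) auto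
  also have "\<dots> \<le> cL * (Ts i + bz y i epowr (p * r / (p - r)))"
    using bz_sum_le[OF assms] by (rule mult_left_mono) simp
  finally show ?thesis .
qed

lemma TT_point_block_le:
  assumes rp: "r < p"
  shows "TT (x m) \<le> cL * Ts m"
proof -
  let ?f = "\<lambda>l. bz (x m) l epowr (p * r / (p - r))"
  have t: "0 < p * r / (p - r)" using rp p r by simp
  have "?f l = ?f l * indicator {..m - 1} l" for l
  proof (cases "l \<le> m - 1")
    case False
    then have "x m \<le> x l" by (intro partition_mono[OF px]) simp
    then show ?thesis using bz_above[of "x m" l] t by simp
  qed simp
  then have "isum UNIV ?f = isum {..m - 1} ?f"
    unfolding isum_restrict[of "{..m - 1}"] by (rule isum_cong)
  also have "\<dots> = Ts m"
    unfolding Ts_def beta_def using bz_below[of _ m "x m"] by (intro isum_cong) auto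
  finally show ?thesis using TT_le[OF rp x_bounds(1,2), of m] by simp
qed

text \<open>
  On the part of a block where the tail of \<open>u\<close> beyond the block dominates, \<open>u\<close> is treated as part
  of the global inequality; on the rest the tail is comparable to the mass inside the block.
\<close>

lemma Phi_integ_le:
  assumes qp: "q < p" and y: "a \<le> y"
  shows "integ y (x (i + 1)) Phi \<le> p2 (q / (p - q)) * integ y (x (i + 1)) u epowr (p / (p - q)) + integ y (x (i + 1)) (lo i)"
proof -
  let ?e = "q / (p - q)" and ?m = "integ y (x (i + 1)) u"
  have e: "0 < ?e" "p / (p - q) = ?e + 1" using qp p q by (auto simp: field_simps)
  have "integ y (x (i + 1)) Phi \<le> integ y (x (i + 1)) (\<lambda>t. (p2 ?e * ?m epowr ?e) * u t + lo i t)"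
  proof (rule integ_mono)
    fix t assume t: "t \<in> einterval y (x (i + 1))"
    show "Phi t \<le> p2 ?e * ?m epowr ?e * u t + lo i t"
    proof (cases "integ t b u \<le> p2 1 * integ (x (i + 1)) b u")
      case True
      then show ?thesis by (simp add: lo_def)
    next
      case False
      let ?A = "integ t (x (i + 1)) u" and ?U = "integ (x (i + 1)) b u"
      have split: "integ t b u = ?A + ?U"
        using t y x_bounds(5)[of "i + 1"] by (intro integ_split u) (auto simp: einterval_iff)
      have two: "p2 1 * z = z + z" for z :: ennreal
        using distrib_right[of 1 1 z] p2_double[of 0] by simp
      have "?U \<le> ?A"
      proof (rule ccontr)
        assume "\<not> ?U \<le> ?A"
        then have "integ t b u \<le> ?U + ?U" unfolding split by (intro add_mono) auto
        then show False using False two by simp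
      qed
      then have "integ t b u \<le> ?A + ?A" unfolding split by (intro add_mono) auto
      also have "\<dots> \<le> p2 1 * ?m"
        unfolding two using t by (intro add_mono integ_subset) (auto simp: einterval_iff)
      finally have "integ t b u epowr ?e \<le> (p2 1 * ?m) epowr ?e"
        using e by (intro epowr_mono) auto
      also have "\<dots> = p2 ?e * ?m epowr ?e" using e(1) by (simp add: epowr_mult p2_epowr)
      finally have "Phi t \<le> p2 ?e * ?m epowr ?e * u t"
        unfolding Phi_def by (rule mult_right_mono) simp
      then show ?thesis by (simp add: add_increasing2)
    qed
  qed
  also have "\<dots> = integ y (x (i + 1)) (\<lambda>t. (p2 ?e * ?m epowr ?e) * u t) + integ y (x (i + 1)) (lo i)"
    using y x_bounds(5) lo_measurable by (intro integ_add) auto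
  also have "integ y (x (i + 1)) (\<lambda>t. (p2 ?e * ?m epowr ?e) * u t) = p2 ?e * ?m epowr ?e * ?m"
    using y x_bounds(5) by (intro integ_cmult) auto
  also have "\<dots> = p2 ?e * ?m epowr (p / (p - q))"
    unfolding e(2) using e(1) by (subst epowr_add) (auto simp: mult.assoc)
  finally show ?thesis .
qed

text \<open>In the first part of \<open>Phi_integ_le\<close>, bz combines with the u-mass of the
  rest of the block to a power of bz^q times this mass, which \<open>V_point_le_B\<close> bounds by
  the local quantity \<open>YB 0 i\<close>. In the second part bz is simply enlarged to vv.\<close>

lemma block_term_le:
  assumes qp: "q < p" and y: "x i < y" "y \<le> x (i + 1)"
  shows "bz y i epowr (p * q / (p - q)) * integ y (x (i + 1)) Phi
    \<le> p2 (q / (p - q)) * YB 0 i epowr (p / (p - q)) + vv x i epowr (p * q / (p - q)) * integ (x i) (x (i + 1)) (lo i)"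
proof (cases "y < x (i + 1)")
  case True
  let ?s = "p * q / (p - q)" and ?k = "p / (p - q)" and ?e = "q / (p - q)" and ?m = "integ y (x (i + 1)) u"
  have s: "0 < ?s" "0 < ?k" "q * ?k = ?s" using qp p q by auto
  have ay: "a \<le> y" using y x_bounds(1)[of i] by simp
  have bz: "bz y i = p2 (real_of_int i / p) * V r v (x i) y" using y by (simp add: bz_def min_absorb2)
  have le: "bz y i \<le> vv x i"
    unfolding bz vv_def using y x_bounds by (intro mult_left_mono V_mono) auto
  have "bz y i epowr ?s * integ y (x (i + 1)) Phi \<le> bz y i epowr ?s * (p2 ?e * ?m epowr ?k + integ y (x (i + 1)) (lo i))"
    by (intro mult_left_mono Phi_integ_le qp ay) simp
  also have "\<dots> = p2 ?e * (bz y i epowr ?s * ?m epowr ?k) + bz y i epowr ?s * integ y (x (i + 1)) (lo i)"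
    by (simp only: distrib_left ac_simps)
  also have "bz y i epowr ?s * integ y (x (i + 1)) (lo i) \<le> vv x i epowr ?s * integ (x i) (x (i + 1)) (lo i)"
    using le s y by (intro mult_mono epowr_mono integ_subset) auto
  also have "bz y i epowr ?s * ?m epowr ?k \<le> YB 0 i epowr ?k"
  proof -
    have "bz y i epowr ?s * ?m epowr ?k = (bz y i epowr q * ?m) epowr ?k"
      using s by (simp only: epowr_mult[OF less_imp_le[OF s(2)]] epowr_epowr)
    also have "bz y i epowr q * ?m = p2 (real_of_int i * (q / p)) * (?m * V r v (x i) y epowr q)"
      unfolding bz using q by (simp add: epowr_mult p2_epowr ac_simps)
    also have "?m * V r v (x i) y epowr q \<le> B (x i) (x (i + 1))"
    proof (rule V_point_le_B)
      have "ereal y < b" using x_bounds(2)[of "i + 1"] y(2) by (rule ereal_real_trans(3))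
      then have "integ y b u < top" using y x_bounds(1)[of i] by (intro u_fin) auto
      moreover have "?m \<le> integ y b u" using x_bounds by (intro integ_subset) auto
      ultimately show "?m < top" by (rule le_less_trans[rotated])
    qed (use y True x_bounds in auto)
    finally show ?thesis
      using y s(2) by (simp add: YB_def mult_left_mono epowr_mono)
  qed
  finally show ?thesis by (simp add: mult_left_mono add_mono)
qed simp

text \<open>For y in block i and the outer variable in block k, the integral of \<open>Phi\<close>
  is split at x (i + 1). \<open>Mb i\<close> bounds the part inside block i, and \<open>Pb m\<close>
  the part in a later block m, with TT y enlarged to TT (x m).\<close>

definition Mb :: "int \<Rightarrow> ennreal" where
  "Mb i = (SUP y\<in>{x i<..x (i + 1)}. integ y (x (i + 1)) Phi * TT y epowr (q * (p - r) / (r * (p - q))))"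

definition Pb :: "int \<Rightarrow> ennreal" where
  "Pb m = TT (x m) epowr (q * (p - r) / (r * (p - q))) * integ (x m) (x (m + 1)) Phi"

lemma blocks_integ_le:
  assumes g: "g \<in> borel_measurable L"
  shows "integ (x i) (x (k + 1)) g \<le> isum {i..k} (\<lambda>m. integ (x m) (x (m + 1)) g)"
proof -
  have "integ (x i) (x (k + 1)) g \<le> integ a b (\<lambda>t. g t * indicator (einterval (x i) (x (k + 1))) t)"
    using einterval_subset[OF x_bounds(4,5), of i "k + 1"] by (auto intro!: nn_integral_mono split: split_indicator)
  also have "\<dots> \<le> isum UNIV (\<lambda>m. indicator {i..k} m * integ (x m) (x (m + 1)) g)"
  proof (rule partition_upper[OF px _ _ g])
    fix m t assume t: "x m < t" "t < x (m + 1)"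
    show "g t * indicator (einterval (x i) (x (k + 1))) t \<le> indicator {i..k} m * g t"
      using partition_index_le[OF px, of i t m] partition_index_le[OF px, of m t k] t
      by (auto simp: einterval_iff split: split_indicator)
  qed auto
  also have "\<dots> = isum {i..k} (\<lambda>m. integ (x m) (x (m + 1)) g)"
    unfolding isum_restrict[of "{i..k}"] by (simp add: mult.commute)
  finally show ?thesis .
qed

lemma isum_geometric: "isum {..m} (\<lambda>i. p2 (real_of_int i + 1)) = p2 (real_of_int m + 1) * geo 1"
proof -
  have "isum {..m} (\<lambda>i. p2 (real_of_int i + 1)) = (\<Sum>n. p2 (real_of_int m + 1) * p2 (- (real n * 1)))"
    unfolding isum_atMost by (intro suminf_cong) (simp add: p2_add algebra_simps)
  then show ?thesis by (simp add: geo_def)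
qed

text \<open>The factors 2^(i+1) that bound the reciprocal tails of w form a geometric series over i
  <= m, so exchanging the sums over i and m leaves one factor 2^(m+1).
  \<open>geometric_Hardy\<close> with exponent 1 then removes the sum over m <= k, and the powers of
  two cancel.\<close>

lemma J6_blocks:
  assumes qp: "q < p" and rp: "r < p"
  shows "J6 \<le> p2 2 * GH 1 1 * geo 1 * isum UNIV (\<lambda>m. Mb m + Pb m)"
proof -
  let ?e3 = "q * (p - r) / (r * (p - q))"
  let ?Q = "\<lambda>m. Mb m + Pb m"
  have e3: "0 < ?e3" using qp rp q r by simp
  have "J6 \<le> isum UNIV (\<lambda>k. isum {..k} (\<lambda>i. p2 (real_of_int i + 1) * isum {i..k} ?Q) * integ (x k) (x (k + 1)) w)"
    unfolding J6_def
  proof (rule partition_upper[OF px _ _ w])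
    fix k t assume t: "x k < t" "t < x (k + 1)"
    have "(SUP y\<in>einterval a t. integ y b w epowr (- 1) * integ y t Phi * TT y epowr ?e3)
      \<le> isum {..k} (\<lambda>i. p2 (real_of_int i + 1) * isum {i..k} ?Q)"
    proof (rule SUP_least)
      fix y assume "y \<in> einterval a t"
      then have y: "a < y" "y < t" by (auto simp: einterval_iff)
      have "y \<le> x (k + 1)" using t y by simp
      with x_bounds(2)[of "k + 1"] have yb: "ereal y < b" by (rule ereal_real_trans(3))
      then obtain i where i: "x i < y" "y \<le> x (i + 1)" using partition_obtain[OF px y(1)] by blast
      then have ik: "i \<le> k" using y t by (intro partition_index_le[OF px, of i y k]) auto
      have xik: "x (i + 1) \<le> x (k + 1)" using ik by (intro partition_mono[OF px]) simp
      have "integ y t Phi \<le> integ y (x (k + 1)) Phi" using t by (intro integ_subset) auto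
      also have "\<dots> = integ y (x (i + 1)) Phi + integ (x (i + 1)) (x (k + 1)) Phi"
        using i xik y x_bounds by (intro integ_split Phi_measurable) auto
      also have "integ (x (i + 1)) (x (k + 1)) Phi \<le> isum {i + 1..k} (\<lambda>m. integ (x m) (x (m + 1)) Phi)"
        by (rule blocks_integ_le[OF Phi_measurable])
      finally have "integ y t Phi * TT y epowr ?e3
        \<le> (integ y (x (i + 1)) Phi + isum {i + 1..k} (\<lambda>m. integ (x m) (x (m + 1)) Phi)) * TT y epowr ?e3"
        by (simp add: add_left_mono mult_right_mono)
      also have "\<dots> = integ y (x (i + 1)) Phi * TT y epowr ?e3 + isum {i + 1..k} (\<lambda>m. TT y epowr ?e3 * integ (x m) (x (m + 1)) Phi)"
        by (simp only: distrib_right isum_cmult) (simp only: mult.commute)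
      also have "\<dots> \<le> Mb i + isum {i + 1..k} Pb"
      proof (rule add_mono)
        show "integ y (x (i + 1)) Phi * TT y epowr ?e3 \<le> Mb i"
          unfolding Mb_def using i by (intro SUP_upper) auto
        show "isum {i + 1..k} (\<lambda>m. TT y epowr ?e3 * integ (x m) (x (m + 1)) Phi) \<le> isum {i + 1..k} Pb"
        proof (rule isum_mono)
          fix m assume "m \<in> {i + 1..k}"
          then have "x (i + 1) \<le> x m" by (intro partition_mono[OF px]) simp
          then have "TT y \<le> TT (x m)" using i x_bounds by (intro TT_mono rp) auto
          then show "TT y epowr ?e3 * integ (x m) (x (m + 1)) Phi \<le> Pb m"
            unfolding Pb_def using e3 by (intro mult_right_mono epowr_mono) auto
        qed
      qed
      also have "\<dots> \<le> isum {i..k} Mb + isum {i..k} Pb"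
        using ik by (intro add_mono isum_point isum_subset) auto
      also have "\<dots> = isum {i..k} ?Q" by (simp add: isum_add)
      finally have 1: "integ y t Phi * TT y epowr ?e3 \<le> isum {i..k} ?Q" .
      have "integ y b w epowr (- 1) \<le> p2 ((real_of_int i + 1) * 1)"
        using i by (intro W_power_le) auto
      then have "integ y b w epowr (- 1) * (integ y t Phi * TT y epowr ?e3) \<le> p2 (real_of_int i + 1) * isum {i..k} ?Q"
        using 1 by (intro mult_mono) auto
      also have "\<dots> \<le> isum {..k} (\<lambda>i. p2 (real_of_int i + 1) * isum {i..k} ?Q)"
        using ik by (intro isum_point) auto
      finally show "integ y b w epowr (- 1) * integ y t Phi * TT y epowr ?e3
        \<le> isum {..k} (\<lambda>i. p2 (real_of_int i + 1) * isum {i..k} ?Q)" by (simp only: mult.assoc)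
    qed
    then have "w t * (SUP y\<in>einterval a t. integ y b w epowr (- 1) * integ y t Phi * TT y epowr ?e3)
      \<le> w t * isum {..k} (\<lambda>i. p2 (real_of_int i + 1) * isum {i..k} ?Q)" by (rule mult_left_mono) simp
    then show "w t * (SUP y\<in>einterval a t. integ y b w epowr (- 1) * integ y t Phi * TT y epowr ?e3)
      \<le> isum {..k} (\<lambda>i. p2 (real_of_int i + 1) * isum {i..k} ?Q) * w t" by (simp only: mult.commute)
  qed auto
  also have "\<dots> \<le> isum UNIV (\<lambda>k. p2 1 * (p2 (- 1 * real_of_int k) * isum {..k} (\<lambda>m. ?Q m * (p2 (real_of_int m + 1) * geo 1)) epowr 1))"
  proof (rule isum_mono)
    fix k
    have "isum {..k} (\<lambda>i. p2 (real_of_int i + 1) * isum {i..k} ?Q)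
      = isum UNIV (\<lambda>i. isum UNIV (\<lambda>m. ?Q m * (p2 (real_of_int i + 1) * indicator {..m} i) * indicator {..k} m))"
      unfolding isum_restrict[of "{..k}"]
    proof (rule isum_cong)
      fix i
      have "p2 (real_of_int i + 1) * isum {i..k} ?Q * indicator {..k} i
        = isum UNIV (\<lambda>m. p2 (real_of_int i + 1) * (?Q m * indicator {i..k} m) * indicator {..k} i)"
        by (simp only: isum_multc isum_cmult isum_restrict[of "{i..k}"])
      also have "\<dots> = isum UNIV (\<lambda>m. ?Q m * (p2 (real_of_int i + 1) * indicator {..m} i) * indicator {..k} m)"
        by (intro isum_cong) (auto simp: mult.commute split: split_indicator)
      finally show "p2 (real_of_int i + 1) * isum {i..k} ?Q * indicator {..k} i
        = isum UNIV (\<lambda>m. ?Q m * (p2 (real_of_int i + 1) * indicator {..m} i) * indicator {..k} m)" .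
    qed
    also have "\<dots> = isum UNIV (\<lambda>m. isum UNIV (\<lambda>i. ?Q m * (p2 (real_of_int i + 1) * indicator {..m} i) * indicator {..k} m))"
      by (rule isum_swap)
    also have "\<dots> = isum UNIV (\<lambda>m. ?Q m * isum UNIV (\<lambda>i. p2 (real_of_int i + 1) * indicator {..m} i) * indicator {..k} m)"
      by (simp only: isum_multc isum_cmult)
    also have "\<dots> = isum {..k} (\<lambda>m. ?Q m * (p2 (real_of_int m + 1) * geo 1))"
      by (simp only: isum_restrict[of "{..k}"] isum_restrict[of "{.._}" "\<lambda>i. p2 (real_of_int i + 1)", symmetric] isum_geometric)
    finally have eq: "isum {..k} (\<lambda>i. p2 (real_of_int i + 1) * isum {i..k} ?Q) = isum {..k} (\<lambda>m. ?Q m * (p2 (real_of_int m + 1) * geo 1))" .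
    have "isum {..k} (\<lambda>m. ?Q m * (p2 (real_of_int m + 1) * geo 1)) * integ (x k) (x (k + 1)) w
      \<le> isum {..k} (\<lambda>m. ?Q m * (p2 (real_of_int m + 1) * geo 1)) * p2 (1 - real_of_int k)"
      using dyadic_block_mass[OF dx, of k] by (intro mult_left_mono) auto
    also have "\<dots> = p2 1 * (p2 (- 1 * real_of_int k) * isum {..k} (\<lambda>m. ?Q m * (p2 (real_of_int m + 1) * geo 1)) epowr 1)"
      by (simp add: p2_add_left mult.commute)
    finally show "isum {..k} (\<lambda>i. p2 (real_of_int i + 1) * isum {i..k} ?Q) * integ (x k) (x (k + 1)) w
      \<le> p2 1 * (p2 (- 1 * real_of_int k) * isum {..k} (\<lambda>m. ?Q m * (p2 (real_of_int m + 1) * geo 1)) epowr 1)"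
      unfolding eq .
  qed
  also have "\<dots> \<le> p2 1 * (GH 1 1 * isum UNIV (\<lambda>k. p2 (- 1 * real_of_int k) * (?Q k * (p2 (real_of_int k + 1) * geo 1)) epowr 1))"
    unfolding isum_cmult[of _ "p2 1"] by (intro mult_left_mono geometric_Hardy) auto
  also have "isum UNIV (\<lambda>k. p2 (- 1 * real_of_int k) * (?Q k * (p2 (real_of_int k + 1) * geo 1)) epowr 1) = isum UNIV (\<lambda>k. p2 1 * geo 1 * ?Q k)"
  proof (rule isum_cong)
    fix k
    have "p2 (- 1 * real_of_int k) * (?Q k * (p2 (real_of_int k + 1) * geo 1)) epowr 1
      = (p2 (- 1 * real_of_int k) * p2 (real_of_int k + 1)) * geo 1 * ?Q k"
      by (simp only: epowr_one ac_simps)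
    also have "p2 (- 1 * real_of_int k) * p2 (real_of_int k + 1) = p2 1" by (simp add: p2_add)
    finally show "p2 (- 1 * real_of_int k) * (?Q k * (p2 (real_of_int k + 1) * geo 1)) epowr 1 = p2 1 * geo 1 * ?Q k" .
  qed
  finally have "J6 \<le> p2 1 * (GH 1 1 * (p2 1 * geo 1 * isum UNIV ?Q))" by (simp only: isum_cmult)
  also have "\<dots> = (p2 1 * p2 1) * GH 1 1 * geo 1 * isum UNIV ?Q" by (simp only: ac_simps)
  also have "p2 1 * p2 1 = p2 2" by (simp add: p2_add)
  finally show ?thesis .
qed

lemma block_sums_le:
  assumes qp: "q < p" and rp: "r < p"
  defines "e3 \<equiv> q * (p - r) / (r * (p - q))"
  shows "Mb i + Pb i \<le> cL epowr e3 * p2 (e3 + 1) *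
    (Ts i epowr e3 * integ (x i) (x (i + 1)) Phi + (p2 (q / (p - q)) * YB 0 i epowr (p / (p - q))
      + vv x i epowr (p * q / (p - q)) * integ (x i) (x (i + 1)) (lo i)))"
    (is "_ \<le> _ * (?A + ?D)")
proof -
  let ?t = "p * r / (p - r)"
  have e3: "0 < e3" "?t * e3 = p * q / (p - q)" using qp rp q r p by (auto simp: e3_def)
  have "Mb i \<le> cL epowr e3 * (p2 e3 * (?A + ?D))"
    unfolding Mb_def e3_def[symmetric]
  proof (rule SUP_least)
    fix y assume "y \<in> {x i<..x (i + 1)}"
    then have y: "x i < y" "y \<le> x (i + 1)" by auto
    have "TT y epowr e3 \<le> (cL * (Ts i + bz y i epowr ?t)) epowr e3"
      using TT_block_le[OF rp y] e3 by (intro epowr_mono) auto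
    also have "\<dots> = cL epowr e3 * (Ts i + bz y i epowr ?t) epowr e3" using e3 by (intro epowr_mult) auto
    also have "\<dots> \<le> cL epowr e3 * (p2 e3 * (Ts i epowr e3 + (bz y i epowr ?t) epowr e3))"
      using e3 by (intro mult_left_mono epowr_sum_le_p2) auto
    finally have "integ y (x (i + 1)) Phi * TT y epowr e3
      \<le> integ y (x (i + 1)) Phi * (cL epowr e3 * (p2 e3 * (Ts i epowr e3 + bz y i epowr (p * q / (p - q)))))"
      unfolding epowr_epowr e3(2) by (rule mult_left_mono) simp
    also have "\<dots> = cL epowr e3 * (p2 e3 * (Ts i epowr e3 * integ y (x (i + 1)) Phi + bz y i epowr (p * q / (p - q)) * integ y (x (i + 1)) Phi))"
      by (simp only: distrib_left distrib_right ac_simps)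
    also have "\<dots> \<le> cL epowr e3 * (p2 e3 * (?A + ?D))"
      using y by (intro mult_left_mono add_mono integ_subset block_term_le qp) auto
    finally show "integ y (x (i + 1)) Phi * TT y epowr e3 \<le> cL epowr e3 * (p2 e3 * (?A + ?D))" .
  qed
  moreover have "Pb i \<le> cL epowr e3 * (p2 e3 * (?A + ?D))"
  proof -
    have "TT (x i) epowr e3 \<le> (cL * Ts i) epowr e3"
      using TT_point_block_le[OF rp] e3 by (intro epowr_mono) auto
    also have "\<dots> = cL epowr e3 * Ts i epowr e3" using e3 by (intro epowr_mult) auto
    finally have "Pb i \<le> cL epowr e3 * Ts i epowr e3 * integ (x i) (x (i + 1)) Phi"
      unfolding Pb_def e3_def[symmetric] by (rule mult_right_mono) simp
    also have "\<dots> = cL epowr e3 * (1 * ?A)" by (simp add: mult.assoc)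
    also have "\<dots> \<le> cL epowr e3 * (p2 e3 * (?A + ?D))"
      using e3 p2_le_iff[of 0 e3] by (intro mult_left_mono mult_mono) auto
    finally show ?thesis .
  qed
  ultimately have "Mb i + Pb i \<le> cL epowr e3 * (p2 e3 * (?A + ?D)) + cL epowr e3 * (p2 e3 * (?A + ?D))"
    by (rule add_mono)
  also have "\<dots> = cL epowr e3 * ((p2 e3 + p2 e3) * (?A + ?D))"
  proof -
    have "c * (z * y) + c * (z * y) = c * ((z + z) * y)" for c y z :: ennreal
      by (simp only: distrib_left distrib_right)
    then show ?thesis .
  qed
  also have "\<dots> = cL epowr e3 * p2 (e3 + 1) * (?A + ?D)" by (simp only: p2_double mult.assoc)
  finally show ?thesis .
qed

lemma vv_empty: "\<not> x i < x (i + 1) \<Longrightarrow> vv x i = 0"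
  using V_empty[of "x (i + 1)" "x i"] by (simp add: vv_def)

lemma level_obtain:
  assumes "x l < x (l + 1)" obtains j where "l \<in> levels \<tau> x j"
proof -
  have "a < x (l + 1)" using assms x_bounds(1)[of l] by simp
  from partition_obtain[OF pt this x_bounds(2)] that show ?thesis by (auto simp: levels_def)
qed

lemma Ts_le:
  assumes rp: "r < p" and t: "x k < t" "t \<le> \<tau> (j + 1)"
  shows "Ts k \<le> isum {..j} (\<lambda>l. isum (levels \<tau> x l) (beta x))"
  unfolding Ts_def
proof (rule isum_cover_le)
  fix i assume i: "i \<in> {..k - 1}" "beta x i \<noteq> 0"
  have "0 < p * r / (p - r)" using rp p r by simp
  then have "x i < x (i + 1)" using i(2) vv_empty[of i] by (cases "x i < x (i + 1)") (auto simp: beta_def)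
  then obtain l where l: "i \<in> levels \<tau> x l" by (rule level_obtain)
  have "x (i + 1) \<le> x k" using i by (intro partition_mono[OF px]) auto
  then have "l \<le> j" using l t by (intro partition_index_le[OF pt, of l "x (i + 1)" j]) (auto simp: levels_def)
  then show "\<exists>l\<in>{..j}. i \<in> levels \<tau> x l" using l by blast
qed

text \<open>The tail of u at most halves between t and the end of block k, so block k ends at most
  one level after that of t. If it ended beyond \<tau> (j + 2), the tail there would be less than
  2^(-j-2), and twice that is less than 2^(-j-1), a lower bound for the tail at t.\<close>

lemma low_level_le:
  assumes t: "x k < t" "t < x (k + 1)" "\<tau> j < t" "t \<le> \<tau> (j + 1)"
    and U: "integ t b u \<le> p2 1 * integ (x (k + 1)) b u"
  shows "beta x k \<le> isum {..j + 1} (\<lambda>l. isum (levels \<tau> x l) (beta x))"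
proof -
  obtain l where l: "k \<in> levels \<tau> x l" using t level_obtain[of k] by auto
  have "l \<le> j + 1"
  proof (rule ccontr)
    assume "\<not> ?thesis"
    then have "\<tau> (j + 2) \<le> \<tau> l" by (intro partition_mono[OF pt]) simp
    then have less: "\<tau> (j + 2) < x (k + 1)" using l by (auto simp: levels_def)
    have ne: "\<tau> j < \<tau> (j + 1)" using t by simp
    have ne2: "\<tau> (j + 1) < \<tau> (j + 1 + 1)" using dyadic_next(3)[OF dt ne] by (simp add: add.assoc)
    have eq: "integ (\<tau> (j + 2)) b u = p2 (- real_of_int j - 2)"
      using dyadic_next(2)[OF dt ne2] by (simp add: add.assoc)
    have "a < x (k + 1)" using t x_bounds(1)[of k] by simp
    then have "integ (x (k + 1)) b u < integ (\<tau> (j + 2)) b u"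
      using less t_bounds(4) x_bounds(5) u_pos u_fin[OF _ x_bounds(2)] by (intro integ_strict u) auto
    then have "p2 1 * integ (x (k + 1)) b u < p2 1 * p2 (- real_of_int j - 2)"
      unfolding eq by (intro ennreal_mult_strict_left_mono) auto
    also have "p2 1 * p2 (- real_of_int j - 2) = p2 (- real_of_int j - 1)" by (simp add: p2_add)
    also have "\<dots> \<le> integ t b u" using dyadic_block(1)[OF dt t(3,4)] by simp
    finally show False using U by simp
  qed
  have "beta x k \<le> isum (levels \<tau> x l) (beta x)" using l by (rule isum_point)
  also have "\<dots> \<le> isum {..j + 1} (\<lambda>l. isum (levels \<tau> x l) (beta x))"
    using \<open>l \<le> j + 1\<close> by (intro isum_point) auto
  finally show ?thesis .
qed

lemma level_sums_le:
  assumes qp: "q < p" and rp: "r < p"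
    and G: "\<And>k. G k \<in> borel_measurable L"
    and H: "\<And>k j t. x k < t \<Longrightarrow> t < x (k + 1) \<Longrightarrow> \<tau> j < t \<Longrightarrow> t \<le> \<tau> (j + 1) \<Longrightarrow>
      G k t \<le> Phi t * isum {..j + 1} (\<lambda>l. isum (levels \<tau> x l) (beta x)) epowr (q * (p - r) / (r * (p - q)))"
  shows "isum UNIV (\<lambda>k. integ (x k) (x (k + 1)) (G k)) \<le> A6 * (C epowr q) epowr (p / (p - q))"
proof -
  let ?k = "p / (p - q)" and ?e = "q / (p - q)" and ?e3 = "q * (p - r) / (r * (p - q))"
  let ?th = "\<lambda>l. isum (levels \<tau> x l) (beta x)"
  have k: "0 < ?k" "0 < ?e" "?k = ?e + 1" using qp p q by (auto simp: field_simps)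
  have e3: "0 < ?e3" "q * (p - r) / (p * r) * ?k = ?e3" using qp rp p q r by auto
  define S where "S t = (SUP j\<in>{j. \<tau> j < t}. isum {..j + 1} ?th epowr ?e3)" for t
  have "isum UNIV (\<lambda>k. integ (x k) (x (k + 1)) (G k)) \<le> integ a b (\<lambda>t. Phi t * S t)"
  proof (rule partition_lower_gen[OF px _ _ G])
    fix k t assume t: "x k < t" "t < x (k + 1)"
    have "a < t" using t x_bounds(1)[of k] by simp
    moreover have "ereal t < b" using x_bounds(2)[of "k + 1"] less_imp_le[OF t(2)] by (rule ereal_real_trans(3))
    ultimately obtain j where j: "\<tau> j < t" "t \<le> \<tau> (j + 1)" using partition_obtain[OF pt] by blast
    have "G k t \<le> Phi t * isum {..j + 1} ?th epowr ?e3" by (rule H[OF t j])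
    also have "\<dots> \<le> Phi t * S t" unfolding S_def using j by (intro mult_left_mono SUP_upper) auto
    finally show "G k t \<le> Phi t * S t" .
  qed auto
  also have "\<dots> \<le> isum UNIV (\<lambda>j. (p2 ((1 - real_of_int j) * ?e) * isum {..j + 1} ?th epowr ?e3) * integ (\<tau> j) (\<tau> (j + 1)) u)"
  proof (rule partition_upper[OF pt _ _ u])
    fix j t assume t: "\<tau> j < t" "t < \<tau> (j + 1)"
    have "integ t b u epowr ?e \<le> p2 (1 - real_of_int j) epowr ?e"
      using dyadic_block(2)[OF dt, of j t] t k(2) by (intro epowr_mono) auto
    then have 1: "integ t b u epowr ?e \<le> p2 ((1 - real_of_int j) * ?e)" by (simp add: p2_epowr)
    have 2: "S t \<le> isum {..j + 1} ?th epowr ?e3"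
      unfolding S_def
    proof (rule SUP_least)
      fix l assume "l \<in> {j. \<tau> j < t}"
      then have "l \<le> j" using t by (intro partition_index_le[OF pt, of l t j]) auto
      then show "isum {..l + 1} ?th epowr ?e3 \<le> isum {..j + 1} ?th epowr ?e3"
        using e3(1) by (intro epowr_mono isum_subset) auto
    qed
    have "integ t b u epowr ?e * u t * S t \<le> p2 ((1 - real_of_int j) * ?e) * u t * isum {..j + 1} ?th epowr ?e3"
      using 1 2 by (intro mult_mono) auto
    then show "Phi t * S t \<le> (p2 ((1 - real_of_int j) * ?e) * isum {..j + 1} ?th epowr ?e3) * u t"
      unfolding Phi_def by (simp only: ac_simps)
  qed auto
  also have "\<dots> \<le> isum UNIV (\<lambda>j. p2 (2 * ?k) * (p2 (- ?k * real_of_int (j + 1)) * isum {..j + 1} ?th epowr ?e3))"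
  proof (rule isum_mono)
    fix j
    have "(p2 ((1 - real_of_int j) * ?e) * isum {..j + 1} ?th epowr ?e3) * integ (\<tau> j) (\<tau> (j + 1)) u
      \<le> (p2 ((1 - real_of_int j) * ?e) * isum {..j + 1} ?th epowr ?e3) * p2 (1 - real_of_int j)"
      using dyadic_block_mass[OF dt, of j] by (intro mult_left_mono) auto
    also have "\<dots> = p2 ((1 - real_of_int j) * ?e + (1 - real_of_int j)) * isum {..j + 1} ?th epowr ?e3"
      by (simp only: p2_add[symmetric] ac_simps)
    also have "(1 - real_of_int j) * ?e + (1 - real_of_int j) = 2 * ?k + - ?k * real_of_int (j + 1)"
    proof -
      have "(1 - real_of_int j) * S + (1 - real_of_int j) = 2 * (S + 1) + - (S + 1) * real_of_int (j + 1)" for S :: real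
        by (simp add: algebra_simps)
      then show ?thesis unfolding k(3) .
    qed
    finally show "(p2 ((1 - real_of_int j) * ?e) * isum {..j + 1} ?th epowr ?e3) * integ (\<tau> j) (\<tau> (j + 1)) u
      \<le> p2 (2 * ?k) * (p2 (- ?k * real_of_int (j + 1)) * isum {..j + 1} ?th epowr ?e3)"
      by (simp only: p2_add_left)
  qed
  also have "\<dots> = p2 (2 * ?k) * isum UNIV (\<lambda>j. p2 (- ?k * real_of_int j) * isum {..j} ?th epowr ?e3)"
    unfolding isum_cmult isum_shift[of "\<lambda>j. p2 (- ?k * real_of_int j) * isum {..j} ?th epowr ?e3" 1] ..
  also have "\<dots> \<le> p2 (2 * ?k) * (GH ?k ?e3 * isum UNIV (\<lambda>j. p2 (- ?k * real_of_int j) * ?th j epowr ?e3))"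
    using k(1) e3(1) by (intro mult_left_mono geometric_Hardy) auto
  also have "(\<lambda>j. p2 (- ?k * real_of_int j) * ?th j epowr ?e3) = (\<lambda>j. (p2 (- real_of_int j) * Theta \<tau> x j epowr (q / r)) epowr ?k)"
  proof
    fix j
    have "(p2 (- real_of_int j) * Theta \<tau> x j epowr (q / r)) epowr ?k = p2 (- real_of_int j * ?k) * (?th j epowr (q * (p - r) / (p * r))) epowr ?k"
      unfolding Theta_eq[OF rp] by (simp only: epowr_mult[OF less_imp_le[OF k(1)]] p2_epowr)
    also have "\<dots> = p2 (- ?k * real_of_int j) * ?th j epowr ?e3"
      unfolding epowr_epowr e3(2) by (simp add: mult.commute)
    finally show "p2 (- ?k * real_of_int j) * ?th j epowr ?e3 = (p2 (- real_of_int j) * Theta \<tau> x j epowr (q / r)) epowr ?k" by simp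
  qed
  also have "isum UNIV (\<lambda>j. (p2 (- real_of_int j) * Theta \<tau> x j epowr (q / r)) epowr ?k) \<le> (p2 (2 + 2 * q / r) * cR epowr (q / p) * C epowr q) epowr ?k"
  proof -
    have "isum UNIV (\<lambda>j. (p2 (- real_of_int j) * Theta \<tau> x j epowr (q / r)) epowr ?k) epowr ((p - q) / p) \<le> p2 (2 + 2 * q / r) * (C epowr q * cR epowr (q / p))"
      using global_const_le unfolding global_const_def dual_eq[OF q qp] .
    then have "isum UNIV (\<lambda>j. (p2 (- real_of_int j) * Theta \<tau> x j epowr (q / r)) epowr ?k) \<le> (p2 (2 + 2 * q / r) * (C epowr q * cR epowr (q / p))) epowr (1 / ((p - q) / p))"
      by (rule epowr_le_iff[THEN iffD1, rotated]) (use qp p in simp)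
    then show ?thesis by (simp add: ac_simps)
  qed
  finally have "isum UNIV (\<lambda>k. integ (x k) (x (k + 1)) (G k))
    \<le> p2 (2 * ?k) * (GH ?k ?e3 * (p2 (2 + 2 * q / r) * cR epowr (q / p) * C epowr q) epowr ?k)"
    by (simp add: mult_left_mono)
  also have "\<dots> = A6 * (C epowr q) epowr ?k"
    unfolding A6_def epowr_mult[OF less_imp_le[OF k(1)]] by (simp only: mult.assoc)
  finally show ?thesis .
qed

lemma J6_le:
  assumes qp: "q < p" and rp: "r < p"
  shows "J6 \<le> K6 * (C epowr q) epowr (p / (p - q))"
proof -
  let ?k = "p / (p - q)" and ?e3 = "q * (p - r) / (r * (p - q))" and ?s = "p * q / (p - q)"
  let ?th = "\<lambda>l. isum (levels \<tau> x l) (beta x)" and ?C = "(C epowr q) epowr (p / (p - q))"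
  have k: "0 < ?k" using qp p by simp
  have e3: "0 < ?e3" "p * r / (p - r) * ?e3 = ?s" using qp rp p q r by auto
  have "integ (x i) (x (i + 1)) (\<lambda>t. c * g t) = c * integ (x i) (x (i + 1)) g" if "g \<in> borel_measurable L" for i c g
    using that x_bounds by (intro integ_cmult) auto
  note cm = this[OF Phi_measurable] this[OF lo_measurable]
  have 1: "isum UNIV (\<lambda>i. Ts i epowr ?e3 * integ (x i) (x (i + 1)) Phi) \<le> A6 * ?C"
    unfolding cm(1)[symmetric]
  proof (rule level_sums_le[OF qp rp])
    fix k j t assume t: "x k < t" "t < x (k + 1)" "\<tau> j < t" "t \<le> \<tau> (j + 1)"
    have "Ts k \<le> isum {..j} ?th" using t by (intro Ts_le rp) auto
    also have "\<dots> \<le> isum {..j + 1} ?th" by (rule isum_subset) auto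
    finally have "Ts k epowr ?e3 * Phi t \<le> isum {..j + 1} ?th epowr ?e3 * Phi t"
      using e3(1) by (intro mult_right_mono epowr_mono) auto
    then show "Ts k epowr ?e3 * Phi t \<le> Phi t * isum {..j + 1} ?th epowr ?e3" by (simp only: mult.commute)
  qed (use Phi_measurable in measurable)
  have 2: "isum UNIV (\<lambda>i. vv x i epowr ?s * integ (x i) (x (i + 1)) (lo i)) \<le> A6 * ?C"
    unfolding cm(2)[symmetric]
  proof (rule level_sums_le[OF qp rp])
    fix k j t assume t: "x k < t" "t < x (k + 1)" "\<tau> j < t" "t \<le> \<tau> (j + 1)"
    show "vv x k epowr ?s * lo k t \<le> Phi t * isum {..j + 1} ?th epowr ?e3"
    proof (cases "integ t b u \<le> p2 1 * integ (x (k + 1)) b u")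
      case True
      have "vv x k epowr ?s = beta x k epowr ?e3" unfolding beta_def epowr_epowr e3(2) ..
      also have "\<dots> \<le> isum {..j + 1} ?th epowr ?e3"
        using low_level_le[OF t True] e3(1) by (intro epowr_mono) auto
      finally have "vv x k epowr ?s * Phi t \<le> isum {..j + 1} ?th epowr ?e3 * Phi t" by (rule mult_right_mono) simp
      then show ?thesis using True by (simp add: lo_def mult.commute)
    qed (simp add: lo_def)
  next
    show "(\<lambda>t. vv x k epowr ?s * lo k t) \<in> borel_measurable L" for k using lo_measurable[of k] by measurable
  qed
  have 3: "isum UNIV (\<lambda>i. YB 0 i epowr ?k) \<le> (p2 1 * cR epowr (q / p)) epowr ?k * ?C"
    using YB_sum_le[OF qp, of 0] k by (simp add: epowr_mult)
  have "J6 \<le> p2 2 * GH 1 1 * geo 1 * isum UNIV (\<lambda>m. Mb m + Pb m)" by (rule J6_blocks[OF qp rp])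
  also have "isum UNIV (\<lambda>m. Mb m + Pb m) \<le> isum UNIV (\<lambda>i. cL epowr ?e3 * p2 (?e3 + 1) *
    (Ts i epowr ?e3 * integ (x i) (x (i + 1)) Phi + (p2 (q / (p - q)) * YB 0 i epowr ?k
      + vv x i epowr ?s * integ (x i) (x (i + 1)) (lo i))))"
    by (intro isum_mono block_sums_le qp rp)
  also have "\<dots> = cL epowr ?e3 * p2 (?e3 + 1) * (isum UNIV (\<lambda>i. Ts i epowr ?e3 * integ (x i) (x (i + 1)) Phi)
    + (p2 (q / (p - q)) * isum UNIV (\<lambda>i. YB 0 i epowr ?k) + isum UNIV (\<lambda>i. vv x i epowr ?s * integ (x i) (x (i + 1)) (lo i))))"
    by (simp only: isum_cmult isum_add)
  also have "\<dots> \<le> cL epowr ?e3 * p2 (?e3 + 1) * (A6 * ?C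
    + (p2 (q / (p - q)) * ((p2 1 * cR epowr (q / p)) epowr ?k * ?C) + A6 * ?C))"
    using 1 2 3 by (intro mult_left_mono add_mono) auto
  finally have "J6 \<le> p2 2 * GH 1 1 * geo 1 * (cL epowr ?e3 * p2 (?e3 + 1) * (A6 * ?C
    + (p2 (q / (p - q)) * ((p2 1 * cR epowr (q / p)) epowr ?k * ?C) + A6 * ?C)))"
    by (simp add: mult_left_mono)
  also have "\<dots> = K6 * ?C"
    unfolding K6_def by (simp only: distrib_left distrib_right mult.assoc)
  finally show ?thesis .
qed

end

subsection \<open>Essential suprema in the constants\<close>

lemma less_epowr_minus_iff:
  assumes "0 < s" "0 < c"
  shows "c < x epowr (- s) \<longleftrightarrow> x < c epowr (- (1 / s))"
proof -
  have "x epowr (- s) \<le> c \<longleftrightarrow> c epowr (- (1 / s)) \<le> x"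
    using epowr_antimono[of "c epowr (- (1 / s))" x "- s"] epowr_antimono[of "x epowr (- s)" c "- (1 / s)"] assms
    by (auto simp: epowr_epowr)
  then show ?thesis by (simp flip: not_le)
qed

context interval
begin

lemma integ_power_right_lsc:
  assumes g: "g \<in> borel_measurable L" and "a \<le> t" "y \<le> b" "0 < s" "c < integ t y g epowr s"
  shows "\<exists>t'>t. ereal t' \<le> y \<and> (\<forall>s'\<in>{t<..<t'}. c \<le> integ s' y g epowr s)"
proof -
  have "c epowr (1 / s) < integ t y g" using assms by (simp add: epowr_less_iff)
  with g assms obtain t' where t': "t < t'" "ereal t' < y" "c epowr (1 / s) < integ t' y g"
    by (elim integ_less_left) auto
  have "c \<le> integ s' y g epowr s" if "s' \<in> {t<..<t'}" for s'
  proof -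
    have "integ t' y g \<le> integ s' y g" using that by (intro integ_subset) auto
    with t'(3) have "c epowr (1 / s) < integ s' y g" by (rule less_le_trans)
    then show ?thesis using assms(4) by (simp add: epowr_less_iff less_imp_le)
  qed
  then show ?thesis using t' by (intro exI[of _ t']) auto
qed

text \<open>Moving left from t enlarges the tail by the mass in between, which is small by
  \<open>integ_small_tail\<close>, because the mass on (m, t) is finite for some m > a.\<close>

lemma integ_power_left_lsc:
  assumes g: "g \<in> borel_measurable L" and fin: "\<And>t. a < t \<Longrightarrow> ereal t < b \<Longrightarrow> integ t b g < top"
    and t: "a < t" "ereal t < b" and s: "0 < s" and c: "c < integ t b g epowr (- s)"
  shows "\<exists>s'<t. ereal a \<le> ereal s' \<and> (\<forall>s''\<in>{s'<..<t}. c \<le> integ s'' b g epowr (- s))"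
proof (cases "c = 0")
  case True
  then show ?thesis using t by (intro exI[of _ a]) auto
next
  case False
  then have c0: "0 < c" by (simp add: zero_less_iff_neq_zero)
  let ?d = "c epowr (- (1 / s))"
  have d: "integ t b g < ?d" using c less_epowr_minus_iff[OF s c0] by simp
  obtain m where m: "a < m" "m < t" using dense[OF t(1)] by blast
  have "ereal m < b" using t(2) less_imp_le[OF m(2)] by (rule ereal_real_trans(3))
  with m have "integ m b g < top" by (intro fin)
  moreover have "integ m t g \<le> integ m b g" using t by (intro integ_subset) auto
  ultimately have mt: "integ m t g < top" by (rule le_less_trans[rotated])
  have d0: "0 < ?d - integ t b g" using d by (simp add: diff_gr0_ennreal)
  obtain s' where s': "m < s'" "s' < t" "integ s' t g < ?d - integ t b g"
    by (rule integ_small_tail[OF g _ _ _ mt d0]) (use m t in auto)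
  have "c \<le> integ s'' b g epowr (- s)" if "s'' \<in> {s'<..<t}" for s''
  proof -
    have "integ s'' b g \<le> integ s' b g" using that by (intro integ_subset) auto
    also have "\<dots> = integ s' t g + integ t b g"
      using m s' t by (intro integ_split g) auto
    also have "\<dots> \<le> (?d - integ t b g) + integ t b g" using s' by (intro add_right_mono) simp
    also have "\<dots> = ?d" using d by (intro diff_add_cancel_ennreal) simp
    finally have "?d epowr (- s) \<le> integ s'' b g epowr (- s)" using s by (intro epowr_antimono) auto
    then show ?thesis using s by (simp add: epowr_epowr)
  qed
  then show ?thesis using m s' by (intro exI[of _ s']) auto
qed

end

context three_weights
begin

lemma W_power_mono: "0 \<le> e \<Longrightarrow> s \<le> t \<Longrightarrow> integ s b w epowr (- e) \<le> integ t b w epowr (- e)"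
  by (intro epowr_antimono integ_subset) auto

text \<open>Covers the outer suprema of C1, C4, C5 and C7: the power of the tail of w is continuous
  and increasing, the other factor decreases. In C6 the directions are reversed, with the integral
  of \<open>Phi\<close> as the continuous decreasing factor, so \<open>C6_eq\<close> uses
  \<open>ess_sup_right\<close>.\<close>

lemma ess_sup_W_power:
  assumes x: "x \<le> b" and e: "0 < e" and S: "\<And>s t. a < s \<Longrightarrow> s \<le> t \<Longrightarrow> ereal t < x \<Longrightarrow> S t \<le> S s"
  shows "ess_sup a x (\<lambda>t. integ t b w epowr (- e) * S t) = (SUP t\<in>einterval a x. integ t b w epowr (- e) * S t)"
proof (rule ess_sup_left)
  have [measurable]: "S \<in> borel_measurable (lebesgue_on (einterval a x))"
    by (rule antimono_measurable) (auto simp: einterval_iff intro: S)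
  have [measurable]: "(\<lambda>t. integ t b w) \<in> borel_measurable (lebesgue_on (einterval a x))"
    by (rule antimono_measurable) (auto intro: integ_subset)
  show "(\<lambda>t. integ t b w epowr (- e) * S t) \<in> borel_measurable (lebesgue_on (einterval a x))"
    by measurable
next
  fix t c assume t: "t \<in> einterval a x" and c: "c < integ t b w epowr (- e)"
  have "ereal t < b" using t x less_le_trans[of "ereal t" x b] by (auto simp: einterval_iff)
  then show "\<exists>s<t. ereal a \<le> ereal s \<and> (\<forall>s'\<in>{s<..<t}. c \<le> integ s' b w epowr (- e))"
    using t w w_fin e c by (intro integ_power_left_lsc) (auto simp: einterval_iff)
qed (auto simp: einterval_iff intro: S)

lemma ess_sup_C1_inner:
  assumes x: "a \<le> x"
  shows "ess_sup x b (\<lambda>t. integ t b u epowr (1 / q) * V r v x t) = (SUP t\<in>einterval x b. integ t b u epowr (1 / q) * V r v x t)"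
proof (rule ess_sup_right)
  have [measurable]: "(\<lambda>t. integ t b u) \<in> borel_measurable (lebesgue_on (einterval x b))"
    by (rule antimono_measurable) (auto intro: integ_subset)
  have [measurable]: "(\<lambda>t. V r v x t) \<in> borel_measurable (lebesgue_on (einterval x b))"
    using x by (intro mono_measurable V_mono) (auto simp: einterval_iff)
  show "(\<lambda>t. integ t b u epowr (1 / q) * V r v x t) \<in> borel_measurable (lebesgue_on (einterval x b))"
    by measurable
qed (use x q u in \<open>auto simp: einterval_iff intro!: integ_power_right_lsc V_mono\<close>)

lemma C1_eq:
  "C1 a b p q r u v w = (SUP x\<in>einterval a b. integ x b w epowr (- (1 / p)) *
     (SUP t\<in>einterval x b. integ t b u epowr (1 / q) * V r v x t))"
proof -
  let ?S = "\<lambda>x. ess_sup x b (\<lambda>t. integ t b u epowr (1 / q) * V r v x t)"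
  have mono: "?S t \<le> ?S s" if "s \<in> einterval a b" "t \<in> einterval a b" "s \<le> t" for s t
  proof -
    have st: "a \<le> s" "a \<le> t" using that by (auto simp: einterval_iff)
    show ?thesis
      unfolding ess_sup_C1_inner[OF st(1)] ess_sup_C1_inner[OF st(2)]
    proof (rule SUP_mono)
      fix y assume y: "y \<in> einterval t b"
      then have "y \<in> einterval s b" using that(3) by (auto simp: einterval_iff intro: le_less_trans)
      moreover have "V r v t y \<le> V r v s y" using that y st by (intro V_mono) (auto simp: einterval_iff)
      ultimately show "\<exists>y'\<in>einterval s b. integ y b u epowr (1 / q) * V r v t y \<le> integ y' b u epowr (1 / q) * V r v s y'"
        by (intro bexI[of _ y] mult_left_mono) auto
    qed
  qed
  have "C1 a b p q r u v w = (SUP x\<in>einterval a b. integ x b w epowr (- (1 / p)) * ?S x)"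
    unfolding C1_def W_def
  proof (rule ess_sup_W_power)
    fix s t assume st: "a < s" "s \<le> t" "ereal t < b"
    from st(3,2) have "ereal s < b" by (rule ereal_real_trans(3))
    with st show "?S t \<le> ?S s" by (intro mono) (auto simp: einterval_iff)
  qed (use p in auto)
  also have "\<dots> = (SUP x\<in>einterval a b. integ x b w epowr (- (1 / p)) *
     (SUP t\<in>einterval x b. integ t b u epowr (1 / q) * V r v x t))"
    using ess_sup_C1_inner by (intro SUP_cong) (auto simp: einterval_iff)
  finally show ?thesis .
qed

lemma C2_eq:
  assumes "q < 1"
  shows "C2 a b p q r u v w = (SUP x\<in>einterval a b. integ x b w epowr (- (1 / p)) * E x b)"
  using assms by (simp add: C2_def W_def E_def)

lemma C3_eq:
  "C3 a b p q r u v w = (SUP x\<in>einterval a b. integ x b u epowr (1 / q) * TT x epowr ((p - r) / (p * r)))"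
  by (simp add: C3_def W_def TT_def)

lemma C4_eq:
  assumes qp: "q < p"
  shows "C4 a b p q r u v w = J4 epowr ((p - q) / (p * q))"
proof -
  have "0 < q / (p - q)" "0 < p * q / (p - q)" using qp p q by auto
  then show ?thesis
    unfolding C4_def J4_def W_def
    by (intro arg_cong[of _ _ "\<lambda>z. z epowr _"] integ_cong arg_cong2[of _ _ _ _ "(*)"] refl ess_sup_W_power epowr_mono V_mono)
       (auto simp: einterval_iff)
qed

lemma C5_eq:
  assumes qp: "q < p" and q1: "q < 1"
  shows "C5 a b p q r u v w = J57 epowr ((p - q) / (p * q))"
proof -
  have pos: "0 < p / (p - q)" "0 < p * q / (p - q)" using qp p q by auto
  have e: "p * (1 - q) / (p - q) = (1 - q) / q * (p * q / (p - q))" using q by simp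
  have E: "integ y x (\<lambda>t. integ t x u epowr (q / (1 - q)) * u t * V r v y t epowr (q / (1 - q))) epowr (p * (1 - q) / (p - q))
    = E y x epowr (p * q / (p - q))" for y x
    unfolding E_def if_P[OF q1] epowr_epowr e ..
  show ?thesis
    unfolding C5_def J57_def W_def E using pos
    by (intro arg_cong[of _ _ "\<lambda>z. z epowr _"] integ_cong arg_cong2[of _ _ _ _ "(*)"] refl ess_sup_W_power epowr_mono E_mono)
       (auto simp: einterval_iff)
qed

lemma ess_sup_C7_inner:
  assumes y: "a \<le> y" "y < x" "ereal x \<le> b" and qp: "q < p" and q1: "1 \<le> q"
  shows "ess_sup y x (\<lambda>t. integ t x u epowr (p / (p - q)) * V r v y t epowr (p * q / (p - q))) = E y x epowr (p * q / (p - q))"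
proof -
  have pos: "0 < p / (p - q)" "0 < p * q / (p - q)" "1 / q * (p * q / (p - q)) = p / (p - q)" using qp p q by auto
  have "ess_sup y x (\<lambda>t. integ t x u epowr (p / (p - q)) * V r v y t epowr (p * q / (p - q)))
    = (SUP t\<in>einterval y x. integ t x u epowr (p / (p - q)) * V r v y t epowr (p * q / (p - q)))"
  proof (rule ess_sup_right)
    have [measurable]: "(\<lambda>t. integ t x u) \<in> borel_measurable (lebesgue_on (einterval y x))"
      by (rule antimono_measurable) (auto intro: integ_subset)
    have [measurable]: "(\<lambda>t. V r v y t) \<in> borel_measurable (lebesgue_on (einterval y x))"
    proof (intro mono_measurable V_mono)
      fix t assume "t \<in> einterval y x"
      then show "ereal t \<le> b" using y(3) by (auto simp: einterval_iff intro: order_trans[of _ "ereal x"])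
    qed (use y in auto)
    show "(\<lambda>t. integ t x u epowr (p / (p - q)) * V r v y t epowr (p * q / (p - q))) \<in> borel_measurable (lebesgue_on (einterval y x))"
      by measurable
  next
    fix t c assume "t \<in> einterval y x" "c < integ t x u epowr (p / (p - q))"
    then show "\<exists>s>t. ereal s \<le> ereal x \<and> (\<forall>s'\<in>{t<..<s}. c \<le> integ s' x u epowr (p / (p - q)))"
      using y pos u by (intro integ_power_right_lsc) (auto simp: einterval_iff)
  next
    fix s t assume st: "s \<in> einterval y x" "t \<in> einterval y x" "s \<le> t"
    then have "ereal t \<le> b" using y(3) by (auto simp: einterval_iff intro: order_trans[of _ "ereal x"])
    then show "V r v y s epowr (p * q / (p - q)) \<le> V r v y t epowr (p * q / (p - q))"
      using st y pos by (intro epowr_mono V_mono) auto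
  qed
  also have "\<dots> = (SUP t\<in>einterval y x. (integ t x u epowr (1 / q) * V r v y t) epowr (p * q / (p - q)))"
    unfolding epowr_mult[OF less_imp_le[OF pos(2)]] epowr_epowr pos(3) ..
  also have "\<dots> = E y x epowr (p * q / (p - q))"
  proof -
    obtain m where "y < m" "m < x" using dense[OF y(2)] by blast
    then have "einterval y x \<noteq> {}" by (auto simp: einterval_iff intro: ex_in_conv[THEN iffD1])
    then show ?thesis using q1 pos(2) by (simp add: E_def epowr_SUP)
  qed
  finally show ?thesis .
qed

lemma C7_eq:
  assumes qp: "q < p" and q1: "1 \<le> q"
  shows "C7 a b p q r u v w = J57 epowr ((p - q) / (p * q))"
proof -
  have pos: "0 < p / (p - q)" "0 < p * q / (p - q)" using qp p q by auto
  have "ess_sup a x (\<lambda>y. integ y b w epowr (- (p / (p - q))) *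
      ess_sup y x (\<lambda>t. integ t x u epowr (p / (p - q)) * V r v y t epowr (p * q / (p - q))))
    = (SUP y\<in>einterval a x. integ y b w epowr (- (p / (p - q))) * E y x epowr (p * q / (p - q)))"
    (is "ess_sup a x (\<lambda>y. _ * ?S y) = ?R") if x: "a < x" "ereal x < b" for x
  proof -
    have S: "?S y = E y x epowr (p * q / (p - q))" if "a < y" "y < x" for y
      using that x by (intro ess_sup_C7_inner qp q1) auto
    have "ess_sup a x (\<lambda>y. integ y b w epowr (- (p / (p - q))) * ?S y)
      = (SUP y\<in>einterval a x. integ y b w epowr (- (p / (p - q))) * ?S y)"
    proof (rule ess_sup_W_power[OF _ pos(1)])
      fix s t assume st: "a < s" "s \<le> t" "ereal t < ereal x"
      then show "?S t \<le> ?S s" using S[of s] S[of t] x pos by (simp add: epowr_mono E_mono)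
    qed (use x in auto)
    also have "\<dots> = ?R" using S by (intro SUP_cong refl) (auto simp: einterval_iff)
    finally show ?thesis .
  qed
  then show ?thesis
    unfolding C7_def J57_def W_def
    by (intro arg_cong[of _ _ "\<lambda>z. z epowr _"] integ_cong arg_cong2[of _ _ _ _ "(*)"] refl) (auto simp: einterval_iff)
qed

lemma C6_eq:
  assumes qp: "q < p" and rp: "r < p"
  shows "C6 a b p q r u v w = J6 epowr ((p - q) / (p * q))"
proof -
  let ?e = "q * (p - r) / (r * (p - q))"
  have e: "0 < ?e" using qp rp q r by simp
  have "ess_sup a x (\<lambda>y. integ y b w epowr (- 1) * integ y x Phi * TT y epowr ?e)
    = (SUP y\<in>einterval a x. integ y b w epowr (- 1) * integ y x Phi * TT y epowr ?e)" if x: "a < x" "ereal x < b" for x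
  proof -
    have yb: "ereal y \<le> b" if "y \<in> einterval a x" for y
      using that x by (auto simp: einterval_iff intro: order_trans[of _ "ereal x"])
    have mono: "integ s b w epowr (- 1) * TT s epowr ?e \<le> integ t b w epowr (- 1) * TT t epowr ?e"
      if "s \<in> einterval a x" "t \<in> einterval a x" "s \<le> t" for s t
      using that e yb[of t] rp by (intro mult_mono W_power_mono epowr_mono TT_mono) auto
    have "ess_sup a x (\<lambda>y. integ y x Phi * (integ y b w epowr (- 1) * TT y epowr ?e))
      = (SUP y\<in>einterval a x. integ y x Phi * (integ y b w epowr (- 1) * TT y epowr ?e))"
    proof (rule ess_sup_right)
      have [measurable]: "(\<lambda>y. integ y x Phi) \<in> borel_measurable (lebesgue_on (einterval a x))"
        by (rule antimono_measurable) (auto intro: integ_subset)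
      have [measurable]: "(\<lambda>y. integ y b w epowr (- 1) * TT y epowr ?e) \<in> borel_measurable (lebesgue_on (einterval a x))"
        by (rule mono_measurable) (rule mono)
      show "(\<lambda>y. integ y x Phi * (integ y b w epowr (- 1) * TT y epowr ?e)) \<in> borel_measurable (lebesgue_on (einterval a x))"
        by measurable
    next
      fix t c assume "t \<in> einterval a x" "c < integ t x Phi"
      then show "\<exists>s>t. ereal s \<le> ereal x \<and> (\<forall>s'\<in>{t<..<s}. c \<le> integ s' x Phi)"
        using x integ_power_right_lsc[OF Phi_measurable, of t x 1 c] by (auto simp: einterval_iff)
    qed (rule mono)
    then show ?thesis by (simp only: ac_simps)
  qed
  then show ?thesis
    unfolding C6_def J6_def W_def TT_def[symmetric] Phi_def[symmetric]
    by (intro arg_cong[of _ _ "\<lambda>z. z epowr _"] integ_cong arg_cong2[of _ _ _ _ "(*)"] refl) (auto simp: einterval_iff)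
qed

end

subsection \<open>The characterization\<close>

lemma epowr_bound:
  assumes "A \<le> n * D epowr s" "0 < s" "n epowr (1 / s) \<le> K"
  shows "A \<le> (K * D) epowr s"
proof -
  have "n = (n epowr (1 / s)) epowr s" using assms(2) by (simp add: epowr_epowr)
  also have "\<dots> \<le> K epowr s" using assms by (intro epowr_mono) auto
  finally have "n * D epowr s \<le> K epowr s * D epowr s" by (rule mult_right_mono) simp
  then show ?thesis using assms by (simp add: epowr_mult)
qed

lemma epowr_bound_left:
  assumes "A \<le> D epowr s" "0 < e" "0 \<le> s"
  shows "(n * A) epowr e \<le> n epowr e * D epowr (s * e)"
proof -
  have "(n * A) epowr e \<le> (n * D epowr s) epowr e"
    using assms by (intro epowr_mono mult_left_mono) auto
  then show ?thesis using assms by (simp add: epowr_mult epowr_epowr)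
qed

lemma epowr_minus_mult_le_iff:
  assumes "0 < x" "x < top"
  shows "x epowr (- e) * y \<le> z \<longleftrightarrow> y \<le> z * x epowr e"
  using mult_le_iff_inverse[of "x epowr (- e)" y z] assms
  by (simp add: epowr_pos' epowr_finite' epowr_epowr)

section \<open>One condition for all seven cases\<close>

context three_weights
begin

text \<open>Each clause is guarded by the parameter range in which the sufficiency argument uses it,
  so one sufficiency and one necessity statement serve all cases. In each case the clauses that
  remain say that the constants of that case are at most D, up to a factor when p <= q < 1.\<close>

definition bounded_by :: "ennreal \<Rightarrow> bool" where
  "bounded_by D \<longleftrightarrow>
    (p \<le> q \<longrightarrow> (\<forall>y. a < y \<and> ereal y < b \<longrightarrow> integ y b w epowr (- (1 / p)) * E y b \<le> D)) \<and>
    (p \<le> q \<or> r < p \<longrightarrow> (\<forall>y t. a < y \<and> y < t \<and> ereal t < b \<longrightarrow>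
      integ t b u * V r v y t epowr q \<le> D epowr q * integ y b w epowr (q / p))) \<and>
    (p \<le> q \<and> r < p \<longrightarrow> (\<forall>z. a < z \<and> ereal z < b \<longrightarrow>
      integ z b u * TT z epowr (q * (p - r) / (p * r)) \<le> D epowr q)) \<and>
    (q < p \<longrightarrow> J57 \<le> D epowr (p * q / (p - q))) \<and>
    (q < p \<and> p \<le> r \<longrightarrow> J4 \<le> D epowr (p * q / (p - q))) \<and>
    (q < p \<and> r < p \<longrightarrow> J6 \<le> D epowr (p * q / (p - q)))"

lemma bounded_by_mono:
  assumes "bounded_by D" "D \<le> D'"
  shows "bounded_by D'"
proof -
  have 1: "D epowr q \<le> D' epowr q" using assms q by (intro epowr_mono) auto
  have 2: "D epowr (p * q / (p - q)) \<le> D' epowr (p * q / (p - q))" if "q < p"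
    using assms that p q by (intro epowr_mono) auto
  have 3: "D epowr q * z \<le> D' epowr q * z" for z using 1 by (rule mult_right_mono) simp
  show ?thesis
    using assms(1) unfolding bounded_by_def
    by (meson 1 2 3 assms(2) order_trans)
qed

text \<open>In this form, with q-th powers and no negative power of the tail of w, the condition is
  both used and proved. The tail may be moved across because it is positive and finite inside (a,
  b).\<close>

lemma C1_le_iff:
  "C1 a b p q r u v w \<le> D \<longleftrightarrow> (\<forall>y t. a < y \<and> y < t \<and> ereal t < b \<longrightarrow>
    integ t b u * V r v y t epowr q \<le> D epowr q * integ y b w epowr (q / p))"
proof -
  have *: "integ y b w epowr (- (1 / p)) * (integ t b u epowr (1 / q) * V r v y t) \<le> D
    \<longleftrightarrow> integ t b u * V r v y t epowr q \<le> D epowr q * integ y b w epowr (q / p)"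
    if "a < y" "ereal y < b" for y t
  proof -
    have "integ y b w epowr (- (1 / p)) * (integ t b u epowr (1 / q) * V r v y t) \<le> D
      \<longleftrightarrow> integ t b u epowr (1 / q) * V r v y t \<le> D * integ y b w epowr (1 / p)"
      using that by (intro epowr_minus_mult_le_iff w_integ_pos w_fin)
    also have "\<dots> \<longleftrightarrow> (integ t b u epowr (1 / q) * V r v y t) epowr q \<le> (D * integ y b w epowr (1 / p)) epowr q"
      using q by (simp only: epowr_mono_iff)
    finally show ?thesis using q by (simp add: epowr_mult epowr_epowr)
  qed
  have "C1 a b p q r u v w \<le> D \<longleftrightarrow> (\<forall>y\<in>einterval a b. \<forall>t\<in>einterval y b.
    integ y b w epowr (- (1 / p)) * (integ t b u epowr (1 / q) * V r v y t) \<le> D)"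
    unfolding C1_eq SUP_mult_left_ennreal SUP_le_iff ..
  also have "\<dots> \<longleftrightarrow> (\<forall>y t. a < y \<and> y < t \<and> ereal t < b \<longrightarrow>
    integ t b u * V r v y t epowr q \<le> D epowr q * integ y b w epowr (q / p))"
  proof -
    have "ereal y < b" if "y < t" "ereal t < b" for y t
      using that(2) less_imp_le[OF that(1)] by (rule ereal_real_trans(3))
    then show ?thesis using * by (auto simp: einterval_iff)
  qed
  finally show ?thesis .
qed

lemma E_bound_C1:
  assumes "1 \<le> q"
  shows "C1 a b p q r u v w \<le> D \<longleftrightarrow> (\<forall>y. a < y \<and> ereal y < b \<longrightarrow> integ y b w epowr (- (1 / p)) * E y b \<le> D)"
  unfolding C1_eq SUP_le_iff using assms by (auto simp: E_def einterval_iff)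

lemma E_bound_C2:
  assumes "q < 1"
  shows "C2 a b p q r u v w \<le> D \<longleftrightarrow> (\<forall>y. a < y \<and> ereal y < b \<longrightarrow> integ y b w epowr (- (1 / p)) * E y b \<le> D)"
  unfolding C2_eq[OF assms] SUP_le_iff by (auto simp: einterval_iff)

lemma C3_le_iff:
  "C3 a b p q r u v w \<le> D \<longleftrightarrow> (\<forall>z. a < z \<and> ereal z < b \<longrightarrow> integ z b u * TT z epowr (q * (p - r) / (p * r)) \<le> D epowr q)"
proof -
  have "integ z b u epowr (1 / q) * TT z epowr ((p - r) / (p * r)) \<le> D
    \<longleftrightarrow> integ z b u * TT z epowr (q * (p - r) / (p * r)) \<le> D epowr q" for z
  proof -
    have e: "(p - r) / (p * r) * q = q * (p - r) / (p * r)" "1 / q * q = 1" using q by auto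
    have eq: "(integ z b u epowr (1 / q) * TT z epowr ((p - r) / (p * r))) epowr q = integ z b u * TT z epowr (q * (p - r) / (p * r))"
      unfolding epowr_mult[OF less_imp_le[OF q]] epowr_epowr e epowr_one ..
    show ?thesis unfolding eq[symmetric] epowr_mono_iff[OF q] ..
  qed
  then show ?thesis unfolding C3_eq SUP_le_iff by (auto simp: einterval_iff)
qed

lemma power_constant_le_iff:
  assumes "q < p"
  shows "J epowr ((p - q) / (p * q)) \<le> D \<longleftrightarrow> J \<le> D epowr (p * q / (p - q))"
  using epowr_le_iff[of "(p - q) / (p * q)" J D] assms p q by simp

lemma integ_top:
  assumes "a \<le> s" "s < t" "ereal t \<le> b" and f: "\<And>z. s < z \<Longrightarrow> z < t \<Longrightarrow> top * u z \<le> f z" and y: "y \<le> ereal s" "ereal t \<le> y'"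
  shows "integ y y' f = top"
proof -
  have "0 < integ s t u" using assms u u_pos by (intro integ_pos) auto
  then have "top = top * integ s t u" by (simp add: ennreal_top_mult)
  also have "\<dots> = integ s t (\<lambda>z. top * u z)" using assms u by (intro integ_cmult[symmetric]) auto
  also have "\<dots> \<le> integ s t f" using f by (intro integ_mono) (auto simp: einterval_iff)
  also have "\<dots> \<le> integ y y' f" using y by (rule integ_subset)
  finally show ?thesis by (simp add: top_unique)
qed

text \<open>An infinite tail at t is infinite at all points to the left of t, and then the integrand
  of E is infinite on (s, t), where V is bounded below by its positive value at s.\<close>

lemma u_finite_of_E:
  assumes q1: "q < 1" and y: "a < y" "y < t" "ereal t < b" and E: "E y b < top"
  shows "integ t b u < top"
proof (rule ccontr)
  assume "\<not> integ t b u < top"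
  then have U: "integ t b u = top" by (simp add: not_less top_unique)
  obtain s where s: "y < s" "s < t" using dense[OF y(2)] by blast
  have e: "0 < q / (1 - q)" using q q1 by simp
  have "ereal s < b" using y(3) less_imp_le[OF s(2)] by (rule ereal_real_trans(3))
  then have V: "0 < V r v y s" using y s by (intro V_pos) auto
  have "integ y b (\<lambda>t. integ t b u epowr (q / (1 - q)) * u t * V r v y t epowr (q / (1 - q))) = top"
  proof (rule integ_top)
    fix z assume z: "s < z" "z < t"
    have "top = integ z b u" using U integ_subset[of z t b b u] z by (simp add: top_unique)
    then have Uz: "integ z b u epowr (q / (1 - q)) = top" using e by simp
    have "ereal z < b" using y(3) less_imp_le[OF z(2)] by (rule ereal_real_trans(3))
    then have "V r v y s \<le> V r v y z" using y s z by (intro V_mono) auto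
    then have "0 < V r v y z epowr (q / (1 - q))" using V e by (intro epowr_pos) auto
    then show "top * u z \<le> integ z b u epowr (q / (1 - q)) * u z * V r v y z epowr (q / (1 - q))"
      unfolding Uz by (auto simp: ennreal_mult_eq_top_iff ennreal_top_mult ennreal_mult_top)
  qed (use y s in auto)
  then have "E y b = top" using q q1 by (simp add: E_def)
  then show False using E by simp
qed

text \<open>Cutting u into dyadic blocks needs finite tails, which here come from the constants.
  Where the pointwise clause is available it gives them directly, as V is positive; for q < p <= r
  an infinite tail would make the integrand of \<open>J4\<close> infinite on an interval.\<close>

lemma u_finite:
  assumes D: "bounded_by D" "D < top" and t: "a < t" "ereal t < b"
  shows "integ t b u < top"
proof (rule ccontr)
  assume "\<not> integ t b u < top"
  then have U: "integ t b u = top" by (simp add: not_less top_unique)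
  obtain s where s: "a < s" "s < t" using dense[OF t(1)] by blast
  obtain y where y: "a < y" "y < s" using dense[OF s(1)] by blast
  have sb: "ereal s < b" using t(2) less_imp_le[OF s(2)] by (rule ereal_real_trans(3))
  have yb: "ereal y < b" using sb less_imp_le[OF y(2)] by (rule ereal_real_trans(3))
  show False
  proof (cases "p \<le> q \<or> r < p")
    case True
    have "0 < V r v y t" using y s t by (intro V_pos) auto
    then have "0 < V r v y t epowr q" using q by (intro epowr_pos)
    then have "top = integ t b u * V r v y t epowr q" unfolding U by (simp add: ennreal_top_mult)
    also have "\<dots> \<le> D epowr q * integ y b w epowr (q / p)"
      using D(1) True y s t unfolding bounded_by_def by auto
    also have "\<dots> < top"
      using D(2) w_fin[OF y(1) yb] p q by (intro ennreal_mult_less_top[THEN iffD2] disjI2 conjI epowr_finite) auto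
    finally show False by simp
  next
    case False
    then have qp: "q < p" and pr: "p \<le> r" by auto
    let ?e = "q / (p - q)" and ?s = "p * q / (p - q)"
    let ?S = "\<lambda>x. SUP t\<in>einterval a x. integ t b w epowr (- ?e) * V r v t x epowr ?s"
    have e: "0 < ?e" "0 < ?s" using p q qp by auto
    have "0 < V r v y s" using y sb by (intro V_pos) auto
    then have "0 < V r v y s epowr ?s" using e by (intro epowr_pos)
    moreover have "0 < integ y b w epowr (- ?e)"
      using y yb by (intro epowr_pos' w_integ_pos w_fin)
    ultimately have c0: "0 < integ y b w epowr (- ?e) * V r v y s epowr ?s" by (simp add: ennreal_zero_less_mult_iff)
    have "J4 = top"
      unfolding J4_def
    proof (rule integ_top)
      fix z assume z: "s < z" "z < t"
      have "top = integ z b u" using U integ_subset[of z t b b u] z by (simp add: top_unique)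
      then have Uz: "integ z b u epowr ?e = top" using e by simp
      have zb: "ereal z < b" using t(2) less_imp_le[OF z(2)] by (rule ereal_real_trans(3))
      have "integ y b w epowr (- ?e) * V r v y s epowr ?s \<le> integ y b w epowr (- ?e) * V r v y z epowr ?s"
        using y z zb e by (intro mult_left_mono epowr_mono V_mono) auto
      also have "\<dots> \<le> ?S z" using y z by (intro SUP_upper) (auto simp: einterval_iff)
      finally have "0 < ?S z" using c0 by (rule less_le_trans[rotated])
      then show "top * u z \<le> integ z b u epowr ?e * u z * ?S z"
        unfolding Uz by (auto simp: ennreal_mult_eq_top_iff ennreal_top_mult ennreal_mult_top)
    qed (use s t in auto)
    moreover have "J4 \<le> D epowr ?s" using D(1) qp pr unfolding bounded_by_def by auto
    moreover have "D epowr ?s < top" using D(2) e by (intro epowr_finite) auto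
    ultimately show False by simp
  qed
qed

text \<open>\<open>V_point_le_B\<close> bounds the left side by B, and \<open>Hardy_upper\<close>
  bounds B by the power of E. The finite tails of u that both need follow from the finiteness of E
  at a point further left.\<close>

lemma point_of_E:
  assumes q1: "q < 1" and D: "D < top"
    and E: "\<And>y. a < y \<Longrightarrow> ereal y < b \<Longrightarrow> integ y b w epowr (- (1 / p)) * E y b \<le> D"
    and y: "a < y" "y < t" "ereal t < b"
  shows "integ t b u * V r v y t epowr q \<le> cHU * (D epowr q * integ y b w epowr (q / p))"
proof -
  have Ele: "E z b \<le> D * integ z b w epowr (1 / p)" if "a < z" "ereal z < b" for z
    using E[OF that] epowr_minus_mult_le_iff[OF w_integ_pos[OF that] w_fin[OF that]] by simp
  have fin: "integ s b u < top" if s: "a < s" "ereal s < b" for s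
  proof -
    obtain z where z: "a < z" "z < s" using dense[OF s(1)] by blast
    have zb: "ereal z < b" using s(2) less_imp_le[OF z(2)] by (rule ereal_real_trans(3))
    note Ele[OF z(1) zb]
    also have "D * integ z b w epowr (1 / p) < top"
      using D w_fin[OF z(1) zb] p by (intro ennreal_mult_less_top[THEN iffD2] disjI2 conjI epowr_finite) auto
    finally show ?thesis using q1 z s by (intro u_finite_of_E)
  qed
  have yb: "ereal y < b" using y(3) less_imp_le[OF y(2)] by (rule ereal_real_trans(3))
  have "integ t b u * V r v y t epowr q \<le> B y b"
    using y fin[of t] by (intro V_point_le_B) auto
  also have "\<dots> \<le> cHU * E y b epowr q"
    unfolding B_def
  proof (rule SUP_least)
    fix f assume f: "f \<in> unit_ball y b"
    have "outer f y b \<le> cHU * E y b epowr q * integ y b f epowr q"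
      using y fin unit_ballD(1)[OF f] by (intro Hardy_upper) auto
    also have "\<dots> \<le> cHU * E y b epowr q * 1 epowr q"
      using unit_ballD(3)[OF f] q by (intro mult_left_mono epowr_mono) auto
    finally show "outer f y b \<le> cHU * E y b epowr q" by simp
  qed
  also have "\<dots> \<le> cHU * (D * integ y b w epowr (1 / p)) epowr q"
    using Ele[OF y(1) yb] q by (intro mult_left_mono epowr_mono) auto
  finally show ?thesis using q by (simp add: epowr_mult epowr_epowr)
qed

text \<open>Monotone convergence along cut-off points decreasing to a: in the inner integral by
  continuity in the left end point, then in the outer one.\<close>

lemma outer_limit:
  assumes f: "f \<in> borel_measurable L"
    and K: "\<And>a'. a < a' \<Longrightarrow> ereal a' < b \<Longrightarrow> outer (\<lambda>s. f s * indicator {a'<..} s) a b \<le> K"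
  shows "outer f a b \<le> K"
proof -
  obtain m where m: "a < m" "ereal m < b" using einterval_dense[OF ab] by auto
  define an where "an n = a + (m - a) / real (n + 1)" for n
  have an: "a < an n" "ereal (an n) < b" for n
  proof -
    show "a < an n" using m by (simp add: an_def)
    have "(m - a) / real (n + 1) \<le> (m - a) / 1" using m by (intro divide_left_mono) auto
    then have "an n \<le> m" by (simp add: an_def)
    with m(2) show "ereal (an n) < b" by (rule ereal_real_trans(3))
  qed
  have an_anti: "an n \<le> an k" if "k \<le> n" for n k
    unfolding an_def using that m by (intro add_left_mono divide_left_mono) auto
  have an_small: "\<exists>n. an n < s" if "a < s" for s
  proof -
    have "0 < (s - a) / (m - a)" using that m by simp
    from reals_Archimedean[OF this] obtain n where "inverse (real (Suc n)) < (s - a) / (m - a)" by blast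
    then have "an n < s" using m by (simp add: an_def field_simps)
    then show ?thesis ..
  qed
  let ?g = "\<lambda>n t. inner f (an n) (ereal t) epowr (q / r) * u t"
  have mono: "?g n t \<le> ?g k t" if "n \<le> k" for n k t
    using an_anti[OF that] qr by (intro mult_right_mono epowr_mono inner_subset) auto
  have sup: "inner f a t epowr (q / r) * u t \<le> (SUP n. ?g n t)" if t: "a < t" "ereal t < b" for t
  proof -
    have "inner f a t \<le> (SUP n. inner f (an n) t)"
    proof (rule dense_le)
      fix c assume "c < inner f a t"
      then have "c < integ a t (\<lambda>s. f s epowr r * v s)" by (simp add: inner_def)
      then obtain s where "ereal a < ereal s" "ereal s < ereal t" "c < integ s t (\<lambda>s. f s epowr r * v s)"
        by (rule integ_less_left[OF inner_measurable_fun[OF f] order_refl less_imp_le[OF t(2)]])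
      then have s: "a < s" "c < inner f s t" by (auto simp: inner_def)
      obtain n where "an n < s" using an_small[OF s(1)] by blast
      then have "inner f s t \<le> inner f (an n) t" by (intro inner_subset) auto
      also have "\<dots> \<le> (SUP n. inner f (an n) t)" by (rule SUP_upper) simp
      finally show "c \<le> (SUP n. inner f (an n) t)" using s by simp
    qed
    then have "inner f a t epowr (q / r) \<le> (SUP n. inner f (an n) t epowr (q / r))"
      using qr by (subst epowr_SUP[symmetric]) (auto intro: epowr_mono)
    then have "inner f a t epowr (q / r) * u t \<le> (SUP n. inner f (an n) t epowr (q / r)) * u t" by (rule mult_right_mono) simp
    then show ?thesis by (simp add: SUP_mult_right_ennreal)
  qed
  have "outer f a b \<le> (\<integral>\<^sup>+t. (SUP n. ?g n t * indicator (einterval a b) t) \<partial>L)"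
    unfolding outer_def integ_L[OF order_refl order_refl] using sup
    by (intro nn_integral_mono) (auto simp: einterval_iff split: split_indicator)
  also have "\<dots> = (SUP n. \<integral>\<^sup>+t. ?g n t * indicator (einterval a b) t \<partial>L)"
  proof (rule nn_integral_monotone_convergence_SUP)
    show "incseq (\<lambda>n t. ?g n t * indicator (einterval a b) t)"
      unfolding incseq_def le_fun_def by (intro allI impI mult_right_mono[OF mono]) auto
    have [measurable]: "(\<lambda>t. inner f (an n) (ereal t)) \<in> borel_measurable L" for n
      unfolding inner_def using inner_measurable_fun[OF f] by (intro mono_measurable integ_subset) auto
    show "(\<lambda>t. ?g n t * indicator (einterval a b) t) \<in> borel_measurable L" for n by measurable
  qed
  also have "\<dots> \<le> K"
  proof (rule SUP_least)
    fix n
    have "inner f (an n) t \<le> inner (\<lambda>s. f s * indicator {an n<..} s) a t" for t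
    proof -
      have "inner f (an n) t = inner (\<lambda>s. f s * indicator {an n<..} s) (an n) t"
        unfolding inner_def by (intro integ_cong) (auto simp: einterval_iff)
      also have "\<dots> \<le> inner (\<lambda>s. f s * indicator {an n<..} s) a t"
        using an(1)[of n] by (intro inner_subset) auto
      finally show ?thesis .
    qed
    then have "(\<integral>\<^sup>+t. ?g n t * indicator (einterval a b) t \<partial>L) \<le> outer (\<lambda>s. f s * indicator {an n<..} s) a b"
      unfolding outer_def integ_L[OF order_refl order_refl] using qr
      by (intro nn_integral_mono mult_right_mono epowr_mono) auto
    also have "\<dots> \<le> K" using an by (rule K)
    finally show "(\<integral>\<^sup>+t. ?g n t * indicator (einterval a b) t \<partial>L) \<le> K" .
  qed
  finally show ?thesis .
qed

end

section \<open>Constants of the sufficiency part\<close>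

definition local_factor :: "real \<Rightarrow> real \<Rightarrow> ennreal" where
  "local_factor p q = (if p \<le> q then p2 (q / p) else p2 (2 * (p / (p - q)) + 1) epowr ((p - q) / p))"

text \<open>\<open>cT\<close> and \<open>c6\<close> take only the exponents as arguments, so this
  factor can be defined outside the locale and visibly depends on p, q and r alone. The four
  branches match the four bounds for \<open>global_const\<close>.\<close>

definition global_factor :: "real \<Rightarrow> real \<Rightarrow> real \<Rightarrow> ennreal" where
  "global_factor p q r =
    (if p \<le> q then
       if p \<le> r then p2 (1 + q / p)
       else p2 (q * (p - r) / (p * r)) * (p2 (1 + q / p) + p2 1 * three_weights.cT r p epowr (q * (p - r) / (p * r)))
     else if p \<le> r then p2 (2 * (p / (p - q)) + q / (p - q)) epowr ((p - q) / p)
     else (p2 (q * (p - r) / (p * r) * (p / (p - q)) + p / (p - q)) *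
       (p2 (1 + q / p) epowr (p / (p - q)) + three_weights.c6 r q p)) epowr ((p - q) / p))"

context dyadic_pair
begin

lemma local_const_bound:
  assumes D: "bounded_by D"
  shows "local_const x \<le> local_factor p q * D epowr q"
proof (cases "p \<le> q")
  case True
  then have "local_const x \<le> p2 (q / p) * D epowr q"
    using D unfolding bounded_by_def by (intro local_const_le_sup) auto
  then show ?thesis using True by (simp add: local_factor_def)
next
  case False
  then have qp: "q < p" by simp
  have pos: "0 < (p - q) / p" "0 \<le> p * q / (p - q)" "p * q / (p - q) * ((p - q) / p) = q" using p q qp by auto
  have "J57 \<le> D epowr (p * q / (p - q))" using D qp unfolding bounded_by_def by auto
  then have "(p2 (2 * (p / (p - q)) + 1) * J57) epowr ((p - q) / p)
    \<le> p2 (2 * (p / (p - q)) + 1) epowr ((p - q) / p) * D epowr (p * q / (p - q) * ((p - q) / p))"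
    using pos by (intro epowr_bound_left)
  with local_const_le_J57[OF qp] show ?thesis
    unfolding pos(3) using False by (simp add: local_factor_def)
qed

lemma global_const_bound:
  assumes D: "bounded_by D"
  shows "global_const \<tau> x \<le> global_factor p q r * D epowr q"
proof -
  let ?e2 = "q * (p - r) / (p * r)" and ?k = "p / (p - q)" and ?s = "p * q / (p - q)"
  have K1: "integ t b u * V r v y t epowr q \<le> D epowr q * integ y b w epowr (q / p)"
    if "p \<le> q \<or> r < p" "a < y" "y < t" "ereal t < b" for y t
    using D that unfolding bounded_by_def by auto
  consider "p \<le> q" "p \<le> r" | "p \<le> q" "r < p" | "q < p" "p \<le> r" | "q < p" "r < p" by linarith
  then show ?thesis
  proof cases
    case 1
    then show ?thesis
      using global_const_le_sup[OF 1 K1] by (simp add: global_factor_def)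
  next
    case 2
    have K3: "integ z b u * TT z epowr ?e2 \<le> D epowr q" if "a < z" "ereal z < b" for z
      using D 2 that unfolding bounded_by_def by auto
    have "global_const \<tau> x \<le> p2 ?e2 * (p2 (1 + q / p) * D epowr q + p2 1 * cT epowr ?e2 * D epowr q)"
      using 2 by (intro global_const_le_C3 K1 K3) auto
    also have "\<dots> = p2 ?e2 * (p2 (1 + q / p) + p2 1 * cT epowr ?e2) * D epowr q"
      by (simp only: distrib_left distrib_right mult.assoc)
    finally show ?thesis using 2 by (simp add: global_factor_def)
  next
    case 3
    have pos: "0 < (p - q) / p" "0 \<le> ?s" "?s * ((p - q) / p) = q" using p q 3 by auto
    have "J4 \<le> D epowr ?s" using D 3 unfolding bounded_by_def by auto
    then have "(p2 (2 * ?k + q / (p - q)) * J4) epowr ((p - q) / p)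
      \<le> p2 (2 * ?k + q / (p - q)) epowr ((p - q) / p) * D epowr (?s * ((p - q) / p))"
      using pos by (intro epowr_bound_left)
    with global_const_le_J4[OF 3] show ?thesis
      unfolding pos(3) using 3 by (simp add: global_factor_def)
  next
    case 4
    have pos: "0 < (p - q) / p" "0 \<le> ?s" "?s * ((p - q) / p) = q" "0 \<le> ?k" "q * ?k = ?s" using p q 4 by auto
    have J6: "J6 \<le> D epowr ?s" using D 4 unfolding bounded_by_def by auto
    have "global_const \<tau> x \<le> (p2 (?e2 * ?k + ?k) * ((p2 (1 + q / p) * D epowr q) epowr ?k + c6 * J6)) epowr ((p - q) / p)"
      using 4 by (intro global_const_le_J6 K1) auto
    also have "\<dots> \<le> (p2 (?e2 * ?k + ?k) * ((p2 (1 + q / p) * D epowr q) epowr ?k + c6 * D epowr ?s)) epowr ((p - q) / p)"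
      using J6 pos by (intro epowr_mono mult_left_mono add_left_mono) auto
    also have "(p2 (1 + q / p) * D epowr q) epowr ?k = p2 (1 + q / p) epowr ?k * D epowr ?s"
      unfolding epowr_mult[OF pos(4)] epowr_epowr pos(5) ..
    also have "p2 (?e2 * ?k + ?k) * (p2 (1 + q / p) epowr ?k * D epowr ?s + c6 * D epowr ?s)
      = (p2 (?e2 * ?k + ?k) * (p2 (1 + q / p) epowr ?k + c6)) * D epowr ?s"
      by (simp only: distrib_left distrib_right mult.assoc)
    also have "\<dots> epowr ((p - q) / p) = (p2 (?e2 * ?k + ?k) * (p2 (1 + q / p) epowr ?k + c6)) epowr ((p - q) / p) * D epowr q"
      unfolding epowr_mult[OF less_imp_le[OF pos(1)]] epowr_epowr pos(3) ..
    finally show ?thesis using 4 by (simp add: global_factor_def)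
  qed
qed

end

context three_weights
begin

lemma factors_finite: "local_factor p q < top" "global_factor p q r < top"
proof -
  have cT: "cT epowr e < top" for e unfolding cT_def p2_epowr by simp
  have "c6 < top" unfolding c6_def using cT by (simp add: ennreal_mult_less_top)
  then show "local_factor p q < top" "global_factor p q r < top"
    using cT p q unfolding local_factor_def global_factor_def
    by (auto simp: p2_epowr ennreal_mult_less_top intro!: epowr_finite)
qed

definition suff_factor :: ennreal where
  "suff_factor = (cS * (local_factor p q + global_factor p q r)) epowr (1 / q)"

lemma dyadic_pair_exists:
  assumes fin: "\<And>t. a < t \<Longrightarrow> ereal t < b \<Longrightarrow> integ t b u < top" and a': "a < a'" "ereal a' < b"
  obtains x \<tau> where "dyadic_pair a b r v q u p w a' x \<tau>"
proof -
  obtain x where x: "dyadic w a' b x"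
    by (rule dyadic_exists[OF w w_pos, of a' b]) (use a' w_fin in auto)
  obtain \<tau> where \<tau>: "dyadic u a' b \<tau>"
    by (rule dyadic_exists[OF u u_pos, of a' b]) (use a' fin in auto)
  have "dyadic_pair a b r v q u p w a' x \<tau>"
    using x \<tau> a' by unfold_locales
  then show ?thesis by (rule that)
qed

lemma sufficiency:
  assumes D: "bounded_by D" "D < top" and f: "f \<in> borel_measurable L"
  shows "outer f a b epowr (1 / q) \<le> suff_factor * D * R f epowr (1 / p)"
proof -
  let ?K = "cS * (local_factor p q + global_factor p q r)"
  have "outer f a b \<le> ?K * D epowr q * R f epowr (q / p)"
  proof (rule outer_limit[OF f])
    fix a' assume a': "a < a'" "ereal a' < b"
    let ?f = "\<lambda>s. f s * indicator {a'<..} s"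
    from dyadic_pair_exists[OF u_finite[OF D] a'] obtain x \<tau>
      where "dyadic_pair a b r v q u p w a' x \<tau>" by blast
    then interpret dyadic_pair a b r v q u p w a' x \<tau> .
    have [measurable]: "(indicator {a'<..} :: real \<Rightarrow> ennreal) \<in> borel_measurable L"
      by (rule mono_measurable) (auto split: split_indicator)
    have [measurable]: "?f \<in> borel_measurable L" using f by measurable
    have "outer ?f a b \<le> cS * (local_const x + global_const \<tau> x) * R ?f epowr (q / p)"
      using u_finite[OF D] by (intro discrete_sufficiency[OF a' _ _ _ dx dt]) auto
    also have "\<dots> \<le> cS * (local_factor p q * D epowr q + global_factor p q r * D epowr q) * R f epowr (q / p)"
    proof (intro mult_mono add_mono local_const_bound global_const_bound D epowr_mono order_refl)
      show "R ?f \<le> R f"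
        unfolding R_def using p by (intro integ_mono mult_right_mono epowr_mono) (auto split: split_indicator)
    qed (use p q in auto)
    also have "\<dots> = ?K * D epowr q * R f epowr (q / p)" by (simp only: distrib_right mult.assoc)
    finally show "outer ?f a b \<le> ?K * D epowr q * R f epowr (q / p)" .
  qed
  then have "outer f a b epowr (1 / q) \<le> (?K * D epowr q * R f epowr (q / p)) epowr (1 / q)"
    using q by (intro epowr_mono) auto
  also have "\<dots> = suff_factor * D * R f epowr (1 / p)"
    using q by (simp add: suff_factor_def epowr_mult epowr_epowr)
  finally show ?thesis .
qed

lemma suff_factor_finite: "suff_factor < top"
  unfolding suff_factor_def using q cS_finite factors_finite
  by (intro epowr_finite) (auto simp: ennreal_mult_less_top)

text \<open>The sum of the constants of all necessity estimates, each raised to the power that makes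
  it a factor of C itself. The conditions restrict each summand to the range in which its estimate
  holds and it is shown to be finite.\<close>

definition nec_factor :: ennreal where
  "nec_factor = 1 + (p2 (4 + q / r)) epowr (1 / q) +
    (if p \<le> q \<and> r < p
     then (cL epowr (q * (p - r) / (p * r)) * p2 (q / r) * cR epowr (q / p)) epowr (1 / q) else 0) +
    (if q < p
     then (p2 (1 + p / (p - q) + (4 + q / r) * (p / (p - q))) * polygeo (p / (p - q)) *
         (p2 1 * cR epowr (q / p)) epowr (p / (p - q))) epowr (1 / (p * q / (p - q))) +
       (p2 (p / (p - q)) * p2 (4 + q / r) epowr (p / (p - q))) epowr (1 / (p * q / (p - q))) else 0) +
    (if q < p \<and> r < p then K6 epowr (1 / (p * q / (p - q))) else 0)"

lemma cR_finite: "cR < top"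
  unfolding cR_def using p by (simp add: ennreal_mult_less_top GH_finite)

lemma cL_finite: "r < p \<Longrightarrow> cL < top"
proof -
  assume rp: "r < p"
  have "0 < p / (p - r) - 1" using rp r by (simp add: field_simps)
  then show ?thesis
    unfolding cL_def using rp p r rho_pos by (simp add: ennreal_mult_less_top GH_finite)
qed

lemma K6_finite:
  assumes qp: "q < p" and rp: "r < p" shows "K6 < top"
proof -
  have e: "0 < p / (p - q)" "0 < q * (p - r) / (r * (p - q))" "0 \<le> q / p" using qp rp p q r by auto
  have R: "cR epowr (q / p) < top" using cR_finite e by (intro epowr_finite)
  have "(p2 (2 + 2 * q / r) * cR epowr (q / p)) epowr (p / (p - q)) < top"
    using R e by (intro epowr_finite) (auto simp: ennreal_mult_less_top)
  then have "A6 < top"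
    unfolding A6_def using GH_finite[OF e(1,2)] by (simp add: ennreal_mult_less_top)
  moreover have "(p2 1 * cR epowr (q / p)) epowr (p / (p - q)) < top"
    using R e by (intro epowr_finite) (auto simp: ennreal_mult_less_top)
  moreover have "cL epowr (q * (p - r) / (r * (p - q))) < top"
    using cL_finite[OF rp] e by (intro epowr_finite) auto
  ultimately show ?thesis
    unfolding K6_def using geo_finite[of 1] GH_finite[of 1 1] by (simp add: ennreal_mult_less_top)
qed

lemma nec_factor_finite: "nec_factor < top"
proof -
  have R: "cR epowr (q / p) < top" using cR_finite p q by (intro epowr_finite) auto
  have 1: "(cL epowr (q * (p - r) / (p * r)) * p2 (q / r) * cR epowr (q / p)) epowr (1 / q) < top" if rp: "r < p"
  proof -
    have "cL epowr (q * (p - r) / (p * r)) < top" using cL_finite[OF rp] rp p q r by (intro epowr_finite) auto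
    then show ?thesis using R q by (intro epowr_finite) (auto simp: ennreal_mult_less_top)
  qed
  have 2: "(p2 (1 + p / (p - q) + (4 + q / r) * (p / (p - q))) * polygeo (p / (p - q)) *
         (p2 1 * cR epowr (q / p)) epowr (p / (p - q))) epowr (1 / (p * q / (p - q))) < top" if qp: "q < p"
  proof -
    have "(p2 1 * cR epowr (q / p)) epowr (p / (p - q)) < top"
      using R qp p by (intro epowr_finite) (auto simp: ennreal_mult_less_top)
    moreover have "polygeo (p / (p - q)) < top" using qp p by (intro polygeo_finite) auto
    ultimately show ?thesis using qp p q by (intro epowr_finite) (auto simp: ennreal_mult_less_top)
  qed
  have 3: "(p2 (p / (p - q)) * p2 (4 + q / r) epowr (p / (p - q))) epowr (1 / (p * q / (p - q))) < top"
    by (simp add: p2_epowr p2_add)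
  have 4: "K6 epowr (1 / (p * q / (p - q))) < top" if "q < p" "r < p"
    using K6_finite[OF that] that p q by (intro epowr_finite) auto
  show ?thesis
    unfolding nec_factor_def using 1 2 3 4 by (simp add: p2_epowr)
qed

end

context necessity_dyadic
begin

lemma bounded_by_nec_factor: "bounded_by (nec_factor * C)"
proof -
  let ?k = "p / (p - q)" and ?s = "p * q / (p - q)"
  have one: "1 \<le> nec_factor" unfolding nec_factor_def by (simp add: add.assoc)
  have power: "(C epowr q) epowr ?k = C epowr ?s" by (simp add: epowr_epowr mult.commute)
  have s: "0 < ?s" "0 \<le> ?k" if "q < p" using that p q by auto
  have E: "integ y b w epowr (- (1 / p)) * E y b \<le> nec_factor * C" if y: "a < y" "ereal y < b" for y
  proof -
    have "p2 (4 + q / r) epowr (1 / q) \<le> nec_factor"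
      unfolding nec_factor_def by (intro add_increasing2 add_increasing order_refl zero_le)
    moreover have "E y b epowr q \<le> p2 (4 + q / r) * (C * integ y b w epowr (1 / p)) epowr q"
      using E_le[of y] y q by (simp add: epowr_mult epowr_epowr)
    ultimately have "E y b epowr q \<le> (nec_factor * (C * integ y b w epowr (1 / p))) epowr q"
      using q by (intro epowr_bound)
    then have "E y b \<le> nec_factor * C * integ y b w epowr (1 / p)"
      using q by (simp only: epowr_mono_iff mult.assoc)
    then show ?thesis using epowr_minus_mult_le_iff[OF w_integ_pos[OF y] w_fin[OF y]] by simp
  qed
  have V: "integ t b u * V r v y t epowr q \<le> (nec_factor * C) epowr q * integ y b w epowr (q / p)"
    if "a < y" "y < t" "ereal t < b" for y t
  proof -
    have "1 * C \<le> nec_factor * C" using one by (rule mult_right_mono) simp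
    then have "C epowr q \<le> (nec_factor * C) epowr q" using q by (intro epowr_mono) auto
    then have "C epowr q * integ y b w epowr (q / p) \<le> (nec_factor * C) epowr q * integ y b w epowr (q / p)"
      by (rule mult_right_mono) simp
    with point_le[of y t] that show ?thesis by simp
  qed
  have T: "integ z b u * TT z epowr (q * (p - r) / (p * r)) \<le> (nec_factor * C) epowr q"
    if z: "a < z" "ereal z < b" and pq: "p \<le> q" "r < p" for z
  proof (rule epowr_bound[OF TT_point_le[OF pq(2) z] q])
    show "(cL epowr (q * (p - r) / (p * r)) * p2 (q / r) * cR epowr (q / p)) epowr (1 / q) \<le> nec_factor"
      unfolding nec_factor_def using pq
      by (simp only: if_True simp_thms) (intro add_increasing2 add_increasing order_refl zero_le)
  qed
  have J57: "J57 \<le> (nec_factor * C) epowr ?s" if qp: "q < p"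
  proof (rule epowr_bound[OF _ s(1)[OF qp]])
    show "J57 \<le> p2 (1 + ?k + (4 + q / r) * ?k) * polygeo ?k * (p2 1 * cR epowr (q / p)) epowr ?k * C epowr ?s"
      using J57_le[OF qp] unfolding epowr_mult[OF s(2)[OF qp], of _ "C epowr q"] power by (simp only: mult.assoc)
    show "(p2 (1 + ?k + (4 + q / r) * ?k) * polygeo ?k * (p2 1 * cR epowr (q / p)) epowr ?k) epowr (1 / ?s) \<le> nec_factor"
      unfolding nec_factor_def using qp
      by (simp only: if_True simp_thms) (intro add_increasing2 add_increasing order_refl zero_le)
  qed
  have J4: "J4 \<le> (nec_factor * C) epowr ?s" if qp: "q < p" and pr: "p \<le> r"
  proof (rule epowr_bound[OF _ s(1)[OF qp]])
    have "p \<le> 1" using pr r by simp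
    then show "J4 \<le> p2 ?k * p2 (4 + q / r) epowr ?k * C epowr ?s"
      using J4_le[OF qp] unfolding epowr_mult[OF s(2)[OF qp], of _ "C epowr q"] power by (simp only: mult.assoc)
    show "(p2 ?k * p2 (4 + q / r) epowr ?k) epowr (1 / ?s) \<le> nec_factor"
      unfolding nec_factor_def using qp
      by (simp only: if_True simp_thms) (intro add_increasing2 add_increasing order_refl zero_le)
  qed
  have J6: "J6 \<le> (nec_factor * C) epowr ?s" if qp: "q < p" and rp: "r < p"
  proof (rule epowr_bound[OF _ s(1)[OF qp]])
    show "J6 \<le> K6 * C epowr ?s" using J6_le[OF qp rp] unfolding power .
    show "K6 epowr (1 / ?s) \<le> nec_factor"
      unfolding nec_factor_def using qp rp
      by (simp only: if_True simp_thms) (intro add_increasing order_refl zero_le)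
  qed
  show ?thesis unfolding bounded_by_def using E V T J57 J4 J6 by blast
qed

end

section \<open>From the two estimates to the equivalence\<close>

context three_weights
begin

lemma inequality_holds_iff:
  "inequality_holds a b p q r u v w C \<longleftrightarrow>
    (\<forall>f. f \<in> borel_measurable L \<longrightarrow> outer f a b epowr (1 / q) \<le> C * R f epowr (1 / p))"
  by (auto simp: inequality_holds_def measurable_on_interval_def outer_def inner_def R_def)

lemma bounded_by_of_inequality:
  assumes C: "C < top" and ineq: "inequality_holds a b p q r u v w C"
  shows "bounded_by (nec_factor * C)"
proof -
  interpret necessity a b r v q u p w C
    using C ineq by unfold_locales (auto simp: inequality_holds_iff)
  obtain x where x: "dyadic w a b x"
    by (rule dyadic_exists[OF w w_pos, of a b]) (use ab w_fin in auto)
  \<comment> \<open>The partition of u rests on \<open>u_fin\<close>, a consequence of the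
    inequality, so the locale is entered in two stages.\<close>
  obtain \<tau> where \<tau>: "dyadic u a b \<tau>"
    by (rule dyadic_exists[OF u u_pos, of a b]) (use ab u_fin in auto)
  interpret necessity_dyadic a b r v q u p w C x \<tau>
    using x \<tau> by unfold_locales
  show ?thesis by (rule bounded_by_nec_factor)
qed

text \<open>
  For \<open>q < 1\<close> the pointwise bound in \<open>bounded_by\<close> follows from \<^const>\<open>C2\<close> only up to the constant of
  the local Hardy inequality.
\<close>

definition slack :: ennreal where
  "slack = (1 + cHU) epowr (1 / q)"

lemma slack: "1 \<le> slack" "cHU \<le> slack epowr q" "slack < top"
proof -
  have "1 epowr (1 / q) \<le> slack"
    unfolding slack_def using q by (intro epowr_mono) auto
  then show "1 \<le> slack" by simp
  have "slack epowr q = 1 + cHU" using q by (simp add: slack_def epowr_epowr)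
  then show "cHU \<le> slack epowr q" by simp
  show "slack < top" unfolding slack_def using cHU_finite q by (intro epowr_finite) auto
qed

text \<open>One constant for all seven cases. At most three characteristic constants are added in a
  case, whence the factor 3; the summand 1 keeps the constant at least 1.\<close>

definition total :: ennreal where
  "total = 1 + suff_factor * slack + 3 * nec_factor"

lemma total: "total < top" "1 \<le> total" "suff_factor * slack \<le> total" "3 * nec_factor \<le> total"
proof -
  show "total < top"
    unfolding total_def using suff_factor_finite slack nec_factor_finite by (simp add: ennreal_mult_less_top)
  show "1 \<le> total" "suff_factor * slack \<le> total" "3 * nec_factor \<le> total"
    unfolding total_def by (auto intro: add_increasing add_increasing2)
qed

text \<open>D stands for the constant, or the sum of constants, of one case. The assumptions S and N
  feed the sufficiency and the necessity estimate; what is left concerns the infimum over constants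
  that are positive and finite.\<close>

lemma characterization:
  assumes S: "D < top \<Longrightarrow> bounded_by (slack * D)" and N: "\<And>C. bounded_by C \<Longrightarrow> D \<le> 3 * C"
  shows "((\<exists>C. 0 < C \<and> C < \<infinity> \<and> inequality_holds a b p q r u v w C) \<longleftrightarrow> D < \<infinity>) \<and>
    approx (enn2real total) (best_constant a b p q r u v w) D"
proof -
  have tot: "ennreal (enn2real total) = total" using total by simp
  have c: "1 \<le> enn2real total" using total(1,2) enn2real_mono[of 1 total] by simp
  have up: "inequality_holds a b p q r u v w C" if D: "D < top" and C: "total * D \<le> C" for C
    unfolding inequality_holds_iff
  proof (intro allI impI)
    fix f :: "real \<Rightarrow> ennreal" assume f: "f \<in> borel_measurable L"
    have "slack * D < top" using D slack by (simp add: ennreal_mult_less_top)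
    with f have "outer f a b epowr (1 / q) \<le> suff_factor * (slack * D) * R f epowr (1 / p)"
      by (intro sufficiency S D)
    also have "suff_factor * (slack * D) \<le> total * D"
      unfolding mult.assoc[symmetric] using total(3) by (rule mult_right_mono) simp
    also note C
    finally show "outer f a b epowr (1 / q) \<le> C * R f epowr (1 / p)" by (simp add: mult_right_mono)
  qed
  have lo: "D \<le> total * C" if C: "C < top" "inequality_holds a b p q r u v w C" for C
  proof -
    have "D \<le> 3 * (nec_factor * C)" using C by (intro N bounded_by_of_inequality)
    also have "\<dots> \<le> total * C" unfolding mult.assoc[symmetric] using total(4) by (rule mult_right_mono) simp
    finally show ?thesis .
  qed
  have "\<exists>C. 0 < C \<and> C < \<infinity> \<and> inequality_holds a b p q r u v w C" if D: "D < top"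
  proof (intro exI conjI)
    \<comment> \<open>The summand 1 keeps the constant positive when D = 0.\<close>
    show "0 < total * D + 1" by (rule less_le_trans[OF zero_less_one add_increasing]) auto
    show "total * D + 1 < \<infinity>" using D total by (simp add: ennreal_mult_less_top)
    show "inequality_holds a b p q r u v w (total * D + 1)" using D by (intro up) auto
  qed
  moreover have "D < top" if "0 < C" "C < \<infinity>" "inequality_holds a b p q r u v w C" for C
    using lo[of C] that total by (auto intro: le_less_trans simp: ennreal_mult_less_top)
  moreover have "ennreal (1 / enn2real total) * D \<le> best_constant a b p q r u v w"
    unfolding best_constant_def
  proof (rule Inf_greatest)
    fix C assume "C \<in> {C. 0 < C \<and> C < \<infinity> \<and> inequality_holds a b p q r u v w C}"
    then have "ennreal (1 / enn2real total) * D \<le> ennreal (1 / enn2real total) * (total * C)"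
      by (intro mult_left_mono lo) auto
    also have "\<dots> = (ennreal (1 / enn2real total) * ennreal (enn2real total)) * C"
      unfolding tot mult.assoc ..
    also have "\<dots> = C" using c by (simp flip: ennreal_mult'')
    finally show "ennreal (1 / enn2real total) * D \<le> C" .
  qed
  moreover have "best_constant a b p q r u v w \<le> ennreal (enn2real total) * D"
  proof (cases "D = top")
    case True
    then show ?thesis using total(2) unfolding tot by (auto simp: ennreal_mult_top)
  next
    case False
    then have D: "D < top" by (simp add: less_top)
    show ?thesis
      unfolding tot
    \<comment> \<open>The product itself may be 0 and then is not an admissible constant, so it is
      approached from above.\<close>
    proof (rule dense_ge)
      fix C assume C: "total * D < C"
      show "best_constant a b p q r u v w \<le> C"
      proof (cases "C = top")
        case False
        have "0 < C" using C by (rule le_less_trans[OF zero_le])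
        moreover have "C < \<infinity>" using False by (simp add: less_top)
        ultimately show ?thesis
          unfolding best_constant_def using C D by (intro Inf_lower) (auto intro: up)
      qed simp
    qed
  qed
  ultimately show ?thesis unfolding approx_def by auto
qed

lemma bounded_by_slack: "bounded_by D \<Longrightarrow> bounded_by (slack * D)"
  using slack(1) mult_right_mono[of 1 slack D] by (auto intro: bounded_by_mono)

lemma le_triple: "x \<le> C \<Longrightarrow> y \<le> C \<Longrightarrow> z \<le> C \<Longrightarrow> x + y + z \<le> 3 * (C::ennreal)"
proof -
  assume "x \<le> C" "y \<le> C" "z \<le> C"
  then have "x + y + z \<le> C + C + C" by (intro add_mono)
  also have "\<dots> = 3 * C" by (metis distrib_right mult_1 numeral_3_eq_3 numeral_plus_one one_add_one semiring_norm(5))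
  finally show ?thesis .
qed

lemma summand_le: "(x::ennreal) \<le> x + y" "y \<le> x + y"
  by (auto intro: add_increasing add_increasing2)

lemma bounded_by_pq_iff:
  assumes "p \<le> q" "1 \<le> q"
  shows "bounded_by D \<longleftrightarrow> C1 a b p q r u v w \<le> D \<and> (r < p \<longrightarrow> C3 a b p q r u v w \<le> D)"
  unfolding bounded_by_def C3_le_iff using assms C1_le_iff[of D] E_bound_C1[of D] by auto

lemma bounded_by_C2:
  assumes pq: "p \<le> q" "q < 1" and D: "D < top" "C2 a b p q r u v w \<le> D" "r < p \<Longrightarrow> C3 a b p q r u v w \<le> D"
  shows "bounded_by (slack * D)"
proof -
  have E: "integ y b w epowr (- (1 / p)) * E y b \<le> D" if "a < y" "ereal y < b" for y
    using D(2) that unfolding E_bound_C2[OF pq(2)] by blast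
  have le: "D \<le> slack * D" using slack(1) mult_right_mono[of 1 slack D] by simp
  have V: "integ t b u * V r v y t epowr q \<le> (slack * D) epowr q * integ y b w epowr (q / p)"
    if "a < y" "y < t" "ereal t < b" for y t
  proof -
    have "integ t b u * V r v y t epowr q \<le> cHU * (D epowr q * integ y b w epowr (q / p))"
      using E that by (intro point_of_E pq D)
    also have "\<dots> \<le> slack epowr q * (D epowr q * integ y b w epowr (q / p))"
      using slack(2) by (rule mult_right_mono) simp
    finally show ?thesis using q by (simp add: epowr_mult mult.assoc)
  qed
  have "C3 a b p q r u v w \<le> slack * D" if "r < p" using D(3)[OF that] le by (rule order_trans)
  then show ?thesis
    unfolding bounded_by_def C3_le_iff using E V le pq by (auto intro: order_trans)
qed

lemma C2_of_bounded_by: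
  assumes pq: "p \<le> q" "q < 1" and D: "bounded_by D"
  shows "C2 a b p q r u v w \<le> D \<and> (r < p \<longrightarrow> C3 a b p q r u v w \<le> D)"
  unfolding E_bound_C2[OF pq(2)] C3_le_iff using D pq unfolding bounded_by_def by auto

lemma bounded_by_C4:
  assumes qp: "q < p" and pr: "p \<le> r"
  shows "bounded_by D \<longleftrightarrow> C4 a b p q r u v w \<le> D \<and> C5 a b p q r u v w \<le> D"
proof -
  have q1: "q < 1" using qp pr r by simp
  show ?thesis
    unfolding C4_eq[OF qp] C5_eq[OF qp q1] power_constant_le_iff[OF qp] bounded_by_def using qp pr by auto
qed

lemma bounded_by_C6:
  assumes qp: "q < p" and rp: "r < p"
  shows "bounded_by D \<longleftrightarrow> C1 a b p q r u v w \<le> D \<and> C6 a b p q r u v w \<le> D \<and>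
    (if q < 1 then C5 a b p q r u v w \<le> D else C7 a b p q r u v w \<le> D)"
proof -
  have "(if q < 1 then C5 a b p q r u v w \<le> D else C7 a b p q r u v w \<le> D) \<longleftrightarrow> J57 \<le> D epowr (p * q / (p - q))"
    using C5_eq[OF qp] C7_eq[OF qp] power_constant_le_iff[OF qp, of J57] by auto
  then show ?thesis
    unfolding C6_eq[OF qp rp] power_constant_le_iff[OF qp] C1_le_iff bounded_by_def using qp rp by auto
qed

end

section \<open>The seven cases\<close>

lemma Max_less_top: "Max {x, y::ennreal} < top \<longleftrightarrow> x + y < top" "Max {x, y, z::ennreal} < top \<longleftrightarrow> x + y + z < top"
  by auto

theorem theorem2p1:
  fixes p q r :: real
  assumes "0 < r" "r \<le> 1" "0 < p" "0 < q"
  shows "\<exists>c>0. \<forall>(a::ereal) (b::ereal) u v w.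
      0 \<le> a \<and> a < b \<and>
      weight a b u \<and> weight a b v \<and> weight a b w \<and>
      (\<forall>x \<in> einterval a b. 0 < W b w x \<and> W b w x < \<infinity>) \<longrightarrow>
        (p \<le> r \<and> r \<le> 1 \<and> 1 \<le> q \<longrightarrow>
          ((\<exists>C. 0 < C \<and> C < \<infinity> \<and> inequality_holds a b p q r u v w C)
             \<longleftrightarrow> C1 a b p q r u v w < \<infinity>) \<and>
          approx c (best_constant a b p q r u v w) (C1 a b p q r u v w)) \<and>
        (p \<le> q \<and> q < 1 \<and> p \<le> r \<and> r \<le> 1 \<longrightarrow>
          ((\<exists>C. 0 < C \<and> C < \<infinity> \<and> inequality_holds a b p q r u v w C)
             \<longleftrightarrow> C2 a b p q r u v w < \<infinity>) \<and>
          approx c (best_constant a b p q r u v w) (C2 a b p q r u v w)) \<and>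
        (r < p \<and> p \<le> q \<and> r \<le> 1 \<and> 1 \<le> q \<longrightarrow>
          ((\<exists>C. 0 < C \<and> C < \<infinity> \<and> inequality_holds a b p q r u v w C)
             \<longleftrightarrow> Max {C1 a b p q r u v w, C3 a b p q r u v w} < \<infinity>) \<and>
          approx c (best_constant a b p q r u v w) (C1 a b p q r u v w + C3 a b p q r u v w)) \<and>
        (r < p \<and> p \<le> q \<and> q < 1 \<longrightarrow>
          ((\<exists>C. 0 < C \<and> C < \<infinity> \<and> inequality_holds a b p q r u v w C)
             \<longleftrightarrow> Max {C2 a b p q r u v w, C3 a b p q r u v w} < \<infinity>) \<and>
          approx c (best_constant a b p q r u v w) (C2 a b p q r u v w + C3 a b p q r u v w)) \<and>
        (q < p \<and> p \<le> r \<and> r \<le> 1 \<longrightarrow>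
          ((\<exists>C. 0 < C \<and> C < \<infinity> \<and> inequality_holds a b p q r u v w C)
             \<longleftrightarrow> Max {C4 a b p q r u v w, C5 a b p q r u v w} < \<infinity>) \<and>
          approx c (best_constant a b p q r u v w) (C4 a b p q r u v w + C5 a b p q r u v w)) \<and>
        (q < p \<and> q < 1 \<and> r < p \<and> r \<le> 1 \<longrightarrow>
          ((\<exists>C. 0 < C \<and> C < \<infinity> \<and> inequality_holds a b p q r u v w C)
             \<longleftrightarrow> Max {C1 a b p q r u v w, C5 a b p q r u v w, C6 a b p q r u v w} < \<infinity>) \<and>
          approx c (best_constant a b p q r u v w) (C1 a b p q r u v w + C5 a b p q r u v w + C6 a b p q r u v w)) \<and>
        (r \<le> 1 \<and> 1 \<le> q \<and> q < p \<longrightarrow>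
          ((\<exists>C. 0 < C \<and> C < \<infinity> \<and> inequality_holds a b p q r u v w C)
             \<longleftrightarrow> Max {C1 a b p q r u v w, C6 a b p q r u v w, C7 a b p q r u v w} < \<infinity>) \<and>
          approx c (best_constant a b p q r u v w) (C1 a b p q r u v w + C6 a b p q r u v w + C7 a b p q r u v w))"
\<comment> \<open>The constant is chosen before the weights, and outside the locale
  \<open>total\<close> is not known to be positive. The default 1 makes the witness positive in any
  event; once the locale is interpreted, the first branch applies.\<close>
proof (intro exI[of _ "if 0 < enn2real (three_weights.total r q p) then enn2real (three_weights.total r q p) else 1"]
    conjI[of "0 < _"] allI impI[of "0 \<le> _ \<and> _"], goal_cases)
  case 1
  then show ?case by simp
next
  case (2 a b u v w)
  define c where "c = (if 0 < enn2real (three_weights.total r q p) then enn2real (three_weights.total r q p) else 1)"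
  \<comment> \<open>The assumption 0 <= a < b makes the left end point real.\<close>
  obtain a0 where a: "a = ereal a0" using 2 by (cases a) auto
  interpret three_weights a0 b r v q u p w
    using 2 assms unfolding a weight_def measurable_on_interval_def W_def
    by unfold_locales (auto simp: einterval_iff elim: eventually_mono)
  let ?adm = "\<exists>C. 0 < C \<and> C < \<infinity> \<and> inequality_holds a b p q r u v w C"
  let ?best = "best_constant a b p q r u v w"
  let ?C1 = "C1 a b p q r u v w" and ?C2 = "C2 a b p q r u v w" and ?C3 = "C3 a b p q r u v w" and ?C4 = "C4 a b p q r u v w"
    and ?C5 = "C5 a b p q r u v w" and ?C6 = "C6 a b p q r u v w" and ?C7 = "C7 a b p q r u v w"
  have "0 < enn2real total" using total(1,2) enn2real_mono[of 1 total] by simp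
  then have c: "c = enn2real total" by (simp add: c_def)
  have char: "(?adm \<longleftrightarrow> D < \<infinity>) \<and> approx c ?best D"
    if "D < top \<Longrightarrow> bounded_by (slack * D)" "\<And>C. bounded_by C \<Longrightarrow> D \<le> 3 * C" for D
    unfolding c a using that by (rule characterization)
  have i: "(?adm \<longleftrightarrow> ?C1 < \<infinity>) \<and> approx c ?best ?C1" if "p \<le> r \<and> r \<le> 1 \<and> 1 \<le> q"
  proof (rule char)
    have "p \<le> q" "1 \<le> q" "\<not> r < p" using that by auto
    note iff = bounded_by_pq_iff[OF this(1,2)]
    show "bounded_by (slack * ?C1)" using iff \<open>\<not> r < p\<close> unfolding a by (intro bounded_by_slack) auto
    \<comment> \<open>With fewer than three constants, \<open>le_triple\<close> is filled up with
      zeros.\<close>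
    show "?C1 \<le> 3 * C" if "bounded_by C" for C
      using that iff le_triple[of ?C1 C 0 0] unfolding a by auto
  qed
  have ii: "(?adm \<longleftrightarrow> ?C2 < \<infinity>) \<and> approx c ?best ?C2" if "p \<le> q \<and> q < 1 \<and> p \<le> r \<and> r \<le> 1"
  proof (rule char)
    show "bounded_by (slack * ?C2)" if "?C2 < top"
      using that \<open>p \<le> q \<and> q < 1 \<and> p \<le> r \<and> r \<le> 1\<close> unfolding a by (intro bounded_by_C2) auto
    show "?C2 \<le> 3 * C" if "bounded_by C" for C
      using that \<open>p \<le> q \<and> q < 1 \<and> p \<le> r \<and> r \<le> 1\<close> C2_of_bounded_by[of C] le_triple[of ?C2 C 0 0] unfolding a by auto
  qed
  have iii: "(?adm \<longleftrightarrow> Max {?C1, ?C3} < \<infinity>) \<and> approx c ?best (?C1 + ?C3)" if "r < p \<and> p \<le> q \<and> r \<le> 1 \<and> 1 \<le> q"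
    unfolding infinity_ennreal_def Max_less_top
  proof (rule char[unfolded infinity_ennreal_def])
    have *: "p \<le> q" "1 \<le> q" "r < p" using that by auto
    note iff = bounded_by_pq_iff[OF *(1,2)]
    show "bounded_by (slack * (?C1 + ?C3))" using iff summand_le unfolding a by (intro bounded_by_slack) auto
    show "?C1 + ?C3 \<le> 3 * C" if "bounded_by C" for C
      using that iff *(3) le_triple[of ?C1 C ?C3 0] unfolding a by auto
  qed
  have iv: "(?adm \<longleftrightarrow> Max {?C2, ?C3} < \<infinity>) \<and> approx c ?best (?C2 + ?C3)" if "r < p \<and> p \<le> q \<and> q < 1"
    unfolding infinity_ennreal_def Max_less_top
  proof (rule char[unfolded infinity_ennreal_def])
    show "bounded_by (slack * (?C2 + ?C3))" if "?C2 + ?C3 < top"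
      using that \<open>r < p \<and> p \<le> q \<and> q < 1\<close> summand_le unfolding a by (intro bounded_by_C2) auto
    show "?C2 + ?C3 \<le> 3 * C" if "bounded_by C" for C
      using that \<open>r < p \<and> p \<le> q \<and> q < 1\<close> C2_of_bounded_by[of C] le_triple[of ?C2 C ?C3 0] unfolding a by auto
  qed
  have v: "(?adm \<longleftrightarrow> Max {?C4, ?C5} < \<infinity>) \<and> approx c ?best (?C4 + ?C5)" if "q < p \<and> p \<le> r \<and> r \<le> 1"
    unfolding infinity_ennreal_def Max_less_top
  proof (rule char[unfolded infinity_ennreal_def])
    have *: "q < p" "p \<le> r" using that by auto
    note iff = bounded_by_C4[OF *]
    show "bounded_by (slack * (?C4 + ?C5))" using iff summand_le unfolding a by (intro bounded_by_slack) auto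
    show "?C4 + ?C5 \<le> 3 * C" if "bounded_by C" for C
      using that iff le_triple[of ?C4 C ?C5 0] unfolding a by auto
  qed
  have sum3: "x \<le> x + y + z" "y \<le> x + y + z" "z \<le> x + y + z" for x y z :: ennreal
    by (auto simp: add.assoc intro: add_increasing add_increasing2)
  have vi: "(?adm \<longleftrightarrow> Max {?C1, ?C5, ?C6} < \<infinity>) \<and> approx c ?best (?C1 + ?C5 + ?C6)"
    if "q < p \<and> q < 1 \<and> r < p \<and> r \<le> 1"
    unfolding infinity_ennreal_def Max_less_top
  proof (rule char[unfolded infinity_ennreal_def])
    have *: "q < p" "r < p" "q < 1" using that by auto
    note iff = bounded_by_C6[OF *(1,2), unfolded if_P[OF *(3)]]
    show "bounded_by (slack * (?C1 + ?C5 + ?C6))" using iff sum3 unfolding a by (intro bounded_by_slack) auto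
    show "?C1 + ?C5 + ?C6 \<le> 3 * C" if "bounded_by C" for C
      using that iff unfolding a by (intro le_triple) auto
  qed
  have vii: "(?adm \<longleftrightarrow> Max {?C1, ?C6, ?C7} < \<infinity>) \<and> approx c ?best (?C1 + ?C6 + ?C7)"
    if "r \<le> 1 \<and> 1 \<le> q \<and> q < p"
    unfolding infinity_ennreal_def Max_less_top
  proof (rule char[unfolded infinity_ennreal_def])
    have *: "q < p" "r < p" "\<not> q < 1" using that by auto
    note iff = bounded_by_C6[OF *(1,2), unfolded if_not_P[OF *(3)]]
    show "bounded_by (slack * (?C1 + ?C6 + ?C7))" using iff sum3 unfolding a by (intro bounded_by_slack) auto
    show "?C1 + ?C6 + ?C7 \<le> 3 * C" if "bounded_by C" for C
      using that iff unfolding a by (intro le_triple) auto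
  qed
  show ?case
    unfolding c_def[symmetric] using i ii iii iv v vi vii by simp
qed

end
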